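(* Let $\mathcal E$ be a closed symmetric monoidal category which is cocomplete and finitely complete, and let $C$ be a cosimplicial object of $\mathcal E$ with $I\cong C^0$, where $I$ is the unit of $\mathcal E$. The following three properties are equivalent (both in the version without, and in the version with, the words in parentheses): (1) $C$ is (strong) monoidal; (2) the functor $|(-)_{\mathcal E}|_C:\mathrm{Sets}^{\Delta^{\mathrm{op}}}\to\mathcal E$ is (strong) symmetric monoidal; (3) there exists a system of Eilenberg-Zilber (iso)morphisms $$EZ^{m,n}_{\mathcal E}:|\Delta^m_{\mathcal E}|_C\otimes|\Delta^n_{\mathcal E}|_C\to|\Delta^m_{\mathcal E}\otimes\Delta^n_{\mathcal E}|_C$$ subject to natural associativity, unit and symmetry conditions.
   Context: A symmetric monoidal functor $\phi$ has a unit map $\phi_0:I'\to\phi(I)$ and binatural maps $\phi_{XY}:\phi(X)\otimes'\phi(Y)\to\phi(X\otimes Y)$ satisfying the usual associativity, symmetry and unit constraints; it is strong if $\phi_0$ and all $\phi_{XY}$ are isomorphisms, unit-preserving if $\phi_0$ is an isomorphism. $\mathcal E^{\Delta^{\mathrm{op}}}$ has the degreewise tensor product. The realisation of a simplicial object $X$ with respect to a cosimplicial object $C:\Delta\to\mathcal E$ is the coend $|X|_C=X_\cdot\otimes_\Delta C^\cdot$. For a set $S$, $S_{\mathcal E}=\coprod_SI$; applied degreewise this gives $(-)_{\mathcal E}:\mathrm{Sets}^{\Delta^{\mathrm{op}}}\to\mathcal E^{\Delta^{\mathrm{op}}}$ (strong symmetric monoidal). $\Delta^n$ is the representable $n$-simplex,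 $\Delta^n_{\mathcal E}=(\Delta^n)_{\mathcal E}$; thus $|\Delta^n_{\mathcal E}|_C\cong C^n$, and the unit maps of the functors $|-|_C$ and $|(-)_{\mathcal E}|_C$ are given by the isomorphism $I\cong C^0\cong|\Delta^0_{\mathcal E}|_C$. $C$ is (strong) monoidal if $|-|_C:\mathcal E^{\Delta^{\mathrm{op}}}\to\mathcal E$ is unit-preserving and (strong) symmetric monoidal. Eilenberg-Zilber system: the maps $EZ^{m,n}_{\mathcal E}$ are natural in $[m],[n]\in\Delta$; the unit and symmetry conditions express compatibility with the unit ($[m]$ or $[n]$ equal to $[0]$, using $C^0\cong I$) and with the symmetry of $\mathcal E$. For the associativity condition, write $X\Box Y$ for the bisimplicial object $([m],[n])\mapsto X_m\otimes Y_n$. There are canonical isomorphisms $|X|_C\otimes|Y|_C\cong(X\Box Y)\otimes_{\Delta\times\Delta}(|\Delta^\cdot_{\mathcal E}|_C\otimes|\Delta^\cdot_{\mathcal E}|_C)$ and $|X\otimes Y|_C\cong(X\Box Y)\otimes_{\Delta\times\Delta}|\Delta^\cdot_{\mathcal E}\otimes\Delta^\cdot_{\mathcal E}|_C$, so a natural family $EZ$ induces maps $EZ_{X,Y}:|X|_C\otimes|Y|_C\to|X\otimes Y|_C$ for all simplicial objects $X,Y$. The associativity condition requires that for all $[m],[n],[p]$ the two composites $$|\Delta^m_{\mathcal E}|_C\otimes|\Delta^n_{\mathcal E}|_C\otimes|\Delta^p_{\mathcal E}|_C\to|\Delta^m_{\mathcal E}\otimes\Delta^n_{\mathcal E}\otimes\Delta^p_{\mathcal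 E}|_C,$$ namely $EZ_{\Delta^m_{\mathcal E}\otimes\Delta^n_{\mathcal E},\Delta^p_{\mathcal E}}\circ(EZ^{m,n}_{\mathcal E}\otimes id)$ and $EZ_{\Delta^m_{\mathcal E},\Delta^n_{\mathcal E}\otimes\Delta^p_{\mathcal E}}\circ(id\otimes EZ^{n,p}_{\mathcal E})$, are equal. *)

theory Defs
  imports Main "HOL-Library.FuncSet" "HOL-Library.Equipollence"
begin

section \<open>Categories and functors\<close>

record ('o, 'a) cat =
  Obj :: "'o set"
  Arr :: "'a set"
  Dom :: "'a \<Rightarrow> 'o"
  Cod :: "'a \<Rightarrow> 'o"
  Ide :: "'o \<Rightarrow> 'a"
  Comp :: "'a \<Rightarrow> 'a \<Rightarrow> 'a"  (infixl "\<cdot>\<index>" 70)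

definition Hom :: "('o, 'a, 'z) cat_scheme \<Rightarrow> 'o \<Rightarrow> 'o \<Rightarrow> 'a set" where
  "Hom E A B = {f \<in> Arr E. Dom E f = A \<and> Cod E f = B}"

locale category =
  fixes E :: "('o, 'a, 'z) cat_scheme" (structure)
  assumes dom_cod: "f \<in> Arr E \<Longrightarrow> Dom E f \<in> Obj E \<and> Cod E f \<in> Obj E"
    and ide_hom: "A \<in> Obj E \<Longrightarrow> Ide E A \<in> Hom E A A"
    and comp_hom: "f \<in> Hom E A B \<Longrightarrow> g \<in> Hom E B D \<Longrightarrow> g \<cdot> f \<in> Hom E A D"
    and ide_left: "f \<in> Hom E A B \<Longrightarrow> Ide E B \<cdot> f = f"
    and ide_right: "f \<in> Hom E A B \<Longrightarrow> f \<cdot> Ide E A = f"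
    and comp_assoc: "f \<in> Hom E A B \<Longrightarrow> g \<in> Hom E B D \<Longrightarrow> h \<in> Hom E D F \<Longrightarrow>
      (h \<cdot> g) \<cdot> f = h \<cdot> (g \<cdot> f)"

definition inverse_arrows :: "('o, 'a, 'z) cat_scheme \<Rightarrow> 'a \<Rightarrow> 'a \<Rightarrow> bool" where
  "inverse_arrows E f g \<longleftrightarrow> f \<in> Arr E \<and> g \<in> Hom E (Cod E f) (Dom E f) \<and>
     g \<cdot>\<^bsub>E\<^esub> f = Ide E (Dom E f) \<and> f \<cdot>\<^bsub>E\<^esub> g = Ide E (Cod E f)"

definition is_iso :: "('o, 'a, 'z) cat_scheme \<Rightarrow> 'a \<Rightarrow> bool" where
  "is_iso E f \<longleftrightarrow> (\<exists>g. inverse_arrows E f g)"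

definition inv_arr :: "('o, 'a, 'z) cat_scheme \<Rightarrow> 'a \<Rightarrow> 'a" where
  "inv_arr E f = (THE g. inverse_arrows E f g)"

definition op_cat :: "('o, 'a, 'z) cat_scheme \<Rightarrow> ('o, 'a) cat" where
  "op_cat J = \<lparr>Obj = Obj J, Arr = Arr J, Dom = Cod J, Cod = Dom J, Ide = Ide J,
     Comp = (\<lambda>g f. f \<cdot>\<^bsub>J\<^esub> g)\<rparr>"

definition prod_cat ::
  "('o, 'a, 'y) cat_scheme \<Rightarrow> ('p, 'b, 'z) cat_scheme \<Rightarrow> ('o \<times> 'p, 'a \<times> 'b) cat" where
  "prod_cat J K = \<lparr>Obj = Obj J \<times> Obj K, Arr = Arr J \<times> Arr K,
     Dom = map_prod (Dom J) (Dom K), Cod = map_prod (Cod J) (Cod K),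
     Ide = map_prod (Ide J) (Ide K),
     Comp = (\<lambda>(g, g') (f, f'). (g \<cdot>\<^bsub>J\<^esub> f, g' \<cdot>\<^bsub>K\<^esub> f'))\<rparr>"

definition discrete_cat :: "'x set \<Rightarrow> ('x, 'x) cat" where
  "discrete_cat S = \<lparr>Obj = S, Arr = S, Dom = id, Cod = id, Ide = id, Comp = (\<lambda>g f. f)\<rparr>"

record ('i, 'j, 'o, 'a) functor_data =
  fob :: "'i \<Rightarrow> 'o"
  far :: "'j \<Rightarrow> 'a"

definition is_functor ::
  "('i, 'j, 'y) cat_scheme \<Rightarrow> ('o, 'a, 'z) cat_scheme \<Rightarrow> ('i, 'j, 'o, 'a) functor_data \<Rightarrow> bool" where
  "is_functor J E F \<longleftrightarrow> category J \<and> category E \<and>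
     (\<forall>i\<in>Obj J. fob F i \<in> Obj E) \<and>
     (\<forall>f\<in>Arr J. far F f \<in> Hom E (fob F (Dom J f)) (fob F (Cod J f))) \<and>
     (\<forall>i\<in>Obj J. far F (Ide J i) = Ide E (fob F i)) \<and>
     (\<forall>i j k. \<forall>f\<in>Hom J i j. \<forall>g\<in>Hom J j k. far F (g \<cdot>\<^bsub>J\<^esub> f) = far F g \<cdot>\<^bsub>E\<^esub> far F f)"

definition comp_functor ::
  "('o, 'a, 'p, 'b) functor_data \<Rightarrow> ('i, 'j, 'o, 'a) functor_data \<Rightarrow> ('i, 'j, 'p, 'b) functor_data" where
  "comp_functor G F = \<lparr>fob = fob G \<circ> fob F, far = far G \<circ> far F\<rparr>"

text \<open>Functors and natural transformations that are elements of functor categories are taken to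
  be extensional (\<open>undefined\<close> off the source category), so that equality of arrows is the
  usual componentwise one.\<close>

definition restrict_functor ::
  "('i, 'j, 'y) cat_scheme \<Rightarrow> ('i, 'j, 'o, 'a) functor_data \<Rightarrow> ('i, 'j, 'o, 'a) functor_data" where
  "restrict_functor J F = \<lparr>fob = restrict (fob F) (Obj J), far = restrict (far F) (Arr J)\<rparr>"

definition functors ::
  "('i, 'j, 'y) cat_scheme \<Rightarrow> ('o, 'a, 'z) cat_scheme \<Rightarrow> ('i, 'j, 'o, 'a) functor_data set" where
  "functors J E = {F. is_functor J E F \<and> fob F \<in> extensional (Obj J) \<and> far F \<in> extensional (Arr J)}"

type_synonym ('i, 'j, 'o, 'a) nat_trans =
  "('i, 'j, 'o, 'a) functor_data \<times> ('i \<Rightarrow> 'a) \<times> ('i, 'j, 'o, 'a) functor_data"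

abbreviation source :: "'f \<times> 'c \<times> 'f \<Rightarrow> 'f" where "source t \<equiv> fst t"
abbreviation component :: "'f \<times> 'c \<times> 'f \<Rightarrow> 'c" where "component t \<equiv> fst (snd t)"
abbreviation target :: "'f \<times> 'c \<times> 'f \<Rightarrow> 'f" where "target t \<equiv> snd (snd t)"

definition nat_transs ::
  "('i, 'j, 'y) cat_scheme \<Rightarrow> ('o, 'a, 'z) cat_scheme \<Rightarrow> ('i, 'j, 'o, 'a) nat_trans set" where
  "nat_transs J E = {(F, t, G). F \<in> functors J E \<and> G \<in> functors J E \<and> t \<in> extensional (Obj J) \<and>
     (\<forall>i\<in>Obj J. t i \<in> Hom E (fob F i) (fob G i)) \<and>
     (\<forall>i j. \<forall>f\<in>Hom J i j. t j \<cdot>\<^bsub>E\<^esub> far F f = far G f \<cdot>\<^bsub>E\<^esub> t i)}"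


section \<open>Limits, colimits and coends\<close>

definition is_cocone ::
  "('i, 'j, 'y) cat_scheme \<Rightarrow> ('o, 'a, 'z) cat_scheme \<Rightarrow> ('i, 'j, 'o, 'a) functor_data \<Rightarrow>
   'o \<Rightarrow> ('i \<Rightarrow> 'a) \<Rightarrow> bool" where
  "is_cocone J E F A w \<longleftrightarrow> A \<in> Obj E \<and> (\<forall>i\<in>Obj J. w i \<in> Hom E (fob F i) A) \<and>
     (\<forall>i j. \<forall>f\<in>Hom J i j. w j \<cdot>\<^bsub>E\<^esub> far F f = w i)"

definition is_colimit ::
  "('i, 'j, 'y) cat_scheme \<Rightarrow> ('o, 'a, 'z) cat_scheme \<Rightarrow> ('i, 'j, 'o, 'a) functor_data \<Rightarrow>
   'o \<Rightarrow> ('i \<Rightarrow> 'a) \<Rightarrow> bool" where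
  "is_colimit J E F A w \<longleftrightarrow> is_cocone J E F A w \<and>
     (\<forall>B v. is_cocone J E F B v \<longrightarrow> (\<exists>!h. h \<in> Hom E A B \<and> (\<forall>i\<in>Obj J. h \<cdot>\<^bsub>E\<^esub> w i = v i)))"

definition is_cone ::
  "('i, 'j, 'y) cat_scheme \<Rightarrow> ('o, 'a, 'z) cat_scheme \<Rightarrow> ('i, 'j, 'o, 'a) functor_data \<Rightarrow>
   'o \<Rightarrow> ('i \<Rightarrow> 'a) \<Rightarrow> bool" where
  "is_cone J E F A w \<longleftrightarrow> A \<in> Obj E \<and> (\<forall>i\<in>Obj J. w i \<in> Hom E A (fob F i)) \<and>
     (\<forall>i j. \<forall>f\<in>Hom J i j. far F f \<cdot>\<^bsub>E\<^esub> w i = w j)"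

definition is_limit ::
  "('i, 'j, 'y) cat_scheme \<Rightarrow> ('o, 'a, 'z) cat_scheme \<Rightarrow> ('i, 'j, 'o, 'a) functor_data \<Rightarrow>
   'o \<Rightarrow> ('i \<Rightarrow> 'a) \<Rightarrow> bool" where
  "is_limit J E F A w \<longleftrightarrow> is_cone J E F A w \<and>
     (\<forall>B v. is_cone J E F B v \<longrightarrow> (\<exists>!h. h \<in> Hom E B A \<and> (\<forall>i\<in>Obj J. w i \<cdot>\<^bsub>E\<^esub> h = v i)))"

definition finitely_complete :: "('o, 'a, 'z) cat_scheme \<Rightarrow> bool" where
  "finitely_complete E \<longleftrightarrow>
     (\<forall>(J :: (nat, nat) cat) F. finite (Obj J) \<and> finite (Arr J) \<and> is_functor J E F \<longrightarrow>
       (\<exists>A w. is_limit J E F A w))"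

text \<open>The sets of the theory are the subsets of a type \<open>'u\<close> of cardinality smaller than
  \<open>'u\<close>, where the cardinality of \<open>'u\<close> is a regular uncountable cardinal.  If it is moreover a
  strong limit, these are, up to bijection, the sets of a Grothendieck universe.\<close>

definition small :: "'u set \<Rightarrow> bool" where
  "small S \<longleftrightarrow> S \<prec> (UNIV :: 'u set)"

definition regular_universe :: "'u itself \<Rightarrow> bool" where
  "regular_universe U \<longleftrightarrow> (UNIV :: nat set) \<prec> (UNIV :: 'u set) \<and>
     (\<forall>(A :: 'u set) (f :: 'u \<Rightarrow> 'u set).
        small A \<and> (\<forall>a\<in>A. small (f a)) \<longrightarrow> small (\<Union>a\<in>A. f a))"

definition cocomplete :: "'u itself \<Rightarrow> ('o, 'a, 'z) cat_scheme \<Rightarrow> bool" where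
  "cocomplete U E \<longleftrightarrow>
     (\<forall>(J :: ('u, 'u) cat) F. small (Obj J) \<and> small (Arr J) \<and> is_functor J E F \<longrightarrow>
       (\<exists>A w. is_colimit J E F A w))"

definition is_wedge ::
  "('i, 'j, 'y) cat_scheme \<Rightarrow> ('o, 'a, 'z) cat_scheme \<Rightarrow> ('i \<times> 'i, 'j \<times> 'j, 'o, 'a) functor_data \<Rightarrow>
   'o \<Rightarrow> ('i \<Rightarrow> 'a) \<Rightarrow> bool" where
  "is_wedge J E T A w \<longleftrightarrow> A \<in> Obj E \<and> (\<forall>i\<in>Obj J. w i \<in> Hom E (fob T (i, i)) A) \<and>
     (\<forall>i j. \<forall>f\<in>Hom J i j. w i \<cdot>\<^bsub>E\<^esub> far T (f, Ide J i) = w j \<cdot>\<^bsub>E\<^esub> far T (Ide J j, f))"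

definition is_coend ::
  "('i, 'j, 'y) cat_scheme \<Rightarrow> ('o, 'a, 'z) cat_scheme \<Rightarrow> ('i \<times> 'i, 'j \<times> 'j, 'o, 'a) functor_data \<Rightarrow>
   'o \<Rightarrow> ('i \<Rightarrow> 'a) \<Rightarrow> bool" where
  "is_coend J E T A w \<longleftrightarrow> is_wedge J E T A w \<and>
     (\<forall>B v. is_wedge J E T B v \<longrightarrow> (\<exists>!h. h \<in> Hom E A B \<and> (\<forall>i\<in>Obj J. h \<cdot>\<^bsub>E\<^esub> w i = v i)))"


section \<open>Symmetric monoidal categories\<close>

record ('o, 'a) smcat = "('o, 'a) cat" +
  TensO :: "'o \<Rightarrow> 'o \<Rightarrow> 'o"  (infixl "\<otimes>\<index>" 75)
  TensA :: "'a \<Rightarrow> 'a \<Rightarrow> 'a"  (infixl "\<odot>\<index>" 75)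
  Unit :: 'o
  Assoc :: "'o \<Rightarrow> 'o \<Rightarrow> 'o \<Rightarrow> 'a"
  LUnit :: "'o \<Rightarrow> 'a"
  RUnit :: "'o \<Rightarrow> 'a"
  Swap :: "'o \<Rightarrow> 'o \<Rightarrow> 'a"

locale symmetric_monoidal_category = category E
  for E :: "('o, 'a, 'z) smcat_scheme" (structure) +
  assumes tens_obj: "A \<in> Obj E \<Longrightarrow> B \<in> Obj E \<Longrightarrow> A \<otimes> B \<in> Obj E"
    and tens_hom: "f \<in> Hom E A A' \<Longrightarrow> g \<in> Hom E B B' \<Longrightarrow> f \<odot> g \<in> Hom E (A \<otimes> B) (A' \<otimes> B')"
    and tens_ide: "A \<in> Obj E \<Longrightarrow> B \<in> Obj E \<Longrightarrow> Ide E A \<odot> Ide E B = Ide E (A \<otimes> B)"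
    and tens_comp: "f \<in> Hom E A A' \<Longrightarrow> f' \<in> Hom E A' A'' \<Longrightarrow>
      g \<in> Hom E B B' \<Longrightarrow> g' \<in> Hom E B' B'' \<Longrightarrow> (f' \<cdot> f) \<odot> (g' \<cdot> g) = (f' \<odot> g') \<cdot> (f \<odot> g)"
    and unit_obj: "Unit E \<in> Obj E"
    and assoc_hom: "A \<in> Obj E \<Longrightarrow> B \<in> Obj E \<Longrightarrow> D \<in> Obj E \<Longrightarrow>
      Assoc E A B D \<in> Hom E ((A \<otimes> B) \<otimes> D) (A \<otimes> (B \<otimes> D)) \<and> is_iso E (Assoc E A B D)"
    and assoc_nat: "f \<in> Hom E A A' \<Longrightarrow> g \<in> Hom E B B' \<Longrightarrow> h \<in> Hom E D D' \<Longrightarrow>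
      Assoc E A' B' D' \<cdot> ((f \<odot> g) \<odot> h) = (f \<odot> (g \<odot> h)) \<cdot> Assoc E A B D"
    and lunit_hom: "A \<in> Obj E \<Longrightarrow> LUnit E A \<in> Hom E (Unit E \<otimes> A) A \<and> is_iso E (LUnit E A)"
    and lunit_nat: "f \<in> Hom E A A' \<Longrightarrow> LUnit E A' \<cdot> (Ide E (Unit E) \<odot> f) = f \<cdot> LUnit E A"
    and runit_hom: "A \<in> Obj E \<Longrightarrow> RUnit E A \<in> Hom E (A \<otimes> Unit E) A \<and> is_iso E (RUnit E A)"
    and runit_nat: "f \<in> Hom E A A' \<Longrightarrow> RUnit E A' \<cdot> (f \<odot> Ide E (Unit E)) = f \<cdot> RUnit E A"
    and swap_hom: "A \<in> Obj E \<Longrightarrow> B \<in> Obj E \<Longrightarrow> Swap E A B \<in> Hom E (A \<otimes> B) (B \<otimes> A)"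
    and swap_nat: "f \<in> Hom E A A' \<Longrightarrow> g \<in> Hom E B B' \<Longrightarrow>
      Swap E A' B' \<cdot> (f \<odot> g) = (g \<odot> f) \<cdot> Swap E A B"
    and swap_swap: "A \<in> Obj E \<Longrightarrow> B \<in> Obj E \<Longrightarrow> Swap E B A \<cdot> Swap E A B = Ide E (A \<otimes> B)"
    and pentagon: "A \<in> Obj E \<Longrightarrow> B \<in> Obj E \<Longrightarrow> D \<in> Obj E \<Longrightarrow> F \<in> Obj E \<Longrightarrow>
      Assoc E A B (D \<otimes> F) \<cdot> Assoc E (A \<otimes> B) D F =
      (Ide E A \<odot> Assoc E B D F) \<cdot> Assoc E A (B \<otimes> D) F \<cdot> (Assoc E A B D \<odot> Ide E F)"
    and triangle: "A \<in> Obj E \<Longrightarrow> B \<in> Obj E \<Longrightarrow>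
      (Ide E A \<odot> LUnit E B) \<cdot> Assoc E A (Unit E) B = RUnit E A \<odot> Ide E B"
    and hexagon: "A \<in> Obj E \<Longrightarrow> B \<in> Obj E \<Longrightarrow> D \<in> Obj E \<Longrightarrow>
      Assoc E B D A \<cdot> Swap E A (B \<otimes> D) \<cdot> Assoc E A B D =
      (Ide E B \<odot> Swap E A D) \<cdot> Assoc E B A D \<cdot> (Swap E A B \<odot> Ide E D)"

definition monoidal_closed :: "('o, 'a, 'z) smcat_scheme \<Rightarrow> bool" where
  "monoidal_closed E \<longleftrightarrow> (\<forall>B\<in>Obj E. \<forall>D\<in>Obj E. \<exists>H\<in>Obj E. \<exists>ev\<in>Hom E (H \<otimes>\<^bsub>E\<^esub> B) D.
     \<forall>A\<in>Obj E. \<forall>f\<in>Hom E (A \<otimes>\<^bsub>E\<^esub> B) D. \<exists>!g. g \<in> Hom E A H \<and> ev \<cdot>\<^bsub>E\<^esub> (g \<odot>\<^bsub>E\<^esub> Ide E B) = f)"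

text \<open>\<open>u\<close> is the unit map and \<open>p X Y\<close> the binatural structure map of the functor \<open>F\<close>.\<close>

locale symmetric_monoidal_functor =
  M: symmetric_monoidal_category M + N: symmetric_monoidal_category N
  for M :: "('i, 'j, 'y) smcat_scheme" and N :: "('o, 'a, 'z) smcat_scheme"
    and F :: "('i, 'j, 'o, 'a) functor_data" and u :: 'a and p :: "'i \<Rightarrow> 'i \<Rightarrow> 'a" +
  assumes functor_F: "is_functor M N F"
    and unit_map: "u \<in> Hom N (Unit N) (fob F (Unit M))"
    and mult_map: "X \<in> Obj M \<Longrightarrow> Y \<in> Obj M \<Longrightarrow>
      p X Y \<in> Hom N (fob F X \<otimes>\<^bsub>N\<^esub> fob F Y) (fob F (X \<otimes>\<^bsub>M\<^esub> Y))"
    and mult_natural: "f \<in> Hom M X X' \<Longrightarrow> g \<in> Hom M Y Y' \<Longrightarrow>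
      p X' Y' \<cdot>\<^bsub>N\<^esub> (far F f \<odot>\<^bsub>N\<^esub> far F g) = far F (f \<odot>\<^bsub>M\<^esub> g) \<cdot>\<^bsub>N\<^esub> p X Y"
    and mult_assoc: "X \<in> Obj M \<Longrightarrow> Y \<in> Obj M \<Longrightarrow> Z \<in> Obj M \<Longrightarrow>
      far F (Assoc M X Y Z) \<cdot>\<^bsub>N\<^esub> p (X \<otimes>\<^bsub>M\<^esub> Y) Z \<cdot>\<^bsub>N\<^esub> (p X Y \<odot>\<^bsub>N\<^esub> Ide N (fob F Z)) =
      p X (Y \<otimes>\<^bsub>M\<^esub> Z) \<cdot>\<^bsub>N\<^esub> (Ide N (fob F X) \<odot>\<^bsub>N\<^esub> p Y Z) \<cdot>\<^bsub>N\<^esub> Assoc N (fob F X) (fob F Y) (fob F Z)"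
    and left_unit: "X \<in> Obj M \<Longrightarrow>
      far F (LUnit M X) \<cdot>\<^bsub>N\<^esub> p (Unit M) X \<cdot>\<^bsub>N\<^esub> (u \<odot>\<^bsub>N\<^esub> Ide N (fob F X)) = LUnit N (fob F X)"
    and right_unit: "X \<in> Obj M \<Longrightarrow>
      far F (RUnit M X) \<cdot>\<^bsub>N\<^esub> p X (Unit M) \<cdot>\<^bsub>N\<^esub> (Ide N (fob F X) \<odot>\<^bsub>N\<^esub> u) = RUnit N (fob F X)"
    and mult_swap: "X \<in> Obj M \<Longrightarrow> Y \<in> Obj M \<Longrightarrow>
      far F (Swap M X Y) \<cdot>\<^bsub>N\<^esub> p X Y = p Y X \<cdot>\<^bsub>N\<^esub> Swap N (fob F X) (fob F Y)"

definition unit_preserving :: "('o, 'a, 'z) smcat_scheme \<Rightarrow> 'a \<Rightarrow> bool" where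
  "unit_preserving N u \<longleftrightarrow> is_iso N u"

definition strong_structure ::
  "('i, 'j, 'y) smcat_scheme \<Rightarrow> ('o, 'a, 'z) smcat_scheme \<Rightarrow> 'a \<Rightarrow> ('i \<Rightarrow> 'i \<Rightarrow> 'a) \<Rightarrow> bool" where
  "strong_structure M N u p \<longleftrightarrow> is_iso N u \<and> (\<forall>X\<in>Obj M. \<forall>Y\<in>Obj M. is_iso N (p X Y))"

definition tensor_functor ::
  "('i, 'j, 'y) cat_scheme \<Rightarrow> ('o, 'a, 'z) smcat_scheme \<Rightarrow>
   ('i, 'j, 'o, 'a) functor_data \<Rightarrow> ('i, 'j, 'o, 'a) functor_data \<Rightarrow> ('i, 'j, 'o, 'a) functor_data" where
  "tensor_functor J M F G = restrict_functor J
     \<lparr>fob = \<lambda>i. fob F i \<otimes>\<^bsub>M\<^esub> fob G i, far = \<lambda>f. far F f \<odot>\<^bsub>M\<^esub> far G f\<rparr>"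

definition const_functor ::
  "('i, 'j, 'y) cat_scheme \<Rightarrow> ('o, 'a, 'z) cat_scheme \<Rightarrow> 'o \<Rightarrow> ('i, 'j, 'o, 'a) functor_data" where
  "const_functor J E A = restrict_functor J \<lparr>fob = \<lambda>_. A, far = \<lambda>_. Ide E A\<rparr>"

text \<open>The category of functors \<open>J \<rightarrow> M\<close> with the pointwise symmetric monoidal structure.\<close>

definition functor_cat ::
  "('i, 'j, 'y) cat_scheme \<Rightarrow> ('o, 'a, 'z) smcat_scheme \<Rightarrow>
   (('i, 'j, 'o, 'a) functor_data, ('i, 'j, 'o, 'a) nat_trans) smcat" where
  "functor_cat J M = \<lparr>Obj = functors J M, Arr = nat_transs J M,
     Dom = (\<lambda>t. source t), Cod = (\<lambda>t. target t),
     Ide = (\<lambda>F. (F, \<lambda>i\<in>Obj J. Ide M (fob F i), F)),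
     Comp = (\<lambda>s t. (source t, \<lambda>i\<in>Obj J. component s i \<cdot>\<^bsub>M\<^esub> component t i, target s)),
     TensO = tensor_functor J M,
     TensA = (\<lambda>s t. (tensor_functor J M (source s) (source t),
        \<lambda>i\<in>Obj J. component s i \<odot>\<^bsub>M\<^esub> component t i, tensor_functor J M (target s) (target t))),
     Unit = const_functor J M (Unit M),
     Assoc = (\<lambda>F G H. (tensor_functor J M (tensor_functor J M F G) H,
        \<lambda>i\<in>Obj J. Assoc M (fob F i) (fob G i) (fob H i),
        tensor_functor J M F (tensor_functor J M G H))),
     LUnit = (\<lambda>F. (tensor_functor J M (const_functor J M (Unit M)) F,
        \<lambda>i\<in>Obj J. LUnit M (fob F i), F)),
     RUnit = (\<lambda>F. (tensor_functor J M F (const_functor J M (Unit M)),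
        \<lambda>i\<in>Obj J. RUnit M (fob F i), F)),
     Swap = (\<lambda>F G. (tensor_functor J M F G,
        \<lambda>i\<in>Obj J. Swap M (fob F i) (fob G i), tensor_functor J M G F))\<rparr>"

definition postcomp_functor ::
  "('i, 'j, 'y) cat_scheme \<Rightarrow> ('o, 'a, 'p, 'b) functor_data \<Rightarrow>
   (('i, 'j, 'o, 'a) functor_data, ('i, 'j, 'o, 'a) nat_trans,
    ('i, 'j, 'p, 'b) functor_data, ('i, 'j, 'p, 'b) nat_trans) functor_data" where
  "postcomp_functor J H = \<lparr>fob = (\<lambda>F. restrict_functor J (comp_functor H F)),
     far = (\<lambda>t. (restrict_functor J (comp_functor H (source t)),
        \<lambda>i\<in>Obj J. far H (component t i), restrict_functor J (comp_functor H (target t))))\<rparr>"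


section \<open>The cartesian category of small sets\<close>

text \<open>A fixed coding of elements of another type in the universe \<open>'u\<close>; it is used for ordered
  pairs and for the arrows of the simplex category, where an injection exists by cardinality.\<close>

definition code :: "'x \<Rightarrow> 'u" where
  "code = (SOME c. inj c)"

definition decode :: "'u \<Rightarrow> 'x" where
  "decode = inv code"

definition pair_code :: "'u \<Rightarrow> 'u \<Rightarrow> 'u" where
  "pair_code a b = code (a, b)"

definition fst_code :: "'u \<Rightarrow> 'u" where
  "fst_code c = fst (decode c :: 'u \<times> 'u)"

definition snd_code :: "'u \<Rightarrow> 'u" where
  "snd_code c = snd (decode c :: 'u \<times> 'u)"

definition set_prod :: "'u set \<Rightarrow> 'u set \<Rightarrow> 'u set" where
  "set_prod A B = (\<lambda>(a, b). pair_code a b) ` (A \<times> B)"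

definition set_unit :: "'u set" where
  "set_unit = {undefined}"

type_synonym 'u set_map = "'u set \<times> ('u \<Rightarrow> 'u) \<times> 'u set"

definition Sets :: "('u set, 'u set_map) smcat" where
  "Sets = \<lparr>Obj = {A. small A},
     Arr = {(A, f, B). small A \<and> small B \<and> f \<in> A \<rightarrow>\<^sub>E B},
     Dom = (\<lambda>f. source f), Cod = (\<lambda>f. target f),
     Ide = (\<lambda>A. (A, \<lambda>a\<in>A. a, A)),
     Comp = (\<lambda>g f. (source f, compose (source f) (component g) (component f), target g)),
     TensO = set_prod,
     TensA = (\<lambda>f g. (set_prod (source f) (source g),
        \<lambda>c\<in>set_prod (source f) (source g).
          pair_code (component f (fst_code c)) (component g (snd_code c)),
        set_prod (target f) (target g))),
     Unit = set_unit,
     Assoc = (\<lambda>A B D. (set_prod (set_prod A B) D,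
        \<lambda>c\<in>set_prod (set_prod A B) D.
          pair_code (fst_code (fst_code c)) (pair_code (snd_code (fst_code c)) (snd_code c)),
        set_prod A (set_prod B D))),
     LUnit = (\<lambda>A. (set_prod set_unit A, \<lambda>c\<in>set_prod set_unit A. snd_code c, A)),
     RUnit = (\<lambda>A. (set_prod A set_unit, \<lambda>c\<in>set_prod A set_unit. fst_code c, A)),
     Swap = (\<lambda>A B. (set_prod A B,
        \<lambda>c\<in>set_prod A B. pair_code (snd_code c) (fst_code c), set_prod B A))\<rparr>"


section \<open>Simplicial objects\<close>

text \<open>The object \<open>[n]\<close> is represented by \<open>n\<close>, and a monotone map \<open>f : [m] \<rightarrow> [n]\<close> by
  \<open>([f 0, \<dots>, f m], n)\<close>.\<close>

type_synonym simplex_arr = "nat list \<times> nat"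

definition \<Delta> :: "(nat, simplex_arr) cat" where
  "\<Delta> = \<lparr>Obj = UNIV,
     Arr = {(xs, n). xs \<noteq> [] \<and> sorted xs \<and> (\<forall>x\<in>set xs. x \<le> n)},
     Dom = (\<lambda>(xs, n). length xs - 1), Cod = (\<lambda>(xs, n). n),
     Ide = (\<lambda>n. ([0..<Suc n], n)),
     Comp = (\<lambda>(ys, p) (xs, n). (map (\<lambda>x. ys ! x) xs, p))\<rparr>"

type_synonym ('o, 'a) cosimplicial = "(nat, simplex_arr, 'o, 'a) functor_data"
type_synonym ('o, 'a) simplicial = "(nat, simplex_arr, 'o, 'a) functor_data"
type_synonym ('o, 'a) simplicial_map = "(nat, simplex_arr, 'o, 'a) nat_trans"

definition Simplicial ::
  "('o, 'a, 'z) smcat_scheme \<Rightarrow> (('o, 'a) simplicial, ('o, 'a) simplicial_map) smcat" where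
  "Simplicial M = functor_cat (op_cat \<Delta>) M"

definition simplex :: "nat \<Rightarrow> ('u set, 'u set_map) simplicial" where
  "simplex n = restrict_functor (op_cat \<Delta>)
     \<lparr>fob = (\<lambda>k. code ` Hom \<Delta> k n),
      far = (\<lambda>f. (code ` Hom \<Delta> (Cod \<Delta> f) n,
        \<lambda>x\<in>code ` Hom \<Delta> (Cod \<Delta> f) n. code ((decode x :: simplex_arr) \<cdot>\<^bsub>\<Delta>\<^esub> f),
        code ` Hom \<Delta> (Dom \<Delta> f) n))\<rparr>"

definition yoneda ::
  "(nat, simplex_arr, ('u set, 'u set_map) simplicial, ('u set, 'u set_map) simplicial_map) functor_data" where
  "yoneda = \<lparr>fob = simplex,
     far = (\<lambda>g. (simplex (Dom \<Delta> g),
       \<lambda>k\<in>Obj \<Delta>. (code ` Hom \<Delta> k (Dom \<Delta> g),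
         \<lambda>x\<in>code ` Hom \<Delta> k (Dom \<Delta> g). code (g \<cdot>\<^bsub>\<Delta>\<^esub> (decode x :: simplex_arr)),
         code ` Hom \<Delta> k (Cod \<Delta> g)),
       simplex (Cod \<Delta> g)))\<rparr>"


section \<open>Copowers of the unit and tensor products of functors\<close>

definition copower_cocone :: "('o, 'a, 'z) smcat_scheme \<Rightarrow> 'x set \<Rightarrow> 'o \<times> ('x \<Rightarrow> 'a)" where
  "copower_cocone E S = (SOME (A, w).
     is_colimit (discrete_cat S) E (const_functor (discrete_cat S) E (Unit E)) A w)"

definition copower :: "('o, 'a, 'z) smcat_scheme \<Rightarrow> 'x set \<Rightarrow> 'o" where
  "copower E S = fst (copower_cocone E S)"

definition copower_in :: "('o, 'a, 'z) smcat_scheme \<Rightarrow> 'x set \<Rightarrow> 'x \<Rightarrow> 'a" where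
  "copower_in E S = snd (copower_cocone E S)"

definition copower_desc ::
  "('o, 'a, 'z) smcat_scheme \<Rightarrow> 'x set \<Rightarrow> 'o \<Rightarrow> ('x \<Rightarrow> 'a) \<Rightarrow> 'a" where
  "copower_desc E S B v =
     (THE h. h \<in> Hom E (copower E S) B \<and> (\<forall>s\<in>S. h \<cdot>\<^bsub>E\<^esub> copower_in E S s = v s))"

definition copower_functor ::
  "('o, 'a, 'z) smcat_scheme \<Rightarrow> ('u set, 'u set_map, 'o, 'a) functor_data" where
  "copower_functor E = \<lparr>fob = copower E,
     far = (\<lambda>f. copower_desc E (source f) (copower E (target f))
       (\<lambda>s. copower_in E (target f) (component f s)))\<rparr>"

text \<open>The functor \<open>(-)\<^sub>E\<close> from simplicial sets to simplicial objects of \<open>E\<close>.\<close>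

definition simp_copower ::
  "('o, 'a, 'z) smcat_scheme \<Rightarrow>
   (('u set, 'u set_map) simplicial, ('u set, 'u set_map) simplicial_map,
    ('o, 'a) simplicial, ('o, 'a) simplicial_map) functor_data" where
  "simp_copower E = postcomp_functor (op_cat \<Delta>) (copower_functor E)"

definition external_tensor ::
  "('o, 'a, 'z) smcat_scheme \<Rightarrow> ('i, 'j, 'o, 'a) functor_data \<Rightarrow> ('k, 'l, 'o, 'a) functor_data \<Rightarrow>
   ('i \<times> 'k, 'j \<times> 'l, 'o, 'a) functor_data" where
  "external_tensor E X Z =
     \<lparr>fob = (\<lambda>(i, k). fob X i \<otimes>\<^bsub>E\<^esub> fob Z k), far = (\<lambda>(f, g). far X f \<odot>\<^bsub>E\<^esub> far Z g)\<rparr>"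

text \<open>The tensor product over \<open>J\<close> of \<open>X : J\<^sup>o\<^sup>p \<rightarrow> E\<close> and \<open>Z : J \<rightarrow> E\<close>, with the legs
  \<open>X i \<otimes> Z i \<rightarrow> X \<otimes>\<^sub>J Z\<close> of the universal wedge.\<close>

definition tensor_over_wedge ::
  "('i, 'j, 'y) cat_scheme \<Rightarrow> ('o, 'a, 'z) smcat_scheme \<Rightarrow> ('i, 'j, 'o, 'a) functor_data \<Rightarrow>
   ('i, 'j, 'o, 'a) functor_data \<Rightarrow> 'o \<times> ('i \<Rightarrow> 'a)" where
  "tensor_over_wedge J E X Z = (SOME (A, w). is_coend J E (external_tensor E X Z) A w)"

definition tensor_over ::
  "('i, 'j, 'y) cat_scheme \<Rightarrow> ('o, 'a, 'z) smcat_scheme \<Rightarrow> ('i, 'j, 'o, 'a) functor_data \<Rightarrow>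
   ('i, 'j, 'o, 'a) functor_data \<Rightarrow> 'o" where
  "tensor_over J E X Z = fst (tensor_over_wedge J E X Z)"

definition tensor_over_leg ::
  "('i, 'j, 'y) cat_scheme \<Rightarrow> ('o, 'a, 'z) smcat_scheme \<Rightarrow> ('i, 'j, 'o, 'a) functor_data \<Rightarrow>
   ('i, 'j, 'o, 'a) functor_data \<Rightarrow> 'i \<Rightarrow> 'a" where
  "tensor_over_leg J E X Z = snd (tensor_over_wedge J E X Z)"

definition tensor_over_desc ::
  "('i, 'j, 'y) cat_scheme \<Rightarrow> ('o, 'a, 'z) smcat_scheme \<Rightarrow> ('i, 'j, 'o, 'a) functor_data \<Rightarrow>
   ('i, 'j, 'o, 'a) functor_data \<Rightarrow> 'o \<Rightarrow> ('i \<Rightarrow> 'a) \<Rightarrow> 'a" where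
  "tensor_over_desc J E X Z B v = (THE h. h \<in> Hom E (tensor_over J E X Z) B \<and>
     (\<forall>i\<in>Obj J. h \<cdot>\<^bsub>E\<^esub> tensor_over_leg J E X Z i = v i))"


section \<open>Realisation\<close>

definition realisation ::
  "('o, 'a, 'z) smcat_scheme \<Rightarrow> ('o, 'a) cosimplicial \<Rightarrow>
   (('o, 'a) simplicial, ('o, 'a) simplicial_map, 'o, 'a) functor_data" where
  "realisation E C = \<lparr>fob = (\<lambda>X. tensor_over \<Delta> E X C),
     far = (\<lambda>t. tensor_over_desc \<Delta> E (source t) C (tensor_over \<Delta> E (target t) C)
       (\<lambda>n. tensor_over_leg \<Delta> E (target t) C n \<cdot>\<^bsub>E\<^esub> (component t n \<odot>\<^bsub>E\<^esub> Ide E (fob C n))))\<rparr>"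

abbreviation real_leg ::
  "('o, 'a, 'z) smcat_scheme \<Rightarrow> ('o, 'a) cosimplicial \<Rightarrow> ('o, 'a) simplicial \<Rightarrow> nat \<Rightarrow> 'a" where
  "real_leg E C X n \<equiv> tensor_over_leg \<Delta> E X C n"

definition set_realisation ::
  "('o, 'a, 'z) smcat_scheme \<Rightarrow> ('o, 'a) cosimplicial \<Rightarrow>
   (('u set, 'u set_map) simplicial, ('u set, 'u set_map) simplicial_map, 'o, 'a) functor_data" where
  "set_realisation E C = comp_functor (realisation E C) (simp_copower E)"

text \<open>The argument \<open>U\<close> below only fixes the universe \<open>'u\<close> in which the standard simplices live.\<close>

definition simplex_E ::
  "'u itself \<Rightarrow> ('o, 'a, 'z) smcat_scheme \<Rightarrow>
   (nat, simplex_arr, ('o, 'a) simplicial, ('o, 'a) simplicial_map) functor_data" where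
  "simplex_E U E = comp_functor (simp_copower E)
     (yoneda :: (nat, simplex_arr, ('u set, 'u set_map) simplicial, ('u set, 'u set_map) simplicial_map) functor_data)"

definition simplex_in ::
  "'u itself \<Rightarrow> ('o, 'a, 'z) smcat_scheme \<Rightarrow> nat \<Rightarrow> nat \<Rightarrow> simplex_arr \<Rightarrow> 'a" where
  "simplex_in U E m k f = copower_in E (fob (simplex m) k :: 'u set) (code f)"

text \<open>The isomorphism from \<open>C m\<close> to the realisation of the standard \<open>m\<close>-simplex of \<open>E\<close>, namely
  \<open>C m \<cong> I \<otimes> C m \<rightarrow> \<Delta>[m] m \<otimes> C m \<rightarrow> |\<Delta>[m]|\<close>, where \<open>I\<close> is included as the summand of \<open>id\<close>.\<close>

definition yoneda_iso ::
  "'u itself \<Rightarrow> ('o, 'a, 'z) smcat_scheme \<Rightarrow> ('o, 'a) cosimplicial \<Rightarrow> nat \<Rightarrow> 'a" where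
  "yoneda_iso U E C m =
     real_leg E C (fob (simplex_E U E) m) m \<cdot>\<^bsub>E\<^esub>
     (simplex_in U E m m (Ide \<Delta> m) \<odot>\<^bsub>E\<^esub> Ide E (fob C m)) \<cdot>\<^bsub>E\<^esub> inv_arr E (LUnit E (fob C m))"

text \<open>The arrow \<open>\<iota>\<close> is the given isomorphism from the unit of \<open>E\<close> to \<open>C 0\<close>.\<close>

definition simplex_unit ::
  "'u itself \<Rightarrow> ('o, 'a, 'z) smcat_scheme \<Rightarrow> ('o, 'a) cosimplicial \<Rightarrow> 'a \<Rightarrow> 'a" where
  "simplex_unit U E C \<iota> = yoneda_iso U E C 0 \<cdot>\<^bsub>E\<^esub> \<iota>"

text \<open>The canonical isomorphisms from the 0-simplex to the monoidal units of the categories of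
  simplicial objects of \<open>E\<close> and of simplicial sets.\<close>

definition simplex0_E ::
  "'u itself \<Rightarrow> ('o, 'a, 'z) smcat_scheme \<Rightarrow> ('o, 'a) simplicial_map" where
  "simplex0_E U E = (fob (simplex_E U E) 0,
     \<lambda>k\<in>Obj \<Delta>. copower_desc E (fob (simplex 0) k :: 'u set) (Unit E) (\<lambda>_. Ide E (Unit E)),
     Unit (Simplicial E))"

definition simplex0_set :: "('u set, 'u set_map) simplicial_map" where
  "simplex0_set = (simplex 0,
     \<lambda>k\<in>Obj \<Delta>. (fob (simplex 0) k, \<lambda>x\<in>fob (simplex 0) k. undefined, set_unit),
     Unit (Simplicial Sets))"

definition realisation_unit ::
  "'u itself \<Rightarrow> ('o, 'a, 'z) smcat_scheme \<Rightarrow> ('o, 'a) cosimplicial \<Rightarrow> 'a \<Rightarrow> 'a" where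
  "realisation_unit U E C \<iota> = far (realisation E C) (simplex0_E U E) \<cdot>\<^bsub>E\<^esub> simplex_unit U E C \<iota>"

definition set_realisation_unit ::
  "'u itself \<Rightarrow> ('o, 'a, 'z) smcat_scheme \<Rightarrow> ('o, 'a) cosimplicial \<Rightarrow> 'a \<Rightarrow> 'a" where
  "set_realisation_unit U E C \<iota> =
     far (set_realisation E C) (simplex0_set :: ('u set, 'u set_map) simplicial_map) \<cdot>\<^bsub>E\<^esub>
     simplex_unit U E C \<iota>"

definition monoidal_cosimplicial ::
  "'u itself \<Rightarrow> ('o, 'a, 'z) smcat_scheme \<Rightarrow> ('o, 'a) cosimplicial \<Rightarrow> 'a \<Rightarrow> bool" where
  "monoidal_cosimplicial U E C \<iota> \<longleftrightarrow> unit_preserving E (realisation_unit U E C \<iota>) \<and>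
     (\<exists>p. symmetric_monoidal_functor (Simplicial E) E (realisation E C) (realisation_unit U E C \<iota>) p)"

definition strong_monoidal_cosimplicial ::
  "'u itself \<Rightarrow> ('o, 'a, 'z) smcat_scheme \<Rightarrow> ('o, 'a) cosimplicial \<Rightarrow> 'a \<Rightarrow> bool" where
  "strong_monoidal_cosimplicial U E C \<iota> \<longleftrightarrow> unit_preserving E (realisation_unit U E C \<iota>) \<and>
     (\<exists>p. symmetric_monoidal_functor (Simplicial E) E (realisation E C) (realisation_unit U E C \<iota>) p \<and>
          strong_structure (Simplicial E) E (realisation_unit U E C \<iota>) p)"

definition monoidal_set_realisation ::
  "'u itself \<Rightarrow> ('o, 'a, 'z) smcat_scheme \<Rightarrow> ('o, 'a) cosimplicial \<Rightarrow> 'a \<Rightarrow> bool" where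
  "monoidal_set_realisation U E C \<iota> \<longleftrightarrow>
     (\<exists>p. symmetric_monoidal_functor (Simplicial (Sets :: ('u set, 'u set_map) smcat)) E
            (set_realisation E C) (set_realisation_unit U E C \<iota>) p)"

definition strong_monoidal_set_realisation ::
  "'u itself \<Rightarrow> ('o, 'a, 'z) smcat_scheme \<Rightarrow> ('o, 'a) cosimplicial \<Rightarrow> 'a \<Rightarrow> bool" where
  "strong_monoidal_set_realisation U E C \<iota> \<longleftrightarrow>
     (\<exists>p. symmetric_monoidal_functor (Simplicial (Sets :: ('u set, 'u set_map) smcat)) E
            (set_realisation E C) (set_realisation_unit U E C \<iota>) p \<and>
          strong_structure (Simplicial (Sets :: ('u set, 'u set_map) smcat)) E
            (set_realisation_unit U E C \<iota>) p)"


section \<open>Eilenberg-Zilber systems\<close>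

abbreviation \<Delta>\<Delta> :: "(nat \<times> nat, simplex_arr \<times> simplex_arr) cat" where
  "\<Delta>\<Delta> \<equiv> prod_cat \<Delta> \<Delta>"

type_synonym ('o, 'a) bifunctor =
  "(nat \<times> nat, simplex_arr \<times> simplex_arr, 'o, 'a) functor_data"

text \<open>The bicosimplicial objects \<open>|\<Delta>[m]| \<otimes> |\<Delta>[n]|\<close> and \<open>|\<Delta>[m] \<otimes> \<Delta>[n]|\<close>.\<close>

definition EZ_source ::
  "'u itself \<Rightarrow> ('o, 'a, 'z) smcat_scheme \<Rightarrow> ('o, 'a) cosimplicial \<Rightarrow> ('o, 'a) bifunctor" where
  "EZ_source U E C = external_tensor E
     (comp_functor (realisation E C) (simplex_E U E)) (comp_functor (realisation E C) (simplex_E U E))"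

definition EZ_target ::
  "'u itself \<Rightarrow> ('o, 'a, 'z) smcat_scheme \<Rightarrow> ('o, 'a) cosimplicial \<Rightarrow> ('o, 'a) bifunctor" where
  "EZ_target U E C = comp_functor (realisation E C)
     (external_tensor (Simplicial E) (simplex_E U E) (simplex_E U E))"

text \<open>\<open>(A \<otimes> B) \<otimes> (D \<otimes> F) \<cong> (A \<otimes> D) \<otimes> (B \<otimes> F)\<close>\<close>

definition interchange :: "('o, 'a, 'z) smcat_scheme \<Rightarrow> 'o \<Rightarrow> 'o \<Rightarrow> 'o \<Rightarrow> 'o \<Rightarrow> 'a" where
  "interchange E A B D F =
     inv_arr E (Assoc E A D (B \<otimes>\<^bsub>E\<^esub> F)) \<cdot>\<^bsub>E\<^esub>
     (Ide E A \<odot>\<^bsub>E\<^esub> (Assoc E D B F \<cdot>\<^bsub>E\<^esub> (Swap E B D \<odot>\<^bsub>E\<^esub> Ide E F) \<cdot>\<^bsub>E\<^esub> inv_arr E (Assoc E B D F))) \<cdot>\<^bsub>E\<^esub>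
     Assoc E A B (D \<otimes>\<^bsub>E\<^esub> F)"

text \<open>The canonical isomorphism
  \<open>(X \<box> Y) \<otimes>\<^sub>\<Delta>\<^sub>\<Delta> (|\<Delta>[m]| \<otimes> |\<Delta>[n]|) \<cong> |X| \<otimes> |Y|\<close>: on the summand \<open>(m, n)\<close> it is induced
  by \<open>(X m \<otimes> Y n) \<otimes> (C m \<otimes> C n) \<cong> (X m \<otimes> C m) \<otimes> (Y n \<otimes> C n) \<rightarrow> |X| \<otimes> |Y|\<close>.\<close>

definition source_leg ::
  "'u itself \<Rightarrow> ('o, 'a, 'z) smcat_scheme \<Rightarrow> ('o, 'a) cosimplicial \<Rightarrow>
   ('o, 'a) simplicial \<Rightarrow> ('o, 'a) simplicial \<Rightarrow> nat \<Rightarrow> nat \<Rightarrow> 'a" where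
  "source_leg U E C X Y m n =
     (real_leg E C X m \<odot>\<^bsub>E\<^esub> real_leg E C Y n) \<cdot>\<^bsub>E\<^esub>
     interchange E (fob X m) (fob Y n) (fob C m) (fob C n) \<cdot>\<^bsub>E\<^esub>
     (Ide E (fob X m \<otimes>\<^bsub>E\<^esub> fob Y n) \<odot>\<^bsub>E\<^esub>
       (inv_arr E (yoneda_iso U E C m) \<odot>\<^bsub>E\<^esub> inv_arr E (yoneda_iso U E C n)))"

definition source_iso ::
  "'u itself \<Rightarrow> ('o, 'a, 'z) smcat_scheme \<Rightarrow> ('o, 'a) cosimplicial \<Rightarrow>
   ('o, 'a) simplicial \<Rightarrow> ('o, 'a) simplicial \<Rightarrow> 'a" where
  "source_iso U E C X Y = tensor_over_desc \<Delta>\<Delta> E (external_tensor E X Y) (EZ_source U E C)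
     (fob (realisation E C) X \<otimes>\<^bsub>E\<^esub> fob (realisation E C) Y) (\<lambda>(m, n). source_leg U E C X Y m n)"

text \<open>The map \<open>X m \<otimes> \<Delta>[m] k \<rightarrow> X k\<close> given on the summand of \<open>f : [k] \<rightarrow> [m]\<close> by
  \<open>X f : X m \<rightarrow> X k\<close>.\<close>

definition simplex_action ::
  "'u itself \<Rightarrow> ('o, 'a, 'z) smcat_scheme \<Rightarrow> ('o, 'a) simplicial \<Rightarrow> nat \<Rightarrow> nat \<Rightarrow> 'a" where
  "simplex_action U E X m k =
     (THE h. h \<in> Hom E (fob X m \<otimes>\<^bsub>E\<^esub> fob (fob (simplex_E U E) m) k) (fob X k) \<and>
        (\<forall>f\<in>Hom \<Delta> k m. h \<cdot>\<^bsub>E\<^esub> (Ide E (fob X m) \<odot>\<^bsub>E\<^esub> simplex_in U E m k f) =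
           far X f \<cdot>\<^bsub>E\<^esub> RUnit E (fob X m)))"

text \<open>The canonical isomorphism
  \<open>(X \<box> Y) \<otimes>\<^sub>\<Delta>\<^sub>\<Delta> |\<Delta>[m] \<otimes> \<Delta>[n]| \<cong> |X \<otimes> Y|\<close>: on the summand \<open>(m, n)\<close> it is induced by
  \<open>(X m \<otimes> Y n) \<otimes> ((\<Delta>[m] k \<otimes> \<Delta>[n] k) \<otimes> C k) \<rightarrow> (X k \<otimes> Y k) \<otimes> C k \<rightarrow> |X \<otimes> Y|\<close>.\<close>

definition target_leg ::
  "'u itself \<Rightarrow> ('o, 'a, 'z) smcat_scheme \<Rightarrow> ('o, 'a) cosimplicial \<Rightarrow>
   ('o, 'a) simplicial \<Rightarrow> ('o, 'a) simplicial \<Rightarrow> nat \<Rightarrow> nat \<Rightarrow> 'a" where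
  "target_leg U E C X Y m n =
     (let \<Delta>m = fob (simplex_E U E) m; \<Delta>n = fob (simplex_E U E) n in
      THE h. h \<in> Hom E ((fob X m \<otimes>\<^bsub>E\<^esub> fob Y n) \<otimes>\<^bsub>E\<^esub> fob (realisation E C) (\<Delta>m \<otimes>\<^bsub>Simplicial E\<^esub> \<Delta>n))
                       (fob (realisation E C) (X \<otimes>\<^bsub>Simplicial E\<^esub> Y)) \<and>
        (\<forall>k. h \<cdot>\<^bsub>E\<^esub> (Ide E (fob X m \<otimes>\<^bsub>E\<^esub> fob Y n) \<odot>\<^bsub>E\<^esub> real_leg E C (\<Delta>m \<otimes>\<^bsub>Simplicial E\<^esub> \<Delta>n) k) =
           real_leg E C (X \<otimes>\<^bsub>Simplicial E\<^esub> Y) k \<cdot>\<^bsub>E\<^esub>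
           (((simplex_action U E X m k \<odot>\<^bsub>E\<^esub> simplex_action U E Y n k) \<cdot>\<^bsub>E\<^esub>
             interchange E (fob X m) (fob Y n) (fob \<Delta>m k) (fob \<Delta>n k)) \<odot>\<^bsub>E\<^esub> Ide E (fob C k)) \<cdot>\<^bsub>E\<^esub>
           inv_arr E (Assoc E (fob X m \<otimes>\<^bsub>E\<^esub> fob Y n) (fob \<Delta>m k \<otimes>\<^bsub>E\<^esub> fob \<Delta>n k) (fob C k))))"

definition target_iso ::
  "'u itself \<Rightarrow> ('o, 'a, 'z) smcat_scheme \<Rightarrow> ('o, 'a) cosimplicial \<Rightarrow>
   ('o, 'a) simplicial \<Rightarrow> ('o, 'a) simplicial \<Rightarrow> 'a" where
  "target_iso U E C X Y = tensor_over_desc \<Delta>\<Delta> E (external_tensor E X Y) (EZ_target U E C)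
     (fob (realisation E C) (X \<otimes>\<^bsub>Simplicial E\<^esub> Y)) (\<lambda>(m, n). target_leg U E C X Y m n)"

text \<open>The map \<open>|X| \<otimes> |Y| \<rightarrow> |X \<otimes> Y|\<close> induced by a natural family \<open>e m n\<close>.\<close>

definition EZ_extension ::
  "'u itself \<Rightarrow> ('o, 'a, 'z) smcat_scheme \<Rightarrow> ('o, 'a) cosimplicial \<Rightarrow> (nat \<Rightarrow> nat \<Rightarrow> 'a) \<Rightarrow>
   ('o, 'a) simplicial \<Rightarrow> ('o, 'a) simplicial \<Rightarrow> 'a" where
  "EZ_extension U E C e X Y =
     target_iso U E C X Y \<cdot>\<^bsub>E\<^esub>
     tensor_over_desc \<Delta>\<Delta> E (external_tensor E X Y) (EZ_source U E C)
       (tensor_over \<Delta>\<Delta> E (external_tensor E X Y) (EZ_target U E C))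
       (\<lambda>(m, n). tensor_over_leg \<Delta>\<Delta> E (external_tensor E X Y) (EZ_target U E C) (m, n) \<cdot>\<^bsub>E\<^esub>
          (Ide E (fob X m \<otimes>\<^bsub>E\<^esub> fob Y n) \<odot>\<^bsub>E\<^esub> e m n)) \<cdot>\<^bsub>E\<^esub>
     inv_arr E (source_iso U E C X Y)"

text \<open>Domains and codomains are matched along the associator of \<open>E\<close> and the images of the
  canonical maps of simplicial objects; in particular the unit conditions use
  \<open>\<Delta>[0] \<otimes> \<Delta>[n] \<rightarrow> I \<otimes> \<Delta>[n] \<rightarrow> \<Delta>[n]\<close> and \<open>I \<cong> C 0 \<cong> |\<Delta>[0]|\<close>.\<close>

locale EZ_system =
  fixes U :: "'u itself" and E :: "('o, 'a, 'z) smcat_scheme" and C :: "('o, 'a) cosimplicial"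
    and \<iota> :: 'a and e :: "nat \<Rightarrow> nat \<Rightarrow> 'a"
    and S :: "nat \<Rightarrow> ('o, 'a) simplicial" and R :: "('o, 'a) simplicial \<Rightarrow> 'o"
    and RA :: "('o, 'a) simplicial_map \<Rightarrow> 'a"
  defines "S \<equiv> fob (simplex_E U E)"
    and "R \<equiv> fob (realisation E C)"
    and "RA \<equiv> far (realisation E C)"
  assumes EZ_hom: "e m n \<in> Hom E (R (S m) \<otimes>\<^bsub>E\<^esub> R (S n)) (R (S m \<otimes>\<^bsub>Simplicial E\<^esub> S n))"
    and EZ_natural: "f \<in> Hom \<Delta> m m' \<Longrightarrow> g \<in> Hom \<Delta> n n' \<Longrightarrow>
      e m' n' \<cdot>\<^bsub>E\<^esub> (RA (far (simplex_E U E) f) \<odot>\<^bsub>E\<^esub> RA (far (simplex_E U E) g)) =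
      RA (far (simplex_E U E) f \<odot>\<^bsub>Simplicial E\<^esub> far (simplex_E U E) g) \<cdot>\<^bsub>E\<^esub> e m n"
    and EZ_assoc:
      "RA (Assoc (Simplicial E) (S m) (S n) (S q)) \<cdot>\<^bsub>E\<^esub>
         EZ_extension U E C e (S m \<otimes>\<^bsub>Simplicial E\<^esub> S n) (S q) \<cdot>\<^bsub>E\<^esub> (e m n \<odot>\<^bsub>E\<^esub> Ide E (R (S q))) =
       EZ_extension U E C e (S m) (S n \<otimes>\<^bsub>Simplicial E\<^esub> S q) \<cdot>\<^bsub>E\<^esub> (Ide E (R (S m)) \<odot>\<^bsub>E\<^esub> e n q) \<cdot>\<^bsub>E\<^esub>
         Assoc E (R (S m)) (R (S n)) (R (S q))"
    and EZ_left_unit: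
      "RA (LUnit (Simplicial E) (S n) \<cdot>\<^bsub>Simplicial E\<^esub>
           (simplex0_E U E \<odot>\<^bsub>Simplicial E\<^esub> Ide (Simplicial E) (S n))) \<cdot>\<^bsub>E\<^esub>
         e 0 n \<cdot>\<^bsub>E\<^esub> (simplex_unit U E C \<iota> \<odot>\<^bsub>E\<^esub> Ide E (R (S n))) = LUnit E (R (S n))"
    and EZ_right_unit:
      "RA (RUnit (Simplicial E) (S m) \<cdot>\<^bsub>Simplicial E\<^esub>
           (Ide (Simplicial E) (S m) \<odot>\<^bsub>Simplicial E\<^esub> simplex0_E U E)) \<cdot>\<^bsub>E\<^esub>
         e m 0 \<cdot>\<^bsub>E\<^esub> (Ide E (R (S m)) \<odot>\<^bsub>E\<^esub> simplex_unit U E C \<iota>) = RUnit E (R (S m))"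
    and EZ_swap:
      "RA (Swap (Simplicial E) (S m) (S n)) \<cdot>\<^bsub>E\<^esub> e m n = e n m \<cdot>\<^bsub>E\<^esub> Swap E (R (S m)) (R (S n))"

end

theory Submission
  imports Defs "HOL-Library.Countable"
begin

text \<open>
  Write \<open>|X|\<close> for the realisation \<open>R X\<close> of a simplicial object, \<open>G\<close> for the functor that turns a
  simplicial set into a simplicial object by degreewise copowers of the unit, and \<open>S m\<close> for the
  value of \<open>G\<close> at the standard \<open>m\<close>-simplex.  The reason for the theorem is that a symmetric monoidal
  structure on the realisation is determined by its values at pairs of standard simplices, and that
  each of its axioms can be tested on standard simplices.

  Any simplicial object \<open>X\<close> is glued from simplices with coefficients in \<open>E\<close>: there are maps
  \<open>X m \<otimes> |S m| \<rightarrow> |X|\<close>, which are jointly epic (\<open>co_yoneda_jointly_epic\<close>).  As \<open>E\<close> is closed, tensoring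
  preserves such presentations in both variables.  Hence \<open>|X| \<otimes> |Y|\<close> and \<open>|X \<otimes> Y|\<close> are coends over
  \<open>\<Delta> \<times> \<Delta>\<close> in which the coefficients \<open>X m \<otimes> Y n\<close> are paired with \<open>|S m| \<otimes> |S n|\<close> and with
  \<open>|S m \<otimes> S n|\<close> (\<open>source_universal\<close>, \<open>target_desc\<close>).  A natural family \<open>e m n\<close> thus extends to natural
  maps \<open>P X Y\<close> from \<open>|X| \<otimes> |Y|\<close> to \<open>|X \<otimes> Y|\<close>.  The extension restricts to the family on simplices
  (\<open>P_simplex\<close>) and is invertible if the family is (\<open>P_iso\<close>).

  It remains to see that the conditions on an Eilenberg-Zilber system become the axioms of a
  symmetric monoidal functor.  For the symmetry this is a computation on the two coends
  (\<open>P_swap\<close>).  The laws of associativity and unit contain nested pairings, and here the key is that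
  \<open>P\<close> is linear: coefficients from \<open>E\<close> that act on its first variable pass through it (\<open>P_linear\<close>).
  If the associativity law holds for \<open>S m, Y, Z\<close> for every \<open>m\<close>, it therefore holds for \<open>X, Y, Z\<close>
  (\<open>P_assoc_peel\<close>).  This concerns the first variable only, but in the presence of the symmetry the
  law for some orders of three objects implies it for others (\<open>associative_reverse\<close>,
  \<open>associative_middle\<close>), which suffices to replace the three simplices one after another by
  arbitrary objects.  The right unit law follows in the same manner (\<open>P_runit\<close>), and the left one by
  symmetry.  So an Eilenberg-Zilber system makes the realisation monoidal
  (\<open>monoidal_of_EZ_system\<close>).

  The functor \<open>G\<close> is strong symmetric monoidal (\<open>symmetric_monoidal_copower\<close>), and the realisation of
  simplicial sets is its composite with \<open>|-|\<close>, hence monoidal if \<open>|-|\<close> is.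

  Finally let \<open>p\<close> be the structure map of a monoidal realisation of simplicial sets.  Composing it with the
  inverse of the isomorphism from \<open>G X \<otimes> G Y\<close> to \<open>G (X \<times> Y)\<close> yields maps from \<open>|G X| \<otimes> |G Y|\<close> to
  \<open>|G X \<otimes> G Y|\<close>, and their values at simplices are the desired family.  Its conditions are the axioms
  for \<open>p\<close>, except that associativity is formulated with the extension of the family to
  \<open>S m \<otimes> S n\<close>.  That extension agrees with the given maps on all objects \<open>G X\<close>, since every element of
  a simplicial set is the image of a universal element of a simplex (\<open>P_free\<close>).

  In each step isomorphisms yield isomorphisms, which gives the strong version.
\<close>

section \<open>Calculating with arrows\<close>

lemma in_Hom [simp]: "f \<in> Hom E A B \<longleftrightarrow> f \<in> Arr E \<and> Dom E f = A \<and> Cod E f = B"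
  by (simp add: Hom_def)

context category
begin

abbreviation ident ("\<i>") where "\<i> A \<equiv> Ide E A"

lemma Obj_Dom [simp]: "f \<in> Arr E \<Longrightarrow> Dom E f \<in> Obj E"
  and Obj_Cod [simp]: "f \<in> Arr E \<Longrightarrow> Cod E f \<in> Obj E"
  using dom_cod by auto

lemma Arr_Ide [simp]: "A \<in> Obj E \<Longrightarrow> \<i> A \<in> Arr E"
  and Dom_Ide [simp]: "A \<in> Obj E \<Longrightarrow> Dom E (\<i> A) = A"
  and Cod_Ide [simp]: "A \<in> Obj E \<Longrightarrow> Cod E (\<i> A) = A"
  using ide_hom by auto

lemma
  assumes "f \<in> Arr E" "g \<in> Arr E" "Dom E g = Cod E f"
  shows Arr_Comp [simp]: "g \<cdot> f \<in> Arr E"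
    and Dom_Comp [simp]: "Dom E (g \<cdot> f) = Dom E f"
    and Cod_Comp [simp]: "Cod E (g \<cdot> f) = Cod E g"
  using comp_hom[of f "Dom E f" "Cod E f" g "Cod E g"] assms by auto

lemma Ide_Comp [simp]: "f \<in> Arr E \<Longrightarrow> Cod E f = B \<Longrightarrow> \<i> B \<cdot> f = f"
  using ide_left[of f "Dom E f" B] by auto

lemma Comp_Ide [simp]: "f \<in> Arr E \<Longrightarrow> Dom E f = A \<Longrightarrow> f \<cdot> \<i> A = f"
  using ide_right[of f A "Cod E f"] by auto

lemma Comp_assoc [simp]:
  "f \<in> Arr E \<Longrightarrow> g \<in> Arr E \<Longrightarrow> h \<in> Arr E \<Longrightarrow> Dom E g = Cod E f \<Longrightarrow> Dom E h = Cod E g \<Longrightarrow>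
   (h \<cdot> g) \<cdot> f = h \<cdot> (g \<cdot> f)"
  using comp_assoc[of f "Dom E f" "Cod E f" g "Cod E g" h "Cod E h"] by auto

text \<open>Composites are normalised to the right; this turns an equation for a composite of two
  arrows into one that applies at the head of a longer composite.\<close>

lemma reassoc:
  "g \<cdot> f = k \<Longrightarrow> g \<in> Arr E \<Longrightarrow> f \<in> Arr E \<Longrightarrow> Dom E g = Cod E f \<Longrightarrow>
   x \<in> Arr E \<Longrightarrow> Cod E x = Dom E f \<Longrightarrow> g \<cdot> (f \<cdot> x) = k \<cdot> x"
  using Comp_assoc by metis

lemma inverse_arrows_unique:
  assumes "inverse_arrows E f g" "inverse_arrows E f h" shows "g = h"
proof -
  have "g = g \<cdot> (f \<cdot> h)" using assms by (simp add: inverse_arrows_def)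
  also have "\<dots> = (g \<cdot> f) \<cdot> h" using assms by (subst Comp_assoc) (auto simp: inverse_arrows_def)
  finally show ?thesis using assms by (simp add: inverse_arrows_def)
qed

lemma inv_arrI: "inverse_arrows E f g \<Longrightarrow> inv_arr E f = g"
  unfolding inv_arr_def using inverse_arrows_unique by (intro the_equality) auto

lemma is_isoI: "f \<in> Hom E A B \<Longrightarrow> g \<in> Hom E B A \<Longrightarrow> g \<cdot> f = \<i> A \<Longrightarrow> f \<cdot> g = \<i> B \<Longrightarrow> is_iso E f"
  by (auto simp: is_iso_def inverse_arrows_def)

lemma inv_arr_eqI:
  "f \<in> Hom E A B \<Longrightarrow> g \<in> Hom E B A \<Longrightarrow> g \<cdot> f = \<i> A \<Longrightarrow> f \<cdot> g = \<i> B \<Longrightarrow> inv_arr E f = g"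
  by (rule inv_arrI) (auto simp: inverse_arrows_def)

lemma inverse_arrows_inv: "is_iso E f \<Longrightarrow> inverse_arrows E f (inv_arr E f)"
  by (metis inv_arrI is_iso_def)

lemma is_iso_Arr: "is_iso E f \<Longrightarrow> f \<in> Arr E"
  by (auto simp: is_iso_def inverse_arrows_def)

lemma
  assumes "is_iso E f"
  shows Arr_inv [simp]: "inv_arr E f \<in> Arr E"
    and Dom_inv [simp]: "Dom E (inv_arr E f) = Cod E f"
    and Cod_inv [simp]: "Cod E (inv_arr E f) = Dom E f"
    and inv_Comp [simp]: "inv_arr E f \<cdot> f = \<i> (Dom E f)"
    and Comp_inv [simp]: "f \<cdot> inv_arr E f = \<i> (Cod E f)"
    and is_iso_inv [simp]: "is_iso E (inv_arr E f)"
  using inverse_arrows_inv[OF assms] by (auto simp: is_iso_def inverse_arrows_def)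

lemma inv_Comp' [simp]: "is_iso E f \<Longrightarrow> x \<in> Arr E \<Longrightarrow> Cod E x = Dom E f \<Longrightarrow> inv_arr E f \<cdot> (f \<cdot> x) = x"
  using reassoc[OF inv_Comp] is_iso_Arr by simp

lemma Comp_inv' [simp]: "is_iso E f \<Longrightarrow> x \<in> Arr E \<Longrightarrow> Cod E x = Cod E f \<Longrightarrow> f \<cdot> (inv_arr E f \<cdot> x) = x"
  using reassoc[OF Comp_inv] is_iso_Arr by simp

lemma is_iso_Ide [simp]: "A \<in> Obj E \<Longrightarrow> is_iso E (\<i> A)"
  by (rule is_isoI[of _ A A "\<i> A"]) auto

lemma inv_Ide [simp]: "A \<in> Obj E \<Longrightarrow> inv_arr E (\<i> A) = \<i> A"
  by (rule inv_arr_eqI[of _ A A "\<i> A"]) auto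

lemma is_iso_Comp [simp]: "is_iso E f \<Longrightarrow> is_iso E g \<Longrightarrow> Dom E g = Cod E f \<Longrightarrow> is_iso E (g \<cdot> f)"
  using is_iso_Arr[of f] is_iso_Arr[of g]
  by (intro is_isoI[of _ "Dom E f" "Cod E g" "inv_arr E f \<cdot> inv_arr E g"]) auto

lemma inv_of_Comp: "is_iso E f \<Longrightarrow> is_iso E g \<Longrightarrow> Dom E g = Cod E f \<Longrightarrow>
    inv_arr E (g \<cdot> f) = inv_arr E f \<cdot> inv_arr E g"
  using is_iso_Arr[of f] is_iso_Arr[of g]
  by (intro inv_arr_eqI[of _ "Dom E f" "Cod E g"]) auto

lemma inv_inv [simp]: "is_iso E f \<Longrightarrow> inv_arr E (inv_arr E f) = f"
  using is_iso_Arr[of f] by (intro inv_arr_eqI[of _ "Cod E f" "Dom E f"]) auto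

lemma iso_cancel_left:
  assumes "is_iso E f" "x \<in> Arr E" "y \<in> Arr E" "Cod E x = Dom E f" "Cod E y = Dom E f"
    and "f \<cdot> x = f \<cdot> y" shows "x = y"
  using assms inv_Comp' by metis

lemma iso_cancel_right:
  assumes "is_iso E f" "x \<in> Arr E" "y \<in> Arr E" "Dom E x = Cod E f" "Dom E y = Cod E f"
    and "x \<cdot> f = y \<cdot> f" shows "x = y"
proof -
  have "x = (x \<cdot> f) \<cdot> inv_arr E f" using assms(1-5) is_iso_Arr[of f] by simp
  also have "\<dots> = y" unfolding assms(6) using assms(1-5) is_iso_Arr[of f] by simp
  finally show ?thesis .
qed

lemma iso_move_right:
  "is_iso E f \<Longrightarrow> x \<in> Arr E \<Longrightarrow> Dom E x = Cod E f \<Longrightarrow> x \<cdot> f = y \<Longrightarrow> x = y \<cdot> inv_arr E f"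
  using is_iso_Arr[of f] by auto

text \<open>A square of arrows with two opposite invertible sides can be read backwards.\<close>

lemma square_inverse:
  assumes "g \<cdot> f = k \<cdot> h" "is_iso E g" "is_iso E h" "f \<in> Arr E" "k \<in> Arr E"
    "Dom E g = Cod E f" "Dom E k = Cod E h" "Dom E f = Dom E h"
  shows "inv_arr E g \<cdot> k = f \<cdot> inv_arr E h"
proof -
  have 1: "h \<in> Arr E" "g \<in> Arr E" using assms is_iso_Arr by auto
  have "Cod E (g \<cdot> f) = Cod E (k \<cdot> h)" using assms(1) by simp
  then have 2: "Cod E k = Cod E g" using assms(4-) 1 by (metis Cod_Comp)
  have "f \<cdot> inv_arr E h = inv_arr E g \<cdot> ((g \<cdot> f) \<cdot> inv_arr E h)" using assms(2-) 1 by simp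
  also have "\<dots> = inv_arr E g \<cdot> k" unfolding assms(1) using assms(2-) 1 2 by simp
  finally show ?thesis by simp
qed

end


section \<open>Coherence in symmetric monoidal categories\<close>

context symmetric_monoidal_category
begin

abbreviation unit_object ("\<u>") where "\<u> \<equiv> Unit E"
abbreviation associator ("\<alpha>") where "\<alpha> A B D \<equiv> Assoc E A B D"
abbreviation associator_inv ("\<alpha>''") where "\<alpha>' A B D \<equiv> inv_arr E (Assoc E A B D)"
abbreviation left_unitor ("\<l>") where "\<l> A \<equiv> LUnit E A"
abbreviation left_unitor_inv ("\<l>''") where "\<l>' A \<equiv> inv_arr E (LUnit E A)"
abbreviation right_unitor ("\<r>") where "\<r> A \<equiv> RUnit E A"
abbreviation right_unitor_inv ("\<r>''") where "\<r>' A \<equiv> inv_arr E (RUnit E A)"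
abbreviation braiding ("\<s>") where "\<s> A B \<equiv> Swap E A B"

lemma Obj_tens [simp]: "A \<in> Obj E \<Longrightarrow> B \<in> Obj E \<Longrightarrow> A \<otimes> B \<in> Obj E"
  by (rule tens_obj)

lemma Obj_unit [simp]: "\<u> \<in> Obj E"
  by (rule unit_obj)

lemma
  assumes "f \<in> Arr E" "g \<in> Arr E"
  shows Arr_tens [simp]: "f \<odot> g \<in> Arr E"
    and Dom_tens [simp]: "Dom E (f \<odot> g) = Dom E f \<otimes> Dom E g"
    and Cod_tens [simp]: "Cod E (f \<odot> g) = Cod E f \<otimes> Cod E g"
  using tens_hom[of f "Dom E f" "Cod E f" g "Dom E g" "Cod E g"] assms by auto

lemma tens_Ide [simp]: "A \<in> Obj E \<Longrightarrow> B \<in> Obj E \<Longrightarrow> \<i> A \<odot> \<i> B = \<i> (A \<otimes> B)"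
  by (rule tens_ide)

lemma tens_Comp [simp]:
  "f \<in> Arr E \<Longrightarrow> g \<in> Arr E \<Longrightarrow> f' \<in> Arr E \<Longrightarrow> g' \<in> Arr E \<Longrightarrow> Dom E f' = Cod E f \<Longrightarrow> Dom E g' = Cod E g \<Longrightarrow>
   (f' \<odot> g') \<cdot> (f \<odot> g) = (f' \<cdot> f) \<odot> (g' \<cdot> g)"
  using tens_comp[of f "Dom E f" "Cod E f" f' "Cod E f'" g "Dom E g" "Cod E g" g' "Cod E g'"] by simp

lemma tens_Comp' [simp]:
  "f \<in> Arr E \<Longrightarrow> g \<in> Arr E \<Longrightarrow> f' \<in> Arr E \<Longrightarrow> g' \<in> Arr E \<Longrightarrow> Dom E f' = Cod E f \<Longrightarrow> Dom E g' = Cod E g \<Longrightarrow>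
   x \<in> Arr E \<Longrightarrow> Cod E x = Dom E f \<otimes> Dom E g \<Longrightarrow> (f' \<odot> g') \<cdot> ((f \<odot> g) \<cdot> x) = ((f' \<cdot> f) \<odot> (g' \<cdot> g)) \<cdot> x"
  by (rule reassoc[OF tens_Comp]) simp_all

lemma is_iso_tens [simp]: "is_iso E f \<Longrightarrow> is_iso E g \<Longrightarrow> is_iso E (f \<odot> g)"
  using is_iso_Arr[of f] is_iso_Arr[of g]
  by (intro is_isoI[of _ "Dom E f \<otimes> Dom E g" "Cod E f \<otimes> Cod E g" "inv_arr E f \<odot> inv_arr E g"]) auto

lemma inv_tens [simp]:
  "is_iso E f \<Longrightarrow> is_iso E g \<Longrightarrow> inv_arr E (f \<odot> g) = inv_arr E f \<odot> inv_arr E g"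
  using is_iso_Arr[of f] is_iso_Arr[of g]
  by (intro inv_arr_eqI[of _ "Dom E f \<otimes> Dom E g" "Cod E f \<otimes> Cod E g"]) auto

lemma
  assumes "A \<in> Obj E" "B \<in> Obj E" "D \<in> Obj E"
  shows Arr_assoc [simp]: "\<alpha> A B D \<in> Arr E"
    and Dom_assoc [simp]: "Dom E (\<alpha> A B D) = (A \<otimes> B) \<otimes> D"
    and Cod_assoc [simp]: "Cod E (\<alpha> A B D) = A \<otimes> (B \<otimes> D)"
    and is_iso_assoc [simp]: "is_iso E (\<alpha> A B D)"
  using assoc_hom[OF assms] by auto

lemma
  assumes "A \<in> Obj E"
  shows Arr_lunit [simp]: "\<l> A \<in> Arr E" and Dom_lunit [simp]: "Dom E (\<l> A) = \<u> \<otimes> A"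
    and Cod_lunit [simp]: "Cod E (\<l> A) = A" and is_iso_lunit [simp]: "is_iso E (\<l> A)"
    and Arr_runit [simp]: "\<r> A \<in> Arr E" and Dom_runit [simp]: "Dom E (\<r> A) = A \<otimes> \<u>"
    and Cod_runit [simp]: "Cod E (\<r> A) = A" and is_iso_runit [simp]: "is_iso E (\<r> A)"
  using lunit_hom[OF assms] runit_hom[OF assms] by auto

lemma
  assumes "A \<in> Obj E" "B \<in> Obj E"
  shows Arr_swap [simp]: "\<s> A B \<in> Arr E" and Dom_swap [simp]: "Dom E (\<s> A B) = A \<otimes> B"
    and Cod_swap [simp]: "Cod E (\<s> A B) = B \<otimes> A"
  using swap_hom[OF assms] by auto

lemma swap_Swap [simp]: "A \<in> Obj E \<Longrightarrow> B \<in> Obj E \<Longrightarrow> \<s> B A \<cdot> \<s> A B = \<i> (A \<otimes> B)"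
  by (rule swap_swap)

lemma swap_Swap' [simp]:
  "A \<in> Obj E \<Longrightarrow> B \<in> Obj E \<Longrightarrow> x \<in> Arr E \<Longrightarrow> Cod E x = A \<otimes> B \<Longrightarrow> \<s> B A \<cdot> (\<s> A B \<cdot> x) = x"
  by (subst reassoc[OF swap_Swap]) auto

lemma is_iso_swap [simp]: "A \<in> Obj E \<Longrightarrow> B \<in> Obj E \<Longrightarrow> is_iso E (\<s> A B)"
  by (rule is_isoI[of _ "A \<otimes> B" "B \<otimes> A" "\<s> B A"]) auto

lemma inv_swap [simp]: "A \<in> Obj E \<Longrightarrow> B \<in> Obj E \<Longrightarrow> inv_arr E (\<s> A B) = \<s> B A"
  by (rule inv_arr_eqI[of _ "A \<otimes> B" "B \<otimes> A"]) auto

text \<open>Naturality of the structure maps, oriented so that they travel towards the domain.\<close>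

lemma assoc_natural:
  "f \<in> Arr E \<Longrightarrow> g \<in> Arr E \<Longrightarrow> h \<in> Arr E \<Longrightarrow> Cod E f = A' \<Longrightarrow> Cod E g = B' \<Longrightarrow> Cod E h = D' \<Longrightarrow>
   \<alpha> A' B' D' \<cdot> ((f \<odot> g) \<odot> h) = (f \<odot> (g \<odot> h)) \<cdot> \<alpha> (Dom E f) (Dom E g) (Dom E h)"
  using assoc_nat[of f "Dom E f" A' g "Dom E g" B' h "Dom E h" D'] by simp

lemma assoc_natural_ide:
  "A \<in> Obj E \<Longrightarrow> B \<in> Obj E \<Longrightarrow> h \<in> Arr E \<Longrightarrow> Cod E h = D' \<Longrightarrow>
   \<alpha> A B D' \<cdot> (\<i> (A \<otimes> B) \<odot> h) = (\<i> A \<odot> (\<i> B \<odot> h)) \<cdot> \<alpha> A B (Dom E h)"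
  using assoc_natural[of "\<i> A" "\<i> B" h A B D'] by simp

lemma assoc_inv_natural:
  assumes "f \<in> Arr E" "g \<in> Arr E" "h \<in> Arr E" "Cod E f = A'" "Cod E g = B'" "Cod E h = D'"
  shows "\<alpha>' A' B' D' \<cdot> (f \<odot> (g \<odot> h)) = ((f \<odot> g) \<odot> h) \<cdot> \<alpha>' (Dom E f) (Dom E g) (Dom E h)"
  using assms by (intro square_inverse assoc_natural) auto

lemma assoc_inv_natural_ide:
  "f \<in> Arr E \<Longrightarrow> B \<in> Obj E \<Longrightarrow> D \<in> Obj E \<Longrightarrow> Cod E f = A' \<Longrightarrow>
   \<alpha>' A' B D \<cdot> (f \<odot> \<i> (B \<otimes> D)) = ((f \<odot> \<i> B) \<odot> \<i> D) \<cdot> \<alpha>' (Dom E f) B D"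
  using assoc_inv_natural[of f "\<i> B" "\<i> D" A' B D] by simp

text \<open>Simplification merges composites inside a tensor product; the next two forms recognise an
  associator in front of a tensor product whose factor has been merged with a further arrow.\<close>

lemma assoc_natural_Comp:
  assumes "f \<in> Arr E" "g \<in> Arr E" "h \<in> Arr E" "p \<in> Arr E" "Cod E f = A'" "Cod E g = B'" "Cod E h = D'"
    and "Cod E p = Dom E f \<otimes> Dom E g"
  shows "\<alpha> A' B' D' \<cdot> (((f \<odot> g) \<cdot> p) \<odot> h) = (f \<odot> (g \<odot> h)) \<cdot> (\<alpha> (Dom E f) (Dom E g) (Dom E h) \<cdot> (p \<odot> \<i> (Dom E h)))"
proof -
  have [simp]: "A' \<in> Obj E" "B' \<in> Obj E" "D' \<in> Obj E" using assms by auto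
  have "((f \<odot> g) \<cdot> p) \<odot> h = ((f \<odot> g) \<odot> h) \<cdot> (p \<odot> \<i> (Dom E h))" using assms by simp
  then show ?thesis using assms by (simp add: reassoc[OF assoc_natural] del: tens_Comp tens_Comp')
qed

lemma assoc_inv_natural_Comp:
  assumes "f \<in> Arr E" "g \<in> Arr E" "h \<in> Arr E" "p \<in> Arr E" "Cod E f = A'" "Cod E g = B'" "Cod E h = D'"
    and "Cod E p = Dom E g \<otimes> Dom E h"
  shows "\<alpha>' A' B' D' \<cdot> (f \<odot> ((g \<odot> h) \<cdot> p)) = ((f \<odot> g) \<odot> h) \<cdot> (\<alpha>' (Dom E f) (Dom E g) (Dom E h) \<cdot> (\<i> (Dom E f) \<odot> p))"
proof -
  have [simp]: "A' \<in> Obj E" "B' \<in> Obj E" "D' \<in> Obj E" using assms by auto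
  have "f \<odot> ((g \<odot> h) \<cdot> p) = (f \<odot> (g \<odot> h)) \<cdot> (\<i> (Dom E f) \<odot> p)" using assms by simp
  then show ?thesis using assms by (simp add: reassoc[OF assoc_inv_natural] del: tens_Comp tens_Comp')
qed

lemma lunit_natural:
  "f \<in> Arr E \<Longrightarrow> Cod E f = A' \<Longrightarrow> \<l> A' \<cdot> (\<i> \<u> \<odot> f) = f \<cdot> \<l> (Dom E f)"
  using lunit_nat[of f "Dom E f" A'] by simp

lemma runit_natural:
  "f \<in> Arr E \<Longrightarrow> Cod E f = A' \<Longrightarrow> \<r> A' \<cdot> (f \<odot> \<i> \<u>) = f \<cdot> \<r> (Dom E f)"
  using runit_nat[of f "Dom E f" A'] by simp

lemma lunit_inv_natural:
  "f \<in> Arr E \<Longrightarrow> Cod E f = A' \<Longrightarrow> \<l>' A' \<cdot> f = (\<i> \<u> \<odot> f) \<cdot> \<l>' (Dom E f)"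
  by (rule square_inverse[OF lunit_natural]) auto

lemma swap_natural:
  "f \<in> Arr E \<Longrightarrow> g \<in> Arr E \<Longrightarrow> Cod E f = A' \<Longrightarrow> Cod E g = B' \<Longrightarrow>
   \<s> A' B' \<cdot> (f \<odot> g) = (g \<odot> f) \<cdot> \<s> (Dom E f) (Dom E g)"
  using swap_nat[of f "Dom E f" A' g "Dom E g" B'] by simp

lemmas naturality = assoc_natural assoc_natural_ide assoc_inv_natural assoc_inv_natural_ide
  assoc_natural_Comp assoc_inv_natural_Comp
  lunit_natural runit_natural swap_natural

lemmas naturality' = naturality naturality[THEN reassoc]

lemma unit_faithful:
  assumes "f \<in> Hom E A B" "g \<in> Hom E A B" "\<i> \<u> \<odot> f = \<i> \<u> \<odot> g" shows "f = g"
proof -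
  have "f \<cdot> \<l> A = g \<cdot> \<l> A"
    using lunit_natural[of f B] lunit_natural[of g B] assms by simp
  then show ?thesis by (rule iso_cancel_right[rotated 5]) (use assms in auto)
qed

lemma unit_faithful_right:
  assumes "f \<in> Hom E A B" "g \<in> Hom E A B" "f \<odot> \<i> \<u> = g \<odot> \<i> \<u>" shows "f = g"
proof -
  have "f \<cdot> \<r> A = g \<cdot> \<r> A"
    using runit_natural[of f B] runit_natural[of g B] assms by simp
  then show ?thesis by (rule iso_cancel_right[rotated 5]) (use assms in auto)
qed

lemma pentagon_equation:
  assumes "A \<in> Obj E" "B \<in> Obj E" "D \<in> Obj E" "F \<in> Obj E"
  shows "(\<i> A \<odot> \<alpha> B D F) \<cdot> (\<alpha> A (B \<otimes> D) F \<cdot> (\<alpha> A B D \<odot> \<i> F)) = \<alpha> A B (D \<otimes> F) \<cdot> \<alpha> (A \<otimes> B) D F"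
  using pentagon[OF assms] assms by simp

lemma pentagon_inverse:
  assumes "A \<in> Obj E" "B \<in> Obj E" "D \<in> Obj E" "F \<in> Obj E"
  shows "(\<alpha>' A B D \<odot> \<i> F) \<cdot> (\<alpha>' A (B \<otimes> D) F \<cdot> (\<i> A \<odot> \<alpha>' B D F)) = \<alpha>' (A \<otimes> B) D F \<cdot> \<alpha>' A B (D \<otimes> F)"
  using arg_cong[OF pentagon_equation[OF assms], of "inv_arr E"] assms by (simp add: inv_of_Comp)

lemma pentagon_mixed:
  assumes "A \<in> Obj E" "B \<in> Obj E" "D \<in> Obj E" "F \<in> Obj E"
  shows "\<alpha>' A B (D \<otimes> F) \<cdot> (\<i> A \<odot> \<alpha> B D F) = \<alpha> (A \<otimes> B) D F \<cdot> ((\<alpha>' A B D \<odot> \<i> F) \<cdot> \<alpha>' A (B \<otimes> D) F)"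
proof -
  have "\<alpha>' A B (D \<otimes> F) \<cdot> ((\<alpha> A B (D \<otimes> F) \<cdot> \<alpha> (A \<otimes> B) D F) \<cdot> ((\<alpha>' A B D \<odot> \<i> F) \<cdot> \<alpha>' A (B \<otimes> D) F))
     = \<alpha> (A \<otimes> B) D F \<cdot> ((\<alpha>' A B D \<odot> \<i> F) \<cdot> \<alpha>' A (B \<otimes> D) F)"
    using assms by simp
  then show ?thesis unfolding pentagon_equation[OF assms, symmetric] using assms by simp
qed

lemma hexagon_equation:
  assumes "A \<in> Obj E" "B \<in> Obj E" "D \<in> Obj E"
  shows "\<alpha> B D A \<cdot> (\<s> A (B \<otimes> D) \<cdot> \<alpha> A B D) = (\<i> B \<odot> \<s> A D) \<cdot> (\<alpha> B A D \<cdot> (\<s> A B \<odot> \<i> D))"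
  using hexagon[OF assms] assms by simp

lemma triangle_equation:
  "A \<in> Obj E \<Longrightarrow> B \<in> Obj E \<Longrightarrow> (\<i> A \<odot> \<l> B) \<cdot> \<alpha> A \<u> B = \<r> A \<odot> \<i> B"
  by (rule triangle)

lemma triangle_inverse:
  "A \<in> Obj E \<Longrightarrow> B \<in> Obj E \<Longrightarrow> (\<r> A \<odot> \<i> B) \<cdot> \<alpha>' A \<u> B = \<i> A \<odot> \<l> B"
  using triangle_equation[of A B, symmetric] by simp

text \<open>Kelly's consequences of the axioms.  The trick is to tensor with the unit, which is
  faithful, so that pentagon and triangle apply.\<close>

lemma lunit_tens:
  assumes [simp]: "A \<in> Obj E" "B \<in> Obj E"
  shows "\<l> (A \<otimes> B) \<cdot> \<alpha> \<u> A B = \<l> A \<odot> \<i> B"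
proof (rule unit_faithful)
  let ?k = "\<alpha> \<u> (\<u> \<otimes> A) B \<cdot> (\<alpha> \<u> \<u> A \<odot> \<i> B)"
  have "(\<i> \<u> \<odot> \<l> (A \<otimes> B)) \<cdot> ((\<i> \<u> \<odot> \<alpha> \<u> A B) \<cdot> ?k) = (\<i> \<u> \<odot> \<l> (A \<otimes> B)) \<cdot> (\<alpha> \<u> \<u> (A \<otimes> B) \<cdot> \<alpha> (\<u> \<otimes> \<u>) A B)"
    by (simp only: pentagon_equation assms unit_obj)
  also have "\<dots> = (\<r> \<u> \<odot> \<i> (A \<otimes> B)) \<cdot> \<alpha> (\<u> \<otimes> \<u>) A B"
    by (simp add: reassoc[OF triangle_equation])
  also have "\<dots> = \<alpha> \<u> A B \<cdot> ((\<r> \<u> \<odot> \<i> A) \<odot> \<i> B)"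
    by (simp add: assoc_natural)
  also have "\<dots> = \<alpha> \<u> A B \<cdot> (((\<i> \<u> \<odot> \<l> A) \<odot> \<i> B) \<cdot> (\<alpha> \<u> \<u> A \<odot> \<i> B))"
    by (simp add: triangle_equation)
  also have "\<dots> = (\<i> \<u> \<odot> (\<l> A \<odot> \<i> B)) \<cdot> ?k"
    by (simp add: reassoc[OF assoc_natural] del: tens_Comp)
  finally have "(\<i> \<u> \<odot> (\<l> (A \<otimes> B) \<cdot> \<alpha> \<u> A B)) \<cdot> ?k = (\<i> \<u> \<odot> (\<l> A \<odot> \<i> B)) \<cdot> ?k" by simp
  then show "\<i> \<u> \<odot> (\<l> (A \<otimes> B) \<cdot> \<alpha> \<u> A B) = \<i> \<u> \<odot> (\<l> A \<odot> \<i> B)"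
    by (rule iso_cancel_right[rotated 5]) simp_all
qed simp_all

lemma runit_tens:
  assumes [simp]: "A \<in> Obj E" "B \<in> Obj E"
  shows "(\<i> A \<odot> \<r> B) \<cdot> \<alpha> A B \<u> = \<r> (A \<otimes> B)"
proof (rule unit_faithful_right)
  have "\<alpha> A B \<u> \<cdot> (((\<i> A \<odot> \<r> B) \<cdot> \<alpha> A B \<u>) \<odot> \<i> \<u>) = \<alpha> A B \<u> \<cdot> (((\<i> A \<odot> \<r> B) \<odot> \<i> \<u>) \<cdot> (\<alpha> A B \<u> \<odot> \<i> \<u>))"
    by simp
  also have "\<dots> = (\<i> A \<odot> (\<r> B \<odot> \<i> \<u>)) \<cdot> (\<alpha> A (B \<otimes> \<u>) \<u> \<cdot> (\<alpha> A B \<u> \<odot> \<i> \<u>))"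
    by (simp add: reassoc[OF assoc_natural] del: tens_Comp)
  also have "\<dots> = (\<i> A \<odot> (\<i> B \<odot> \<l> \<u>)) \<cdot> ((\<i> A \<odot> \<alpha> B \<u> \<u>) \<cdot> (\<alpha> A (B \<otimes> \<u>) \<u> \<cdot> (\<alpha> A B \<u> \<odot> \<i> \<u>)))"
    by (simp add: triangle_equation)
  also have "\<dots> = (\<i> A \<odot> (\<i> B \<odot> \<l> \<u>)) \<cdot> (\<alpha> A B (\<u> \<otimes> \<u>) \<cdot> \<alpha> (A \<otimes> B) \<u> \<u>)"
    by (simp only: pentagon_equation assms unit_obj)
  also have "\<dots> = \<alpha> A B \<u> \<cdot> (\<r> (A \<otimes> B) \<odot> \<i> \<u>)"
    by (simp add: triangle_equation[symmetric] reassoc[OF assoc_natural_ide])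
  finally show "((\<i> A \<odot> \<r> B) \<cdot> \<alpha> A B \<u>) \<odot> \<i> \<u> = \<r> (A \<otimes> B) \<odot> \<i> \<u>"
    by (rule iso_cancel_left[rotated 5]) simp_all
qed simp_all

lemma runit_unit: "\<r> \<u> = \<l> \<u>"
proof (rule unit_faithful_right)
  have "\<l> \<u> \<cdot> \<l> (\<u> \<otimes> \<u>) = \<l> \<u> \<cdot> (\<i> \<u> \<odot> \<l> \<u>)" using lunit_natural[of "\<l> \<u>" \<u>] by simp
  then have "\<l> (\<u> \<otimes> \<u>) = \<i> \<u> \<odot> \<l> \<u>" by (rule iso_cancel_left[rotated 5]) simp_all
  then show "\<r> \<u> \<odot> \<i> \<u> = \<l> \<u> \<odot> \<i> \<u>"
    using lunit_tens[of \<u> \<u>] triangle_equation[of \<u> \<u>] by simp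
qed simp_all

lemma lunit_swap:
  assumes [simp]: "A \<in> Obj E" shows "\<l> A \<cdot> \<s> A \<u> = \<r> A"
proof (rule unit_faithful_right[symmetric])
  have "\<s> A \<u> \<cdot> (\<r> A \<odot> \<i> \<u>) = \<s> A \<u> \<cdot> ((\<i> A \<odot> \<l> \<u>) \<cdot> \<alpha> A \<u> \<u>)"
    by (simp add: triangle_equation)
  also have "\<dots> = (\<l> \<u> \<odot> \<i> A) \<cdot> (\<s> A (\<u> \<otimes> \<u>) \<cdot> \<alpha> A \<u> \<u>)"
    by (simp add: reassoc[OF swap_natural])
  also have "\<dots> = \<l> (\<u> \<otimes> A) \<cdot> (\<alpha> \<u> \<u> A \<cdot> (\<s> A (\<u> \<otimes> \<u>) \<cdot> \<alpha> A \<u> \<u>))"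
    by (simp add: reassoc[OF lunit_tens])
  also have "\<dots> = \<l> (\<u> \<otimes> A) \<cdot> ((\<i> \<u> \<odot> \<s> A \<u>) \<cdot> (\<alpha> \<u> A \<u> \<cdot> (\<s> A \<u> \<odot> \<i> \<u>)))"
    using hexagon[of A \<u> \<u>] by simp
  also have "\<dots> = \<s> A \<u> \<cdot> (\<l> (A \<otimes> \<u>) \<cdot> (\<alpha> \<u> A \<u> \<cdot> (\<s> A \<u> \<odot> \<i> \<u>)))"
    by (simp add: reassoc[OF lunit_natural])
  also have "\<dots> = \<s> A \<u> \<cdot> ((\<l> A \<cdot> \<s> A \<u>) \<odot> \<i> \<u>)"
    by (simp add: reassoc[OF lunit_tens])
  finally show "\<r> A \<odot> \<i> \<u> = (\<l> A \<cdot> \<s> A \<u>) \<odot> \<i> \<u>"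
    by (rule iso_cancel_left[rotated 5]) simp_all
qed simp_all

lemma runit_swap: "A \<in> Obj E \<Longrightarrow> \<r> A \<cdot> \<s> \<u> A = \<l> A"
  using lunit_swap[of A, symmetric] by simp

lemma swap_unit: "\<s> \<u> \<u> = \<i> (\<u> \<otimes> \<u>)"
proof -
  have "\<l> \<u> \<cdot> \<s> \<u> \<u> = \<l> \<u> \<cdot> \<i> (\<u> \<otimes> \<u>)" by (simp add: lunit_swap runit_unit)
  then show ?thesis by (rule iso_cancel_left[rotated 5]) simp_all
qed

text \<open>Right-nested words are a normal form for tensor products; on them the symmetry acts by
  exchanging two neighbours in front of a tail.\<close>

definition exchange ("\<x>") where
  "\<x> A B D = \<alpha> B A D \<cdot> ((\<s> A B \<odot> \<i> D) \<cdot> \<alpha>' A B D)"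

lemma
  assumes [simp]: "A \<in> Obj E" "B \<in> Obj E" "D \<in> Obj E"
  shows Arr_exchange [simp]: "\<x> A B D \<in> Arr E"
    and Dom_exchange [simp]: "Dom E (\<x> A B D) = A \<otimes> (B \<otimes> D)"
    and Cod_exchange [simp]: "Cod E (\<x> A B D) = B \<otimes> (A \<otimes> D)"
    and exchange_exchange [simp]: "\<x> B A D \<cdot> \<x> A B D = \<i> (A \<otimes> (B \<otimes> D))"
  by (simp_all add: exchange_def)

lemma is_iso_exchange [simp]: "A \<in> Obj E \<Longrightarrow> B \<in> Obj E \<Longrightarrow> D \<in> Obj E \<Longrightarrow> is_iso E (\<x> A B D)"
  by (simp add: exchange_def)

lemma inv_exchange [simp]: "A \<in> Obj E \<Longrightarrow> B \<in> Obj E \<Longrightarrow> D \<in> Obj E \<Longrightarrow> inv_arr E (\<x> A B D) = \<x> B A D"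
  by (rule inv_arr_eqI[of _ "A \<otimes> (B \<otimes> D)" "B \<otimes> (A \<otimes> D)"]) auto

lemma exchange_natural:
  "f \<in> Arr E \<Longrightarrow> g \<in> Arr E \<Longrightarrow> h \<in> Arr E \<Longrightarrow> Cod E f = A' \<Longrightarrow> Cod E g = B' \<Longrightarrow> Cod E h = D' \<Longrightarrow>
   \<x> A' B' D' \<cdot> (f \<odot> (g \<odot> h)) = (g \<odot> (f \<odot> h)) \<cdot> \<x> (Dom E f) (Dom E g) (Dom E h)"
proof clarify
  assume [simp]: "f \<in> Arr E" "g \<in> Arr E" "h \<in> Arr E"
  show "\<x> (Cod E f) (Cod E g) (Cod E h) \<cdot> (f \<odot> (g \<odot> h)) = (g \<odot> (f \<odot> h)) \<cdot> \<x> (Dom E f) (Dom E g) (Dom E h)"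
    by (simp add: exchange_def naturality')
qed

text \<open>Both hexagons say that moving past a tensor product is moving past one factor after the other.\<close>

lemma swap_past_tens:
  assumes [simp]: "A \<in> Obj E" "B \<in> Obj E" "D \<in> Obj E"
  shows "\<alpha> B D A \<cdot> \<s> A (B \<otimes> D) = (\<i> B \<odot> \<s> A D) \<cdot> \<x> A B D"
proof -
  have "\<alpha> B D A \<cdot> \<s> A (B \<otimes> D) = (\<alpha> B D A \<cdot> \<s> A (B \<otimes> D) \<cdot> \<alpha> A B D) \<cdot> \<alpha>' A B D" by simp
  also have "\<dots> = (\<i> B \<odot> \<s> A D) \<cdot> \<x> A B D" by (subst hexagon) (simp_all add: exchange_def)
  finally show ?thesis .
qed

lemma swap_tens_past:
  assumes [simp]: "A \<in> Obj E" "B \<in> Obj E" "D \<in> Obj E"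
  shows "\<s> (A \<otimes> B) D \<cdot> \<alpha>' A B D = \<x> A D B \<cdot> (\<i> A \<odot> \<s> B D)"
  using arg_cong[OF swap_past_tens[of D A B], of "inv_arr E"] by (simp add: inv_of_Comp)

text \<open>The hexagon in front of a tail \<open>F\<close>: two pentagons carry the brackets past the tail, and
  between them the hexagon applies.\<close>

lemma exchange_past_tens:
  assumes [simp]: "A \<in> Obj E" "B \<in> Obj E" "D \<in> Obj E" "F \<in> Obj E"
  shows "\<alpha> B D (A \<otimes> F) \<cdot> \<x> A (B \<otimes> D) F = (\<i> B \<odot> \<x> A D F) \<cdot> (\<x> A B (D \<otimes> F) \<cdot> (\<i> A \<odot> \<alpha> B D F))"
proof -
  have "\<alpha> B D (A \<otimes> F) \<cdot> \<x> A (B \<otimes> D) F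
      = (\<alpha> B D (A \<otimes> F) \<cdot> \<alpha> (B \<otimes> D) A F) \<cdot> ((\<s> A (B \<otimes> D) \<odot> \<i> F) \<cdot> \<alpha>' A (B \<otimes> D) F)"
    by (simp add: exchange_def)
  also have "\<dots> = (\<i> B \<odot> \<alpha> D A F) \<cdot> (\<alpha> B (D \<otimes> A) F \<cdot>
      (((\<alpha> B D A \<cdot> \<s> A (B \<otimes> D) \<cdot> \<alpha> A B D) \<odot> \<i> F) \<cdot> ((\<alpha>' A B D \<odot> \<i> F) \<cdot> \<alpha>' A (B \<otimes> D) F)))"
    by (simp add: pentagon_equation[symmetric])
  also have "\<dots> = (\<i> B \<odot> \<alpha> D A F) \<cdot> (\<alpha> B (D \<otimes> A) F \<cdot>
      (((\<i> B \<odot> \<s> A D) \<odot> \<i> F) \<cdot> ((\<alpha> B A D \<odot> \<i> F) \<cdot> (((\<s> A B \<odot> \<i> D) \<odot> \<i> F) \<cdot>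
      ((\<alpha>' A B D \<odot> \<i> F) \<cdot> \<alpha>' A (B \<otimes> D) F)))))"
    by (simp add: hexagon_equation)
  also have "\<dots> = (\<i> B \<odot> (\<alpha> D A F \<cdot> (\<s> A D \<odot> \<i> F) \<cdot> \<alpha>' A D F)) \<cdot> ((\<i> B \<odot> \<alpha> A D F) \<cdot> (\<alpha> B (A \<otimes> D) F \<cdot>
      ((\<alpha> B A D \<odot> \<i> F) \<cdot> (((\<s> A B \<odot> \<i> D) \<odot> \<i> F) \<cdot> ((\<alpha>' A B D \<odot> \<i> F) \<cdot> \<alpha>' A (B \<otimes> D) F)))))"
    by (simp add: reassoc[OF assoc_natural] del: tens_Comp')
       (simp add: reassoc[OF assoc_natural])
  also have "\<dots> = (\<i> B \<odot> \<x> A D F) \<cdot> (((\<i> B \<odot> \<alpha> A D F) \<cdot> (\<alpha> B (A \<otimes> D) F \<cdot> (\<alpha> B A D \<odot> \<i> F))) \<cdot>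
      (((\<s> A B \<odot> \<i> D) \<odot> \<i> F) \<cdot> ((\<alpha>' A B D \<odot> \<i> F) \<cdot> \<alpha>' A (B \<otimes> D) F)))"
    by (simp add: exchange_def)
  also have "\<dots> = (\<i> B \<odot> \<x> A D F) \<cdot> (\<alpha> B A (D \<otimes> F) \<cdot> ((\<s> A B \<odot> \<i> (D \<otimes> F)) \<cdot>
      (\<alpha> (A \<otimes> B) D F \<cdot> ((\<alpha>' A B D \<odot> \<i> F) \<cdot> \<alpha>' A (B \<otimes> D) F))))"
    by (simp only: pentagon_equation assms) (simp add: reassoc[OF assoc_natural] del: tens_Comp')
  also have "\<dots> = (\<i> B \<odot> \<x> A D F) \<cdot> (\<x> A B (D \<otimes> F) \<cdot> (\<i> A \<odot> \<alpha> B D F))"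
    by (simp add: exchange_def pentagon_mixed[symmetric])
  finally show ?thesis .
qed

text \<open>Two factorisations through a cyclic permutation of three factors.  Associativity of a symmetric
  pairing will turn out to be compatibility with such a cycle, so these identities say how
  associativity for one order of the factors implies it for another.\<close>

lemma cycle_hexagon:
  assumes [simp]: "A \<in> Obj E" "B \<in> Obj E" "D \<in> Obj E"
  shows "(\<i> A \<odot> \<s> D B) \<cdot> (\<alpha> A D B \<cdot> \<s> B (A \<otimes> D)) = \<x> B A D"
  by (simp add: swap_past_tens)

lemma cycle_reverse:
  assumes [simp]: "A \<in> Obj E" "B \<in> Obj E" "D \<in> Obj E"
  shows "(\<i> D \<odot> \<s> B A) \<cdot> (\<alpha> D B A \<cdot> \<s> A (D \<otimes> B)) =
    \<s> (A \<otimes> B) D \<cdot> (\<alpha>' A B D \<cdot> (\<i> A \<odot> \<s> D B))"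
  by (simp add: swap_past_tens reassoc[OF swap_tens_past])

text \<open>On right-nested words the interchange of the middle factors is an exchange behind the first
  factor; all its properties come from there.\<close>

lemma interchange_eq:
  assumes [simp]: "A \<in> Obj E" "B \<in> Obj E" "D \<in> Obj E" "F \<in> Obj E"
  shows "interchange E A B D F = \<alpha>' A D (B \<otimes> F) \<cdot> ((\<i> A \<odot> \<x> B D F) \<cdot> \<alpha> A B (D \<otimes> F))"
  by (simp add: interchange_def exchange_def)

abbreviation middle_interchange ("\<m>") where "\<m> A B D F \<equiv> interchange E A B D F"

lemma
  assumes [simp]: "A \<in> Obj E" "B \<in> Obj E" "D \<in> Obj E" "F \<in> Obj E"
  shows Arr_interchange [simp]: "\<m> A B D F \<in> Arr E"
    and Dom_interchange [simp]: "Dom E (\<m> A B D F) = (A \<otimes> B) \<otimes> (D \<otimes> F)"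
    and Cod_interchange [simp]: "Cod E (\<m> A B D F) = (A \<otimes> D) \<otimes> (B \<otimes> F)"
    and is_iso_interchange [simp]: "is_iso E (\<m> A B D F)"
    and interchange_interchange [simp]: "\<m> A D B F \<cdot> \<m> A B D F = \<i> ((A \<otimes> B) \<otimes> (D \<otimes> F))"
  by (simp_all add: interchange_eq)

lemma interchange_interchange' [simp]:
  "A \<in> Obj E \<Longrightarrow> B \<in> Obj E \<Longrightarrow> D \<in> Obj E \<Longrightarrow> F \<in> Obj E \<Longrightarrow> y \<in> Arr E \<Longrightarrow> Cod E y = (A \<otimes> B) \<otimes> (D \<otimes> F) \<Longrightarrow>
   \<m> A D B F \<cdot> (\<m> A B D F \<cdot> y) = y"
  by (subst reassoc[OF interchange_interchange]) auto

lemma interchange_natural: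
  "f \<in> Arr E \<Longrightarrow> g \<in> Arr E \<Longrightarrow> h \<in> Arr E \<Longrightarrow> k \<in> Arr E \<Longrightarrow>
   Cod E f = A' \<Longrightarrow> Cod E g = B' \<Longrightarrow> Cod E h = D' \<Longrightarrow> Cod E k = F' \<Longrightarrow>
   \<m> A' B' D' F' \<cdot> ((f \<odot> g) \<odot> (h \<odot> k)) = ((f \<odot> h) \<odot> (g \<odot> k)) \<cdot> \<m> (Dom E f) (Dom E g) (Dom E h) (Dom E k)"
proof clarify
  assume [simp]: "f \<in> Arr E" "g \<in> Arr E" "h \<in> Arr E" "k \<in> Arr E"
  show "\<m> (Cod E f) (Cod E g) (Cod E h) (Cod E k) \<cdot> ((f \<odot> g) \<odot> (h \<odot> k)) =
     ((f \<odot> h) \<odot> (g \<odot> k)) \<cdot> \<m> (Dom E f) (Dom E g) (Dom E h) (Dom E k)"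
    by (simp add: interchange_eq naturality' exchange_natural reassoc[OF exchange_natural])
qed

lemma interchange_natural_left:
  "f \<in> Arr E \<Longrightarrow> g \<in> Arr E \<Longrightarrow> D \<in> Obj E \<Longrightarrow> F \<in> Obj E \<Longrightarrow> Cod E f = A' \<Longrightarrow> Cod E g = B' \<Longrightarrow>
   \<m> A' B' D F \<cdot> ((f \<odot> g) \<odot> \<i> (D \<otimes> F)) = ((f \<odot> \<i> D) \<odot> (g \<odot> \<i> F)) \<cdot> \<m> (Dom E f) (Dom E g) D F"
  using interchange_natural[of f g "\<i> D" "\<i> F" A' B' D F] by simp

lemma interchange_natural_right:
  "A \<in> Obj E \<Longrightarrow> B \<in> Obj E \<Longrightarrow> h \<in> Arr E \<Longrightarrow> k \<in> Arr E \<Longrightarrow> Cod E h = D' \<Longrightarrow> Cod E k = F' \<Longrightarrow>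
   \<m> A B D' F' \<cdot> (\<i> (A \<otimes> B) \<odot> (h \<odot> k)) = ((\<i> A \<odot> h) \<odot> (\<i> B \<odot> k)) \<cdot> \<m> A B (Dom E h) (Dom E k)"
  using interchange_natural[of "\<i> A" "\<i> B" h k A B D' F'] by simp

text \<open>A parameter \<open>A\<close> may be absorbed into the first factor before or after the interchange.  This
  is the source of the linearity of pairings in a parameter.\<close>

lemma interchange_assoc:
  assumes [simp]: "A \<in> Obj E" "X \<in> Obj E" "Y \<in> Obj E" "S \<in> Obj E" "T \<in> Obj E"
  shows "(\<alpha>' A X S \<odot> \<i> (Y \<otimes> T)) \<cdot> (\<alpha>' A (X \<otimes> S) (Y \<otimes> T) \<cdot> (\<i> A \<odot> \<m> X Y S T)) =
    \<m> (A \<otimes> X) Y S T \<cdot> ((\<alpha>' A X Y \<odot> \<i> (S \<otimes> T)) \<cdot> \<alpha>' A (X \<otimes> Y) (S \<otimes> T))"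
proof -
  have "(\<alpha>' A X S \<odot> \<i> (Y \<otimes> T)) \<cdot> (\<alpha>' A (X \<otimes> S) (Y \<otimes> T) \<cdot> (\<i> A \<odot> \<m> X Y S T)) =
    ((\<alpha>' A X S \<odot> \<i> (Y \<otimes> T)) \<cdot> (\<alpha>' A (X \<otimes> S) (Y \<otimes> T) \<cdot> (\<i> A \<odot> \<alpha>' X S (Y \<otimes> T)))) \<cdot>
      ((\<i> A \<odot> (\<i> X \<odot> \<x> Y S T)) \<cdot> (\<i> A \<odot> \<alpha> X Y (S \<otimes> T)))"
    by (simp add: interchange_eq)
  also have "\<dots> = \<alpha>' (A \<otimes> X) S (Y \<otimes> T) \<cdot> (\<alpha>' A X (S \<otimes> (Y \<otimes> T)) \<cdot>
      ((\<i> A \<odot> (\<i> X \<odot> \<x> Y S T)) \<cdot> (\<i> A \<odot> \<alpha> X Y (S \<otimes> T))))"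
    by (subst pentagon_inverse) simp_all
  also have "\<dots> = \<alpha>' (A \<otimes> X) S (Y \<otimes> T) \<cdot> ((\<i> (A \<otimes> X) \<odot> \<x> Y S T) \<cdot>
      (\<alpha>' A X (Y \<otimes> (S \<otimes> T)) \<cdot> (\<i> A \<odot> \<alpha> X Y (S \<otimes> T))))"
    by (simp add: reassoc[OF assoc_inv_natural] del: tens_Comp tens_Comp')
  also have "\<dots> = \<m> (A \<otimes> X) Y S T \<cdot> ((\<alpha>' A X Y \<odot> \<i> (S \<otimes> T)) \<cdot> \<alpha>' A (X \<otimes> Y) (S \<otimes> T))"
    by (simp add: interchange_eq pentagon_mixed)
  finally show ?thesis .
qed

text \<open>Both sides rearrange \<open>X, Y, S, T\<close> into \<open>Y, T, X, S\<close>.  Moving \<open>S\<close> and then \<open>X\<close> past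
  \<open>Y \<otimes> T\<close> one factor at a time cancels the exchange inside the interchange and leaves a
  naturality square.\<close>

lemma interchange_swap:
  assumes [simp]: "X \<in> Obj E" "Y \<in> Obj E" "S \<in> Obj E" "T \<in> Obj E"
  shows "\<s> (X \<otimes> S) (Y \<otimes> T) \<cdot> \<m> X Y S T = \<m> Y X T S \<cdot> (\<s> X Y \<odot> \<s> S T)"
proof -
  have "\<alpha> Y T (X \<otimes> S) \<cdot> (\<s> (X \<otimes> S) (Y \<otimes> T) \<cdot> \<m> X Y S T) =
      \<alpha> Y T (X \<otimes> S) \<cdot> ((\<s> (X \<otimes> S) (Y \<otimes> T) \<cdot> \<alpha>' X S (Y \<otimes> T)) \<cdot> ((\<i> X \<odot> \<x> Y S T) \<cdot> \<alpha> X Y (S \<otimes> T)))"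
    by (simp add: interchange_eq)
  also have "\<dots> = (\<i> Y \<odot> \<x> X T S) \<cdot> (\<x> X Y (T \<otimes> S) \<cdot> ((\<i> X \<odot> (\<alpha> Y T S \<cdot> \<s> S (Y \<otimes> T))) \<cdot>
      ((\<i> X \<odot> \<x> Y S T) \<cdot> \<alpha> X Y (S \<otimes> T))))"
    by (simp add: swap_tens_past reassoc[OF exchange_past_tens])
  also have "\<dots> = (\<i> Y \<odot> \<x> X T S) \<cdot> (\<x> X Y (T \<otimes> S) \<cdot> ((\<i> X \<odot> (\<i> Y \<odot> \<s> S T)) \<cdot> \<alpha> X Y (S \<otimes> T)))"
    by (simp add: swap_past_tens)
  also have "\<dots> = (\<i> Y \<odot> \<x> X T S) \<cdot> ((\<i> Y \<odot> (\<i> X \<odot> \<s> S T)) \<cdot> (\<alpha> Y X (S \<otimes> T) \<cdot> (\<s> X Y \<odot> \<i> (S \<otimes> T))))"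
  proof -
    have "\<x> X Y (S \<otimes> T) \<cdot> \<alpha> X Y (S \<otimes> T) = \<alpha> Y X (S \<otimes> T) \<cdot> (\<s> X Y \<odot> \<i> (S \<otimes> T))"
      by (simp add: exchange_def)
    then show ?thesis by (simp add: reassoc[OF exchange_natural] del: tens_Comp tens_Comp')
  qed
  also have "\<dots> = (\<i> Y \<odot> \<x> X T S) \<cdot> (\<alpha> Y X (T \<otimes> S) \<cdot> (\<s> X Y \<odot> \<s> S T))"
  proof -
    have "\<alpha> Y X (T \<otimes> S) \<cdot> (\<s> X Y \<odot> \<s> S T) = \<alpha> Y X (T \<otimes> S) \<cdot> ((\<i> (Y \<otimes> X) \<odot> \<s> S T) \<cdot> (\<s> X Y \<odot> \<i> (S \<otimes> T)))"
      by simp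
    also have "\<dots> = (\<i> Y \<odot> (\<i> X \<odot> \<s> S T)) \<cdot> (\<alpha> Y X (S \<otimes> T) \<cdot> (\<s> X Y \<odot> \<i> (S \<otimes> T)))"
      by (simp add: reassoc[OF assoc_natural_ide] del: tens_Comp tens_Comp')
    finally show ?thesis by simp
  qed
  also have "\<dots> = \<alpha> Y T (X \<otimes> S) \<cdot> (\<m> Y X T S \<cdot> (\<s> X Y \<odot> \<s> S T))"
    by (simp add: interchange_eq)
  finally show ?thesis by (rule iso_cancel_left[rotated 5]) simp_all
qed

lemma exchange_unit:
  assumes [simp]: "S \<in> Obj E" "T \<in> Obj E"
  shows "(\<i> S \<odot> \<l> T) \<cdot> \<x> \<u> S T = \<l> (S \<otimes> T)"
proof -
  have "(\<i> S \<odot> \<l> T) \<cdot> \<x> \<u> S T = (\<r> S \<odot> \<i> T) \<cdot> ((\<s> \<u> S \<odot> \<i> T) \<cdot> \<alpha>' \<u> S T)"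
    by (simp add: exchange_def reassoc[OF triangle_equation])
  also have "\<dots> = (\<l> S \<odot> \<i> T) \<cdot> \<alpha>' \<u> S T" by (simp add: runit_swap)
  also have "\<dots> = \<l> (S \<otimes> T)" by (simp add: lunit_tens[symmetric])
  finally show ?thesis .
qed

text \<open>Elements of a copower of the unit are arrows out of the unit, so evaluating an interchange on
  elements puts units into two of its four places.\<close>

lemma interchange_unit_left:
  assumes [simp]: "S \<in> Obj E" "T \<in> Obj E"
  shows "(\<l> S \<odot> \<l> T) \<cdot> \<m> \<u> \<u> S T = \<l> (S \<otimes> T) \<cdot> (\<l> \<u> \<odot> \<i> (S \<otimes> T))"
proof -
  have 1: "(\<l> S \<odot> \<i> (\<u> \<otimes> T)) \<cdot> \<alpha>' \<u> S (\<u> \<otimes> T) = \<l> (S \<otimes> (\<u> \<otimes> T))"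
    by (simp add: lunit_tens[symmetric])
  have "(\<l> S \<odot> \<l> T) \<cdot> \<m> \<u> \<u> S T =
     (\<i> S \<odot> \<l> T) \<cdot> ((\<l> S \<odot> \<i> (\<u> \<otimes> T)) \<cdot> \<alpha>' \<u> S (\<u> \<otimes> T)) \<cdot> ((\<i> \<u> \<odot> \<x> \<u> S T) \<cdot> \<alpha> \<u> \<u> (S \<otimes> T))"
    by (simp add: interchange_eq)
  also have "\<dots> = (\<i> S \<odot> \<l> T) \<cdot> (\<x> \<u> S T \<cdot> (\<l> (\<u> \<otimes> (S \<otimes> T)) \<cdot> \<alpha> \<u> \<u> (S \<otimes> T)))"
    unfolding 1 by (simp add: reassoc[OF lunit_natural])
  also have "\<dots> = \<l> (S \<otimes> T) \<cdot> (\<l> \<u> \<odot> \<i> (S \<otimes> T))"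
    by (simp add: reassoc[OF exchange_unit] lunit_tens)
  finally show ?thesis .
qed

lemma interchange_unit_right:
  assumes [simp]: "X \<in> Obj E" "Y \<in> Obj E"
  shows "(\<r> X \<odot> \<r> Y) \<cdot> \<m> X Y \<u> \<u> = \<r> (X \<otimes> Y) \<cdot> (\<i> (X \<otimes> Y) \<odot> \<l> \<u>)"
proof -
  have 1: "\<r> Y \<cdot> (\<l> (Y \<otimes> \<u>) \<cdot> \<x> Y \<u> \<u>) = \<r> Y \<cdot> (\<i> Y \<odot> \<l> \<u>)"
  proof -
    have "\<l> (Y \<otimes> \<u>) \<cdot> \<x> Y \<u> \<u> = (\<r> Y \<odot> \<i> \<u>) \<cdot> \<alpha>' Y \<u> \<u>"
      by (simp add: exchange_def reassoc[OF lunit_tens] lunit_swap)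
    then show ?thesis by (simp add: triangle_inverse)
  qed
  have "(\<r> X \<odot> \<r> Y) \<cdot> \<m> X Y \<u> \<u> =
     (\<i> X \<odot> \<r> Y) \<cdot> ((\<r> X \<odot> \<i> (Y \<otimes> \<u>)) \<cdot> \<alpha>' X \<u> (Y \<otimes> \<u>)) \<cdot> ((\<i> X \<odot> \<x> Y \<u> \<u>) \<cdot> \<alpha> X Y (\<u> \<otimes> \<u>))"
    by (simp add: interchange_eq)
  also have "\<dots> = (\<i> X \<odot> (\<r> Y \<cdot> (\<l> (Y \<otimes> \<u>) \<cdot> \<x> Y \<u> \<u>))) \<cdot> \<alpha> X Y (\<u> \<otimes> \<u>)"
    by (simp add: triangle_inverse)
  also have "\<dots> = (\<i> X \<odot> \<r> Y) \<cdot> ((\<i> X \<odot> (\<i> Y \<odot> \<l> \<u>)) \<cdot> \<alpha> X Y (\<u> \<otimes> \<u>))"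
    unfolding 1 by simp
  also have "\<dots> = (\<i> X \<odot> \<r> Y) \<cdot> (\<alpha> X Y \<u> \<cdot> (\<i> (X \<otimes> Y) \<odot> \<l> \<u>))"
    by (simp add: assoc_natural_ide)
  also have "\<dots> = \<r> (X \<otimes> Y) \<cdot> (\<i> (X \<otimes> Y) \<odot> \<l> \<u>)"
    by (simp add: reassoc[OF runit_tens])
  finally show ?thesis .
qed

end


section \<open>Functor categories\<close>

lemma op_cat_simps [simp]:
  "Obj (op_cat J) = Obj J" "Arr (op_cat J) = Arr J" "Dom (op_cat J) = Cod J" "Cod (op_cat J) = Dom J"
  "Ide (op_cat J) = Ide J" "g \<cdot>\<^bsub>op_cat J\<^esub> f = f \<cdot>\<^bsub>J\<^esub> g"
  by (simp_all add: op_cat_def)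

lemma category_op_cat: "category J \<Longrightarrow> category (op_cat J)"
proof -
  assume "category J" then interpret category J .
  show ?thesis by unfold_locales auto
qed

lemma prod_cat_simps [simp]:
  "Obj (prod_cat J K) = Obj J \<times> Obj K" "Arr (prod_cat J K) = Arr J \<times> Arr K"
  "Dom (prod_cat J K) fg = (Dom J (fst fg), Dom K (snd fg))"
  "Cod (prod_cat J K) fg = (Cod J (fst fg), Cod K (snd fg))"
  "Ide (prod_cat J K) ab = (Ide J (fst ab), Ide K (snd ab))"
  "(g, g') \<cdot>\<^bsub>prod_cat J K\<^esub> (f, f') = (g \<cdot>\<^bsub>J\<^esub> f, g' \<cdot>\<^bsub>K\<^esub> f')"
  by (simp_all add: prod_cat_def map_prod_def split_beta)

lemma category_prod_cat: "category J \<Longrightarrow> category K \<Longrightarrow> category (prod_cat J K)"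
proof -
  assume "category J" "category K"
  then interpret J: category J + K: category K .
  show ?thesis by unfold_locales auto
qed

lemma functor_category_left: "is_functor J E F \<Longrightarrow> category J"
  and functor_category_right: "is_functor J E F \<Longrightarrow> category E"
  by (auto simp: is_functor_def)

lemma
  assumes "is_functor J E F"
  shows Obj_functor: "i \<in> Obj J \<Longrightarrow> fob F i \<in> Obj E"
    and Arr_functor: "f \<in> Arr J \<Longrightarrow> far F f \<in> Arr E"
    and Dom_functor: "f \<in> Arr J \<Longrightarrow> Dom E (far F f) = fob F (Dom J f)"
    and Cod_functor: "f \<in> Arr J \<Longrightarrow> Cod E (far F f) = fob F (Cod J f)"
    and Ide_functor: "i \<in> Obj J \<Longrightarrow> far F (Ide J i) = Ide E (fob F i)"
    and Comp_functor: "f \<in> Arr J \<Longrightarrow> g \<in> Arr J \<Longrightarrow> Dom J g = Cod J f \<Longrightarrow>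
      far F (g \<cdot>\<^bsub>J\<^esub> f) = far F g \<cdot>\<^bsub>E\<^esub> far F f"
  using assms by (auto simp: is_functor_def)

lemmas functor_simps = Obj_functor Arr_functor Dom_functor Cod_functor Ide_functor Comp_functor

lemma is_functorI:
  assumes "category J" "category E"
    and "\<And>i. i \<in> Obj J \<Longrightarrow> fob F i \<in> Obj E"
    and "\<And>f. f \<in> Arr J \<Longrightarrow> far F f \<in> Hom E (fob F (Dom J f)) (fob F (Cod J f))"
    and "\<And>i. i \<in> Obj J \<Longrightarrow> far F (Ide J i) = Ide E (fob F i)"
    and "\<And>f g. f \<in> Arr J \<Longrightarrow> g \<in> Arr J \<Longrightarrow> Dom J g = Cod J f \<Longrightarrow> far F (g \<cdot>\<^bsub>J\<^esub> f) = far F g \<cdot>\<^bsub>E\<^esub> far F f"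
  shows "is_functor J E F"
  using assms by (auto simp: is_functor_def)

lemma functor_iso:
  assumes F: "is_functor J E F" and f: "is_iso J f"
  shows "is_iso E (far F f)" and "inv_arr E (far F f) = far F (inv_arr J f)"
proof -
  interpret J: category J using functor_category_left[OF F] .
  interpret E: category E using functor_category_right[OF F] .
  have fA: "f \<in> Arr J" using f by (rule J.is_iso_Arr)
  have 1: "far F (inv_arr J f) \<cdot>\<^bsub>E\<^esub> far F f = Ide E (fob F (Dom J f))"
    using f fA by (simp add: Comp_functor[OF F, symmetric] Ide_functor[OF F])
  have 2: "far F f \<cdot>\<^bsub>E\<^esub> far F (inv_arr J f) = Ide E (fob F (Cod J f))"
    using f fA by (simp add: Comp_functor[OF F, symmetric] Ide_functor[OF F])
  show "is_iso E (far F f)"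
    by (rule E.is_isoI[OF _ _ 1 2]) (use f fA in \<open>auto simp: functor_simps[OF F]\<close>)
  show "inv_arr E (far F f) = far F (inv_arr J f)"
    by (rule E.inv_arr_eqI[OF _ _ 1 2]) (use f fA in \<open>auto simp: functor_simps[OF F]\<close>)
qed

lemma comp_functor_simps [simp]:
  "fob (comp_functor G F) i = fob G (fob F i)" "far (comp_functor G F) f = far G (far F f)"
  by (simp_all add: comp_functor_def)

lemma is_functor_comp: "is_functor J K F \<Longrightarrow> is_functor K E G \<Longrightarrow> is_functor J E (comp_functor G F)"
  by (rule is_functorI) (auto simp: functor_category_left functor_category_right functor_simps)

lemma restrict_functor_simps [simp]:
  "i \<in> Obj J \<Longrightarrow> fob (restrict_functor J F) i = fob F i"
  "f \<in> Arr J \<Longrightarrow> far (restrict_functor J F) f = far F f"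
  by (simp_all add: restrict_functor_def)

lemma restrict_functor_in_functors:
  assumes "is_functor J E F" shows "restrict_functor J F \<in> functors J E"
proof -
  interpret J: category J using functor_category_left[OF assms] .
  have "is_functor J E (restrict_functor J F)"
    using assms by (intro is_functorI) (auto simp: functor_simps functor_category_left functor_category_right)
  then show ?thesis by (simp add: functors_def restrict_functor_def)
qed

lemma functorsD: "F \<in> functors J E \<Longrightarrow> is_functor J E F"
  by (simp add: functors_def)

text \<open>Components are undefined outside the objects of \<open>J\<close>, so that equality is pointwise.\<close>

lemma nat_transs_eqI:
  assumes "s \<in> nat_transs J E" "t \<in> nat_transs J E" "source s = source t" "target s = target t"
    and "\<And>i. i \<in> Obj J \<Longrightarrow> component s i = component t i"
  shows "s = t"
proof -
  have "component s = component t"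
    using assms by (intro extensionalityI[of _ "Obj J"]) (auto simp: nat_transs_def)
  then show ?thesis using assms by (simp add: prod_eq_iff)
qed

lemma nat_transsI:
  assumes "F \<in> functors J E" "G \<in> functors J E"
    and "\<And>i. i \<in> Obj J \<Longrightarrow> t i \<in> Hom E (fob F i) (fob G i)"
    and "\<And>f. f \<in> Arr J \<Longrightarrow> t (Cod J f) \<cdot>\<^bsub>E\<^esub> far F f = far G f \<cdot>\<^bsub>E\<^esub> t (Dom J f)"
  shows "(F, \<lambda>i\<in>Obj J. t i, G) \<in> nat_transs J E"
proof -
  interpret J: category J using functorsD[OF assms(1)] functor_category_left by blast
  show ?thesis using assms by (auto simp: nat_transs_def)
qed

lemma
  assumes "t \<in> nat_transs J E"
  shows source_functors: "source t \<in> functors J E" and target_functors: "target t \<in> functors J E"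
    and Arr_component: "i \<in> Obj J \<Longrightarrow> component t i \<in> Arr E"
    and Dom_component: "i \<in> Obj J \<Longrightarrow> Dom E (component t i) = fob (source t) i"
    and Cod_component: "i \<in> Obj J \<Longrightarrow> Cod E (component t i) = fob (target t) i"
    and component_natural: "f \<in> Arr J \<Longrightarrow>
      component t (Cod J f) \<cdot>\<^bsub>E\<^esub> far (source t) f = far (target t) f \<cdot>\<^bsub>E\<^esub> component t (Dom J f)"
  using assms by (auto simp: nat_transs_def)

lemmas component_simps = source_functors target_functors Arr_component Dom_component Cod_component

lemma functor_cat_simps [simp]:
  "Obj (functor_cat J M) = functors J M" "Arr (functor_cat J M) = nat_transs J M"
  "Dom (functor_cat J M) t = source t" "Cod (functor_cat J M) t = target t"
  "source (Ide (functor_cat J M) F) = F" "target (Ide (functor_cat J M) F) = F"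
  "i \<in> Obj J \<Longrightarrow> component (Ide (functor_cat J M) F) i = Ide M (fob F i)"
  "source (s \<cdot>\<^bsub>functor_cat J M\<^esub> t) = source t" "target (s \<cdot>\<^bsub>functor_cat J M\<^esub> t) = target s"
  "i \<in> Obj J \<Longrightarrow> component (s \<cdot>\<^bsub>functor_cat J M\<^esub> t) i = component s i \<cdot>\<^bsub>M\<^esub> component t i"
  "i \<in> Obj J \<Longrightarrow> fob (F \<otimes>\<^bsub>functor_cat J M\<^esub> G) i = fob F i \<otimes>\<^bsub>M\<^esub> fob G i"
  "f \<in> Arr J \<Longrightarrow> far (F \<otimes>\<^bsub>functor_cat J M\<^esub> G) f = far F f \<odot>\<^bsub>M\<^esub> far G f"
  "source (s \<odot>\<^bsub>functor_cat J M\<^esub> t) = source s \<otimes>\<^bsub>functor_cat J M\<^esub> source t"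
  "target (s \<odot>\<^bsub>functor_cat J M\<^esub> t) = target s \<otimes>\<^bsub>functor_cat J M\<^esub> target t"
  "i \<in> Obj J \<Longrightarrow> component (s \<odot>\<^bsub>functor_cat J M\<^esub> t) i = component s i \<odot>\<^bsub>M\<^esub> component t i"
  "i \<in> Obj J \<Longrightarrow> fob (Unit (functor_cat J M)) i = Unit M"
  "f \<in> Arr J \<Longrightarrow> far (Unit (functor_cat J M)) f = Ide M (Unit M)"
  "source (Assoc (functor_cat J M) F G H) = (F \<otimes>\<^bsub>functor_cat J M\<^esub> G) \<otimes>\<^bsub>functor_cat J M\<^esub> H"
  "target (Assoc (functor_cat J M) F G H) = F \<otimes>\<^bsub>functor_cat J M\<^esub> (G \<otimes>\<^bsub>functor_cat J M\<^esub> H)"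
  "i \<in> Obj J \<Longrightarrow> component (Assoc (functor_cat J M) F G H) i = Assoc M (fob F i) (fob G i) (fob H i)"
  "source (LUnit (functor_cat J M) F) = Unit (functor_cat J M) \<otimes>\<^bsub>functor_cat J M\<^esub> F"
  "target (LUnit (functor_cat J M) F) = F"
  "i \<in> Obj J \<Longrightarrow> component (LUnit (functor_cat J M) F) i = LUnit M (fob F i)"
  "source (RUnit (functor_cat J M) F) = F \<otimes>\<^bsub>functor_cat J M\<^esub> Unit (functor_cat J M)"
  "target (RUnit (functor_cat J M) F) = F"
  "i \<in> Obj J \<Longrightarrow> component (RUnit (functor_cat J M) F) i = RUnit M (fob F i)"
  "source (Swap (functor_cat J M) F G) = F \<otimes>\<^bsub>functor_cat J M\<^esub> G"
  "target (Swap (functor_cat J M) F G) = G \<otimes>\<^bsub>functor_cat J M\<^esub> F"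
  "i \<in> Obj J \<Longrightarrow> component (Swap (functor_cat J M) F G) i = Swap M (fob F i) (fob G i)"
  by (simp_all add: functor_cat_def tensor_functor_def const_functor_def)

context symmetric_monoidal_category
begin

context
  fixes J :: "('i, 'j, 'y) cat_scheme"
  assumes J: "category J"
begin

interpretation J: category J by (rule J)

lemma tensor_in_functors [simp]:
  assumes F: "F \<in> functors J E" and G: "G \<in> functors J E"
  shows "F \<otimes>\<^bsub>functor_cat J E\<^esub> G \<in> functors J E"
  unfolding functor_cat_def tensor_functor_def
  by (simp, rule restrict_functor_in_functors, rule is_functorI)
     (auto simp: functor_simps[OF functorsD[OF F]] functor_simps[OF functorsD[OF G]] category_axioms J)

lemma unit_in_functors [simp]: "Unit (functor_cat J E) \<in> functors J E"
  unfolding functor_cat_def const_functor_def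
  by (simp, rule restrict_functor_in_functors, rule is_functorI) (auto simp: category_axioms J)

lemma Ide_in_nat_transs [simp]:
  assumes F: "F \<in> functors J E" shows "Ide (functor_cat J E) F \<in> nat_transs J E"
  unfolding functor_cat_def
  by (simp, rule nat_transsI) (auto simp: F functor_simps[OF functorsD[OF F]])

lemma Comp_in_nat_transs [simp]:
  assumes s: "s \<in> nat_transs J E" and t: "t \<in> nat_transs J E" and st: "source s = target t"
  shows "s \<cdot>\<^bsub>functor_cat J E\<^esub> t \<in> nat_transs J E"
proof -
  have F: "is_functor J E (source s)" "is_functor J E (target s)" "is_functor J E (source t)" "is_functor J E (target t)"
    using s t by (auto intro: functorsD source_functors target_functors)
  note simps = component_simps[OF s] component_simps[OF t] F[THEN Arr_functor] F[THEN Dom_functor] F[THEN Cod_functor]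
  have "(component s (Cod J f) \<cdot> component t (Cod J f)) \<cdot> far (source t) f =
      far (target s) f \<cdot> (component s (Dom J f) \<cdot> component t (Dom J f))" if f: "f \<in> Arr J" for f
    using f st
    by (simp add: simps component_natural[OF t, symmetric])
       (simp add: simps component_natural[OF t] reassoc[OF component_natural[OF s], of f] st[symmetric])
  then show ?thesis unfolding functor_cat_def
    by (simp, intro nat_transsI) (auto simp: simps st)
qed

lemma tens_in_nat_transs [simp]:
  assumes s: "s \<in> nat_transs J E" and t: "t \<in> nat_transs J E"
  shows "s \<odot>\<^bsub>functor_cat J E\<^esub> t \<in> nat_transs J E"
proof -
  have F: "is_functor J E (source s)" "is_functor J E (target s)" "is_functor J E (source t)" "is_functor J E (target t)"
    using s t by (auto intro: functorsD source_functors target_functors)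
  note simps = component_simps[OF s] component_simps[OF t] F[THEN Arr_functor] F[THEN Dom_functor] F[THEN Cod_functor]
  have "(source s \<otimes>\<^bsub>functor_cat J E\<^esub> source t, \<lambda>i\<in>Obj J. component s i \<odot> component t i,
      target s \<otimes>\<^bsub>functor_cat J E\<^esub> target t) \<in> nat_transs J E"
    by (intro nat_transsI) (auto simp: simps component_natural[OF s] component_natural[OF t])
  then show ?thesis by (simp add: functor_cat_def)
qed

lemma structure_in_nat_transs [simp]:
  assumes F: "F \<in> functors J E"
  shows "LUnit (functor_cat J E) F \<in> nat_transs J E" "RUnit (functor_cat J E) F \<in> nat_transs J E"
    "G \<in> functors J E \<Longrightarrow> Swap (functor_cat J E) F G \<in> nat_transs J E"
    "G \<in> functors J E \<Longrightarrow> H \<in> functors J E \<Longrightarrow> Assoc (functor_cat J E) F G H \<in> nat_transs J E"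
proof -
  note Fs = functor_simps[OF functorsD[OF F]]
  have "(Unit (functor_cat J E) \<otimes>\<^bsub>functor_cat J E\<^esub> F, \<lambda>i\<in>Obj J. \<l> (fob F i), F) \<in> nat_transs J E"
    by (intro nat_transsI) (auto simp: F Fs naturality)
  then show "LUnit (functor_cat J E) F \<in> nat_transs J E" by (simp add: functor_cat_def)
  have "(F \<otimes>\<^bsub>functor_cat J E\<^esub> Unit (functor_cat J E), \<lambda>i\<in>Obj J. \<r> (fob F i), F) \<in> nat_transs J E"
    by (intro nat_transsI) (auto simp: F Fs naturality)
  then show "RUnit (functor_cat J E) F \<in> nat_transs J E" by (simp add: functor_cat_def)
  assume G: "G \<in> functors J E"
  note Gs = functor_simps[OF functorsD[OF G]]
  have "(F \<otimes>\<^bsub>functor_cat J E\<^esub> G, \<lambda>i\<in>Obj J. \<s> (fob F i) (fob G i), G \<otimes>\<^bsub>functor_cat J E\<^esub> F) \<in> nat_transs J E"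
    by (intro nat_transsI) (auto simp: F G Fs Gs naturality)
  then show "Swap (functor_cat J E) F G \<in> nat_transs J E" by (simp add: functor_cat_def)
  assume H: "H \<in> functors J E"
  note Hs = functor_simps[OF functorsD[OF H]]
  have "((F \<otimes>\<^bsub>functor_cat J E\<^esub> G) \<otimes>\<^bsub>functor_cat J E\<^esub> H, \<lambda>i\<in>Obj J. \<alpha> (fob F i) (fob G i) (fob H i),
      F \<otimes>\<^bsub>functor_cat J E\<^esub> (G \<otimes>\<^bsub>functor_cat J E\<^esub> H)) \<in> nat_transs J E"
    by (intro nat_transsI) (auto simp: F G H Fs Gs Hs naturality)
  then show "Assoc (functor_cat J E) F G H \<in> nat_transs J E" by (simp add: functor_cat_def)
qed

lemma category_functor_cat: "category (functor_cat J E)"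
proof
  fix f g h :: "('i, 'j, 'o, 'a) nat_trans" and A B D F
  assume f: "f \<in> Hom (functor_cat J E) A B" and g: "g \<in> Hom (functor_cat J E) B D"
    and h: "h \<in> Hom (functor_cat J E) D F"
  show "(h \<cdot>\<^bsub>functor_cat J E\<^esub> g) \<cdot>\<^bsub>functor_cat J E\<^esub> f = h \<cdot>\<^bsub>functor_cat J E\<^esub> (g \<cdot>\<^bsub>functor_cat J E\<^esub> f)"
    by (rule nat_transs_eqI[of _ J E]) (use f g h in \<open>auto simp: component_simps\<close>)
next
  fix f :: "('i, 'j, 'o, 'a) nat_trans" and A B
  assume f: "f \<in> Hom (functor_cat J E) A B"
  then have [simp]: "A \<in> functors J E" "B \<in> functors J E" by (auto simp: component_simps)
  show "Ide (functor_cat J E) B \<cdot>\<^bsub>functor_cat J E\<^esub> f = f"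
    by (rule nat_transs_eqI[of _ J E]) (use f in \<open>auto simp: component_simps\<close>)
  show "f \<cdot>\<^bsub>functor_cat J E\<^esub> Ide (functor_cat J E) A = f"
    by (rule nat_transs_eqI[of _ J E]) (use f in \<open>auto simp: component_simps\<close>)
qed (auto simp: component_simps)

lemma is_iso_functor_cat:
  assumes t: "t \<in> nat_transs J E" and iso: "\<And>i. i \<in> Obj J \<Longrightarrow> is_iso E (component t i)"
  shows "is_iso (functor_cat J E) t"
    and "i \<in> Obj J \<Longrightarrow> component (inv_arr (functor_cat J E) t) i = inv_arr E (component t i)"
proof -
  interpret FC: category "functor_cat J E" by (rule category_functor_cat)
  let ?t' = "(target t, \<lambda>i\<in>Obj J. inv_arr E (component t i), source t)"
  have F: "is_functor J E (source t)" "is_functor J E (target t)"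
    using t by (auto intro: functorsD source_functors target_functors)
  note simps = component_simps[OF t] F[THEN Arr_functor] F[THEN Dom_functor] F[THEN Cod_functor]
  have t': "?t' \<in> nat_transs J E"
    by (rule nat_transsI) (auto simp: simps iso intro!: square_inverse component_natural[OF t])
  have 1: "?t' \<cdot>\<^bsub>functor_cat J E\<^esub> t = Ide (functor_cat J E) (source t)"
    by (rule nat_transs_eqI[of _ J E]) (auto simp: simps t t' iso)
  have 2: "t \<cdot>\<^bsub>functor_cat J E\<^esub> ?t' = Ide (functor_cat J E) (target t)"
    by (rule nat_transs_eqI[of _ J E]) (auto simp: simps t t' iso)
  show "is_iso (functor_cat J E) t"
    by (rule FC.is_isoI[OF _ _ 1 2]) (auto simp: t t')
  have "inv_arr (functor_cat J E) t = ?t'"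
    by (rule FC.inv_arr_eqI[OF _ _ 1 2]) (auto simp: t t')
  then show "i \<in> Obj J \<Longrightarrow> component (inv_arr (functor_cat J E) t) i = inv_arr E (component t i)"
    by simp
qed

text \<open>All structure of a functor category is pointwise, so each axiom is the same axiom at every
  object of the index category.\<close>

lemma symmetric_monoidal_functor_cat: "symmetric_monoidal_category (functor_cat J E)"
proof -
  interpret FC: category "functor_cat J E" by (rule category_functor_cat)
  note simps = component_simps[where J = J and E = E] functorsD[THEN Obj_functor, of _ J E] naturality
    pentagon_equation triangle_equation is_iso_functor_cat(1)
  show ?thesis
    apply unfold_locales
    apply (simp_all add: simps)
    apply (rule nat_transs_eqI[of _ J E]; simp add: simps hexagon_equation)+
    done
qed

end

end


section \<open>Symmetric monoidal functors\<close>

context symmetric_monoidal_functor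
begin

lemmas functor_F_simps [simp] = functor_simps[OF functor_F]

lemma Arr_unit_map [simp]: "u \<in> Arr N" "Dom N u = Unit N" "Cod N u = fob F (Unit M)"
  using unit_map by auto

lemma
  assumes "X \<in> Obj M" "Y \<in> Obj M"
  shows Arr_mult [simp]: "p X Y \<in> Arr N" and Dom_mult [simp]: "Dom N (p X Y) = fob F X \<otimes>\<^bsub>N\<^esub> fob F Y"
    and Cod_mult [simp]: "Cod N (p X Y) = fob F (X \<otimes>\<^bsub>M\<^esub> Y)"
  using mult_map[OF assms] by auto

lemma mult_nat:
  assumes "f \<in> Arr M" "g \<in> Arr M" "Cod M f = X'" "Cod M g = Y'"
  shows "p X' Y' \<cdot>\<^bsub>N\<^esub> (far F f \<odot>\<^bsub>N\<^esub> far F g) = far F (f \<odot>\<^bsub>M\<^esub> g) \<cdot>\<^bsub>N\<^esub> p (Dom M f) (Dom M g)"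
  by (rule mult_natural) (use assms in auto)

lemma mult_nat_left:
  assumes "f \<in> Arr M" "Cod M f = X'" "Y \<in> Obj M"
  shows "p X' Y \<cdot>\<^bsub>N\<^esub> (far F f \<odot>\<^bsub>N\<^esub> Ide N (fob F Y)) = far F (f \<odot>\<^bsub>M\<^esub> Ide M Y) \<cdot>\<^bsub>N\<^esub> p (Dom M f) Y"
  using mult_nat[of f "Ide M Y" X' Y] assms by simp

lemma mult_nat_right:
  assumes "g \<in> Arr M" "Cod M g = Y'" "X \<in> Obj M"
  shows "p X Y' \<cdot>\<^bsub>N\<^esub> (Ide N (fob F X) \<odot>\<^bsub>N\<^esub> far F g) = far F (Ide M X \<odot>\<^bsub>M\<^esub> g) \<cdot>\<^bsub>N\<^esub> p X (Dom M g)"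
  using mult_nat[of "Ide M X" g X Y'] assms by simp

end

text \<open>The structure map of the composite is that of \<open>G\<close> followed by the image of that of \<open>F\<close>.
  Naturality of the former moves it out of the way, so that each axiom becomes the image under
  \<open>G\<close> of the axiom for \<open>F\<close> next to the axiom for \<open>G\<close>.\<close>

lemma symmetric_monoidal_functor_comp:
  assumes "symmetric_monoidal_functor L M F u p" "symmetric_monoidal_functor M N G v q"
  shows "symmetric_monoidal_functor L N (comp_functor G F) (far G u \<cdot>\<^bsub>N\<^esub> v)
    (\<lambda>X Y. far G (p X Y) \<cdot>\<^bsub>N\<^esub> q (fob F X) (fob F Y))"
proof -
  interpret F: symmetric_monoidal_functor L M F u p by fact
  interpret G: symmetric_monoidal_functor M N G v q by fact
  show ?thesis
  proof
    show "is_functor L N (comp_functor G F)"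
      by (rule is_functor_comp[OF F.functor_F G.functor_F])
    show "far G u \<cdot>\<^bsub>N\<^esub> v \<in> Hom N (Unit N) (fob (comp_functor G F) (Unit L))" by simp
  next
    fix X Y assume [simp]: "X \<in> Obj L" "Y \<in> Obj L"
    show "far G (p X Y) \<cdot>\<^bsub>N\<^esub> q (fob F X) (fob F Y) \<in> Hom N (fob (comp_functor G F) X \<otimes>\<^bsub>N\<^esub> fob (comp_functor G F) Y)
        (fob (comp_functor G F) (X \<otimes>\<^bsub>L\<^esub> Y))" by simp
    have "far G (far F (Swap L X Y)) \<cdot>\<^bsub>N\<^esub> (far G (p X Y) \<cdot>\<^bsub>N\<^esub> q (fob F X) (fob F Y)) =
        far G (far F (Swap L X Y) \<cdot>\<^bsub>M\<^esub> p X Y) \<cdot>\<^bsub>N\<^esub> q (fob F X) (fob F Y)"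
      by simp
    also have "\<dots> = far G (p Y X) \<cdot>\<^bsub>N\<^esub> (far G (Swap M (fob F X) (fob F Y)) \<cdot>\<^bsub>N\<^esub> q (fob F X) (fob F Y))"
      unfolding F.mult_swap[OF \<open>X \<in> Obj L\<close> \<open>Y \<in> Obj L\<close>] by simp
    also have "\<dots> = (far G (p Y X) \<cdot>\<^bsub>N\<^esub> q (fob F Y) (fob F X)) \<cdot>\<^bsub>N\<^esub>
        Swap N (fob (comp_functor G F) X) (fob (comp_functor G F) Y)"
      by (simp add: G.mult_swap)
    finally show "far (comp_functor G F) (Swap L X Y) \<cdot>\<^bsub>N\<^esub> (far G (p X Y) \<cdot>\<^bsub>N\<^esub> q (fob F X) (fob F Y)) =
        (far G (p Y X) \<cdot>\<^bsub>N\<^esub> q (fob F Y) (fob F X)) \<cdot>\<^bsub>N\<^esub> Swap N (fob (comp_functor G F) X) (fob (comp_functor G F) Y)"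
      by simp
  next
    fix f g X X' Y Y' assume f: "f \<in> Hom L X X'" and g: "g \<in> Hom L Y Y'"
    have "far G (p X' Y') \<cdot>\<^bsub>N\<^esub> (q (fob F X') (fob F Y') \<cdot>\<^bsub>N\<^esub> (far G (far F f) \<odot>\<^bsub>N\<^esub> far G (far F g))) =
        far G (p X' Y' \<cdot>\<^bsub>M\<^esub> (far F f \<odot>\<^bsub>M\<^esub> far F g)) \<cdot>\<^bsub>N\<^esub> q (fob F X) (fob F Y)"
      using f g by (auto simp: G.mult_nat)
    also have "\<dots> = far G (far F (f \<odot>\<^bsub>L\<^esub> g)) \<cdot>\<^bsub>N\<^esub> (far G (p X Y) \<cdot>\<^bsub>N\<^esub> q (fob F X) (fob F Y))"
      unfolding F.mult_natural[OF f g] using f g by auto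
    finally show "(far G (p X' Y') \<cdot>\<^bsub>N\<^esub> q (fob F X') (fob F Y')) \<cdot>\<^bsub>N\<^esub>
         (far (comp_functor G F) f \<odot>\<^bsub>N\<^esub> far (comp_functor G F) g) =
        far (comp_functor G F) (f \<odot>\<^bsub>L\<^esub> g) \<cdot>\<^bsub>N\<^esub> (far G (p X Y) \<cdot>\<^bsub>N\<^esub> q (fob F X) (fob F Y))"
      using f g by auto
  next
    fix X assume X[simp]: "X \<in> Obj L"
    have "far G (far F (LUnit L X)) \<cdot>\<^bsub>N\<^esub> (far G (p (Unit L) X) \<cdot>\<^bsub>N\<^esub> (q (fob F (Unit L)) (fob F X) \<cdot>\<^bsub>N\<^esub>
        ((far G u \<odot>\<^bsub>N\<^esub> Ide N (fob G (fob F X))) \<cdot>\<^bsub>N\<^esub> (v \<odot>\<^bsub>N\<^esub> Ide N (fob G (fob F X)))))) =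
        far G (far F (LUnit L X) \<cdot>\<^bsub>M\<^esub> p (Unit L) X \<cdot>\<^bsub>M\<^esub> (u \<odot>\<^bsub>M\<^esub> Ide M (fob F X))) \<cdot>\<^bsub>N\<^esub>
        (q (Unit M) (fob F X) \<cdot>\<^bsub>N\<^esub> (v \<odot>\<^bsub>N\<^esub> Ide N (fob G (fob F X))))"
      by (simp add: G.N.reassoc[OF G.mult_nat_left] del: G.N.tens_Comp G.N.tens_Comp')
    also have "\<dots> = LUnit N (fob G (fob F X))"
      unfolding F.left_unit[OF X] using G.left_unit[of "fob F X"] by simp
    finally show "far (comp_functor G F) (LUnit L X) \<cdot>\<^bsub>N\<^esub> (far G (p (Unit L) X) \<cdot>\<^bsub>N\<^esub> q (fob F (Unit L)) (fob F X)) \<cdot>\<^bsub>N\<^esub>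
        ((far G u \<cdot>\<^bsub>N\<^esub> v) \<odot>\<^bsub>N\<^esub> Ide N (fob (comp_functor G F) X)) = LUnit N (fob (comp_functor G F) X)"
      by simp
    have "far G (far F (RUnit L X)) \<cdot>\<^bsub>N\<^esub> (far G (p X (Unit L)) \<cdot>\<^bsub>N\<^esub> (q (fob F X) (fob F (Unit L)) \<cdot>\<^bsub>N\<^esub>
        ((Ide N (fob G (fob F X)) \<odot>\<^bsub>N\<^esub> far G u) \<cdot>\<^bsub>N\<^esub> (Ide N (fob G (fob F X)) \<odot>\<^bsub>N\<^esub> v)))) =
        far G (far F (RUnit L X) \<cdot>\<^bsub>M\<^esub> p X (Unit L) \<cdot>\<^bsub>M\<^esub> (Ide M (fob F X) \<odot>\<^bsub>M\<^esub> u)) \<cdot>\<^bsub>N\<^esub>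
        (q (fob F X) (Unit M) \<cdot>\<^bsub>N\<^esub> (Ide N (fob G (fob F X)) \<odot>\<^bsub>N\<^esub> v))"
      by (simp add: G.N.reassoc[OF G.mult_nat_right] del: G.N.tens_Comp G.N.tens_Comp')
    also have "\<dots> = RUnit N (fob G (fob F X))"
      unfolding F.right_unit[OF X] using G.right_unit[of "fob F X"] by simp
    finally show "far (comp_functor G F) (RUnit L X) \<cdot>\<^bsub>N\<^esub> (far G (p X (Unit L)) \<cdot>\<^bsub>N\<^esub> q (fob F X) (fob F (Unit L))) \<cdot>\<^bsub>N\<^esub>
        (Ide N (fob (comp_functor G F) X) \<odot>\<^bsub>N\<^esub> (far G u \<cdot>\<^bsub>N\<^esub> v)) = RUnit N (fob (comp_functor G F) X)"
      by simp
  next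
    fix X Y Z assume X[simp]: "X \<in> Obj L" and Y[simp]: "Y \<in> Obj L" and Z[simp]: "Z \<in> Obj L"
    let ?X = "fob F X" and ?Y = "fob F Y" and ?Z = "fob F Z"
    have "far G (far F (Assoc L X Y Z)) \<cdot>\<^bsub>N\<^esub> (far G (p (X \<otimes>\<^bsub>L\<^esub> Y) Z) \<cdot>\<^bsub>N\<^esub> (q (fob F (X \<otimes>\<^bsub>L\<^esub> Y)) ?Z \<cdot>\<^bsub>N\<^esub>
        ((far G (p X Y) \<odot>\<^bsub>N\<^esub> Ide N (fob G ?Z)) \<cdot>\<^bsub>N\<^esub> (q ?X ?Y \<odot>\<^bsub>N\<^esub> Ide N (fob G ?Z))))) =
        far G (far F (Assoc L X Y Z) \<cdot>\<^bsub>M\<^esub> p (X \<otimes>\<^bsub>L\<^esub> Y) Z \<cdot>\<^bsub>M\<^esub> (p X Y \<odot>\<^bsub>M\<^esub> Ide M ?Z)) \<cdot>\<^bsub>N\<^esub>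
        (q (?X \<otimes>\<^bsub>M\<^esub> ?Y) ?Z \<cdot>\<^bsub>N\<^esub> (q ?X ?Y \<odot>\<^bsub>N\<^esub> Ide N (fob G ?Z)))"
      by (simp add: G.N.reassoc[OF G.mult_nat_left] del: G.N.tens_Comp G.N.tens_Comp')
    also have "\<dots> = far G (p X (Y \<otimes>\<^bsub>L\<^esub> Z)) \<cdot>\<^bsub>N\<^esub> (far G (Ide M ?X \<odot>\<^bsub>M\<^esub> p Y Z) \<cdot>\<^bsub>N\<^esub>
        (far G (Assoc M ?X ?Y ?Z) \<cdot>\<^bsub>N\<^esub> (q (?X \<otimes>\<^bsub>M\<^esub> ?Y) ?Z \<cdot>\<^bsub>N\<^esub> (q ?X ?Y \<odot>\<^bsub>N\<^esub> Ide N (fob G ?Z)))))"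
      unfolding F.mult_assoc[OF X Y Z] by simp
    also have "\<dots> = far G (p X (Y \<otimes>\<^bsub>L\<^esub> Z)) \<cdot>\<^bsub>N\<^esub> (far G (Ide M ?X \<odot>\<^bsub>M\<^esub> p Y Z) \<cdot>\<^bsub>N\<^esub>
        (q ?X (?Y \<otimes>\<^bsub>M\<^esub> ?Z) \<cdot>\<^bsub>N\<^esub> ((Ide N (fob G ?X) \<odot>\<^bsub>N\<^esub> q ?Y ?Z) \<cdot>\<^bsub>N\<^esub> Assoc N (fob G ?X) (fob G ?Y) (fob G ?Z))))"
      using G.mult_assoc[of ?X ?Y ?Z] by simp
    also have "\<dots> = far G (p X (Y \<otimes>\<^bsub>L\<^esub> Z)) \<cdot>\<^bsub>N\<^esub> (q ?X (fob F (Y \<otimes>\<^bsub>L\<^esub> Z)) \<cdot>\<^bsub>N\<^esub>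
        ((Ide N (fob G ?X) \<odot>\<^bsub>N\<^esub> far G (p Y Z)) \<cdot>\<^bsub>N\<^esub> ((Ide N (fob G ?X) \<odot>\<^bsub>N\<^esub> q ?Y ?Z) \<cdot>\<^bsub>N\<^esub>
        Assoc N (fob G ?X) (fob G ?Y) (fob G ?Z))))"
      by (simp add: G.N.reassoc[OF G.mult_nat_right] del: G.N.tens_Comp G.N.tens_Comp')
    finally show "far (comp_functor G F) (Assoc L X Y Z) \<cdot>\<^bsub>N\<^esub>
        (far G (p (X \<otimes>\<^bsub>L\<^esub> Y) Z) \<cdot>\<^bsub>N\<^esub> q (fob F (X \<otimes>\<^bsub>L\<^esub> Y)) (fob F Z)) \<cdot>\<^bsub>N\<^esub>
        ((far G (p X Y) \<cdot>\<^bsub>N\<^esub> q (fob F X) (fob F Y)) \<odot>\<^bsub>N\<^esub> Ide N (fob (comp_functor G F) Z)) =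
        (far G (p X (Y \<otimes>\<^bsub>L\<^esub> Z)) \<cdot>\<^bsub>N\<^esub> q (fob F X) (fob F (Y \<otimes>\<^bsub>L\<^esub> Z))) \<cdot>\<^bsub>N\<^esub>
        (Ide N (fob (comp_functor G F) X) \<odot>\<^bsub>N\<^esub> (far G (p Y Z) \<cdot>\<^bsub>N\<^esub> q (fob F Y) (fob F Z))) \<cdot>\<^bsub>N\<^esub>
        Assoc N (fob (comp_functor G F) X) (fob (comp_functor G F) Y) (fob (comp_functor G F) Z)"
      by simp
  qed
qed

lemma postcomp_functor_simps [simp]:
  "i \<in> Obj J \<Longrightarrow> fob (fob (postcomp_functor J H) F) i = fob H (fob F i)"
  "f \<in> Arr J \<Longrightarrow> far (fob (postcomp_functor J H) F) f = far H (far F f)"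
  "source (far (postcomp_functor J H) t) = fob (postcomp_functor J H) (source t)"
  "target (far (postcomp_functor J H) t) = fob (postcomp_functor J H) (target t)"
  "i \<in> Obj J \<Longrightarrow> component (far (postcomp_functor J H) t) i = far H (component t i)"
  by (simp_all add: postcomp_functor_def)

lemma fob_postcomp_in_functors:
  "is_functor M N H \<Longrightarrow> F \<in> functors J M \<Longrightarrow> fob (postcomp_functor J H) F \<in> functors J N"
  unfolding postcomp_functor_def
  by (simp, rule restrict_functor_in_functors) (auto intro: is_functor_comp functorsD)

lemma far_postcomp_in_nat_transs:
  assumes H: "is_functor M N H" and t: "t \<in> nat_transs J M"
  shows "far (postcomp_functor J H) t \<in> nat_transs J N"
proof -
  interpret J: category J using source_functors[OF t] functorsD functor_category_left by blast
  interpret M: category M by (rule functor_category_left[OF H])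
  have F: "is_functor J M (source t)" "is_functor J M (target t)"
    using t by (auto intro: functorsD source_functors target_functors)
  note simps = component_simps[OF t] functor_simps[OF F(1)] functor_simps[OF F(2)] functor_simps[OF H]
  have "(fob (postcomp_functor J H) (source t), \<lambda>i\<in>Obj J. far H (component t i),
      fob (postcomp_functor J H) (target t)) \<in> nat_transs J N"
    by (intro nat_transsI fob_postcomp_in_functors[OF H])
       (auto simp: simps Comp_functor[OF H, symmetric] component_natural[OF t]
         simp del: Comp_functor[OF H])
  then show ?thesis by (simp add: postcomp_functor_def)
qed

lemma is_functor_postcomp:
  assumes H: "is_functor M N H" and M: "symmetric_monoidal_category M" and N: "symmetric_monoidal_category N"
    and J: "category J"
  shows "is_functor (functor_cat J M) (functor_cat J N) (postcomp_functor J H)"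
proof -
  interpret M: symmetric_monoidal_category M by (rule M)
  interpret N: symmetric_monoidal_category N by (rule N)
  note * = fob_postcomp_in_functors[OF H, where J = J] far_postcomp_in_nat_transs[OF H, where J = J]
    component_simps[where J = J and E = M] functorsD[THEN Obj_functor, of _ J M] functor_simps[OF H]
    M.Ide_in_nat_transs[OF J] N.Ide_in_nat_transs[OF J] M.Comp_in_nat_transs[OF J] N.Comp_in_nat_transs[OF J]
  show ?thesis
  proof (rule is_functorI)
    fix F assume "F \<in> Obj (functor_cat J M)"
    then show "far (postcomp_functor J H) (Ide (functor_cat J M) F) = Ide (functor_cat J N) (fob (postcomp_functor J H) F)"
      by (intro nat_transs_eqI[of _ J N]) (simp_all add: *)
  next
    fix s t assume "s \<in> Arr (functor_cat J M)" "t \<in> Arr (functor_cat J M)" "Dom (functor_cat J M) t = Cod (functor_cat J M) s"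
    then show "far (postcomp_functor J H) (t \<cdot>\<^bsub>functor_cat J M\<^esub> s) =
        far (postcomp_functor J H) t \<cdot>\<^bsub>functor_cat J N\<^esub> far (postcomp_functor J H) s"
      by (intro nat_transs_eqI[of _ J N]) (simp_all add: *)
  qed (simp_all add: * M.category_functor_cat[OF J] N.category_functor_cat[OF J])
qed

text \<open>Everything is pointwise, so each axiom is the axiom for \<open>H\<close> at the objects of \<open>J\<close>.\<close>

lemma symmetric_monoidal_functor_postcomp:
  assumes H: "symmetric_monoidal_functor M N H u p" and J: "category J"
  shows "symmetric_monoidal_functor (functor_cat J M) (functor_cat J N) (postcomp_functor J H)
    (Unit (functor_cat J N), \<lambda>i\<in>Obj J. u, fob (postcomp_functor J H) (Unit (functor_cat J M)))
    (\<lambda>X Y. (fob (postcomp_functor J H) X \<otimes>\<^bsub>functor_cat J N\<^esub> fob (postcomp_functor J H) Y,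
      \<lambda>i\<in>Obj J. p (fob X i) (fob Y i), fob (postcomp_functor J H) (X \<otimes>\<^bsub>functor_cat J M\<^esub> Y)))"
    (is "symmetric_monoidal_functor ?M ?N ?F ?u ?p")
proof -
  interpret H: symmetric_monoidal_functor M N H u p by (rule H)
  interpret J: category J by (rule J)
  interpret FM: symmetric_monoidal_category ?M by (rule H.M.symmetric_monoidal_functor_cat[OF J])
  interpret FN: symmetric_monoidal_category ?N by (rule H.N.symmetric_monoidal_functor_cat[OF J])
  have F: "is_functor ?M ?N ?F"
    by (rule is_functor_postcomp[OF H.functor_F H.M.symmetric_monoidal_category_axioms
        H.N.symmetric_monoidal_category_axioms J])
  note Fob = fob_postcomp_in_functors[OF H.functor_F, where J = J] functorsD[THEN Obj_functor, of _ J M]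
    functorsD[THEN Obj_functor, of _ J N]
  note Farr = functorsD[THEN Arr_functor, of _ J M] functorsD[THEN Dom_functor, of _ J M] functorsD[THEN Cod_functor, of _ J M]
  have u: "?u \<in> nat_transs J N"
    using FM.unit_obj FN.unit_obj by (intro nat_transsI) (auto simp: Fob)
  have p: "?p X Y \<in> nat_transs J N" if "X \<in> functors J M" "Y \<in> functors J M" for X Y
    using that FM.tens_obj[of X Y] FN.tens_obj[of "fob ?F X" "fob ?F Y"]
    by (intro nat_transsI) (auto simp: Fob Farr H.mult_nat)
  note * = F[THEN Obj_functor] F[THEN Arr_functor] component_simps[where J = J] functorsD[THEN Obj_functor, of _ J M]
    Fob u p far_postcomp_in_nat_transs[OF H.functor_F, where J = J]
    H.N.Comp_in_nat_transs[OF J] H.N.tens_in_nat_transs[OF J] H.N.Ide_in_nat_transs[OF J]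
    H.M.Comp_in_nat_transs[OF J] H.M.tens_in_nat_transs[OF J] H.M.Ide_in_nat_transs[OF J]
    H.M.structure_in_nat_transs[OF J] H.N.structure_in_nat_transs[OF J]
    H.M.tensor_in_functors[OF J] H.N.tensor_in_functors[OF J] H.M.unit_in_functors[OF J] H.N.unit_in_functors[OF J]
  have assoc: "far H (Assoc M X Y Z) \<cdot>\<^bsub>N\<^esub> (p (X \<otimes>\<^bsub>M\<^esub> Y) Z \<cdot>\<^bsub>N\<^esub> (p X Y \<odot>\<^bsub>N\<^esub> Ide N (fob H Z))) =
      p X (Y \<otimes>\<^bsub>M\<^esub> Z) \<cdot>\<^bsub>N\<^esub> ((Ide N (fob H X) \<odot>\<^bsub>N\<^esub> p Y Z) \<cdot>\<^bsub>N\<^esub> Assoc N (fob H X) (fob H Y) (fob H Z))"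
    if "X \<in> Obj M" "Y \<in> Obj M" "Z \<in> Obj M" for X Y Z
    using H.mult_assoc[OF that] that by simp
  have lu: "far H (LUnit M X) \<cdot>\<^bsub>N\<^esub> (p (Unit M) X \<cdot>\<^bsub>N\<^esub> (u \<odot>\<^bsub>N\<^esub> Ide N (fob H X))) = LUnit N (fob H X)"
    if "X \<in> Obj M" for X using H.left_unit[OF that] that by simp
  have ru: "far H (RUnit M X) \<cdot>\<^bsub>N\<^esub> (p X (Unit M) \<cdot>\<^bsub>N\<^esub> (Ide N (fob H X) \<odot>\<^bsub>N\<^esub> u)) = RUnit N (fob H X)"
    if "X \<in> Obj M" for X using H.right_unit[OF that] that by simp
  show ?thesis
    apply unfold_locales
    apply (rule F)
    apply (simp_all add: *)
    apply (rule nat_transs_eqI[of _ J N]; simp add: * H.mult_nat assoc lu ru H.mult_swap)+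
    done
qed


section \<open>The category of small sets\<close>

lemma Sets_simps [simp]:
  "A \<in> Obj Sets \<longleftrightarrow> small A"
  "Dom Sets f = source f" "Cod Sets f = target f"
  "source (Ide Sets A) = A" "target (Ide Sets A) = A"
  "x \<in> A \<Longrightarrow> component (Ide Sets A) x = x"
  "source (g \<cdot>\<^bsub>Sets\<^esub> f) = source f" "target (g \<cdot>\<^bsub>Sets\<^esub> f) = target g"
  "x \<in> source f \<Longrightarrow> component (g \<cdot>\<^bsub>Sets\<^esub> f) x = component g (component f x)"
  "A \<otimes>\<^bsub>Sets\<^esub> B = set_prod A B" "Unit Sets = set_unit"
  "source (f \<odot>\<^bsub>Sets\<^esub> g) = set_prod (source f) (source g)" "target (f \<odot>\<^bsub>Sets\<^esub> g) = set_prod (target f) (target g)"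
  "c \<in> set_prod (source f) (source g) \<Longrightarrow>
    component (f \<odot>\<^bsub>Sets\<^esub> g) c = pair_code (component f (fst_code c)) (component g (snd_code c))"
  "source (Assoc Sets A B D) = set_prod (set_prod A B) D" "target (Assoc Sets A B D) = set_prod A (set_prod B D)"
  "c \<in> set_prod (set_prod A B) D \<Longrightarrow> component (Assoc Sets A B D) c =
    pair_code (fst_code (fst_code c)) (pair_code (snd_code (fst_code c)) (snd_code c))"
  "source (LUnit Sets A) = set_prod set_unit A" "target (LUnit Sets A) = A"
  "c \<in> set_prod set_unit A \<Longrightarrow> component (LUnit Sets A) c = snd_code c"
  "source (RUnit Sets A) = set_prod A set_unit" "target (RUnit Sets A) = A"
  "c \<in> set_prod A set_unit \<Longrightarrow> component (RUnit Sets A) c = fst_code c"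
  "source (Swap Sets A B) = set_prod A B" "target (Swap Sets A B) = set_prod B A"
  "c \<in> set_prod A B \<Longrightarrow> component (Swap Sets A B) c = pair_code (snd_code c) (fst_code c)"
  by (simp_all add: Sets_def compose_def)

lemma Arr_Sets_iff: "f \<in> Arr Sets \<longleftrightarrow> small (source f) \<and> small (target f) \<and> component f \<in> source f \<rightarrow>\<^sub>E target f"
  by (cases f) (auto simp: Sets_def)

lemma Arr_SetsI [intro]:
  "small A \<Longrightarrow> small B \<Longrightarrow> (\<And>x. x \<in> A \<Longrightarrow> f x \<in> B) \<Longrightarrow> (A, \<lambda>x\<in>A. f x, B) \<in> Arr Sets"
  by (auto simp: Arr_Sets_iff)

lemma Arr_SetsD:
  assumes "f \<in> Arr Sets"
  shows "small (source f)" "small (target f)" "x \<in> source f \<Longrightarrow> component f x \<in> target f"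
  using assms by (auto simp: Arr_Sets_iff)

lemma Sets_eqI:
  assumes "f \<in> Arr Sets" "g \<in> Arr Sets" "source f = source g" "target f = target g"
    "\<And>x. x \<in> source f \<Longrightarrow> component f x = component g x"
  shows "f = g"
proof -
  have "component f = component g"
    using assms by (intro extensionalityI[of _ "source f"]) (auto simp: Arr_Sets_iff PiE_def)
  then show ?thesis using assms by (simp add: prod_eq_iff)
qed

lemma Arr_Sets_Ide [simp]: "small A \<Longrightarrow> Ide Sets A \<in> Arr Sets"
  by (auto simp: Arr_Sets_iff) (auto simp: Sets_def)

lemma Arr_Sets_Comp [simp]:
  "f \<in> Arr Sets \<Longrightarrow> g \<in> Arr Sets \<Longrightarrow> source g = target f \<Longrightarrow> g \<cdot>\<^bsub>Sets\<^esub> f \<in> Arr Sets"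
  by (auto simp: Arr_Sets_iff) (auto simp: Sets_def compose_def)

lemma category_Sets: "category Sets"
  apply unfold_locales
  apply (simp_all add: Arr_SetsD)
  apply (rule Sets_eqI; simp add: Arr_SetsD)+
  done

lemma is_iso_Sets:
  assumes "f \<in> Arr Sets" "g \<in> Arr Sets" "source g = target f" "target g = source f"
    and "\<And>x. x \<in> source f \<Longrightarrow> component g (component f x) = x"
    and "\<And>y. y \<in> target f \<Longrightarrow> component f (component g y) = y"
  shows "is_iso Sets f"
proof -
  interpret category Sets by (rule category_Sets)
  show ?thesis
  proof (rule is_isoI[of _ "source f" "target f" g])
    show "g \<cdot>\<^bsub>Sets\<^esub> f = Ide Sets (source f)"
      by (rule Sets_eqI) (use assms(1-4) Arr_SetsD[OF assms(1)] in \<open>simp_all add: assms(5)\<close>)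
    show "f \<cdot>\<^bsub>Sets\<^esub> g = Ide Sets (target f)"
      by (rule Sets_eqI) (use assms(1-4) Arr_SetsD[OF assms(1)] in \<open>simp_all add: assms(6)\<close>)
  qed (use assms(1-4) in auto)
qed

locale universe =
  fixes U :: "'u itself"
  assumes regular: "regular_universe U"
begin

abbreviation SetU :: "('u set, 'u set_map) smcat" where "SetU \<equiv> Sets"

lemma nat_lesspoll_universe: "(UNIV :: nat set) \<prec> (UNIV :: 'u set)"
  using regular by (simp add: regular_universe_def)

lemma infinite_universe: "infinite (UNIV :: 'u set)"
  using nat_lesspoll_universe infinite_UNIV_nat lepoll_def lesspoll_imp_lepoll
  by (metis finite_imageD finite_subset)

lemma small_lepoll_nat: "A \<lesssim> (UNIV :: nat set) \<Longrightarrow> small (A :: 'u set)"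
  unfolding small_def using nat_lesspoll_universe lesspoll_trans1 by blast

lemma small_finite: "finite A \<Longrightarrow> small (A :: 'u set)"
  unfolding small_def using infinite_universe finite_lesspoll_infinite by blast

text \<open>As \<open>code\<close> is some injection into the universe if there is one at all, it suffices to exhibit
  one: through the natural numbers for countable types, and by cardinal arithmetic for the square
  of the universe.\<close>

lemma inj_code: "inj (c :: 'x \<Rightarrow> 'u) \<Longrightarrow> inj (code :: 'x \<Rightarrow> 'u)"
  unfolding code_def by (rule someI[where P = inj])

lemma inj_code_countable: "inj (code :: 'x :: countable \<Rightarrow> 'u)"
proof -
  obtain c :: "nat \<Rightarrow> 'u" where "inj c"
    using infinite_universe infinite_countable_subset by blast
  then have "inj (c \<circ> to_nat :: 'x \<Rightarrow> 'u)" by (intro inj_compose) auto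
  then show ?thesis by (rule inj_code)
qed

lemma inj_code_pair: "inj (code :: 'u \<times> 'u \<Rightarrow> 'u)"
proof -
  have "(card_of (UNIV \<times> UNIV :: ('u \<times> 'u) set), card_of (UNIV :: 'u set)) \<in> ordLeq"
    using card_of_Times_same_infinite[OF infinite_universe] ordIso_imp_ordLeq by blast
  then obtain c :: "'u \<times> 'u \<Rightarrow> 'u" where "inj c"
    by (auto simp flip: card_of_ordLeq)
  then show ?thesis by (rule inj_code)
qed

lemma decode_code [simp]: "decode (code f :: 'u) = (f :: 'x :: countable)"
  unfolding decode_def by (rule inv_f_f[OF inj_code_countable])

lemma code_eq_iff [simp]: "(code f :: 'u) = code g \<longleftrightarrow> (f :: 'x :: countable) = g"
  by (rule inj_eq[OF inj_code_countable])

lemma fst_code_pair [simp]: "fst_code (pair_code (a :: 'u) b) = a"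
  and snd_code_pair [simp]: "snd_code (pair_code (a :: 'u) b) = b"
  unfolding fst_code_def snd_code_def pair_code_def decode_def by (simp_all add: inv_f_f[OF inj_code_pair])

lemma pair_code_eq_iff [simp]: "pair_code (a :: 'u) b = pair_code c d \<longleftrightarrow> a = c \<and> b = d"
  by (metis fst_code_pair snd_code_pair)

lemma in_set_prod [simp]: "pair_code a b \<in> set_prod A B \<longleftrightarrow> (a :: 'u) \<in> A \<and> b \<in> B"
  by (auto simp: set_prod_def image_iff)

lemma set_prodE:
  assumes "c \<in> set_prod A B"
  obtains a b where "c = pair_code a b" "(a :: 'u) \<in> A" "b \<in> B"
  using assms by (auto simp: set_prod_def)

text \<open>A product is a small union of small sets; this is what regularity of the universe is for.\<close>

lemma small_set_prod [simp]:
  assumes A: "small A" and B: "small B" shows "small (set_prod A B :: 'u set)"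
proof -
  have "small (pair_code a ` B)" for a :: 'u
    using B unfolding small_def by (meson image_lepoll lesspoll_trans1)
  then have "small (\<Union>a\<in>A. pair_code a ` B)"
    using regular A by (simp add: regular_universe_def)
  moreover have "(\<Union>a\<in>A. pair_code a ` B) = set_prod A B" by (auto simp: set_prod_def)
  ultimately show ?thesis by simp
qed

lemma small_set_unit [simp]: "small (set_unit :: 'u set)"
  by (rule small_finite) (simp add: set_unit_def)

lemma Arr_Sets_tens [simp]:
  assumes f: "f \<in> Arr SetU" and g: "g \<in> Arr SetU" shows "f \<odot>\<^bsub>SetU\<^esub> g \<in> Arr SetU"
proof -
  have "(set_prod (source f) (source g), \<lambda>c\<in>set_prod (source f) (source g).
      pair_code (component f (fst_code c)) (component g (snd_code c)), set_prod (target f) (target g)) \<in> Arr Sets"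
    using f g by (intro Arr_SetsI) (auto simp: Arr_SetsD elim!: set_prodE)
  then show ?thesis by (simp add: Sets_def)
qed

lemma Arr_Sets_structure [simp]:
  assumes [simp]: "small A"
  shows "small B \<Longrightarrow> small D \<Longrightarrow> Assoc SetU A B D \<in> Arr SetU" "LUnit SetU A \<in> Arr SetU" "RUnit SetU A \<in> Arr SetU"
    "small B \<Longrightarrow> Swap SetU A B \<in> Arr SetU"
proof -
  have "(set_prod (set_prod A B) D, \<lambda>c\<in>set_prod (set_prod A B) D.
      pair_code (fst_code (fst_code c)) (pair_code (snd_code (fst_code c)) (snd_code c)), set_prod A (set_prod B D)) \<in> Arr Sets"
    if "small B" "small D" by (intro Arr_SetsI) (use that in \<open>auto elim!: set_prodE\<close>)
  then show "small B \<Longrightarrow> small D \<Longrightarrow> Assoc SetU A B D \<in> Arr SetU" by (simp add: Sets_def)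
  have "(set_prod set_unit A, \<lambda>c\<in>set_prod set_unit A. snd_code c, A) \<in> Arr Sets"
    by (intro Arr_SetsI) (auto elim!: set_prodE)
  then show "LUnit SetU A \<in> Arr SetU" by (simp add: Sets_def)
  have "(set_prod A set_unit, \<lambda>c\<in>set_prod A set_unit. fst_code c, A) \<in> Arr Sets"
    by (intro Arr_SetsI) (auto elim!: set_prodE)
  then show "RUnit SetU A \<in> Arr SetU" by (simp add: Sets_def)
  have "(set_prod A B, \<lambda>c\<in>set_prod A B. pair_code (snd_code c) (fst_code c), set_prod B A) \<in> Arr Sets"
    if "small B" by (intro Arr_SetsI) (use that in \<open>auto elim!: set_prodE\<close>)
  then show "small B \<Longrightarrow> Swap SetU A B \<in> Arr SetU" by (simp add: Sets_def)
qed

lemma is_iso_Assoc_Sets: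
  assumes [simp]: "small A" "small B" "small D" shows "is_iso SetU (Assoc SetU A B D)"
  by (rule is_iso_Sets[of _ "(set_prod A (set_prod B D), \<lambda>c\<in>set_prod A (set_prod B D).
      pair_code (pair_code (fst_code c) (fst_code (snd_code c))) (snd_code (snd_code c)), set_prod (set_prod A B) D)"])
     (auto elim!: set_prodE)

lemma is_iso_LUnit_Sets:
  assumes [simp]: "small A" shows "is_iso SetU (LUnit SetU A)"
proof (rule is_iso_Sets)
  (* the one element of the unit set is undefined *)
  show "(A, \<lambda>a\<in>A. pair_code undefined a, set_prod set_unit A) \<in> Arr SetU"
    by (rule Arr_SetsI) (simp_all add: set_unit_def small_finite)
qed (auto elim!: set_prodE simp: set_unit_def)

lemma is_iso_RUnit_Sets:
  assumes [simp]: "small A" shows "is_iso SetU (RUnit SetU A)"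
proof (rule is_iso_Sets)
  show "(A, \<lambda>a\<in>A. pair_code a undefined, set_prod A set_unit) \<in> Arr SetU"
    by (rule Arr_SetsI) (simp_all add: set_unit_def small_finite)
qed (auto elim!: set_prodE simp: set_unit_def)

lemma symmetric_monoidal_Sets: "symmetric_monoidal_category SetU"
proof -
  interpret category SetU by (rule category_Sets)
  show ?thesis
    apply unfold_locales
    apply (simp_all add: is_iso_Assoc_Sets is_iso_LUnit_Sets is_iso_RUnit_Sets Arr_SetsD)
    apply (rule Sets_eqI; simp add: Arr_SetsD; elim set_prodE; simp add: Arr_SetsD)+
    done
qed

end

sublocale universe \<subseteq> SetU: symmetric_monoidal_category SetU
  by (rule symmetric_monoidal_Sets)


section \<open>The simplex category and the standard simplices\<close>

lemma Obj_Delta [simp]: "Obj \<Delta> = UNIV"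
  by (simp add: \<Delta>_def)

text \<open>An arrow from \<open>k\<close> to \<open>n\<close> is the nondecreasing list of its \<open>k + 1\<close> values together with
  \<open>n\<close>, and composition is indexing into a list.\<close>

lemma category_Delta: "category \<Delta>"
proof -
  have Arr: "f \<in> Arr \<Delta> \<longleftrightarrow> fst f \<noteq> [] \<and> sorted (fst f) \<and> (\<forall>x\<in>set (fst f). x \<le> snd f)"
    and Dom: "Dom \<Delta> f = length (fst f) - 1" and Cod: "Cod \<Delta> f = snd f"
    and Ide: "Ide \<Delta> n = ([0..<Suc n], n)"
    and Comp: "g \<cdot>\<^bsub>\<Delta>\<^esub> f = (map (\<lambda>x. fst g ! x) (fst f), snd g)" for f g n
    by (auto simp: \<Delta>_def split_beta)
  have less: "x < length (fst g)" if "f \<in> Arr \<Delta>" "g \<in> Arr \<Delta>" "Cod \<Delta> f = Dom \<Delta> g" "x \<in> set (fst f)" for f g x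
  proof -
    have "x \<le> length (fst g) - 1" "fst g \<noteq> []" using that by (auto simp: Arr Dom Cod)
    then show ?thesis by (cases "fst g") auto
  qed
  have comp: "g \<cdot>\<^bsub>\<Delta>\<^esub> f \<in> Arr \<Delta>" if f: "f \<in> Arr \<Delta>" and g: "g \<in> Arr \<Delta>" and fg: "Cod \<Delta> f = Dom \<Delta> g" for f g
  proof -
    have "sorted (map (\<lambda>x. fst g ! x) (fst f))"
      unfolding sorted_map
      by (rule sorted_wrt_mono_rel[of _ "(\<le>)"])
         (use f g less[OF f g fg] in \<open>auto simp: Arr intro: sorted_nth_mono\<close>)
    then show ?thesis using f g less[OF f g fg] by (auto simp: Arr Comp)
  qed
  show ?thesis
  proof
    fix f A B assume f: "f \<in> Hom \<Delta> A B"
    have B: "x < Suc B" if "x \<in> set (fst f)" for x using f that by (auto simp: Arr Cod)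
    show "Ide \<Delta> B \<cdot>\<^bsub>\<Delta>\<^esub> f = f"
      using f B by (auto simp: Ide Comp Cod prod_eq_iff intro!: map_idI simp del: upt_Suc)
    have "length (fst f) = Suc A" using f by (cases "fst f") (auto simp: Arr Dom)
    then show "f \<cdot>\<^bsub>\<Delta>\<^esub> Ide \<Delta> A = f"
      using f map_nth[of "fst f"] by (simp add: Ide Comp Cod prod_eq_iff del: upt_Suc)
  next
    fix f g A B D assume "f \<in> Hom \<Delta> A B" "g \<in> Hom \<Delta> B D"
    then show "g \<cdot>\<^bsub>\<Delta>\<^esub> f \<in> Hom \<Delta> A D"
      using comp[of f g] by (auto simp: Dom Cod Comp)
  next
    fix f g h A B D F assume "f \<in> Hom \<Delta> A B" "g \<in> Hom \<Delta> B D" "h \<in> Hom \<Delta> D F"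
    then show "(h \<cdot>\<^bsub>\<Delta>\<^esub> g) \<cdot>\<^bsub>\<Delta>\<^esub> f = h \<cdot>\<^bsub>\<Delta>\<^esub> (g \<cdot>\<^bsub>\<Delta>\<^esub> f)"
      using less[of f g] by (auto simp: Comp)
  qed (auto simp: Arr Dom Cod Ide simp del: upt_Suc)
qed

global_interpretation Delta: category \<Delta>
  by (rule category_Delta)

lemma finite_Hom_Delta [simp]: "finite (Hom \<Delta> k n)"
proof -
  have "Hom \<Delta> k n \<subseteq> {xs. set xs \<subseteq> {..n} \<and> length xs = Suc k} \<times> {n}"
    by (auto simp: Hom_def \<Delta>_def)
  moreover have "finite {xs :: nat list. set xs \<subseteq> {..n} \<and> length xs = Suc k}"
    by (rule finite_lists_length_eq) simp
  ultimately show ?thesis by (meson finite_SigmaI finite.intros finite_subset)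
qed

lemma simplex_simps [simp]:
  "fob (simplex n) k = code ` Hom \<Delta> k n"
  "f \<in> Arr \<Delta> \<Longrightarrow> source (far (simplex n) f) = code ` Hom \<Delta> (Cod \<Delta> f) n"
  "f \<in> Arr \<Delta> \<Longrightarrow> target (far (simplex n) f) = code ` Hom \<Delta> (Dom \<Delta> f) n"
  by (simp_all add: simplex_def)

lemma yoneda_simps [simp]:
  "fob yoneda n = simplex n"
  "source (far yoneda g) = simplex (Dom \<Delta> g)" "target (far yoneda g) = simplex (Cod \<Delta> g)"
  "source (component (far yoneda g) k) = code ` Hom \<Delta> k (Dom \<Delta> g)"
  "target (component (far yoneda g) k) = code ` Hom \<Delta> k (Cod \<Delta> g)"
  by (simp_all add: yoneda_def)

context universe
begin

abbreviation sSet where "sSet \<equiv> Simplicial SetU"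

lemma far_simplex_code [simp]:
  "f \<in> Arr \<Delta> \<Longrightarrow> h \<in> Hom \<Delta> (Cod \<Delta> f) n \<Longrightarrow>
   component (far (simplex n :: ('u set, 'u set_map) simplicial) f) (code h) = code (h \<cdot>\<^bsub>\<Delta>\<^esub> f)"
  by (simp add: simplex_def image_iff)

lemma far_yoneda_code [simp]:
  "h \<in> Hom \<Delta> k (Dom \<Delta> g) \<Longrightarrow>
   component (component (far (yoneda :: (_, _, ('u set, 'u set_map) simplicial, _) functor_data) g) k) (code h) = code (g \<cdot>\<^bsub>\<Delta>\<^esub> h)"
  by (simp add: yoneda_def image_iff)

lemma small_simplex [simp]: "small (code ` Hom \<Delta> k n :: 'u set)"
  by (rule small_finite) simp

lemma far_simplex_Arr [simp]: "f \<in> Arr \<Delta> \<Longrightarrow> far (simplex n) f \<in> Arr SetU"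
  unfolding simplex_def by (simp, rule Arr_SetsI) auto

lemma simplex_in_functors: "simplex n \<in> functors (op_cat \<Delta>) SetU"
proof -
  have "is_functor (op_cat \<Delta>) SetU (simplex n)"
    by (rule is_functorI)
       (auto simp: category_op_cat[OF category_Delta] category_Sets intro!: Sets_eqI)
  moreover have "fob (simplex n) \<in> extensional (Obj (op_cat \<Delta>))" "far (simplex n) \<in> extensional (Arr (op_cat \<Delta>))"
    by (simp_all add: simplex_def restrict_functor_def)
  ultimately show ?thesis by (simp add: functors_def)
qed

lemma yoneda_in_nat_transs: "g \<in> Arr \<Delta> \<Longrightarrow> far yoneda g \<in> nat_transs (op_cat \<Delta>) SetU"
proof -
  assume g: "g \<in> Arr \<Delta>"
  have Arr: "component (far yoneda g) k \<in> Arr SetU" for k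
    unfolding yoneda_def by (simp, rule Arr_SetsI) (use g in auto)
  have "(simplex (Dom \<Delta> g), \<lambda>k\<in>Obj (op_cat \<Delta>). component (far yoneda g) k, simplex (Cod \<Delta> g)) \<in> nat_transs (op_cat \<Delta>) SetU"
    by (rule nat_transsI[OF simplex_in_functors simplex_in_functors])
       (use g Arr in \<open>auto intro!: Sets_eqI\<close>)
  moreover have "(simplex (Dom \<Delta> g), \<lambda>k\<in>Obj (op_cat \<Delta>). component (far yoneda g) k, simplex (Cod \<Delta> g)) = (far yoneda g :: ('u set, 'u set_map) simplicial_map)"
    by (simp add: yoneda_def fun_eq_iff)
  ultimately show ?thesis by simp
qed

text \<open>The map that corresponds to the element \<open>x\<close> under the Yoneda lemma: it sends an arrow \<open>f\<close>
  into \<open>m\<close> to the restriction of \<open>x\<close> along \<open>f\<close>.\<close>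

definition classify :: "('u set, 'u set_map) simplicial \<Rightarrow> nat \<Rightarrow> 'u \<Rightarrow> ('u set, 'u set_map) simplicial_map" where
  "classify X m x = (simplex m, \<lambda>k\<in>Obj (op_cat \<Delta>).
     (code ` Hom \<Delta> k m, \<lambda>c\<in>code ` Hom \<Delta> k m. component (far X (decode c)) x, fob X k), X)"

lemma classify_simps [simp]:
  "source (classify X m x) = simplex m" "target (classify X m x) = X"
  "source (component (classify X m x) k) = code ` Hom \<Delta> k m" "target (component (classify X m x) k) = fob X k"
  "f \<in> Hom \<Delta> k m \<Longrightarrow> component (component (classify X m x) k) (code f) = component (far X f) x"
  by (simp_all add: classify_def image_iff)

lemma classify_in_nat_transs:
  assumes X: "X \<in> functors (op_cat \<Delta>) SetU" and x: "x \<in> fob X m"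
  shows "classify X m x \<in> nat_transs (op_cat \<Delta>) SetU"
proof -
  note Xs = functor_simps[OF functorsD[OF X], simplified]
  have far: "component (far X f) y \<in> fob X (Dom \<Delta> f)" if "f \<in> Arr \<Delta>" "y \<in> fob X (Cod \<Delta> f)" for f y
    using Arr_SetsD(3)[of "far X f" y] Xs that by auto
  have Arr: "component (classify X m x) k \<in> Arr SetU" for k
    unfolding classify_def by (simp, rule Arr_SetsI) (use Xs far x in auto)
  have nat: "component (classify X m x) (Dom \<Delta> f) \<cdot>\<^bsub>SetU\<^esub> far (simplex m) f =
      far X f \<cdot>\<^bsub>SetU\<^esub> component (classify X m x) (Cod \<Delta> f)" if f: "f \<in> Arr \<Delta>" for f
  proof (rule Sets_eqI)
    fix c assume "c \<in> source (component (classify X m x) (Dom \<Delta> f) \<cdot>\<^bsub>SetU\<^esub> far (simplex m) f)"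
    then obtain h where h: "c = code h" "h \<in> Arr \<Delta>" "Dom \<Delta> h = Cod \<Delta> f" "Cod \<Delta> h = m" using f by auto
    have "far X (h \<cdot>\<^bsub>\<Delta>\<^esub> f) = far X f \<cdot>\<^bsub>SetU\<^esub> far X h" using f h by (simp add: Xs)
    then show "component (component (classify X m x) (Dom \<Delta> f) \<cdot>\<^bsub>SetU\<^esub> far (simplex m) f) c =
        component (far X f \<cdot>\<^bsub>SetU\<^esub> component (classify X m x) (Cod \<Delta> f)) c"
      using f h x by (simp add: Xs)
  qed (use f Arr in \<open>simp_all add: Xs\<close>)
  have "(simplex m, \<lambda>k\<in>Obj (op_cat \<Delta>). component (classify X m x) k, X) \<in> nat_transs (op_cat \<Delta>) SetU"
    by (rule nat_transsI[OF simplex_in_functors X]) (use Arr nat in simp_all)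
  moreover have "(simplex m, \<lambda>k\<in>Obj (op_cat \<Delta>). component (classify X m x) k, X) = classify X m x"
    by (simp add: classify_def fun_eq_iff)
  ultimately show ?thesis by simp
qed

end


section \<open>Universal families\<close>

context category
begin

definition jointly_epic :: "'i set \<Rightarrow> ('i \<Rightarrow> 'a) \<Rightarrow> 'o \<Rightarrow> bool" where
  "jointly_epic I w A \<longleftrightarrow> (\<forall>i\<in>I. w i \<in> Arr E \<and> Cod E (w i) = A) \<and>
     (\<forall>h h'. h \<in> Arr E \<longrightarrow> h' \<in> Arr E \<longrightarrow> Dom E h = A \<longrightarrow> Dom E h' = A \<longrightarrow> Cod E h = Cod E h' \<longrightarrow>
       (\<forall>i\<in>I. h \<cdot> w i = h' \<cdot> w i) \<longrightarrow> h = h')"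

lemma jointly_epicI:
  assumes "\<And>i. i \<in> I \<Longrightarrow> w i \<in> Arr E" "\<And>i. i \<in> I \<Longrightarrow> Cod E (w i) = A"
    and "\<And>h h' B. h \<in> Hom E A B \<Longrightarrow> h' \<in> Hom E A B \<Longrightarrow> (\<And>i. i \<in> I \<Longrightarrow> h \<cdot> w i = h' \<cdot> w i) \<Longrightarrow> h = h'"
  shows "jointly_epic I w A"
  using assms unfolding jointly_epic_def by simp

lemma jointly_epicD:
  assumes "jointly_epic I w A" "h \<in> Arr E" "h' \<in> Arr E" "Dom E h = A" "Dom E h' = A" "Cod E h = Cod E h'"
    and "\<And>i. i \<in> I \<Longrightarrow> h \<cdot> w i = h' \<cdot> w i"
  shows "h = h'"
  using assms unfolding jointly_epic_def by blast

lemma jointly_epic_arr: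
  "jointly_epic I w A \<Longrightarrow> i \<in> I \<Longrightarrow> w i \<in> Arr E" "jointly_epic I w A \<Longrightarrow> i \<in> I \<Longrightarrow> Cod E (w i) = A"
  unfolding jointly_epic_def by auto

lemma jointly_epic_Comp:
  assumes w: "jointly_epic I w A" and v: "\<And>i. i \<in> I \<Longrightarrow> jointly_epic (K i) (v i) (Dom E (w i))"
  shows "jointly_epic (SIGMA i:I. K i) (\<lambda>(i, k). w i \<cdot> v i k) A"
proof (rule jointly_epicI)
  fix h h' B assume h: "h \<in> Hom E A B" and h': "h' \<in> Hom E A B"
    and eq: "\<And>i. i \<in> (SIGMA i:I. K i) \<Longrightarrow> h \<cdot> (case i of (i, k) \<Rightarrow> w i \<cdot> v i k) = h' \<cdot> (case i of (i, k) \<Rightarrow> w i \<cdot> v i k)"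
  show "h = h'"
  proof (rule jointly_epicD[OF w])
    fix i assume i: "i \<in> I"
    note wi = jointly_epic_arr[OF w i] and vi = jointly_epic_arr[OF v[OF i]]
    show "h \<cdot> w i = h' \<cdot> w i"
    proof (rule jointly_epicD[OF v[OF i]])
      fix k assume k: "k \<in> K i"
      show "(h \<cdot> w i) \<cdot> v i k = (h' \<cdot> w i) \<cdot> v i k"
        using eq[of "(i, k)"] i k h h' wi vi[OF k] by simp
    qed (use h h' wi in auto)
  qed (use h h' in auto)
qed (use jointly_epic_arr[OF w] jointly_epic_arr[OF v] in auto)

lemma jointly_epic_iso:
  assumes w: "jointly_epic I w A" and f: "\<And>i. i \<in> I \<Longrightarrow> is_iso E (f i) \<and> Cod E (f i) = Dom E (w i)"
  shows "jointly_epic I (\<lambda>i. w i \<cdot> f i) A"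
proof (rule jointly_epicI)
  fix h h' B assume h: "h \<in> Hom E A B" and h': "h' \<in> Hom E A B"
    and eq: "\<And>i. i \<in> I \<Longrightarrow> h \<cdot> (w i \<cdot> f i) = h' \<cdot> (w i \<cdot> f i)"
  show "h = h'"
  proof (rule jointly_epicD[OF w])
    fix i assume i: "i \<in> I"
    note wi = jointly_epic_arr[OF w i] and fi = f[OF i] is_iso_Arr[of "f i"]
    show "h \<cdot> w i = h' \<cdot> w i"
      by (rule iso_cancel_right[of "f i"]) (use eq[OF i] h h' wi fi in auto)
  qed (use h h' in auto)
qed (use jointly_epic_arr[OF w] f is_iso_Arr in auto)

text \<open>A family of arrows into \<open>A\<close> that presents \<open>A\<close>: an arrow out of \<open>A\<close> is the same as a family
  of arrows out of the domains that satisfies the given relations \<open>v i \<cdot> x = v j \<cdot> y\<close>.  Coends and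
  coproducts are of this form, and so are their images under functors that preserve them.\<close>

definition universal_family :: "'i set \<Rightarrow> ('i \<Rightarrow> 'a) \<Rightarrow> ('i \<times> 'a \<times> 'i \<times> 'a) set \<Rightarrow> 'o \<Rightarrow> bool" where
  "universal_family I w R A \<longleftrightarrow> A \<in> Obj E \<and> (\<forall>i\<in>I. w i \<in> Arr E \<and> Cod E (w i) = A) \<and>
     (\<forall>i x j y. (i, x, j, y) \<in> R \<longrightarrow> i \<in> I \<and> j \<in> I \<and> x \<in> Arr E \<and> y \<in> Arr E \<and> Dom E x = Dom E y \<and>
        Cod E x = Dom E (w i) \<and> Cod E y = Dom E (w j) \<and> w i \<cdot> x = w j \<cdot> y) \<and>
     (\<forall>B v. B \<in> Obj E \<longrightarrow> (\<forall>i\<in>I. v i \<in> Hom E (Dom E (w i)) B) \<longrightarrow> (\<forall>i x j y. (i, x, j, y) \<in> R \<longrightarrow> v i \<cdot> x = v j \<cdot> y) \<longrightarrow>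
        (\<exists>!h. h \<in> Hom E A B \<and> (\<forall>i\<in>I. h \<cdot> w i = v i)))"

lemma
  assumes "universal_family I w R A"
  shows Obj_universal: "A \<in> Obj E"
    and Arr_universal: "i \<in> I \<Longrightarrow> w i \<in> Arr E" and Cod_universal: "i \<in> I \<Longrightarrow> Cod E (w i) = A"
    and relation_universal: "(i, x, j, y) \<in> R \<Longrightarrow> i \<in> I \<and> j \<in> I \<and> x \<in> Arr E \<and> y \<in> Arr E \<and> Dom E x = Dom E y \<and>
        Cod E x = Dom E (w i) \<and> Cod E y = Dom E (w j) \<and> w i \<cdot> x = w j \<cdot> y"
    and unique_universal: "B \<in> Obj E \<Longrightarrow> (\<And>i. i \<in> I \<Longrightarrow> v i \<in> Hom E (Dom E (w i)) B) \<Longrightarrow>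
        (\<And>i x j y. (i, x, j, y) \<in> R \<Longrightarrow> v i \<cdot> x = v j \<cdot> y) \<Longrightarrow> \<exists>!h. h \<in> Hom E A B \<and> (\<forall>i\<in>I. h \<cdot> w i = v i)"
  using assms unfolding universal_family_def by blast+

lemma universal_familyI:
  assumes "A \<in> Obj E" "\<And>i. i \<in> I \<Longrightarrow> w i \<in> Arr E" "\<And>i. i \<in> I \<Longrightarrow> Cod E (w i) = A"
    and "\<And>i x j y. (i, x, j, y) \<in> R \<Longrightarrow> i \<in> I \<and> j \<in> I \<and> x \<in> Arr E \<and> y \<in> Arr E \<and> Dom E x = Dom E y \<and>
        Cod E x = Dom E (w i) \<and> Cod E y = Dom E (w j) \<and> w i \<cdot> x = w j \<cdot> y"
    and "jointly_epic I w A"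
    and "\<And>B v. B \<in> Obj E \<Longrightarrow> (\<And>i. i \<in> I \<Longrightarrow> v i \<in> Hom E (Dom E (w i)) B) \<Longrightarrow>
        (\<And>i x j y. (i, x, j, y) \<in> R \<Longrightarrow> v i \<cdot> x = v j \<cdot> y) \<Longrightarrow> \<exists>h. h \<in> Hom E A B \<and> (\<forall>i\<in>I. h \<cdot> w i = v i)"
  shows "universal_family I w R A"
proof -
  have "\<exists>!h. h \<in> Hom E A B \<and> (\<forall>i\<in>I. h \<cdot> w i = v i)"
    if "B \<in> Obj E" "\<And>i. i \<in> I \<Longrightarrow> v i \<in> Hom E (Dom E (w i)) B" "\<And>i x j y. (i, x, j, y) \<in> R \<Longrightarrow> v i \<cdot> x = v j \<cdot> y" for B v
  proof (rule ex_ex1I)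
    show "\<exists>h. h \<in> Hom E A B \<and> (\<forall>i\<in>I. h \<cdot> w i = v i)" using assms(6)[OF that] .
    show "h = h'" if "h \<in> Hom E A B \<and> (\<forall>i\<in>I. h \<cdot> w i = v i)" "h' \<in> Hom E A B \<and> (\<forall>i\<in>I. h' \<cdot> w i = v i)" for h h'
      by (rule jointly_epicD[OF assms(5)]) (use that in auto)
  qed
  then show ?thesis using assms(1-4) unfolding universal_family_def by simp
qed

lemma universal_family_jointly_epic:
  assumes u: "universal_family I w R A" shows "jointly_epic I w A"
proof (rule jointly_epicI)
  fix h h' B assume h: "h \<in> Hom E A B" and h': "h' \<in> Hom E A B" and eq: "\<And>i. i \<in> I \<Longrightarrow> h \<cdot> w i = h' \<cdot> w i"
  note wi = Arr_universal[OF u] Cod_universal[OF u]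
  have rel: "(h \<cdot> w i) \<cdot> x = (h \<cdot> w j) \<cdot> y" if "(i, x, j, y) \<in> R" for i x j y
    using relation_universal[OF u that] h wi by simp
  have "\<exists>!k. k \<in> Hom E A B \<and> (\<forall>i\<in>I. k \<cdot> w i = h \<cdot> w i)"
    by (rule unique_universal[OF u]) (use h wi rel in auto)
  moreover have "h \<in> Hom E A B \<and> (\<forall>i\<in>I. h \<cdot> w i = h \<cdot> w i)" using h by blast
  moreover have "h' \<in> Hom E A B \<and> (\<forall>i\<in>I. h' \<cdot> w i = h \<cdot> w i)" using h' eq by simp
  ultimately show "h = h'" by blast
qed (use u in \<open>auto simp: Arr_universal Cod_universal\<close>)

lemma universal_desc:
  assumes u: "universal_family I w R A" and "B \<in> Obj E" "\<And>i. i \<in> I \<Longrightarrow> v i \<in> Hom E (Dom E (w i)) B"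
    "\<And>i x j y. (i, x, j, y) \<in> R \<Longrightarrow> v i \<cdot> x = v j \<cdot> y"
  obtains h where "h \<in> Hom E A B" "\<And>i. i \<in> I \<Longrightarrow> h \<cdot> w i = v i"
  using unique_universal[OF assms] by blast

text \<open>Each presentation satisfies the hypotheses of the universal property of the other one, which
  yields the inverse.\<close>

lemma universal_comparison_iso:
  assumes u: "universal_family I w R A" and u': "universal_family I w' R A'"
    and d: "\<And>i. i \<in> I \<Longrightarrow> Dom E (w' i) = Dom E (w i)"
    and h: "h \<in> Hom E A A'" and hw: "\<And>i. i \<in> I \<Longrightarrow> h \<cdot> w i = w' i"
  shows "is_iso E h"
proof -
  obtain k where k: "k \<in> Hom E A' A" and kw: "\<And>i. i \<in> I \<Longrightarrow> k \<cdot> w' i = w i"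
    by (rule universal_desc[OF u' Obj_universal[OF u], of w])
       (use d relation_universal[OF u] in \<open>auto simp: Arr_universal[OF u] Cod_universal[OF u]\<close>)
  note a = Arr_universal[OF u] Cod_universal[OF u] Arr_universal[OF u'] Cod_universal[OF u'] Obj_universal[OF u] Obj_universal[OF u']
  show ?thesis
  proof (rule is_isoI[OF h k])
    show "k \<cdot> h = \<i> A"
      by (rule jointly_epicD[OF universal_family_jointly_epic[OF u]]) (use h k hw kw a in auto)
    show "h \<cdot> k = \<i> A'"
      by (rule jointly_epicD[OF universal_family_jointly_epic[OF u']]) (use h k hw kw a in auto)
  qed
qed

end

locale closed_symmetric_monoidal_category = symmetric_monoidal_category +
  assumes closed: "monoidal_closed E"
begin

text \<open>The right adjoint of tensoring with \<open>D\<close>, in the form of transposition along an evaluation.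
  It is the reason why tensoring preserves presentations.\<close>

lemma transpose:
  assumes "B \<in> Obj E" "D \<in> Obj E"
  obtains H ev where "H \<in> Obj E" "ev \<in> Hom E (H \<otimes> D) B"
    and "\<And>A f. A \<in> Obj E \<Longrightarrow> f \<in> Hom E (A \<otimes> D) B \<Longrightarrow> \<exists>g. g \<in> Hom E A H \<and> ev \<cdot> (g \<odot> \<i> D) = f"
    and "\<And>A g g'. g \<in> Hom E A H \<Longrightarrow> g' \<in> Hom E A H \<Longrightarrow> ev \<cdot> (g \<odot> \<i> D) = ev \<cdot> (g' \<odot> \<i> D) \<Longrightarrow> g = g'"
proof -
  obtain H ev where H: "H \<in> Obj E" and ev: "ev \<in> Hom E (H \<otimes> D) B"
    and tr: "\<forall>A\<in>Obj E. \<forall>f\<in>Hom E (A \<otimes> D) B. \<exists>!g. g \<in> Hom E A H \<and> ev \<cdot> (g \<odot> \<i> D) = f"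
    using closed assms unfolding monoidal_closed_def by blast
  show thesis
  proof (rule that[OF H ev])
    show "\<exists>g. g \<in> Hom E A H \<and> ev \<cdot> (g \<odot> \<i> D) = f" if "A \<in> Obj E" "f \<in> Hom E (A \<otimes> D) B" for A f
      using tr that by blast
    show "g = g'" if g: "g \<in> Hom E A H" and g': "g' \<in> Hom E A H" and e: "ev \<cdot> (g \<odot> \<i> D) = ev \<cdot> (g' \<odot> \<i> D)" for A g g'
    proof -
      have "A \<in> Obj E" "ev \<cdot> (g' \<odot> \<i> D) \<in> Hom E (A \<otimes> D) B" using g' ev assms by auto
      then have "\<exists>!k. k \<in> Hom E A H \<and> ev \<cdot> (k \<odot> \<i> D) = ev \<cdot> (g' \<odot> \<i> D)" using tr by blast
      then show ?thesis using g g' e by blast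
    qed
  qed
qed

lemma jointly_epic_tens_right:
  assumes w: "jointly_epic I w A" and A: "A \<in> Obj E" and D[simp]: "D \<in> Obj E"
  shows "jointly_epic I (\<lambda>i. w i \<odot> \<i> D) (A \<otimes> D)"
proof (rule jointly_epicI)
  fix h h' B assume h: "h \<in> Hom E (A \<otimes> D) B" and h': "h' \<in> Hom E (A \<otimes> D) B"
    and eq: "\<And>i. i \<in> I \<Longrightarrow> h \<cdot> (w i \<odot> \<i> D) = h' \<cdot> (w i \<odot> \<i> D)"
  have "B \<in> Obj E" using h by auto
  then obtain H ev where H: "H \<in> Obj E" and ev: "ev \<in> Hom E (H \<otimes> D) B"
    and tr: "\<And>A f. A \<in> Obj E \<Longrightarrow> f \<in> Hom E (A \<otimes> D) B \<Longrightarrow> \<exists>g. g \<in> Hom E A H \<and> ev \<cdot> (g \<odot> \<i> D) = f"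
    and uniq: "\<And>A g g'. g \<in> Hom E A H \<Longrightarrow> g' \<in> Hom E A H \<Longrightarrow> ev \<cdot> (g \<odot> \<i> D) = ev \<cdot> (g' \<odot> \<i> D) \<Longrightarrow> g = g'"
    using transpose[OF _ D] by blast
  obtain g where g: "g \<in> Hom E A H" "ev \<cdot> (g \<odot> \<i> D) = h" using tr[OF A h] by blast
  obtain g' where g': "g' \<in> Hom E A H" "ev \<cdot> (g' \<odot> \<i> D) = h'" using tr[OF A h'] by blast
  have "g = g'"
  proof (rule jointly_epicD[OF w])
    fix i assume i: "i \<in> I"
    note wi = jointly_epic_arr[OF w i]
    have e: "ev \<cdot> ((g \<cdot> w i) \<odot> \<i> D) = ev \<cdot> ((g' \<cdot> w i) \<odot> \<i> D)"
    proof -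
      have "ev \<cdot> ((g \<cdot> w i) \<odot> \<i> D) = (ev \<cdot> (g \<odot> \<i> D)) \<cdot> (w i \<odot> \<i> D)" using g(1) ev wi H by simp
      also have "\<dots> = (ev \<cdot> (g' \<odot> \<i> D)) \<cdot> (w i \<odot> \<i> D)" unfolding g(2) g'(2) by (rule eq[OF i])
      also have "\<dots> = ev \<cdot> ((g' \<cdot> w i) \<odot> \<i> D)" using g'(1) ev wi H by simp
      finally show ?thesis .
    qed
    show "g \<cdot> w i = g' \<cdot> w i"
      by (rule uniq[OF _ _ e]) (use g(1) g'(1) wi in auto)
  qed (use g g' in auto)
  then show "h = h'" using g g' by simp
qed (use jointly_epic_arr[OF w] in auto)

lemma jointly_epic_tens_left:
  assumes w: "jointly_epic I w A" and A[simp]: "A \<in> Obj E" and D[simp]: "D \<in> Obj E"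
  shows "jointly_epic I (\<lambda>i. \<i> D \<odot> w i) (D \<otimes> A)"
proof (rule jointly_epicI)
  fix h h' B assume h: "h \<in> Hom E (D \<otimes> A) B" and h': "h' \<in> Hom E (D \<otimes> A) B"
    and eq: "\<And>i. i \<in> I \<Longrightarrow> h \<cdot> (\<i> D \<odot> w i) = h' \<cdot> (\<i> D \<odot> w i)"
  have "h \<cdot> \<s> A D = h' \<cdot> \<s> A D"
  proof (rule jointly_epicD[OF jointly_epic_tens_right[OF w A D]])
    fix i assume i: "i \<in> I"
    note wi = jointly_epic_arr[OF w i]
    show "(h \<cdot> \<s> A D) \<cdot> (w i \<odot> \<i> D) = (h' \<cdot> \<s> A D) \<cdot> (w i \<odot> \<i> D)"
      using wi h h' reassoc[OF eq[OF i]] by (simp add: swap_natural)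
  qed (use h h' in auto)
  then show "h = h'" by (rule iso_cancel_right[rotated 5]) (use h h' in auto)
qed (use jointly_epic_arr[OF w] in auto)

lemma jointly_epic_tens:
  assumes w: "jointly_epic I w A" and v: "jointly_epic K v B" and [simp]: "A \<in> Obj E" "B \<in> Obj E"
  shows "jointly_epic (I \<times> K) (\<lambda>(i, k). w i \<odot> v k) (A \<otimes> B)"
proof -
  have "jointly_epic (SIGMA i:I. K) (\<lambda>(i, k). (w i \<odot> \<i> B) \<cdot> (\<i> (Dom E (w i)) \<odot> v k)) (A \<otimes> B)"
    by (rule jointly_epic_Comp[OF jointly_epic_tens_right[OF w]])
       (use jointly_epic_arr[OF w] in \<open>auto intro!: jointly_epic_tens_left[OF v]\<close>)
  then show ?thesis
    using jointly_epic_arr[OF w] jointly_epic_arr[OF v] unfolding jointly_epic_def by fastforce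
qed

text \<open>A family that satisfies the tensored relations transposes to one that satisfies the given
  relations; the transpose of the arrow that it induces is the required factorisation.\<close>

lemma universal_family_tens_right:
  assumes u: "universal_family I w R A" and D[simp]: "D \<in> Obj E"
  shows "universal_family I (\<lambda>i. w i \<odot> \<i> D) ((\<lambda>(i, x, j, y). (i, x \<odot> \<i> D, j, y \<odot> \<i> D)) ` R) (A \<otimes> D)"
proof (rule universal_familyI)
  note wi = Arr_universal[OF u] Cod_universal[OF u] and rel = relation_universal[OF u] and A = Obj_universal[OF u]
  show "jointly_epic I (\<lambda>i. w i \<odot> \<i> D) (A \<otimes> D)"
    by (rule jointly_epic_tens_right[OF universal_family_jointly_epic[OF u] A D])
  fix B v assume B: "B \<in> Obj E" and v: "\<And>i. i \<in> I \<Longrightarrow> v i \<in> Hom E (Dom E (w i \<odot> \<i> D)) B"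
    and vrel: "\<And>i x j y. (i, x, j, y) \<in> (\<lambda>(i, x, j, y). (i, x \<odot> \<i> D, j, y \<odot> \<i> D)) ` R \<Longrightarrow> v i \<cdot> x = v j \<cdot> y"
  obtain H ev where H: "H \<in> Obj E" and ev: "ev \<in> Hom E (H \<otimes> D) B"
    and tr: "\<And>A f. A \<in> Obj E \<Longrightarrow> f \<in> Hom E (A \<otimes> D) B \<Longrightarrow> \<exists>g. g \<in> Hom E A H \<and> ev \<cdot> (g \<odot> \<i> D) = f"
    and uniq: "\<And>A g g'. g \<in> Hom E A H \<Longrightarrow> g' \<in> Hom E A H \<Longrightarrow> ev \<cdot> (g \<odot> \<i> D) = ev \<cdot> (g' \<odot> \<i> D) \<Longrightarrow> g = g'"
    using transpose[OF B D] by blast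
  have "\<exists>g. g \<in> Hom E (Dom E (w i)) H \<and> ev \<cdot> (g \<odot> \<i> D) = v i" if i: "i \<in> I" for i
    using tr[of "Dom E (w i)" "v i"] v[OF i] wi[OF i] by auto
  then obtain g where g: "\<And>i. i \<in> I \<Longrightarrow> g i \<in> Hom E (Dom E (w i)) H" and evg: "\<And>i. i \<in> I \<Longrightarrow> ev \<cdot> (g i \<odot> \<i> D) = v i"
    by metis
  have grel: "g i \<cdot> x = g j \<cdot> y" if r: "(i, x, j, y) \<in> R" for i x j y
  proof -
    note rr = rel[OF r]
    have "ev \<cdot> ((g i \<cdot> x) \<odot> \<i> D) = (ev \<cdot> (g i \<odot> \<i> D)) \<cdot> (x \<odot> \<i> D)" using g[of i] ev rr H by auto
    also have "\<dots> = (ev \<cdot> (g j \<odot> \<i> D)) \<cdot> (y \<odot> \<i> D)" using evg[of i] evg[of j] rr vrel[of i "x \<odot> \<i> D" j "y \<odot> \<i> D"] r by force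
    also have "\<dots> = ev \<cdot> ((g j \<cdot> y) \<odot> \<i> D)" using g[of j] ev rr H by auto
    finally have e: "ev \<cdot> ((g i \<cdot> x) \<odot> \<i> D) = ev \<cdot> ((g j \<cdot> y) \<odot> \<i> D)" .
    show ?thesis
      by (rule uniq[OF _ _ e]) (use g[of i] g[of j] rr in auto)
  qed
  obtain k where k: "k \<in> Hom E A H" and kw: "\<And>i. i \<in> I \<Longrightarrow> k \<cdot> w i = g i"
    using universal_desc[OF u H g grel] by blast
  have "(ev \<cdot> (k \<odot> \<i> D)) \<cdot> (w i \<odot> \<i> D) = v i" if i: "i \<in> I" for i
    using k kw[OF i] evg[OF i] ev wi[OF i] by simp
  then show "\<exists>h. h \<in> Hom E (A \<otimes> D) B \<and> (\<forall>i\<in>I. h \<cdot> (w i \<odot> \<i> D) = v i)"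
    using k ev by (intro exI[of _ "ev \<cdot> (k \<odot> \<i> D)"]) auto
next
  fix i x j y assume "(i, x, j, y) \<in> (\<lambda>(i, x, j, y). (i, x \<odot> \<i> D, j, y \<odot> \<i> D)) ` R"
  then obtain x' y' where r: "(i, x', j, y') \<in> R" and xy: "x = x' \<odot> \<i> D" "y = y' \<odot> \<i> D" by auto
  note rr = relation_universal[OF u r]
  show "i \<in> I \<and> j \<in> I \<and> x \<in> Arr E \<and> y \<in> Arr E \<and> Dom E x = Dom E y \<and>
        Cod E x = Dom E (w i \<odot> \<i> D) \<and> Cod E y = Dom E (w j \<odot> \<i> D) \<and> (w i \<odot> \<i> D) \<cdot> x = (w j \<odot> \<i> D) \<cdot> y"
    using rr Arr_universal[OF u, of i] Arr_universal[OF u, of j] xy by auto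
qed (auto simp: Arr_universal[OF u] Cod_universal[OF u] Obj_universal[OF u])

lemma universal_family_tens_left:
  assumes u: "universal_family I w R A" and D[simp]: "D \<in> Obj E"
  shows "universal_family I (\<lambda>i. \<i> D \<odot> w i) ((\<lambda>(i, x, j, y). (i, \<i> D \<odot> x, j, \<i> D \<odot> y)) ` R) (D \<otimes> A)"
proof (rule universal_familyI)
  note wi = Arr_universal[OF u] Cod_universal[OF u] and rel = relation_universal[OF u] and A[simp] = Obj_universal[OF u]
  show "jointly_epic I (\<lambda>i. \<i> D \<odot> w i) (D \<otimes> A)"
    by (rule jointly_epic_tens_left[OF universal_family_jointly_epic[OF u] A D])
  fix B v assume B: "B \<in> Obj E" and v: "\<And>i. i \<in> I \<Longrightarrow> v i \<in> Hom E (Dom E (\<i> D \<odot> w i)) B"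
    and vrel: "\<And>i x j y. (i, x, j, y) \<in> (\<lambda>(i, x, j, y). (i, \<i> D \<odot> x, j, \<i> D \<odot> y)) ` R \<Longrightarrow> v i \<cdot> x = v j \<cdot> y"
  have v': "v i \<in> Hom E (D \<otimes> Dom E (w i)) B" if "i \<in> I" for i using v[OF that] wi[OF that] by simp
  obtain h where h: "h \<in> Hom E (A \<otimes> D) B" and hw: "\<And>i. i \<in> I \<Longrightarrow> h \<cdot> (w i \<odot> \<i> D) = v i \<cdot> \<s> (Dom E (w i)) D"
  proof (rule universal_desc[OF universal_family_tens_right[OF u D] B, of "\<lambda>i. v i \<cdot> \<s> (Dom E (w i)) D"])
    fix i x j y assume "(i, x, j, y) \<in> (\<lambda>(i, x, j, y). (i, x \<odot> \<i> D, j, y \<odot> \<i> D)) ` R"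
    then obtain x' y' where r: "(i, x', j, y') \<in> R" and xy: "x = x' \<odot> \<i> D" "y = y' \<odot> \<i> D" by auto
    note rr = rel[OF r]
    have e: "v i \<cdot> (\<i> D \<odot> x') = v j \<cdot> (\<i> D \<odot> y')" using vrel r by force
    have "(v i \<cdot> \<s> (Dom E (w i)) D) \<cdot> x = (v i \<cdot> (\<i> D \<odot> x')) \<cdot> \<s> (Dom E x') D"
      using rr v'[of i] wi[of i] xy by (simp add: swap_natural)
    also have "\<dots> = (v j \<cdot> \<s> (Dom E (w j)) D) \<cdot> y"
      unfolding e using rr v'[of j] wi[of j] xy by (simp add: swap_natural)
    finally show "(v i \<cdot> \<s> (Dom E (w i)) D) \<cdot> x = (v j \<cdot> \<s> (Dom E (w j)) D) \<cdot> y" .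
  qed (use v' wi in auto)
  have "(h \<cdot> \<s> D A) \<cdot> (\<i> D \<odot> w i) = v i" if i: "i \<in> I" for i
    using h v'[OF i] wi[OF i] by (simp add: swap_natural reassoc[OF hw[OF i]])
  then show "\<exists>h. h \<in> Hom E (D \<otimes> A) B \<and> (\<forall>i\<in>I. h \<cdot> (\<i> D \<odot> w i) = v i)"
    using h by (intro exI[of _ "h \<cdot> \<s> D A"]) auto
next
  fix i x j y assume "(i, x, j, y) \<in> (\<lambda>(i, x, j, y). (i, \<i> D \<odot> x, j, \<i> D \<odot> y)) ` R"
  then obtain x' y' where r: "(i, x', j, y') \<in> R" and xy: "x = \<i> D \<odot> x'" "y = \<i> D \<odot> y'" by auto
  note rr = relation_universal[OF u r]
  show "i \<in> I \<and> j \<in> I \<and> x \<in> Arr E \<and> y \<in> Arr E \<and> Dom E x = Dom E y \<and>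
        Cod E x = Dom E (\<i> D \<odot> w i) \<and> Cod E y = Dom E (\<i> D \<odot> w j) \<and> (\<i> D \<odot> w i) \<cdot> x = (\<i> D \<odot> w j) \<cdot> y"
    using rr Arr_universal[OF u, of i] Arr_universal[OF u, of j] xy by auto
qed (auto simp: Arr_universal[OF u] Cod_universal[OF u] Obj_universal[OF u])

text \<open>In two variables the relations of each variable separately suffice: factor through the first
  presentation with the second variable fixed, and then through the second one.\<close>

lemma tens_desc:
  assumes u: "universal_family I w R A" and u': "universal_family K v Q D" and B: "B \<in> Obj E"
    and t: "\<And>i k. i \<in> I \<Longrightarrow> k \<in> K \<Longrightarrow> t i k \<in> Hom E (Dom E (w i) \<otimes> Dom E (v k)) B"
    and R: "\<And>i x j y k. (i, x, j, y) \<in> R \<Longrightarrow> k \<in> K \<Longrightarrow> t i k \<cdot> (x \<odot> \<i> (Dom E (v k))) = t j k \<cdot> (y \<odot> \<i> (Dom E (v k)))"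
    and Q: "\<And>k x l y i. (k, x, l, y) \<in> Q \<Longrightarrow> i \<in> I \<Longrightarrow> t i k \<cdot> (\<i> (Dom E (w i)) \<odot> x) = t i l \<cdot> (\<i> (Dom E (w i)) \<odot> y)"
  obtains h where "h \<in> Hom E (A \<otimes> D) B" "\<And>i k. i \<in> I \<Longrightarrow> k \<in> K \<Longrightarrow> h \<cdot> (w i \<odot> v k) = t i k"
proof -
  note wi = Arr_universal[OF u] Cod_universal[OF u] and A[simp] = Obj_universal[OF u]
    and vi = Arr_universal[OF u'] Cod_universal[OF u'] and D[simp] = Obj_universal[OF u']
  have "\<exists>h. h \<in> Hom E (A \<otimes> Dom E (v k)) B \<and> (\<forall>i\<in>I. h \<cdot> (w i \<odot> \<i> (Dom E (v k))) = t i k)" if k: "k \<in> K" for k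
  proof -
    have Dk: "Dom E (v k) \<in> Obj E" using vi[OF k] by simp
    show ?thesis
      by (rule universal_desc[OF universal_family_tens_right[OF u Dk] B, of "\<lambda>i. t i k"])
         (use t[OF _ k] wi Dk R[OF _ k] in auto)
  qed
  then obtain h where h: "\<And>k. k \<in> K \<Longrightarrow> h k \<in> Hom E (A \<otimes> Dom E (v k)) B"
    and hw: "\<And>i k. i \<in> I \<Longrightarrow> k \<in> K \<Longrightarrow> h k \<cdot> (w i \<odot> \<i> (Dom E (v k))) = t i k" by metis
  have rel: "h k \<cdot> (\<i> A \<odot> x) = h l \<cdot> (\<i> A \<odot> y)" if q: "(k, x, l, y) \<in> Q" for k x l y
  proof -
    note rr = relation_universal[OF u' q]
    show ?thesis
    proof (rule jointly_epicD[OF jointly_epic_tens_right[OF universal_family_jointly_epic[OF u] A, of "Dom E x"]])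
      fix i assume i: "i \<in> I"
      have "(h k \<cdot> (\<i> A \<odot> x)) \<cdot> (w i \<odot> \<i> (Dom E x)) = (h k \<cdot> (w i \<odot> \<i> (Dom E (v k)))) \<cdot> (\<i> (Dom E (w i)) \<odot> x)"
        using h[of k] rr wi[OF i] vi[of k] by simp
      also have "\<dots> = (h l \<cdot> (w i \<odot> \<i> (Dom E (v l)))) \<cdot> (\<i> (Dom E (w i)) \<odot> y)"
        using hw[OF i, of k] hw[OF i, of l] rr Q[OF q i] by simp
      also have "\<dots> = (h l \<cdot> (\<i> A \<odot> y)) \<cdot> (w i \<odot> \<i> (Dom E x))"
        using h[of l] rr wi[OF i] vi[of l] by simp
      finally show "(h k \<cdot> (\<i> A \<odot> x)) \<cdot> (w i \<odot> \<i> (Dom E x)) = (h l \<cdot> (\<i> A \<odot> y)) \<cdot> (w i \<odot> \<i> (Dom E x))" .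
    qed (use h[of k] h[of l] rr in auto)
  qed
  obtain g where g: "g \<in> Hom E (A \<otimes> D) B" and gv: "\<And>k. k \<in> K \<Longrightarrow> g \<cdot> (\<i> A \<odot> v k) = h k"
    by (rule universal_desc[OF universal_family_tens_left[OF u' A] B, of h]) (use h vi rel in auto)
  have "g \<cdot> (w i \<odot> v k) = t i k" if i: "i \<in> I" and k: "k \<in> K" for i k
  proof -
    have "g \<cdot> (w i \<odot> v k) = (g \<cdot> (\<i> A \<odot> v k)) \<cdot> (w i \<odot> \<i> (Dom E (v k)))"
      using g wi[OF i] vi[OF k] by simp
    then show ?thesis unfolding gv[OF k] by (simp add: hw[OF i k])
  qed
  then show thesis using that g by blast
qed

end


section \<open>Coends and copowers of the unit\<close>

lemma all_Hom: "(\<forall>i j. \<forall>f\<in>Hom J i j. P i j f) \<longleftrightarrow> (\<forall>f\<in>Arr J. P (Dom J f) (Cod J f) f)"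
  by auto

context symmetric_monoidal_category
begin

text \<open>The dinaturality relations; the two sides for \<open>f\<close> start at
  \<open>X (Cod f) \<otimes> Z (Dom f)\<close>.\<close>

definition coend_relations ::
  "('i, 'j, 'y) cat_scheme \<Rightarrow> ('i, 'j, 'o, 'a) functor_data \<Rightarrow> ('i, 'j, 'o, 'a) functor_data \<Rightarrow> ('i \<times> 'a \<times> 'i \<times> 'a) set" where
  "coend_relations J X Z =
     (\<lambda>f. (Dom J f, far X f \<odot> \<i> (fob Z (Dom J f)), Cod J f, \<i> (fob X (Cod J f)) \<odot> far Z f)) ` Arr J"

lemma is_wedge_iff:
  assumes X: "is_functor (op_cat J) E X" and Z: "is_functor J E Z"
  shows "is_wedge J E (external_tensor E X Z) B v \<longleftrightarrow> B \<in> Obj E \<and>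
    (\<forall>i\<in>Obj J. v i \<in> Hom E (fob X i \<otimes> fob Z i) B) \<and>
    (\<forall>f\<in>Arr J. v (Dom J f) \<cdot> (far X f \<odot> \<i> (fob Z (Dom J f))) = v (Cod J f) \<cdot> (\<i> (fob X (Cod J f)) \<odot> far Z f))"
proof -
  interpret J: category J by (rule functor_category_left[OF Z])
  show ?thesis
    unfolding is_wedge_def all_Hom using Ide_functor[OF X] Ide_functor[OF Z] by (simp add: external_tensor_def)
qed

lemma is_coend_iff:
  assumes X: "is_functor (op_cat J) E X" and Z: "is_functor J E Z"
  shows "is_coend J E (external_tensor E X Z) A w \<longleftrightarrow>
    (\<forall>i\<in>Obj J. Dom E (w i) = fob X i \<otimes> fob Z i) \<and> universal_family (Obj J) w (coend_relations J X Z) A"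
    (is "?l \<longleftrightarrow> ?d \<and> ?u")
proof -
  interpret J: category J by (rule functor_category_left[OF Z])
  note simps = functor_simps[OF X, simplified] functor_simps[OF Z]
  have rel: "(i, x, j, y) \<in> coend_relations J X Z \<longleftrightarrow> (\<exists>f\<in>Arr J. i = Dom J f \<and> j = Cod J f \<and>
     x = far X f \<odot> \<i> (fob Z (Dom J f)) \<and> y = \<i> (fob X (Cod J f)) \<odot> far Z f)" for i x j y
    by (auto simp: coend_relations_def)
  have wedge: "is_wedge J E (external_tensor E X Z) B v \<longleftrightarrow> B \<in> Obj E \<and> (\<forall>i\<in>Obj J. v i \<in> Hom E (Dom E (w i)) B) \<and>
      (\<forall>i x j y. (i, x, j, y) \<in> coend_relations J X Z \<longrightarrow> v i \<cdot> x = v j \<cdot> y)" if ?d for B v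
  proof -
    have "(\<forall>i x j y. (i, x, j, y) \<in> coend_relations J X Z \<longrightarrow> v i \<cdot> x = v j \<cdot> y) \<longleftrightarrow>
      (\<forall>f\<in>Arr J. v (Dom J f) \<cdot> (far X f \<odot> \<i> (fob Z (Dom J f))) = v (Cod J f) \<cdot> (\<i> (fob X (Cod J f)) \<odot> far Z f))"
      unfolding rel by blast
    then show ?thesis unfolding is_wedge_iff[OF X Z] using that by simp
  qed
  show ?thesis
  proof
    assume l: ?l
    then have w: "is_wedge J E (external_tensor E X Z) A w" by (simp add: is_coend_def)
    then have d: ?d by (simp add: is_wedge_iff[OF X Z])
    have "universal_family (Obj J) w (coend_relations J X Z) A"
      unfolding universal_family_def
    proof (intro conjI allI impI)
      show "A \<in> Obj E" "\<forall>i\<in>Obj J. w i \<in> Arr E \<and> Cod E (w i) = A" using w by (auto simp: is_wedge_iff[OF X Z])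
    next
      fix i x j y assume r: "(i, x, j, y) \<in> coend_relations J X Z"
      then obtain f where f: "f \<in> Arr J" "i = Dom J f" "j = Cod J f"
        "x = far X f \<odot> \<i> (fob Z (Dom J f))" "y = \<i> (fob X (Cod J f)) \<odot> far Z f" by (auto simp: rel)
      show "w i \<cdot> x = w j \<cdot> y" using w r unfolding wedge[OF d] by blast
      show "i \<in> Obj J" "j \<in> Obj J" "x \<in> Arr E" "y \<in> Arr E" "Dom E x = Dom E y"
        "Cod E x = Dom E (w i)" "Cod E y = Dom E (w j)" using f d by (simp_all add: simps)
    next
      fix B v assume "B \<in> Obj E" "\<forall>i\<in>Obj J. v i \<in> Hom E (Dom E (w i)) B"
        "\<forall>i x j y. (i, x, j, y) \<in> coend_relations J X Z \<longrightarrow> v i \<cdot> x = v j \<cdot> y"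
      then have "is_wedge J E (external_tensor E X Z) B v" unfolding wedge[OF d] by blast
      then show "\<exists>!h. h \<in> Hom E A B \<and> (\<forall>i\<in>Obj J. h \<cdot> w i = v i)" using l by (simp add: is_coend_def)
    qed
    then show "?d \<and> ?u" using d by blast
  next
    assume du: "?d \<and> ?u"
    then have d: ?d and u: ?u by blast+
    show ?l unfolding is_coend_def
    proof (intro conjI allI impI)
      show "is_wedge J E (external_tensor E X Z) A w"
        unfolding wedge[OF d] using Arr_universal[OF u] Cod_universal[OF u] Obj_universal[OF u] relation_universal[OF u] by auto
      fix B v assume "is_wedge J E (external_tensor E X Z) B v"
      then show "\<exists>!h. h \<in> Hom E A B \<and> (\<forall>i\<in>Obj J. h \<cdot> w i = v i)"
        unfolding wedge[OF d] using unique_universal[OF u, of B v] by blast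
    qed
  qed
qed

lemma desc_eqI:
  assumes "\<exists>!h. h \<in> Hom E A B \<and> (\<forall>i\<in>I. h \<cdot> w i = v i)"
  shows "(THE h. h \<in> Hom E A B \<and> (\<forall>i\<in>I. h \<cdot> w i = v i)) \<in> Hom E A B"
    and "i \<in> I \<Longrightarrow> (THE h. h \<in> Hom E A B \<and> (\<forall>i\<in>I. h \<cdot> w i = v i)) \<cdot> w i = v i"
  using theI'[OF assms] by auto

end

text \<open>The subdivision of an index category, which turns coends into colimits: it has an object for
  every object and for every arrow of \<open>J\<close>, and an arrow \<open>f\<close> of \<open>J\<close> maps to its two ends.\<close>

definition subdivision :: "('i, 'j, 'y) cat_scheme \<Rightarrow> ('i + 'j, ('i + 'j) + ('j \<times> bool)) cat" where
  "subdivision J = \<lparr>Obj = Inl ` Obj J \<union> Inr ` Arr J,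
     Arr = Inl ` (Inl ` Obj J \<union> Inr ` Arr J) \<union> Inr ` (Arr J \<times> UNIV),
     Dom = (\<lambda>x. case x of Inl i \<Rightarrow> i | Inr (f, b) \<Rightarrow> Inr f),
     Cod = (\<lambda>x. case x of Inl i \<Rightarrow> i | Inr (f, b) \<Rightarrow> Inl (if b then Dom J f else Cod J f)),
     Ide = Inl, Comp = (\<lambda>g f. case g of Inl i \<Rightarrow> f | Inr x \<Rightarrow> g)\<rparr>"

lemma category_subdivision: "category J \<Longrightarrow> category (subdivision J)"
proof -
  assume "category J" then interpret J: category J .
  show ?thesis by unfold_locales (auto simp: subdivision_def)
qed

locale cocomplete_category = universe U + symmetric_monoidal_category E
  for U :: "'u itself" and E :: "('o, 'a, 'z) smcat_scheme" (structure) +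
  assumes cocomplete: "cocomplete U E"
begin

text \<open>Cocompleteness is about index categories inside the universe; a countable category is moved
  there along \<open>code\<close>.\<close>

lemma countable_colimit:
  fixes J :: "('x :: countable, 'y :: countable, 'w) cat_scheme"
  assumes F: "is_functor J E F"
  shows "\<exists>A w. is_colimit J E F A w"
proof -
  interpret J: category J by (rule functor_category_left[OF F])
  define J' :: "('u, 'u) cat" where "J' = \<lparr>Obj = code ` Obj J, Arr = code ` Arr J,
    Dom = (\<lambda>f. code (Dom J (decode f))), Cod = (\<lambda>f. code (Cod J (decode f))),
    Ide = (\<lambda>i. code (Ide J (decode i))), Comp = (\<lambda>g f. code (decode g \<cdot>\<^bsub>J\<^esub> decode f))\<rparr>"
  define F' :: "('u, 'u, 'o, 'a) functor_data" where "F' = \<lparr>fob = (\<lambda>i. fob F (decode i)), far = (\<lambda>f. far F (decode f))\<rparr>"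
  have "category J'" by unfold_locales (auto simp: J'_def)
  then have F': "is_functor J' E F'"
    by (intro is_functorI) (auto simp: J'_def F'_def functor_simps[OF F] category_axioms)
  have small: "small (code ` S :: 'u set)" for S :: "'v :: countable set"
  proof (rule small_lepoll_nat)
    have "S \<lesssim> (UNIV :: nat set)" unfolding lepoll_def using inj_to_nat by (auto intro: inj_on_subset)
    then show "code ` S \<lesssim> (UNIV :: nat set)" using image_lepoll lepoll_trans by blast
  qed
  then obtain A w where w: "is_colimit J' E F' A w"
    using cocomplete[unfolded cocomplete_def, rule_format, of J' F'] F' small by (auto simp: J'_def)
  have to': "is_cocone J' E F' B (\<lambda>i. v (decode i))" if "is_cocone J E F B v" for B v
    using that unfolding is_cocone_def all_Hom by (auto simp: J'_def F'_def)
  have from': "is_cocone J E F B (\<lambda>i. v (code i))" if "is_cocone J' E F' B v" for B v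
    using that unfolding is_cocone_def all_Hom by (auto simp: J'_def F'_def)
  have "is_colimit J E F A (\<lambda>i. w (code i))"
    unfolding is_colimit_def
  proof (intro conjI allI impI)
    show "is_cocone J E F A (\<lambda>i. w (code i))" using from' w by (simp add: is_colimit_def)
    fix B v assume "is_cocone J E F B v"
    then have "\<exists>!h. h \<in> Hom E A B \<and> (\<forall>i\<in>Obj J'. h \<cdot> w i = v (decode i))"
      using to' w unfolding is_colimit_def by blast
    then show "\<exists>!h. h \<in> Hom E A B \<and> (\<forall>i\<in>Obj J. h \<cdot> w (code i) = v i)" by (simp add: J'_def)
  qed
  then show ?thesis by blast
qed

text \<open>A cocone on the subdivision is determined by its values at the objects of \<open>J\<close>, and the
  condition on these is to be a wedge.\<close>

lemma coend_exists:
  fixes J :: "('x :: countable, 'y :: countable, 'w) cat_scheme"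
  assumes X: "is_functor (op_cat J) E X" and Z: "is_functor J E Z"
  shows "\<exists>A w. is_coend J E (external_tensor E X Z) A w"
proof -
  interpret J: category J by (rule functor_category_left[OF Z])
  note simps = functor_simps[OF X, simplified] functor_simps[OF Z]
  define T where "T i = (case i of Inl i \<Rightarrow> fob X i \<otimes> fob Z i | Inr f \<Rightarrow> fob X (Cod J f) \<otimes> fob Z (Dom J f))" for i
  define F where "F = \<lparr>fob = T, far = (\<lambda>x. case x of Inl i \<Rightarrow> \<i> (T i) |
     Inr (f, b) \<Rightarrow> if b then far X f \<odot> \<i> (fob Z (Dom J f)) else \<i> (fob X (Cod J f)) \<odot> far Z f)\<rparr>"
  have F: "is_functor (subdivision J) E F"
    by (rule is_functorI[OF category_subdivision[OF J.category_axioms] category_axioms])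
       (auto simp: F_def subdivision_def T_def simps split: if_splits)
  have cocone: "is_cocone (subdivision J) E F B v \<longleftrightarrow> is_wedge J E (external_tensor E X Z) B (\<lambda>i. v (Inl i)) \<and>
      (\<forall>f\<in>Arr J. v (Inr f) = v (Inl (Dom J f)) \<cdot> (far X f \<odot> \<i> (fob Z (Dom J f))))" (is "?l \<longleftrightarrow> ?r") for B v
  proof
    assume l: ?l
    then have 1: "\<And>i. i \<in> Obj J \<Longrightarrow> v (Inl i) \<in> Hom E (fob X i \<otimes> fob Z i) B" and B: "B \<in> Obj E"
      and n: "\<And>g. g \<in> Arr (subdivision J) \<Longrightarrow> v (Cod (subdivision J) g) \<cdot> far F g = v (Dom (subdivision J) g)"
      unfolding is_cocone_def all_Hom by (simp_all add: F_def T_def subdivision_def)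
    have "v (Inl (Dom J f)) \<cdot> (far X f \<odot> \<i> (fob Z (Dom J f))) = v (Inr f)"
      "v (Inl (Cod J f)) \<cdot> (\<i> (fob X (Cod J f)) \<odot> far Z f) = v (Inr f)" if "f \<in> Arr J" for f
      using n[of "Inr (f, True)"] n[of "Inr (f, False)"] that by (simp_all add: subdivision_def F_def)
    then show ?r unfolding is_wedge_iff[OF X Z] using 1 B by simp
  next
    assume r: ?r
    then have 1: "\<And>i. i \<in> Obj J \<Longrightarrow> v (Inl i) \<in> Hom E (fob X i \<otimes> fob Z i) B" and B: "B \<in> Obj E"
      and 2: "\<And>f. f \<in> Arr J \<Longrightarrow> v (Inl (Dom J f)) \<cdot> (far X f \<odot> \<i> (fob Z (Dom J f))) = v (Inl (Cod J f)) \<cdot> (\<i> (fob X (Cod J f)) \<odot> far Z f)"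
      and 3: "\<And>f. f \<in> Arr J \<Longrightarrow> v (Inr f) = v (Inl (Dom J f)) \<cdot> (far X f \<odot> \<i> (fob Z (Dom J f)))"
      unfolding is_wedge_iff[OF X Z] by auto
    show ?l unfolding is_cocone_def
    proof (intro conjI allI ballI)
      show "v i \<in> Hom E (fob F i) B" if "i \<in> Obj (subdivision J)" for i
        using that 1 by (auto simp: subdivision_def F_def T_def 3 simps)
      show "v j \<cdot> far F g = v i" if "g \<in> Hom (subdivision J) i j" for i j g
        using that 1 2 by (auto simp: subdivision_def F_def T_def 3 simps split: if_splits)
    qed (rule B)
  qed
  obtain A w where w: "is_colimit (subdivision J) E F A w" using countable_colimit[OF F] by blast
  have "is_coend J E (external_tensor E X Z) A (\<lambda>i. w (Inl i))"
    unfolding is_coend_def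
  proof (intro conjI allI impI)
    show "is_wedge J E (external_tensor E X Z) A (\<lambda>i. w (Inl i))" using w cocone by (simp add: is_colimit_def)
    fix B v assume v: "is_wedge J E (external_tensor E X Z) B v"
    define v' where "v' i = (case i of Inl i \<Rightarrow> v i | Inr f \<Rightarrow> v (Dom J f) \<cdot> (far X f \<odot> \<i> (fob Z (Dom J f))))" for i
    have "is_cocone (subdivision J) E F B v'" unfolding cocone using v by (simp add: v'_def)
    then have ex: "\<exists>!h. h \<in> Hom E A B \<and> (\<forall>i\<in>Obj (subdivision J). h \<cdot> w i = v' i)" using w unfolding is_colimit_def by blast
    have wA: "\<And>i. i \<in> Obj J \<Longrightarrow> w (Inl i) \<in> Hom E (fob X i \<otimes> fob Z i) A"
      and wI: "\<And>f. f \<in> Arr J \<Longrightarrow> w (Inr f) = w (Inl (Dom J f)) \<cdot> (far X f \<odot> \<i> (fob Z (Dom J f)))"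
      using w cocone[of A w] unfolding is_wedge_iff[OF X Z] by (auto simp: is_colimit_def)
    have "(\<forall>i\<in>Obj (subdivision J). h \<cdot> w i = v' i) \<longleftrightarrow> (\<forall>i\<in>Obj J. h \<cdot> w (Inl i) = v i)" if h: "h \<in> Hom E A B" for h
    proof
      assume *: "\<forall>i\<in>Obj J. h \<cdot> w (Inl i) = v i"
      have "h \<cdot> w (Inr f) = v' (Inr f)" if f: "f \<in> Arr J" for f
      proof -
        have "h \<cdot> w (Inr f) = (h \<cdot> w (Inl (Dom J f))) \<cdot> (far X f \<odot> \<i> (fob Z (Dom J f)))"
          using f h wA[of "Dom J f"] by (simp add: wI simps)
        then show ?thesis using * f by (simp add: v'_def)
      qed
      then show "\<forall>i\<in>Obj (subdivision J). h \<cdot> w i = v' i" using * by (auto simp: subdivision_def v'_def)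
    qed (auto simp: subdivision_def v'_def)
    then show "\<exists>!h. h \<in> Hom E A B \<and> (\<forall>i\<in>Obj J. h \<cdot> w (Inl i) = v i)" using ex by (metis (no_types, lifting))
  qed
  then show ?thesis by blast
qed

lemma tensor_over_is_coend:
  fixes J :: "('x :: countable, 'y :: countable, 'w) cat_scheme"
  assumes X: "is_functor (op_cat J) E X" and Z: "is_functor J E Z"
  shows "is_coend J E (external_tensor E X Z) (tensor_over J E X Z) (tensor_over_leg J E X Z)"
proof -
  have "case tensor_over_wedge J E X Z of (A, w) \<Rightarrow> is_coend J E (external_tensor E X Z) A w"
    unfolding tensor_over_wedge_def by (rule someI_ex) (use coend_exists[OF assms] in auto)
  then show ?thesis by (simp add: tensor_over_def tensor_over_leg_def split_beta)
qed

lemma tensor_over_universal: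
  fixes J :: "('x :: countable, 'y :: countable, 'w) cat_scheme"
  assumes X: "is_functor (op_cat J) E X" and Z: "is_functor J E Z"
  shows "universal_family (Obj J) (tensor_over_leg J E X Z) (coend_relations J X Z) (tensor_over J E X Z)"
    and "i \<in> Obj J \<Longrightarrow> Dom E (tensor_over_leg J E X Z i) = fob X i \<otimes> fob Z i"
  using tensor_over_is_coend[OF assms] unfolding is_coend_iff[OF assms] by blast+

lemma tensor_over_desc:
  fixes J :: "('x :: countable, 'y :: countable, 'w) cat_scheme"
  assumes X: "is_functor (op_cat J) E X" and Z: "is_functor J E Z"
    and v: "is_wedge J E (external_tensor E X Z) B v"
  shows "tensor_over_desc J E X Z B v \<in> Hom E (tensor_over J E X Z) B"
    and "i \<in> Obj J \<Longrightarrow> tensor_over_desc J E X Z B v \<cdot> tensor_over_leg J E X Z i = v i"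
proof -
  have *: "\<exists>!h. h \<in> Hom E (tensor_over J E X Z) B \<and> (\<forall>i\<in>Obj J. h \<cdot> tensor_over_leg J E X Z i = v i)"
    using tensor_over_is_coend[OF X Z] v unfolding is_coend_def by blast
  show "tensor_over_desc J E X Z B v \<in> Hom E (tensor_over J E X Z) B"
    "i \<in> Obj J \<Longrightarrow> tensor_over_desc J E X Z B v \<cdot> tensor_over_leg J E X Z i = v i"
    unfolding tensor_over_desc_def using desc_eqI[OF *] by blast+
qed

text \<open>A copower is a coproduct, which is a presentation without relations.\<close>

lemma copower_universal:
  fixes S :: "'u set" assumes S: "small S"
  shows "universal_family S (copower_in E S) {} (copower E S)"
    and "s \<in> S \<Longrightarrow> Dom E (copower_in E S s) = \<u>"
proof -
  let ?D = "discrete_cat S" and ?F = "const_functor (discrete_cat S) E \<u>"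
  have [simp]: "Obj ?D = S" "Arr ?D = S" "Dom ?D s = s" "Cod ?D s = s" "Ide ?D s = s" "g \<cdot>\<^bsub>?D\<^esub> f = f" for s f g
    by (simp_all add: discrete_cat_def)
  have D: "category ?D" by unfold_locales auto
  have F: "is_functor ?D E ?F"
    by (rule is_functorI) (auto simp: D category_axioms const_functor_def)
  have cocone: "is_cocone ?D E ?F B v \<longleftrightarrow> B \<in> Obj E \<and> (\<forall>s\<in>S. v s \<in> Hom E \<u> B)" for B v
    by (auto simp: is_cocone_def const_functor_def)
  have "small (Obj ?D) \<and> small (Arr ?D) \<and> is_functor ?D E ?F" using F S by simp
  then obtain A w where "is_colimit ?D E ?F A w"
    using cocomplete[unfolded cocomplete_def, rule_format, of ?D ?F] by blast
  then have "case copower_cocone E S of (A, w) \<Rightarrow> is_colimit ?D E ?F A w"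
    unfolding copower_cocone_def by - (rule someI_ex, rule exI[of _ "(A, w)"], simp)
  then have col: "is_colimit ?D E ?F (copower E S) (copower_in E S)"
    by (simp add: copower_def copower_in_def split_beta)
  then have c: "copower E S \<in> Obj E" "\<And>s. s \<in> S \<Longrightarrow> copower_in E S s \<in> Hom E \<u> (copower E S)"
    unfolding is_colimit_def cocone by blast+
  then show "s \<in> S \<Longrightarrow> Dom E (copower_in E S s) = \<u>" by simp
  have "\<exists>!h. h \<in> Hom E (copower E S) B \<and> (\<forall>i\<in>S. h \<cdot> copower_in E S i = v i)"
    if "B \<in> Obj E" "\<forall>i\<in>S. v i \<in> Hom E (Dom E (copower_in E S i)) B" for B v
  proof -
    have "is_cocone ?D E ?F B v" unfolding cocone using that c by simp
    then show ?thesis using col unfolding is_colimit_def by simp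
  qed
  then show "universal_family S (copower_in E S) {} (copower E S)"
    unfolding universal_family_def using c by auto
qed

lemma copower_simps [simp]:
  fixes S :: "'u set" assumes "small S"
  shows "copower E S \<in> Obj E" "s \<in> S \<Longrightarrow> copower_in E S s \<in> Arr E"
    "s \<in> S \<Longrightarrow> Dom E (copower_in E S s) = \<u>" "s \<in> S \<Longrightarrow> Cod E (copower_in E S s) = copower E S"
  by (rule Obj_universal[OF copower_universal(1)[OF assms]] Arr_universal[OF copower_universal(1)[OF assms]]
      copower_universal(2)[OF assms] Cod_universal[OF copower_universal(1)[OF assms]]; assumption)+

lemmas copower_jointly_epic = universal_family_jointly_epic[OF copower_universal(1)]

lemma copower_desc:
  fixes S :: "'u set"
  assumes S: "small S" and B: "B \<in> Obj E" and v: "\<And>s. s \<in> S \<Longrightarrow> v s \<in> Hom E \<u> B"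
  shows "copower_desc E S B v \<in> Hom E (copower E S) B"
    and "s \<in> S \<Longrightarrow> copower_desc E S B v \<cdot> copower_in E S s = v s"
proof -
  have *: "\<exists>!h. h \<in> Hom E (copower E S) B \<and> (\<forall>i\<in>S. h \<cdot> copower_in E S i = v i)"
    by (rule unique_universal[OF copower_universal(1)[OF S] B]) (use v S in auto)
  show "copower_desc E S B v \<in> Hom E (copower E S) B"
    "s \<in> S \<Longrightarrow> copower_desc E S B v \<cdot> copower_in E S s = v s"
    unfolding copower_desc_def using desc_eqI[OF *] by blast+
qed

lemma fob_copower_functor [simp]: "fob (copower_functor E) S = copower E S"
  by (simp add: copower_functor_def)

lemma
  assumes f: "f \<in> Arr SetU"
  shows Arr_copower [simp]: "far (copower_functor E) f \<in> Arr E"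
    and Dom_copower [simp]: "Dom E (far (copower_functor E) f) = copower E (source f)"
    and Cod_copower [simp]: "Cod E (far (copower_functor E) f) = copower E (target f)"
    and copower_in_natural: "s \<in> source f \<Longrightarrow> far (copower_functor E) f \<cdot> copower_in E (source f) s =
      copower_in E (target f) (component f s)"
proof -
  have *: "copower_in E (target f) (component f s) \<in> Hom E \<u> (copower E (target f))" if "s \<in> source f" for s
    using Arr_SetsD[OF f] that by simp
  note d = copower_desc[OF Arr_SetsD(1)[OF f] _ *]
  show "far (copower_functor E) f \<in> Arr E" "Dom E (far (copower_functor E) f) = copower E (source f)"
    "Cod E (far (copower_functor E) f) = copower E (target f)"
    "s \<in> source f \<Longrightarrow> far (copower_functor E) f \<cdot> copower_in E (source f) s = copower_in E (target f) (component f s)"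
    using d Arr_SetsD[OF f] by (auto simp: copower_functor_def)
qed

lemma is_functor_copower: "is_functor SetU E (copower_functor E)"
proof (rule is_functorI)
  fix S assume "S \<in> Obj SetU"
  then have S: "small S" by simp
  show "far (copower_functor E) (Ide SetU S) = \<i> (fob (copower_functor E) S)"
    by (rule jointly_epicD[OF copower_jointly_epic[OF S]])
       (use S copower_in_natural[of "Ide SetU S"] in auto)
next
  fix f g assume f: "f \<in> Arr SetU" and g: "g \<in> Arr SetU" and fg: "Dom SetU g = Cod SetU f"
  show "far (copower_functor E) (g \<cdot>\<^bsub>SetU\<^esub> f) = far (copower_functor E) g \<cdot> far (copower_functor E) f"
  proof (rule jointly_epicD[OF copower_jointly_epic[OF Arr_SetsD(1)[OF f]]])
    fix s assume s: "s \<in> source f"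
    show "far (copower_functor E) (g \<cdot>\<^bsub>SetU\<^esub> f) \<cdot> copower_in E (source f) s =
        (far (copower_functor E) g \<cdot> far (copower_functor E) f) \<cdot> copower_in E (source f) s"
      using f g fg s Arr_SetsD[OF f] copower_in_natural[of "g \<cdot>\<^bsub>SetU\<^esub> f" s] copower_in_natural[OF g, of "component f s"]
      by (simp add: copower_in_natural)
  qed (use f g fg in auto)
qed (auto simp: category_axioms category_Sets Arr_SetsD)

end


section \<open>The copower functor is strong symmetric monoidal\<close>

locale realisation_category = cocomplete_category U E + closed_symmetric_monoidal_category E
  for U :: "'u itself" and E :: "('o, 'a, 'z) smcat_scheme" (structure)
begin

lemma copower_tens_jointly_epic:
  "small (S :: 'u set) \<Longrightarrow> small T \<Longrightarrow> jointly_epic (S \<times> T) (\<lambda>(s, t). copower_in E S s \<odot> copower_in E T t) (copower E S \<otimes> copower E (T :: 'u set))"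
  by (rule jointly_epic_tens[OF copower_jointly_epic copower_jointly_epic]) auto

text \<open>On the summand of a pair it is the isomorphism \<open>I \<otimes> I \<cong> I\<close>.  As tensoring preserves
  coproducts in both variables, this determines it, and the same description in the other
  direction gives an inverse.\<close>

definition copower_mult :: "'u set \<Rightarrow> 'u set \<Rightarrow> 'a" where
  "copower_mult S T = (THE h. h \<in> Hom E (copower E S \<otimes> copower E T) (copower E (set_prod S T)) \<and>
     (\<forall>(s, t)\<in>S \<times> T. h \<cdot> (copower_in E S s \<odot> copower_in E T t) = copower_in E (set_prod S T) (pair_code s t) \<cdot> \<l> \<u>))"

lemma
  assumes [simp]: "small S" "small (T :: 'u set)"
  shows Arr_copower_mult [simp]: "copower_mult S T \<in> Arr E"
    and Dom_copower_mult [simp]: "Dom E (copower_mult S T) = copower E S \<otimes> copower E T"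
    and Cod_copower_mult [simp]: "Cod E (copower_mult S T) = copower E (set_prod S T)"
    and copower_mult_in: "s \<in> S \<Longrightarrow> t \<in> T \<Longrightarrow> copower_mult S T \<cdot> (copower_in E S s \<odot> copower_in E T t) =
      copower_in E (set_prod S T) (pair_code s t) \<cdot> \<l> \<u>"
    and is_iso_copower_mult [simp]: "is_iso E (copower_mult S T)"
proof -
  let ?P = "\<lambda>h. h \<in> Hom E (copower E S \<otimes> copower E T) (copower E (set_prod S T)) \<and>
     (\<forall>(s, t)\<in>S \<times> T. h \<cdot> (copower_in E S s \<odot> copower_in E T t) = copower_in E (set_prod S T) (pair_code s t) \<cdot> \<l> \<u>)"
  obtain h where h: "h \<in> Hom E (copower E S \<otimes> copower E T) (copower E (set_prod S T))"
    "\<And>s t. s \<in> S \<Longrightarrow> t \<in> T \<Longrightarrow> h \<cdot> (copower_in E S s \<odot> copower_in E T t) = copower_in E (set_prod S T) (pair_code s t) \<cdot> \<l> \<u>"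
    by (rule tens_desc[OF copower_universal(1) copower_universal(1),
          of S T "copower E (set_prod S T)" "\<lambda>s t. copower_in E (set_prod S T) (pair_code s t) \<cdot> \<l> \<u>"]) auto
  have P: "?P (copower_mult S T)"
    unfolding copower_mult_def
  proof (rule theI[of ?P])
    show "?P h" using h by auto
    show "h' = h" if "?P h'" for h'
      by (rule jointly_epicD[OF copower_tens_jointly_epic[of S T]]) (use that h in auto)
  qed
  then show m[simp]: "copower_mult S T \<in> Arr E" "Dom E (copower_mult S T) = copower E S \<otimes> copower E T"
    "Cod E (copower_mult S T) = copower E (set_prod S T)" by auto
  show min: "copower_mult S T \<cdot> (copower_in E S s \<odot> copower_in E T t) = copower_in E (set_prod S T) (pair_code s t) \<cdot> \<l> \<u>"
    if "s \<in> S" "t \<in> T" for s t using P that by auto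
  define k where "k = copower_desc E (set_prod S T) (copower E S \<otimes> copower E T)
    (\<lambda>c. (copower_in E S (fst_code c) \<odot> copower_in E T (snd_code c)) \<cdot> \<l>' \<u>)"
  have k: "k \<in> Hom E (copower E (set_prod S T)) (copower E S \<otimes> copower E T)"
    "\<And>s t. s \<in> S \<Longrightarrow> t \<in> T \<Longrightarrow> k \<cdot> copower_in E (set_prod S T) (pair_code s t) = (copower_in E S s \<odot> copower_in E T t) \<cdot> \<l>' \<u>"
  proof -
    have "(copower_in E S (fst_code c) \<odot> copower_in E T (snd_code c)) \<cdot> \<l>' \<u> \<in> Hom E \<u> (copower E S \<otimes> copower E T)"
      if "c \<in> set_prod S T" for c using that by (auto elim!: set_prodE)
    note d = copower_desc[OF small_set_prod[of S T] _ this]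
    show "k \<in> Hom E (copower E (set_prod S T)) (copower E S \<otimes> copower E T)" unfolding k_def by (rule d(1)) auto
    show "k \<cdot> copower_in E (set_prod S T) (pair_code s t) = (copower_in E S s \<odot> copower_in E T t) \<cdot> \<l>' \<u>"
      if "s \<in> S" "t \<in> T" for s t unfolding k_def by (subst d(2)) (use that in auto)
  qed
  show "is_iso E (copower_mult S T)"
  proof (rule is_isoI[OF _ k(1)])
    show "k \<cdot> copower_mult S T = \<i> (copower E S \<otimes> copower E T)"
    proof (rule jointly_epicD[OF copower_tens_jointly_epic[of S T]])
      fix st assume "st \<in> S \<times> T"
      then show "(k \<cdot> copower_mult S T) \<cdot> (case st of (s, t) \<Rightarrow> copower_in E S s \<odot> copower_in E T t) =
          \<i> (copower E S \<otimes> copower E T) \<cdot> (case st of (s, t) \<Rightarrow> copower_in E S s \<odot> copower_in E T t)"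
        using k by (auto simp: min reassoc[OF k(2)])
    qed (use k in auto)
    show "copower_mult S T \<cdot> k = \<i> (copower E (set_prod S T))"
    proof (rule jointly_epicD[OF copower_jointly_epic[of "set_prod S T"]])
      fix c assume "c \<in> set_prod S T"
      then obtain s t where "c = pair_code s t" "s \<in> S" "t \<in> T" by (rule set_prodE)
      then show "(copower_mult S T \<cdot> k) \<cdot> copower_in E (set_prod S T) c =
          \<i> (copower E (set_prod S T)) \<cdot> copower_in E (set_prod S T) c"
        using k(1) by (simp add: k(2) reassoc[OF min])
    qed (use k in auto)
  qed auto
qed

text \<open>The element of the one-element set is \<open>undefined\<close>.\<close>

definition copower_unit :: 'a where
  "copower_unit = copower_in E (set_unit :: 'u set) undefined"

lemma copower_unit_simps [simp]:
  "copower_unit \<in> Arr E" "Dom E copower_unit = \<u>" "Cod E copower_unit = copower E (set_unit :: 'u set)"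
  by (simp_all add: copower_unit_def set_unit_def small_finite)

lemma is_iso_copower_unit [simp]: "is_iso E copower_unit"
proof -
  let ?k = "copower_desc E (set_unit :: 'u set) \<u> (\<lambda>_. \<i> \<u>)"
  have k: "?k \<in> Hom E (copower E (set_unit :: 'u set)) \<u>" "?k \<cdot> copower_unit = \<i> \<u>"
  proof -
    have u: "(undefined :: 'u) \<in> set_unit" by (simp add: set_unit_def)
    note d = copower_desc[OF small_set_unit Obj_unit, of "\<lambda>_. \<i> \<u>"]
    show "?k \<in> Hom E (copower E (set_unit :: 'u set)) \<u>" "?k \<cdot> copower_unit = \<i> \<u>"
      unfolding copower_unit_def using d(1) d(2)[OF _ u] by simp_all
  qed
  show ?thesis
  proof (rule is_isoI[OF _ k])
    show "copower_unit \<cdot> ?k = \<i> (copower E (set_unit :: 'u set))"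
    proof (rule jointly_epicD[OF copower_jointly_epic[of "set_unit :: 'u set"]])
      fix s assume "s \<in> (set_unit :: 'u set)"
      then have s: "copower_in E set_unit s = copower_unit" by (simp add: set_unit_def copower_unit_def)
      show "(copower_unit \<cdot> ?k) \<cdot> copower_in E set_unit s = \<i> (copower E (set_unit :: 'u set)) \<cdot> copower_in E set_unit s"
        unfolding s using k by simp
    qed (use k in auto)
  qed auto
qed

text \<open>Every axiom can be tested on the injections of the copowers, where it reduces to a coherence
  for the unit.\<close>

lemma symmetric_monoidal_copower:
  "symmetric_monoidal_functor SetU E (copower_functor E) copower_unit copower_mult"
proof
  show "is_functor SetU E (copower_functor E)" by (rule is_functor_copower)
  show "copower_unit \<in> Hom E \<u> (fob (copower_functor E) (Unit SetU))" by simp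
next
  fix X Y assume "X \<in> Obj SetU" "Y \<in> Obj SetU"
  then have [simp]: "small X" "small Y" by auto
  show "copower_mult X Y \<in> Hom E (fob (copower_functor E) X \<otimes> fob (copower_functor E) Y) (fob (copower_functor E) (X \<otimes>\<^bsub>SetU\<^esub> Y))"
    by simp
  show "far (copower_functor E) (Swap SetU X Y) \<cdot> copower_mult X Y =
      copower_mult Y X \<cdot> \<s> (fob (copower_functor E) X) (fob (copower_functor E) Y)"
  proof (rule jointly_epicD[OF copower_tens_jointly_epic[of X Y]])
    fix st assume "st \<in> X \<times> Y"
    then obtain s t where st: "st = (s, t)" "s \<in> X" "t \<in> Y" by auto
    show "(far (copower_functor E) (Swap SetU X Y) \<cdot> copower_mult X Y) \<cdot> (case st of (s, t) \<Rightarrow> copower_in E X s \<odot> copower_in E Y t) =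
        (copower_mult Y X \<cdot> \<s> (fob (copower_functor E) X) (fob (copower_functor E) Y)) \<cdot> (case st of (s, t) \<Rightarrow> copower_in E X s \<odot> copower_in E Y t)"
      using st copower_in_natural[of "Swap SetU X Y" "pair_code s t"]
      by (simp add: copower_mult_in swap_natural reassoc[OF copower_mult_in] swap_unit reassoc[OF copower_in_natural[of "Swap SetU X Y", simplified]])
  qed auto
next
  fix f g X X' Y Y' assume "f \<in> Hom SetU X X'" "g \<in> Hom SetU Y Y'"
  then have [simp]: "f \<in> Arr SetU" "g \<in> Arr SetU" and e: "source f = X" "target f = X'" "source g = Y" "target g = Y'"
    by auto
  have [simp]: "small X" "small Y" "small X'" "small Y'" using Arr_SetsD[of f] Arr_SetsD[of g] e by auto
  show "copower_mult X' Y' \<cdot> (far (copower_functor E) f \<odot> far (copower_functor E) g) =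
      far (copower_functor E) (f \<odot>\<^bsub>SetU\<^esub> g) \<cdot> copower_mult X Y"
  proof (rule jointly_epicD[OF copower_tens_jointly_epic[of X Y]])
    fix st assume "st \<in> X \<times> Y"
    then obtain s t where st: "st = (s, t)" "s \<in> X" "t \<in> Y" by auto
    have "component f s \<in> X'" "component g t \<in> Y'" using st e Arr_SetsD(3)[of f s] Arr_SetsD(3)[of g t] by auto
    moreover have "far (copower_functor E) (f \<odot>\<^bsub>SetU\<^esub> g) \<cdot> copower_in E (set_prod X Y) (pair_code s t) =
        copower_in E (set_prod X' Y') (pair_code (component f s) (component g t))"
      using copower_in_natural[of "f \<odot>\<^bsub>SetU\<^esub> g" "pair_code s t"] st by (simp add: e)
    ultimately show "(copower_mult X' Y' \<cdot> (far (copower_functor E) f \<odot> far (copower_functor E) g)) \<cdot> (case st of (s, t) \<Rightarrow> copower_in E X s \<odot> copower_in E Y t) =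
       (far (copower_functor E) (f \<odot>\<^bsub>SetU\<^esub> g) \<cdot> copower_mult X Y) \<cdot> (case st of (s, t) \<Rightarrow> copower_in E X s \<odot> copower_in E Y t)"
      using st copower_in_natural[of f s] copower_in_natural[of g t]
      by (simp add: e copower_mult_in reassoc)
  qed (auto simp: e)
next
  fix X assume "X \<in> Obj SetU"
  then have [simp]: "small X" by auto
  have u: "(undefined :: 'u) \<in> set_unit" by (simp add: set_unit_def)
  have je: "jointly_epic X (\<lambda>s. \<i> \<u> \<odot> copower_in E X s) (\<u> \<otimes> copower E X)"
    "jointly_epic X (\<lambda>s. copower_in E X s \<odot> \<i> \<u>) (copower E X \<otimes> \<u>)"
    by (auto intro!: jointly_epic_tens_left jointly_epic_tens_right copower_jointly_epic)
  show "far (copower_functor E) (LUnit SetU X) \<cdot> copower_mult (Unit SetU) X \<cdot> (copower_unit \<odot> \<i> (fob (copower_functor E) X)) =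
     \<l> (fob (copower_functor E) X)"
  proof (rule jointly_epicD[OF je(1)])
    fix s assume s: "s \<in> X"
    show "(far (copower_functor E) (LUnit SetU X) \<cdot> copower_mult (Unit SetU) X \<cdot> (copower_unit \<odot> \<i> (fob (copower_functor E) X))) \<cdot>
        (\<i> \<u> \<odot> copower_in E X s) = \<l> (fob (copower_functor E) X) \<cdot> (\<i> \<u> \<odot> copower_in E X s)"
      using s u copower_in_natural[of "LUnit SetU X" "pair_code undefined s"] copower_mult_in[of set_unit X undefined s]
      by (simp add: copower_unit_def lunit_natural reassoc[OF copower_in_natural[of "LUnit SetU X", simplified]])
  qed auto
  show "far (copower_functor E) (RUnit SetU X) \<cdot> copower_mult X (Unit SetU) \<cdot> (\<i> (fob (copower_functor E) X) \<odot> copower_unit) =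
     \<r> (fob (copower_functor E) X)"
  proof (rule jointly_epicD[OF je(2)])
    fix s assume s: "s \<in> X"
    show "(far (copower_functor E) (RUnit SetU X) \<cdot> copower_mult X (Unit SetU) \<cdot> (\<i> (fob (copower_functor E) X) \<odot> copower_unit)) \<cdot>
        (copower_in E X s \<odot> \<i> \<u>) = \<r> (fob (copower_functor E) X) \<cdot> (copower_in E X s \<odot> \<i> \<u>)"
      using s u copower_in_natural[of "RUnit SetU X" "pair_code s undefined"] copower_mult_in[of X set_unit s undefined]
      by (simp add: copower_unit_def runit_natural runit_unit reassoc[OF copower_in_natural[of "RUnit SetU X", simplified]])
  qed auto
next
  fix X Y Z assume "X \<in> Obj SetU" "Y \<in> Obj SetU" "Z \<in> Obj SetU"
  then have [simp]: "small X" "small Y" "small Z" by auto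
  have je: "jointly_epic ((X \<times> Y) \<times> Z) (\<lambda>(st, r). (case st of (s, t) \<Rightarrow> copower_in E X s \<odot> copower_in E Y t) \<odot> copower_in E Z r)
     ((copower E X \<otimes> copower E Y) \<otimes> copower E Z)"
    by (auto intro!: jointly_epic_tens copower_jointly_epic copower_tens_jointly_epic)
  show "far (copower_functor E) (Assoc SetU X Y Z) \<cdot> copower_mult (X \<otimes>\<^bsub>SetU\<^esub> Y) Z \<cdot> (copower_mult X Y \<odot> \<i> (fob (copower_functor E) Z)) =
     copower_mult X (Y \<otimes>\<^bsub>SetU\<^esub> Z) \<cdot> (\<i> (fob (copower_functor E) X) \<odot> copower_mult Y Z) \<cdot>
     \<alpha> (fob (copower_functor E) X) (fob (copower_functor E) Y) (fob (copower_functor E) Z)"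
  proof (rule jointly_epicD[OF je])
    fix c assume "c \<in> (X \<times> Y) \<times> Z"
    then obtain s t r where c: "c = ((s, t), r)" and [simp]: "s \<in> X" "t \<in> Y" "r \<in> Z" by auto
    let ?is = "copower_in E X s" and ?it = "copower_in E Y t" and ?ir = "copower_in E Z r"
    have "(far (copower_functor E) (Assoc SetU X Y Z) \<cdot> copower_mult (X \<otimes>\<^bsub>SetU\<^esub> Y) Z \<cdot> (copower_mult X Y \<odot> \<i> (fob (copower_functor E) Z))) \<cdot>
        ((?is \<odot> ?it) \<odot> ?ir) = far (copower_functor E) (Assoc SetU X Y Z) \<cdot> (copower_mult (set_prod X Y) Z \<cdot>
        ((copower_in E (set_prod X Y) (pair_code s t) \<odot> ?ir) \<cdot> (\<l> \<u> \<odot> \<i> \<u>)))"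
      by (simp add: copower_mult_in)
    also have "\<dots> = (far (copower_functor E) (Assoc SetU X Y Z) \<cdot> copower_in E (set_prod (set_prod X Y) Z) (pair_code (pair_code s t) r)) \<cdot>
        (\<l> \<u> \<cdot> (\<l> \<u> \<odot> \<i> \<u>))"
      by (simp add: reassoc[OF copower_mult_in] del: tens_Comp tens_Comp')
    also have "\<dots> = copower_in E (set_prod X (set_prod Y Z)) (pair_code s (pair_code t r)) \<cdot> (\<l> \<u> \<cdot> (\<l> \<u> \<odot> \<i> \<u>))"
      using copower_in_natural[of "Assoc SetU X Y Z" "pair_code (pair_code s t) r"] by simp
    also have "\<l> \<u> \<cdot> (\<l> \<u> \<odot> \<i> \<u>) = \<l> \<u> \<cdot> ((\<i> \<u> \<odot> \<l> \<u>) \<cdot> \<alpha> \<u> \<u> \<u>)"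
      using triangle_equation[of \<u> \<u>] by (simp add: runit_unit)
    also have "copower_in E (set_prod X (set_prod Y Z)) (pair_code s (pair_code t r)) \<cdot> (\<l> \<u> \<cdot> ((\<i> \<u> \<odot> \<l> \<u>) \<cdot> \<alpha> \<u> \<u> \<u>)) =
        copower_mult X (set_prod Y Z) \<cdot> ((?is \<odot> copower_in E (set_prod Y Z) (pair_code t r)) \<cdot> ((\<i> \<u> \<odot> \<l> \<u>) \<cdot> \<alpha> \<u> \<u> \<u>))"
      by (simp add: reassoc[OF copower_mult_in] del: tens_Comp tens_Comp')
    also have "\<dots> = copower_mult X (set_prod Y Z) \<cdot> ((\<i> (copower E X) \<odot> copower_mult Y Z) \<cdot> ((?is \<odot> (?it \<odot> ?ir)) \<cdot> \<alpha> \<u> \<u> \<u>))"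
      by (simp add: copower_mult_in)
    also have "\<dots> = (copower_mult X (Y \<otimes>\<^bsub>SetU\<^esub> Z) \<cdot> (\<i> (fob (copower_functor E) X) \<odot> copower_mult Y Z) \<cdot>
       \<alpha> (fob (copower_functor E) X) (fob (copower_functor E) Y) (fob (copower_functor E) Z)) \<cdot> ((?is \<odot> ?it) \<odot> ?ir)"
      by (simp add: assoc_natural)
    finally show "(far (copower_functor E) (Assoc SetU X Y Z) \<cdot> copower_mult (X \<otimes>\<^bsub>SetU\<^esub> Y) Z \<cdot> (copower_mult X Y \<odot> \<i> (fob (copower_functor E) Z))) \<cdot>
        (case c of (st, r) \<Rightarrow> (case st of (s, t) \<Rightarrow> copower_in E X s \<odot> copower_in E Y t) \<odot> copower_in E Z r) =
      (copower_mult X (Y \<otimes>\<^bsub>SetU\<^esub> Z) \<cdot> (\<i> (fob (copower_functor E) X) \<odot> copower_mult Y Z) \<cdot>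
       \<alpha> (fob (copower_functor E) X) (fob (copower_functor E) Y) (fob (copower_functor E) Z)) \<cdot>
        (case c of (st, r) \<Rightarrow> (case st of (s, t) \<Rightarrow> copower_in E X s \<odot> copower_in E Y t) \<odot> copower_in E Z r)"
      unfolding c by simp
  qed auto
qed

end


section \<open>Realisation\<close>

locale realisation_setting = realisation_category U E
  for U :: "'u itself" and E :: "('o, 'a, 'z) smcat_scheme" (structure) +
  fixes C :: "('o, 'a) cosimplicial"
  assumes functor_C: "is_functor \<Delta> E C"
begin

abbreviation SE :: "(('o, 'a) simplicial, ('o, 'a) simplicial_map) smcat" where "SE \<equiv> Simplicial E"
abbreviation R :: "('o, 'a) simplicial \<Rightarrow> 'o" where "R \<equiv> fob (realisation E C)"
abbreviation RA :: "('o, 'a) simplicial_map \<Rightarrow> 'a" where "RA \<equiv> far (realisation E C)"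
abbreviation leg :: "('o, 'a) simplicial \<Rightarrow> nat \<Rightarrow> 'a" where "leg X n \<equiv> real_leg E C X n"

end

sublocale realisation_setting \<subseteq> SE: symmetric_monoidal_category "Simplicial E"
  unfolding Simplicial_def by (rule symmetric_monoidal_functor_cat[OF category_op_cat[OF category_Delta]])

sublocale realisation_setting \<subseteq> SS: symmetric_monoidal_category "Simplicial (Sets :: ('u set, 'u set_map) smcat)"
  unfolding Simplicial_def by (rule SetU.symmetric_monoidal_functor_cat[OF category_op_cat[OF category_Delta]])

context realisation_setting
begin

lemmas C_simps [simp] = functor_simps[OF functor_C]

lemma Obj_SE: "X \<in> Obj SE \<longleftrightarrow> X \<in> functors (op_cat \<Delta>) E"
  by (simp add: Simplicial_def)

lemma Arr_SE: "t \<in> Arr SE \<longleftrightarrow> t \<in> nat_transs (op_cat \<Delta>) E"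
  by (simp add: Simplicial_def)

lemma Dom_SE: "Dom SE t = source t" and Cod_SE: "Cod SE t = target t"
  by (simp_all add: Simplicial_def)

lemma
  assumes "X \<in> Obj SE"
  shows fob_SE [simp]: "fob X n \<in> Obj E"
    and Arr_far_SE [simp]: "f \<in> Arr \<Delta> \<Longrightarrow> far X f \<in> Arr E"
    and Dom_far_SE [simp]: "f \<in> Arr \<Delta> \<Longrightarrow> Dom E (far X f) = fob X (Cod \<Delta> f)"
    and Cod_far_SE [simp]: "f \<in> Arr \<Delta> \<Longrightarrow> Cod E (far X f) = fob X (Dom \<Delta> f)"
    and far_Ide_SE [simp]: "far X (Ide \<Delta> n) = \<i> (fob X n)"
    and far_Comp_SE [simp]: "f \<in> Arr \<Delta> \<Longrightarrow> g \<in> Arr \<Delta> \<Longrightarrow> Dom \<Delta> g = Cod \<Delta> f \<Longrightarrow> far X (g \<cdot>\<^bsub>\<Delta>\<^esub> f) = far X f \<cdot> far X g"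
    and functor_SE: "is_functor (op_cat \<Delta>) E X"
proof -
  show F: "is_functor (op_cat \<Delta>) E X" using assms unfolding Obj_SE by (rule functorsD)
  show "fob X n \<in> Obj E" "f \<in> Arr \<Delta> \<Longrightarrow> far X f \<in> Arr E" "f \<in> Arr \<Delta> \<Longrightarrow> Dom E (far X f) = fob X (Cod \<Delta> f)"
    "f \<in> Arr \<Delta> \<Longrightarrow> Cod E (far X f) = fob X (Dom \<Delta> f)" "far X (Ide \<Delta> n) = \<i> (fob X n)"
    "f \<in> Arr \<Delta> \<Longrightarrow> g \<in> Arr \<Delta> \<Longrightarrow> Dom \<Delta> g = Cod \<Delta> f \<Longrightarrow> far X (g \<cdot>\<^bsub>\<Delta>\<^esub> f) = far X f \<cdot> far X g"
    using functor_simps[OF F] by simp_all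
qed

lemma
  assumes "t \<in> Arr SE"
  shows Arr_component_SE [simp]: "component t n \<in> Arr E"
    and Dom_component_SE [simp]: "Dom E (component t n) = fob (Dom SE t) n"
    and Cod_component_SE [simp]: "Cod E (component t n) = fob (Cod SE t) n"
    and component_natural_SE: "f \<in> Arr \<Delta> \<Longrightarrow>
      component t (Dom \<Delta> f) \<cdot> far (Dom SE t) f = far (Cod SE t) f \<cdot> component t (Cod \<Delta> f)"
  using component_simps[OF assms[unfolded Arr_SE]] component_natural[OF assms[unfolded Arr_SE]]
  by (simp_all add: Dom_SE Cod_SE)

lemma SE_eqI:
  "s \<in> Arr SE \<Longrightarrow> t \<in> Arr SE \<Longrightarrow> Dom SE s = Dom SE t \<Longrightarrow> Cod SE s = Cod SE t \<Longrightarrow>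
   (\<And>n. component s n = component t n) \<Longrightarrow> s = t"
  unfolding Arr_SE Dom_SE Cod_SE by (rule nat_transs_eqI)

lemma is_iso_SE: "t \<in> Arr SE \<Longrightarrow> (\<And>n. is_iso E (component t n)) \<Longrightarrow> is_iso SE t"
  using is_iso_functor_cat(1)[OF category_op_cat[OF category_Delta]] unfolding Arr_SE by (simp add: Simplicial_def)

lemma SE_simps [simp]:
  "component (Ide SE X) n = \<i> (fob X n)"
  "component (s \<cdot>\<^bsub>SE\<^esub> t) n = component s n \<cdot> component t n"
  "fob (X \<otimes>\<^bsub>SE\<^esub> Y) n = fob X n \<otimes> fob Y n"
  "f \<in> Arr \<Delta> \<Longrightarrow> far (X \<otimes>\<^bsub>SE\<^esub> Y) f = far X f \<odot> far Y f"
  "component (s \<odot>\<^bsub>SE\<^esub> t) n = component s n \<odot> component t n"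
  "fob (Unit SE) n = \<u>"
  "f \<in> Arr \<Delta> \<Longrightarrow> far (Unit SE) f = \<i> \<u>"
  "component (Assoc SE X Y Z) n = \<alpha> (fob X n) (fob Y n) (fob Z n)"
  "component (LUnit SE X) n = \<l> (fob X n)"
  "component (RUnit SE X) n = \<r> (fob X n)"
  "component (Swap SE X Y) n = \<s> (fob X n) (fob Y n)"
  by (simp_all add: Simplicial_def)

lemma
  assumes X: "X \<in> Obj SE"
  shows leg_universal: "universal_family UNIV (leg X) (coend_relations \<Delta> X C) (R X)"
    and Obj_R [simp]: "R X \<in> Obj E"
    and Arr_leg [simp]: "leg X n \<in> Arr E" and Dom_leg [simp]: "Dom E (leg X n) = fob X n \<otimes> fob C n"
    and Cod_leg [simp]: "Cod E (leg X n) = R X"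
    and leg_dinatural: "f \<in> Arr \<Delta> \<Longrightarrow> Dom \<Delta> f = m \<Longrightarrow> Cod \<Delta> f = n \<Longrightarrow>
      leg X m \<cdot> (far X f \<odot> \<i> (fob C m)) = leg X n \<cdot> (\<i> (fob X n) \<odot> far C f)"
proof -
  have R: "tensor_over \<Delta> E X C = R X" by (simp add: realisation_def)
  show u: "universal_family UNIV (leg X) (coend_relations \<Delta> X C) (R X)"
    using tensor_over_universal(1)[OF functor_SE[OF X] functor_C] unfolding R by simp
  show "R X \<in> Obj E" by (rule Obj_universal[OF u])
  show "leg X n \<in> Arr E" by (rule Arr_universal[OF u]) simp
  show "Cod E (leg X n) = R X" by (rule Cod_universal[OF u]) simp
  show "Dom E (leg X n) = fob X n \<otimes> fob C n"
    using tensor_over_universal(2)[OF functor_SE[OF X] functor_C] by simp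
  show "f \<in> Arr \<Delta> \<Longrightarrow> Dom \<Delta> f = m \<Longrightarrow> Cod \<Delta> f = n \<Longrightarrow>
      leg X m \<cdot> (far X f \<odot> \<i> (fob C m)) = leg X n \<cdot> (\<i> (fob X n) \<odot> far C f)"
    using relation_universal[OF u, of "Dom \<Delta> f" "far X f \<odot> \<i> (fob C (Dom \<Delta> f))" "Cod \<Delta> f" "\<i> (fob X (Cod \<Delta> f)) \<odot> far C f"]
    by (auto simp: coend_relations_def)
qed

lemma leg_jointly_epic: "X \<in> Obj SE \<Longrightarrow> jointly_epic UNIV (leg X) (R X)"
  by (rule universal_family_jointly_epic[OF leg_universal])

lemma
  assumes t: "t \<in> Arr SE"
  shows Arr_RA [simp]: "RA t \<in> Arr E" and Dom_RA [simp]: "Dom E (RA t) = R (Dom SE t)"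
    and Cod_RA [simp]: "Cod E (RA t) = R (Cod SE t)"
    and RA_leg: "X = Dom SE t \<Longrightarrow> RA t \<cdot> leg X n = leg (Cod SE t) n \<cdot> (component t n \<odot> \<i> (fob C n))"
proof -
  have X: "Dom SE t \<in> Obj SE" and Y: "Cod SE t \<in> Obj SE" using t by auto
  let ?v = "\<lambda>n. leg (Cod SE t) n \<cdot> (component t n \<odot> \<i> (fob C n))"
  have w: "is_wedge \<Delta> E (external_tensor E (Dom SE t) C) (R (Cod SE t)) ?v"
    unfolding is_wedge_iff[OF functor_SE[OF X] functor_C]
  proof (intro conjI ballI)
    fix f assume f: "f \<in> Arr \<Delta>"
    let ?m = "Dom \<Delta> f" and ?n = "Cod \<Delta> f"
    have "?v ?m \<cdot> (far (Dom SE t) f \<odot> \<i> (fob C ?m)) =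
        leg (Cod SE t) ?m \<cdot> ((component t ?m \<cdot> far (Dom SE t) f) \<odot> \<i> (fob C ?m))"
      using f t X Y by simp
    also have "\<dots> = (leg (Cod SE t) ?m \<cdot> (far (Cod SE t) f \<odot> \<i> (fob C ?m))) \<cdot> (component t ?n \<odot> \<i> (fob C ?m))"
      using f t X Y by (simp add: component_natural_SE)
    also have "\<dots> = ?v ?n \<cdot> (\<i> (fob (Dom SE t) ?n) \<odot> far C f)"
      using f t X Y by (simp add: leg_dinatural)
    finally show "?v ?m \<cdot> (far (Dom SE t) f \<odot> \<i> (fob C ?m)) = ?v ?n \<cdot> (\<i> (fob (Dom SE t) ?n) \<odot> far C f)" .
  qed (use t X Y in auto)
  note d = tensor_over_desc[OF functor_SE[OF X] functor_C w]
  have RA: "RA t = tensor_over_desc \<Delta> E (Dom SE t) C (R (Cod SE t)) ?v"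
    by (simp add: realisation_def Dom_SE Cod_SE)
  have R: "tensor_over \<Delta> E X C = R X" for X by (simp add: realisation_def)
  show "RA t \<in> Arr E" "Dom E (RA t) = R (Dom SE t)" "Cod E (RA t) = R (Cod SE t)"
    using d(1) unfolding RA R by auto
  show "X = Dom SE t \<Longrightarrow> RA t \<cdot> leg X n = ?v n" unfolding RA using d(2)[of n] by simp
qed

lemma is_functor_realisation: "is_functor SE E (realisation E C)"
proof (rule is_functorI)
  fix X assume X: "X \<in> Obj SE"
  show "RA (Ide SE X) = \<i> (R X)"
    by (rule jointly_epicD[OF leg_jointly_epic[OF X]]) (use X in \<open>auto simp: RA_leg\<close>)
next
  fix s t assume s: "s \<in> Arr SE" and t: "t \<in> Arr SE" and st: "Dom SE t = Cod SE s"
  have X: "Dom SE s \<in> Obj SE" using s by auto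
  show "RA (t \<cdot>\<^bsub>SE\<^esub> s) = RA t \<cdot> RA s"
  proof (rule jointly_epicD[OF leg_jointly_epic[OF X]])
    fix n
    have "RA (t \<cdot>\<^bsub>SE\<^esub> s) \<cdot> leg (Dom SE s) n = leg (Cod SE t) n \<cdot> ((component t n \<cdot> component s n) \<odot> \<i> (fob C n))"
      by (subst RA_leg) (use s t st in auto)
    also have "\<dots> = (RA t \<cdot> leg (Cod SE s) n) \<cdot> (component s n \<odot> \<i> (fob C n))"
      using s t st by (simp add: RA_leg[OF t])
    also have "\<dots> = (RA t \<cdot> RA s) \<cdot> leg (Dom SE s) n"
      using s t st X by (simp add: RA_leg[OF s])
    finally show "RA (t \<cdot>\<^bsub>SE\<^esub> s) \<cdot> leg (Dom SE s) n = (RA t \<cdot> RA s) \<cdot> leg (Dom SE s) n" .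
  qed (use s t st in auto)
qed (auto simp: SE.category_axioms category_axioms)

lemmas RA_Ide [simp] = Ide_functor[OF is_functor_realisation]
lemmas RA_Comp = Comp_functor[OF is_functor_realisation]

lemma RA_Comp': "s \<in> Arr SE \<Longrightarrow> t \<in> Arr SE \<Longrightarrow> Dom SE t = Cod SE s \<Longrightarrow> x \<in> Arr E \<Longrightarrow> Cod E x = R (Dom SE s) \<Longrightarrow>
   RA t \<cdot> (RA s \<cdot> x) = RA (t \<cdot>\<^bsub>SE\<^esub> s) \<cdot> x"
  by (subst RA_Comp) auto

lemma is_iso_RA [simp]: "is_iso SE t \<Longrightarrow> is_iso E (RA t)"
  by (rule functor_iso(1)[OF is_functor_realisation])


section \<open>Maps of realisations with parameters\<close>

text \<open>A natural family \<open>A \<otimes> V n \<rightarrow> W n\<close> induces a map \<open>A \<otimes> |V| \<rightarrow> |W|\<close>, because tensoring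
  with \<open>A\<close> preserves the coend.\<close>

definition action :: "'o \<Rightarrow> ('o, 'a) simplicial \<Rightarrow> ('o, 'a) simplicial \<Rightarrow> (nat \<Rightarrow> 'a) \<Rightarrow> bool" where
  "action A V W \<phi> \<longleftrightarrow> A \<in> Obj E \<and> V \<in> Obj SE \<and> W \<in> Obj SE \<and> (\<forall>n. \<phi> n \<in> Hom E (A \<otimes> fob V n) (fob W n)) \<and>
     (\<forall>f\<in>Arr \<Delta>. \<phi> (Dom \<Delta> f) \<cdot> (\<i> A \<odot> far V f) = far W f \<cdot> \<phi> (Cod \<Delta> f))"

definition realised_action :: "'o \<Rightarrow> ('o, 'a) simplicial \<Rightarrow> ('o, 'a) simplicial \<Rightarrow> (nat \<Rightarrow> 'a) \<Rightarrow> 'a" where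
  "realised_action A V W \<phi> = (THE h. h \<in> Hom E (A \<otimes> R V) (R W) \<and>
     (\<forall>n\<in>UNIV. h \<cdot> (\<i> A \<odot> leg V n) = leg W n \<cdot> ((\<phi> n \<odot> \<i> (fob C n)) \<cdot> \<alpha>' A (fob V n) (fob C n))))"

lemma actionI:
  assumes "A \<in> Obj E" "V \<in> Obj SE" "W \<in> Obj SE" "\<And>n. \<phi> n \<in> Hom E (A \<otimes> fob V n) (fob W n)"
    and "\<And>f. f \<in> Arr \<Delta> \<Longrightarrow> \<phi> (Dom \<Delta> f) \<cdot> (\<i> A \<odot> far V f) = far W f \<cdot> \<phi> (Cod \<Delta> f)"
  shows "action A V W \<phi>"
  using assms unfolding action_def by blast

lemma actionD:
  assumes "action A V W \<phi>"
  shows "A \<in> Obj E" "V \<in> Obj SE" "W \<in> Obj SE" "\<phi> n \<in> Arr E" "Dom E (\<phi> n) = A \<otimes> fob V n" "Cod E (\<phi> n) = fob W n"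
    and action_natural: "f \<in> Arr \<Delta> \<Longrightarrow> \<phi> (Dom \<Delta> f) \<cdot> (\<i> A \<odot> far V f) = far W f \<cdot> \<phi> (Cod \<Delta> f)"
  using assms by (auto simp: action_def)

lemma action_jointly_epic: "A \<in> Obj E \<Longrightarrow> V \<in> Obj SE \<Longrightarrow> jointly_epic UNIV (\<lambda>n. \<i> A \<odot> leg V n) (A \<otimes> R V)"
  by (rule jointly_epic_tens_left[OF leg_jointly_epic]) auto

lemma
  assumes a: "action A V W \<phi>"
  shows Arr_realised: "realised_action A V W \<phi> \<in> Arr E"
    and Dom_realised: "Dom E (realised_action A V W \<phi>) = A \<otimes> R V"
    and Cod_realised: "Cod E (realised_action A V W \<phi>) = R W"
    and realised_leg: "realised_action A V W \<phi> \<cdot> (\<i> A \<odot> leg V n) = leg W n \<cdot> ((\<phi> n \<odot> \<i> (fob C n)) \<cdot> \<alpha>' A (fob V n) (fob C n))"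
proof -
  note [simp] = actionD(1-6)[OF a]
  let ?v = "\<lambda>n. leg W n \<cdot> ((\<phi> n \<odot> \<i> (fob C n)) \<cdot> \<alpha>' A (fob V n) (fob C n))"
  have *: "\<exists>!h. h \<in> Hom E (A \<otimes> R V) (R W) \<and> (\<forall>n\<in>UNIV. h \<cdot> (\<i> A \<odot> leg V n) = ?v n)"
  proof (rule unique_universal[OF universal_family_tens_left[OF leg_universal]])
    fix i x j y assume "(i, x, j, y) \<in> (\<lambda>(i, x, j, y). (i, \<i> A \<odot> x, j, \<i> A \<odot> y)) ` coend_relations \<Delta> V C"
    then obtain f where f: "f \<in> Arr \<Delta>" "i = Dom \<Delta> f" "j = Cod \<Delta> f"
      "x = \<i> A \<odot> (far V f \<odot> \<i> (fob C (Dom \<Delta> f)))" "y = \<i> A \<odot> (\<i> (fob V (Cod \<Delta> f)) \<odot> far C f)"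
      by (auto simp: coend_relations_def)
    have "?v i \<cdot> x = leg W i \<cdot> (((\<phi> i \<cdot> (\<i> A \<odot> far V f)) \<odot> \<i> (fob C i)) \<cdot> \<alpha>' A (fob V j) (fob C i))"
      using f by (simp add: assoc_inv_natural)
    also have "\<dots> = (leg W i \<cdot> (far W f \<odot> \<i> (fob C i))) \<cdot> ((\<phi> j \<odot> \<i> (fob C i)) \<cdot> \<alpha>' A (fob V j) (fob C i))"
      using f by (simp add: action_natural[OF a])
    also have "\<dots> = leg W j \<cdot> ((\<phi> j \<odot> far C f) \<cdot> \<alpha>' A (fob V j) (fob C i))"
      using f by (simp add: leg_dinatural)
    also have "\<dots> = ?v j \<cdot> y"
      using f assoc_inv_natural[of "\<i> A" "\<i> (fob V j)" "far C f" A "fob V j" "fob C j"] by simp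
    finally show "?v i \<cdot> x = ?v j \<cdot> y" .
  qed auto
  show "realised_action A V W \<phi> \<in> Arr E" "Dom E (realised_action A V W \<phi>) = A \<otimes> R V"
    "Cod E (realised_action A V W \<phi>) = R W" "realised_action A V W \<phi> \<cdot> (\<i> A \<odot> leg V n) = ?v n"
    unfolding realised_action_def using desc_eqI(1)[OF *] desc_eqI(2)[OF *, of n] by simp_all
qed

lemmas realised_simps = Arr_realised Dom_realised Cod_realised

lemma realised_eqI:
  assumes a: "action A V W \<phi>" and h: "h \<in> Hom E (A \<otimes> R V) (R W)"
    and "\<And>n. h \<cdot> (\<i> A \<odot> leg V n) = leg W n \<cdot> ((\<phi> n \<odot> \<i> (fob C n)) \<cdot> \<alpha>' A (fob V n) (fob C n))"
  shows "h = realised_action A V W \<phi>"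
  by (rule jointly_epicD[OF action_jointly_epic[OF actionD(1,2)[OF a]]])
     (use assms realised_simps[OF a] realised_leg[OF a] in auto)

text \<open>Realised actions compose in the same way as the families from which they come: with maps of
  simplicial objects on either side, with a change of parameter, and with each other.\<close>

lemma action_postcomp: "action A V W \<phi> \<Longrightarrow> t \<in> Hom SE W W' \<Longrightarrow> action A V W' (\<lambda>n. component t n \<cdot> \<phi> n)"
  by (rule actionI) (auto simp: actionD action_natural reassoc[OF component_natural_SE])

lemma realised_postcomp:
  assumes a: "action A V W \<phi>" and t: "t \<in> Hom SE W W'"
  shows "RA t \<cdot> realised_action A V W \<phi> = realised_action A V W' (\<lambda>n. component t n \<cdot> \<phi> n)"
proof (rule realised_eqI[OF action_postcomp[OF a t]])
  note [simp] = actionD(1-6)[OF a] realised_simps[OF a]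
  fix n show "(RA t \<cdot> realised_action A V W \<phi>) \<cdot> (\<i> A \<odot> leg V n) =
      leg W' n \<cdot> (((component t n \<cdot> \<phi> n) \<odot> \<i> (fob C n)) \<cdot> \<alpha>' A (fob V n) (fob C n))"
    using t by (auto simp: realised_leg[OF a] reassoc[OF RA_leg[OF _ refl]])
qed (use t actionD[OF a] realised_simps[OF a] in auto)

lemma action_precomp: "action A V W \<phi> \<Longrightarrow> t \<in> Hom SE V' V \<Longrightarrow> action A V' W (\<lambda>n. \<phi> n \<cdot> (\<i> A \<odot> component t n))"
proof (rule actionI)
  fix f assume a: "action A V W \<phi>" and t: "t \<in> Hom SE V' V" and f: "f \<in> Arr \<Delta>"
  have "\<phi> (Dom \<Delta> f) \<cdot> (\<i> A \<odot> (far V f \<cdot> component t (Cod \<Delta> f))) = far W f \<cdot> (\<phi> (Cod \<Delta> f) \<cdot> (\<i> A \<odot> component t (Cod \<Delta> f)))"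
    using t f actionD(1-6)[OF a] reassoc[OF action_natural[OF a f], of "\<i> A \<odot> component t (Cod \<Delta> f)"] by auto
  then show "(\<phi> (Dom \<Delta> f) \<cdot> (\<i> A \<odot> component t (Dom \<Delta> f))) \<cdot> (\<i> A \<odot> far V' f) =
      far W f \<cdot> (\<phi> (Cod \<Delta> f) \<cdot> (\<i> A \<odot> component t (Cod \<Delta> f)))"
    using t f actionD(1-6)[OF a] component_natural_SE[of t f] by auto
qed (auto simp: actionD)

lemma realised_precomp:
  assumes a: "action A V W \<phi>" and t: "t \<in> Hom SE V' V"
  shows "realised_action A V W \<phi> \<cdot> (\<i> A \<odot> RA t) = realised_action A V' W (\<lambda>n. \<phi> n \<cdot> (\<i> A \<odot> component t n))"
proof (rule realised_eqI[OF action_precomp[OF a t]])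
  note [simp] = actionD(1-6)[OF a] realised_simps[OF a]
  have [simp]: "t \<in> Arr SE" "Dom SE t = V'" "Cod SE t = V" "V' \<in> Obj SE" using t by auto
  fix n
  have "(realised_action A V W \<phi> \<cdot> (\<i> A \<odot> RA t)) \<cdot> (\<i> A \<odot> leg V' n) =
      (realised_action A V W \<phi> \<cdot> (\<i> A \<odot> leg V n)) \<cdot> (\<i> A \<odot> (component t n \<odot> \<i> (fob C n)))"
    by (simp add: RA_leg)
  also have "\<dots> = leg W n \<cdot> (((\<phi> n \<cdot> (\<i> A \<odot> component t n)) \<odot> \<i> (fob C n)) \<cdot> \<alpha>' A (fob V' n) (fob C n))"
    unfolding realised_leg[OF a] by (simp add: assoc_inv_natural)
  finally show "(realised_action A V W \<phi> \<cdot> (\<i> A \<odot> RA t)) \<cdot> (\<i> A \<odot> leg V' n) =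
      leg W n \<cdot> (((\<phi> n \<cdot> (\<i> A \<odot> component t n)) \<odot> \<i> (fob C n)) \<cdot> \<alpha>' A (fob V' n) (fob C n))" .
qed (use t actionD[OF a] realised_simps[OF a] in auto)

lemma action_parameter: "action A V W \<phi> \<Longrightarrow> h \<in> Hom E A' A \<Longrightarrow> action A' V W (\<lambda>n. \<phi> n \<cdot> (h \<odot> \<i> (fob V n)))"
proof (rule actionI)
  fix f assume a: "action A V W \<phi>" and h: "h \<in> Hom E A' A" and f: "f \<in> Arr \<Delta>"
  have "(\<phi> (Dom \<Delta> f) \<cdot> (h \<odot> \<i> (fob V (Dom \<Delta> f)))) \<cdot> (\<i> A' \<odot> far V f) =
     (\<phi> (Dom \<Delta> f) \<cdot> (\<i> A \<odot> far V f)) \<cdot> (h \<odot> \<i> (fob V (Cod \<Delta> f)))"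
    using f h actionD(1-6)[OF a] by auto
  then show "(\<phi> (Dom \<Delta> f) \<cdot> (h \<odot> \<i> (fob V (Dom \<Delta> f)))) \<cdot> (\<i> A' \<odot> far V f) =
     far W f \<cdot> (\<phi> (Cod \<Delta> f) \<cdot> (h \<odot> \<i> (fob V (Cod \<Delta> f))))"
    unfolding action_natural[OF a f] using f h actionD(1-6)[OF a] by auto
qed (auto simp: actionD)

lemma realised_parameter:
  assumes a: "action A V W \<phi>" and h: "h \<in> Hom E A' A"
  shows "realised_action A V W \<phi> \<cdot> (h \<odot> \<i> (R V)) = realised_action A' V W (\<lambda>n. \<phi> n \<cdot> (h \<odot> \<i> (fob V n)))"
proof (rule realised_eqI[OF action_parameter[OF a h]])
  note [simp] = actionD(1-6)[OF a] realised_simps[OF a]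
  have [simp]: "h \<in> Arr E" "Dom E h = A'" "Cod E h = A" "A' \<in> Obj E" using h by auto
  fix n
  have "(realised_action A V W \<phi> \<cdot> (h \<odot> \<i> (R V))) \<cdot> (\<i> A' \<odot> leg V n) =
      (realised_action A V W \<phi> \<cdot> (\<i> A \<odot> leg V n)) \<cdot> (h \<odot> \<i> (fob V n \<otimes> fob C n))"
    by simp
  also have "\<dots> = leg W n \<cdot> (((\<phi> n \<cdot> (h \<odot> \<i> (fob V n))) \<odot> \<i> (fob C n)) \<cdot> \<alpha>' A' (fob V n) (fob C n))"
    unfolding realised_leg[OF a] by (simp add: assoc_inv_natural_ide)
  finally show "(realised_action A V W \<phi> \<cdot> (h \<odot> \<i> (R V))) \<cdot> (\<i> A' \<odot> leg V n) =
      leg W n \<cdot> (((\<phi> n \<cdot> (h \<odot> \<i> (fob V n))) \<odot> \<i> (fob C n)) \<cdot> \<alpha>' A' (fob V n) (fob C n))" .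
qed (use h actionD[OF a] realised_simps[OF a] in auto)

lemma action_action:
  assumes a: "action A V W \<phi>" and b: "action B Z V \<psi>"
  shows "action (A \<otimes> B) Z W (\<lambda>n. \<phi> n \<cdot> ((\<i> A \<odot> \<psi> n) \<cdot> \<alpha> A B (fob Z n)))"
proof (rule actionI)
  note [simp] = actionD(1-6)[OF a] actionD(1-6)[OF b]
  fix f assume f: "f \<in> Arr \<Delta>"
  let ?m = "Dom \<Delta> f" and ?n = "Cod \<Delta> f"
  have "(\<phi> ?m \<cdot> ((\<i> A \<odot> \<psi> ?m) \<cdot> \<alpha> A B (fob Z ?m))) \<cdot> (\<i> (A \<otimes> B) \<odot> far Z f) =
     \<phi> ?m \<cdot> ((\<i> A \<odot> (\<psi> ?m \<cdot> (\<i> B \<odot> far Z f))) \<cdot> \<alpha> A B (fob Z ?n))"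
    using f by (simp add: assoc_natural_ide)
  also have "\<dots> = (\<phi> ?m \<cdot> (\<i> A \<odot> far V f)) \<cdot> ((\<i> A \<odot> \<psi> ?n) \<cdot> \<alpha> A B (fob Z ?n))"
    unfolding action_natural[OF b f] using f by simp
  also have "\<dots> = far W f \<cdot> (\<phi> ?n \<cdot> ((\<i> A \<odot> \<psi> ?n) \<cdot> \<alpha> A B (fob Z ?n)))"
    unfolding action_natural[OF a f] using f by simp
  finally show "(\<phi> ?m \<cdot> ((\<i> A \<odot> \<psi> ?m) \<cdot> \<alpha> A B (fob Z ?m))) \<cdot> (\<i> (A \<otimes> B) \<odot> far Z f) =
      far W f \<cdot> (\<phi> ?n \<cdot> ((\<i> A \<odot> \<psi> ?n) \<cdot> \<alpha> A B (fob Z ?n)))" .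
qed (use a b in \<open>auto simp: actionD\<close>)

lemma realised_realised:
  assumes a: "action A V W \<phi>" and b: "action B Z V \<psi>"
  shows "realised_action A V W \<phi> \<cdot> (\<i> A \<odot> realised_action B Z V \<psi>) =
    realised_action (A \<otimes> B) Z W (\<lambda>n. \<phi> n \<cdot> ((\<i> A \<odot> \<psi> n) \<cdot> \<alpha> A B (fob Z n))) \<cdot> \<alpha>' A B (R Z)"
proof -
  note [simp] = actionD(1-6)[OF a] actionD(1-6)[OF b] realised_simps[OF a] realised_simps[OF b]
  note ab = action_action[OF a b]
  have "(realised_action A V W \<phi> \<cdot> (\<i> A \<odot> realised_action B Z V \<psi>)) \<cdot> \<alpha> A B (R Z) =
    realised_action (A \<otimes> B) Z W (\<lambda>n. \<phi> n \<cdot> ((\<i> A \<odot> \<psi> n) \<cdot> \<alpha> A B (fob Z n)))"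
  proof (rule realised_eqI[OF ab])
    fix n
    have "((realised_action A V W \<phi> \<cdot> (\<i> A \<odot> realised_action B Z V \<psi>)) \<cdot> \<alpha> A B (R Z)) \<cdot> (\<i> (A \<otimes> B) \<odot> leg Z n) =
      realised_action A V W \<phi> \<cdot> ((\<i> A \<odot> (realised_action B Z V \<psi> \<cdot> (\<i> B \<odot> leg Z n))) \<cdot> \<alpha> A B (fob Z n \<otimes> fob C n))"
      by (simp add: assoc_natural_ide)
    also have "\<dots> = (realised_action A V W \<phi> \<cdot> (\<i> A \<odot> leg V n)) \<cdot> ((\<i> A \<odot> ((\<psi> n \<odot> \<i> (fob C n)) \<cdot> \<alpha>' B (fob Z n) (fob C n))) \<cdot>
        \<alpha> A B (fob Z n \<otimes> fob C n))"
      unfolding realised_leg[OF b] by simp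
    also have "\<dots> = leg W n \<cdot> (((\<phi> n \<cdot> (\<i> A \<odot> \<psi> n)) \<odot> \<i> (fob C n)) \<cdot>
        (\<alpha>' A (B \<otimes> fob Z n) (fob C n) \<cdot> ((\<i> A \<odot> \<alpha>' B (fob Z n) (fob C n)) \<cdot> \<alpha> A B (fob Z n \<otimes> fob C n))))"
      unfolding realised_leg[OF a] by (simp add: reassoc[OF assoc_inv_natural_Comp])
    also have "\<dots> = leg W n \<cdot> (((\<phi> n \<cdot> ((\<i> A \<odot> \<psi> n) \<cdot> \<alpha> A B (fob Z n))) \<odot> \<i> (fob C n)) \<cdot>
       (((\<alpha>' A B (fob Z n) \<odot> \<i> (fob C n)) \<cdot> (\<alpha>' A (B \<otimes> fob Z n) (fob C n) \<cdot> (\<i> A \<odot> \<alpha>' B (fob Z n) (fob C n)))) \<cdot>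
          \<alpha> A B (fob Z n \<otimes> fob C n)))"
      by simp
    also have "\<dots> = leg W n \<cdot> (((\<phi> n \<cdot> ((\<i> A \<odot> \<psi> n) \<cdot> \<alpha> A B (fob Z n))) \<odot> \<i> (fob C n)) \<cdot> \<alpha>' (A \<otimes> B) (fob Z n) (fob C n))"
      by (subst pentagon_inverse) simp_all
    finally show "((realised_action A V W \<phi> \<cdot> (\<i> A \<odot> realised_action B Z V \<psi>)) \<cdot> \<alpha> A B (R Z)) \<cdot> (\<i> (A \<otimes> B) \<odot> leg Z n) =
      leg W n \<cdot> (((\<phi> n \<cdot> ((\<i> A \<odot> \<psi> n) \<cdot> \<alpha> A B (fob Z n))) \<odot> \<i> (fob C n)) \<cdot> \<alpha>' (A \<otimes> B) (fob Z n) (fob C n))" .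
  qed simp
  then show ?thesis by (rule iso_move_right[rotated 3]) simp_all
qed

lemma realised_lunit:
  assumes [simp]: "V \<in> Obj SE"
  shows "realised_action \<u> V V (\<lambda>n. \<l> (fob V n)) = \<l> (R V)"
proof (rule realised_eqI[symmetric])
  show "action \<u> V V (\<lambda>n. \<l> (fob V n))" by (rule actionI) (auto simp: lunit_natural)
  show "\<l> (R V) \<cdot> (\<i> \<u> \<odot> leg V n) = leg V n \<cdot> ((\<l> (fob V n) \<odot> \<i> (fob C n)) \<cdot> \<alpha>' \<u> (fob V n) (fob C n))" for n
    by (simp add: lunit_natural lunit_tens[symmetric])
qed simp

end


section \<open>Realisations of standard simplices\<close>

context realisation_setting
begin

text \<open>\<open>S m\<close> is the free simplicial object on the standard simplex.  In degree \<open>k\<close> it is a coproduct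
  of units, one for every arrow \<open>f\<close> from \<open>k\<close> to \<open>m\<close>, with injection \<open>elem m k f\<close>.\<close>

abbreviation S :: "nat \<Rightarrow> ('o, 'a) simplicial" where "S \<equiv> fob (simplex_E U E)"
abbreviation SA :: "simplex_arr \<Rightarrow> ('o, 'a) simplicial_map" where "SA \<equiv> far (simplex_E U E)"
abbreviation elem :: "nat \<Rightarrow> nat \<Rightarrow> simplex_arr \<Rightarrow> 'a" where "elem m k f \<equiv> simplex_in U E m k f"
abbreviation yon :: "nat \<Rightarrow> 'a" where "yon m \<equiv> yoneda_iso U E C m"

lemma is_functor_simp_copower: "is_functor sSet SE (simp_copower E)"
  unfolding Simplicial_def simp_copower_def
  by (rule is_functor_postcomp[OF is_functor_copower SetU.symmetric_monoidal_category_axioms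
        symmetric_monoidal_category_axioms category_op_cat[OF category_Delta]])

lemma is_functor_yoneda: "is_functor \<Delta> sSet yoneda"
proof (rule is_functorI)
  show "category \<Delta>" by (rule category_Delta)
  show "category sSet" by (rule SS.category_axioms)
  show "fob yoneda n \<in> Obj sSet" for n using simplex_in_functors by (simp add: Simplicial_def)
  show "far yoneda f \<in> Hom sSet (fob yoneda (Dom \<Delta> f)) (fob yoneda (Cod \<Delta> f))" if "f \<in> Arr \<Delta>" for f
    using yoneda_in_nat_transs[OF that] by (simp add: Simplicial_def)
next
  fix n
  note y = yoneda_in_nat_transs[of "Ide \<Delta> n", simplified]
  note i = SetU.Ide_in_nat_transs[OF category_op_cat[OF category_Delta] simplex_in_functors[of n]]
  have "far yoneda (Ide \<Delta> n) = Ide (functor_cat (op_cat \<Delta>) SetU) (simplex n)"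
  proof (rule nat_transs_eqI[OF y i])
    fix k show "component (far yoneda (Ide \<Delta> n)) k = component (Ide (functor_cat (op_cat \<Delta>) SetU) (simplex n)) k"
      by (rule Sets_eqI) (use Arr_component[OF y, of k] in auto)
  qed auto
  then show "far yoneda (Ide \<Delta> n) = Ide sSet (fob yoneda n)" by (simp add: Simplicial_def)
next
  fix f g assume f: "f \<in> Arr \<Delta>" and g: "g \<in> Arr \<Delta>" and fg: "Dom \<Delta> g = Cod \<Delta> f"
  note yf = yoneda_in_nat_transs[OF f] and yg = yoneda_in_nat_transs[OF g]
  note y = yoneda_in_nat_transs[of "g \<cdot>\<^bsub>\<Delta>\<^esub> f", simplified Delta.Arr_Comp[OF f g fg], OF TrueI]
  note c = SetU.Comp_in_nat_transs[OF category_op_cat[OF category_Delta] yg yf]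
  have "far yoneda (g \<cdot>\<^bsub>\<Delta>\<^esub> f) = far yoneda g \<cdot>\<^bsub>functor_cat (op_cat \<Delta>) SetU\<^esub> far yoneda f"
  proof (rule nat_transs_eqI[OF y c])
    fix k show "component (far yoneda (g \<cdot>\<^bsub>\<Delta>\<^esub> f)) k = component (far yoneda g \<cdot>\<^bsub>functor_cat (op_cat \<Delta>) SetU\<^esub> far yoneda f) k"
      by (rule Sets_eqI) (use f g fg Arr_component[OF y, of k] Arr_component[OF yf, of k] Arr_component[OF yg, of k] in auto)
  qed (use f g fg in auto)
  then show "far yoneda (g \<cdot>\<^bsub>\<Delta>\<^esub> f) = far yoneda g \<cdot>\<^bsub>sSet\<^esub> far yoneda f" by (simp add: Simplicial_def)
qed

lemma is_functor_simplex_E: "is_functor \<Delta> SE (simplex_E U E)"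
  unfolding simplex_E_def by (rule is_functor_comp[OF is_functor_yoneda is_functor_simp_copower])

lemmas SE_functor_simps [simp] = functor_simps[OF is_functor_simplex_E, simplified]

lemma fob_S: "fob (S m) k = copower E (code ` Hom \<Delta> k m :: 'u set)"
  by (simp add: simplex_E_def simp_copower_def)

lemma
  assumes "f \<in> Arr \<Delta>" "Dom \<Delta> f = k" "Cod \<Delta> f = m"
  shows Arr_elem [simp]: "elem m k f \<in> Arr E" and Dom_elem [simp]: "Dom E (elem m k f) = \<u>"
    and Cod_elem [simp]: "Cod E (elem m k f) = fob (S m) k"
  using assms by (auto simp: simplex_in_def fob_S)

lemma elem_jointly_epic: "jointly_epic (Hom \<Delta> k m) (elem m k) (fob (S m) k)"
proof (rule jointly_epicI)
  fix h h' B assume h: "h \<in> Hom E (fob (S m) k) B" and h': "h' \<in> Hom E (fob (S m) k) B"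
    and eq: "\<And>i. i \<in> Hom \<Delta> k m \<Longrightarrow> h \<cdot> elem m k i = h' \<cdot> elem m k i"
  show "h = h'"
    by (rule jointly_epicD[OF copower_jointly_epic[OF small_simplex, of k m]])
       (use h h' eq in \<open>auto simp: fob_S simplex_in_def\<close>)
qed auto

lemma far_S_elem:
  assumes "g \<in> Arr \<Delta>" "f \<in> Arr \<Delta>" "Dom \<Delta> f = Cod \<Delta> g" "Cod \<Delta> f = m"
  shows "far (S m) g \<cdot> elem m (Cod \<Delta> g) f = elem m (Dom \<Delta> g) (f \<cdot>\<^bsub>\<Delta>\<^esub> g)"
  using copower_in_natural[of "far (simplex m) g" "code f"] assms
  by (simp add: simplex_E_def simp_copower_def simplex_in_def image_iff)

lemma component_SA_elem:
  assumes g: "g \<in> Arr \<Delta>" and "f \<in> Arr \<Delta>" "Dom \<Delta> f = k" "Cod \<Delta> f = Dom \<Delta> g" "m = Dom \<Delta> g"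
  shows "component (SA g) k \<cdot> elem m k f = elem (Cod \<Delta> g) k (g \<cdot>\<^bsub>\<Delta>\<^esub> f)"
  using copower_in_natural[of "component (far yoneda g) k" "code f"] assms Arr_component[OF yoneda_in_nat_transs[OF g], of k]
  by (simp add: simplex_E_def simp_copower_def simplex_in_def image_iff)

lemma
  shows Arr_yon [simp]: "yon m \<in> Arr E" and Dom_yon [simp]: "Dom E (yon m) = fob C m"
    and Cod_yon [simp]: "Cod E (yon m) = R (S m)"
  by (simp_all add: yoneda_iso_def)

text \<open>As an element, \<open>f\<close> is the restriction along \<open>f\<close> of the identity of \<open>m\<close>, so dinaturality of
  the legs turns its leg into \<open>C f\<close>.\<close>

lemma leg_elem:
  assumes f: "f \<in> Arr \<Delta>" "Dom \<Delta> f = k" "Cod \<Delta> f = m"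
  shows "leg (S m) k \<cdot> (elem m k f \<odot> \<i> (fob C k)) = yon m \<cdot> (far C f \<cdot> \<l> (fob C k))"
proof -
  have "yon m \<cdot> (far C f \<cdot> \<l> (fob C k)) =
      leg (S m) m \<cdot> ((elem m m (Ide \<Delta> m) \<odot> \<i> (fob C m)) \<cdot> (\<l>' (fob C m) \<cdot> (far C f \<cdot> \<l> (fob C k))))"
    using f by (simp add: yoneda_iso_def)
  also have "\<dots> = (leg (S m) m \<cdot> (\<i> (fob (S m) m) \<odot> far C f)) \<cdot> (elem m m (Ide \<Delta> m) \<odot> \<i> (fob C k))"
    using f by (simp add: reassoc[OF lunit_inv_natural])
  also have "\<dots> = (leg (S m) k \<cdot> (far (S m) f \<odot> \<i> (fob C k))) \<cdot> (elem m m (Ide \<Delta> m) \<odot> \<i> (fob C k))"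
    using f by (simp only: leg_dinatural[OF _ f] SE_functor_simps Obj_Delta UNIV_I)
  also have "\<dots> = leg (S m) k \<cdot> (elem m k f \<odot> \<i> (fob C k))"
    using f far_S_elem[of f "Ide \<Delta> m" m] by simp
  finally show ?thesis by simp
qed

lemma leg_elem_jointly_epic:
  "jointly_epic (SIGMA k:UNIV. Hom \<Delta> k m) (\<lambda>(k, f). leg (S m) k \<cdot> (elem m k f \<odot> \<i> (fob C k))) (R (S m))"
  by (rule jointly_epic_Comp[OF leg_jointly_epic]) (auto intro!: jointly_epic_tens_right elem_jointly_epic)

text \<open>The co-Yoneda lemma for a standard simplex: the maps \<open>C f\<close> on the summands form a wedge, and
  the map that it induces on the coend is the inverse.\<close>

lemma is_iso_yon [simp]: "is_iso E (yon m)"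
proof -
  have "\<exists>h. h \<in> Hom E (fob (S m) k \<otimes> fob C k) (fob C m) \<and>
      (\<forall>f\<in>Hom \<Delta> k m. h \<cdot> (elem m k f \<odot> \<i> (fob C k)) = far C f \<cdot> \<l> (fob C k))" for k
  proof -
    let ?H = "code ` Hom \<Delta> k m :: 'u set"
    obtain h where "h \<in> Hom E (copower E ?H \<otimes> fob C k) (fob C m)"
      "\<And>c. c \<in> ?H \<Longrightarrow> h \<cdot> (copower_in E ?H c \<odot> \<i> (fob C k)) = far C (decode c) \<cdot> \<l> (fob C k)"
      by (rule universal_desc[OF universal_family_tens_right[OF copower_universal(1)[OF small_simplex, of k m]],
            of "fob C k" "fob C m" "\<lambda>c. far C (decode c) \<cdot> \<l> (fob C k)"]) auto
    then show ?thesis by (intro exI[of _ h]) (auto simp: fob_S simplex_in_def)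
  qed
  then obtain v where v: "\<And>k. v k \<in> Hom E (fob (S m) k \<otimes> fob C k) (fob C m)"
    and ve: "\<And>k f. f \<in> Hom \<Delta> k m \<Longrightarrow> v k \<cdot> (elem m k f \<odot> \<i> (fob C k)) = far C f \<cdot> \<l> (fob C k)"
    by metis
  have rel: "v i \<cdot> x = v j \<cdot> y" if r: "(i, x, j, y) \<in> coend_relations \<Delta> (S m) C" for i x j y
  proof -
    obtain g where g[simp]: "g \<in> Arr \<Delta>" and e: "(i, x, j, y) =
        (Dom \<Delta> g, far (S m) g \<odot> \<i> (fob C (Dom \<Delta> g)), Cod \<Delta> g, \<i> (fob (S m) (Cod \<Delta> g)) \<odot> far C g)"
      using r unfolding coend_relations_def by blast
    then have i: "i = Dom \<Delta> g" and j: "j = Cod \<Delta> g"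
      and x: "x = far (S m) g \<odot> \<i> (fob C i)" and y: "y = \<i> (fob (S m) j) \<odot> far C g"
      by simp_all
    show ?thesis
    proof (rule jointly_epicD[OF jointly_epic_tens_right[OF elem_jointly_epic]])
      fix f assume f: "f \<in> Hom \<Delta> j m"
      have "(v i \<cdot> x) \<cdot> (elem m j f \<odot> \<i> (fob C i)) = v i \<cdot> (elem m i (f \<cdot>\<^bsub>\<Delta>\<^esub> g) \<odot> \<i> (fob C i))"
        using f v[of i] by (simp add: x i j far_S_elem)
      also have "\<dots> = far C f \<cdot> (far C g \<cdot> \<l> (fob C i))"
        using f by (subst ve) (auto simp: i j)
      also have "\<dots> = (v j \<cdot> (elem m j f \<odot> \<i> (fob C j))) \<cdot> (\<i> \<u> \<odot> far C g)"
        unfolding ve[OF f] using f by (simp add: i j lunit_natural)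
      also have "\<dots> = (v j \<cdot> y) \<cdot> (elem m j f \<odot> \<i> (fob C i))"
        using f v[of j] by (simp add: y i j)
      finally show "(v i \<cdot> x) \<cdot> (elem m j f \<odot> \<i> (fob C i)) = (v j \<cdot> y) \<cdot> (elem m j f \<odot> \<i> (fob C i))" .
    qed (use v[of i] v[of j] in \<open>auto simp: x y i j\<close>)
  qed
  obtain h where h: "h \<in> Hom E (R (S m)) (fob C m)" and hl: "\<And>k. h \<cdot> leg (S m) k = v k"
    by (rule universal_desc[OF leg_universal[of "S m"], of "fob C m" v]) (use v rel in auto)
  have hy: "h \<cdot> yon m = \<i> (fob C m)"
  proof -
    have "(h \<cdot> yon m) \<cdot> \<l> (fob C m) = h \<cdot> (leg (S m) m \<cdot> (elem m m (Ide \<Delta> m) \<odot> \<i> (fob C m)))"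
      using h by (simp add: leg_elem)
    also have "\<dots> = v m \<cdot> (elem m m (Ide \<Delta> m) \<odot> \<i> (fob C m))"
      using h by (simp add: reassoc[OF hl])
    also have "\<dots> = \<i> (fob C m) \<cdot> \<l> (fob C m)" by (simp add: ve)
    finally show ?thesis by (rule iso_cancel_right[rotated 5]) (use h in auto)
  qed
  have yh: "yon m \<cdot> h = \<i> (R (S m))"
  proof (rule jointly_epicD[OF leg_elem_jointly_epic])
    fix kf assume "kf \<in> (SIGMA k:UNIV. Hom \<Delta> k m)"
    then obtain k f where kf: "kf = (k, f)" and f: "f \<in> Arr \<Delta>" "Dom \<Delta> f = k" "Cod \<Delta> f = m" by auto
    have "(yon m \<cdot> h) \<cdot> (leg (S m) k \<cdot> (elem m k f \<odot> \<i> (fob C k))) = yon m \<cdot> (v k \<cdot> (elem m k f \<odot> \<i> (fob C k)))"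
      using h f by (simp add: reassoc[OF hl])
    also have "\<dots> = leg (S m) k \<cdot> (elem m k f \<odot> \<i> (fob C k))"
      using f by (simp add: ve leg_elem)
    finally show "(yon m \<cdot> h) \<cdot> (case kf of (k, f) \<Rightarrow> leg (S m) k \<cdot> (elem m k f \<odot> \<i> (fob C k))) =
        \<i> (R (S m)) \<cdot> (case kf of (k, f) \<Rightarrow> leg (S m) k \<cdot> (elem m k f \<odot> \<i> (fob C k)))"
      using f by (simp add: kf)
  qed (use h in auto)
  show ?thesis by (rule is_isoI[OF _ h hy yh]) simp
qed

lemma yon_natural: "g \<in> Arr \<Delta> \<Longrightarrow> RA (SA g) \<cdot> yon (Dom \<Delta> g) = yon (Cod \<Delta> g) \<cdot> far C g"
proof -
  assume g[simp]: "g \<in> Arr \<Delta>"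
  let ?m = "Dom \<Delta> g"
  have "(RA (SA g) \<cdot> yon ?m) \<cdot> \<l> (fob C ?m) = RA (SA g) \<cdot> (leg (S ?m) ?m \<cdot> (elem ?m ?m (Ide \<Delta> ?m) \<odot> \<i> (fob C ?m)))"
    by (simp add: leg_elem)
  also have "\<dots> = leg (S (Cod \<Delta> g)) ?m \<cdot> (elem (Cod \<Delta> g) ?m g \<odot> \<i> (fob C ?m))"
    by (simp add: reassoc[OF RA_leg] component_SA_elem)
  also have "\<dots> = (yon (Cod \<Delta> g) \<cdot> far C g) \<cdot> \<l> (fob C ?m)"
    by (simp add: leg_elem)
  finally show ?thesis by (rule iso_cancel_right[rotated 5]) simp_all
qed

text \<open>The action of a simplicial object on the simplices, and the co-Yoneda description of its
  realisation: up to the isomorphism \<open>yon m\<close>, the leg at \<open>m\<close> is the realised action of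
  \<open>X m\<close>.\<close>

lemma
  assumes X[simp]: "X \<in> Obj SE"
  shows Arr_simplex_action [simp]: "simplex_action U E X m k \<in> Arr E"
    and Dom_simplex_action [simp]: "Dom E (simplex_action U E X m k) = fob X m \<otimes> fob (S m) k"
    and Cod_simplex_action [simp]: "Cod E (simplex_action U E X m k) = fob X k"
    and simplex_action_elem: "f \<in> Arr \<Delta> \<Longrightarrow> Dom \<Delta> f = k \<Longrightarrow> Cod \<Delta> f = m \<Longrightarrow>
      simplex_action U E X m k \<cdot> (\<i> (fob X m) \<odot> elem m k f) = far X f \<cdot> \<r> (fob X m)"
proof -
  let ?H = "code ` Hom \<Delta> k m :: 'u set"
  let ?P = "\<lambda>h. h \<in> Hom E (fob X m \<otimes> fob (S m) k) (fob X k) \<and>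
     (\<forall>f\<in>Hom \<Delta> k m. h \<cdot> (\<i> (fob X m) \<odot> elem m k f) = far X f \<cdot> \<r> (fob X m))"
  obtain h where h: "h \<in> Hom E (fob X m \<otimes> copower E ?H) (fob X k)"
    "\<And>c. c \<in> ?H \<Longrightarrow> h \<cdot> (\<i> (fob X m) \<odot> copower_in E ?H c) = far X (decode c) \<cdot> \<r> (fob X m)"
    by (rule universal_desc[OF universal_family_tens_left[OF copower_universal(1)[OF small_simplex, of k m]],
          of "fob X m" "fob X k" "\<lambda>c. far X (decode c) \<cdot> \<r> (fob X m)"]) auto
  have P: "?P (simplex_action U E X m k)"
    unfolding simplex_action_def
  proof (rule theI[of ?P h])
    show "?P h" using h by (auto simp: fob_S simplex_in_def)
    show "h' = h" if h': "?P h'" for h'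
      by (rule jointly_epicD[OF jointly_epic_tens_left[OF elem_jointly_epic, where D = "fob X m"]])
         (use h' \<open>?P h\<close> in auto)
  qed
  then show "simplex_action U E X m k \<in> Arr E" "Dom E (simplex_action U E X m k) = fob X m \<otimes> fob (S m) k"
    "Cod E (simplex_action U E X m k) = fob X k" by auto
  show "f \<in> Arr \<Delta> \<Longrightarrow> Dom \<Delta> f = k \<Longrightarrow> Cod \<Delta> f = m \<Longrightarrow>
      simplex_action U E X m k \<cdot> (\<i> (fob X m) \<odot> elem m k f) = far X f \<cdot> \<r> (fob X m)"
    using P by auto
qed

lemma elem_tens_jointly_epic: "X \<in> Obj SE \<Longrightarrow> jointly_epic (Hom \<Delta> k m) (\<lambda>f. \<i> (fob X m) \<odot> elem m k f) (fob X m \<otimes> fob (S m) k)"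
  by (rule jointly_epic_tens_left[OF elem_jointly_epic]) auto

lemma simplex_action_action:
  assumes X[simp]: "X \<in> Obj SE" shows "action (fob X m) (S m) X (simplex_action U E X m)"
proof (rule actionI)
  fix g assume g[simp]: "g \<in> Arr \<Delta>"
  show "simplex_action U E X m (Dom \<Delta> g) \<cdot> (\<i> (fob X m) \<odot> far (S m) g) = far X g \<cdot> simplex_action U E X m (Cod \<Delta> g)"
  proof (rule jointly_epicD[OF elem_tens_jointly_epic[OF X]])
    fix f assume "f \<in> Hom \<Delta> (Cod \<Delta> g) m"
    then show "(simplex_action U E X m (Dom \<Delta> g) \<cdot> (\<i> (fob X m) \<odot> far (S m) g)) \<cdot> (\<i> (fob X m) \<odot> elem m (Cod \<Delta> g) f) =
        (far X g \<cdot> simplex_action U E X m (Cod \<Delta> g)) \<cdot> (\<i> (fob X m) \<odot> elem m (Cod \<Delta> g) f)"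
      by (simp add: far_S_elem simplex_action_elem)
  qed auto
qed auto

lemma simplex_action_natural:
  assumes t: "t \<in> Hom SE X X'"
  shows "simplex_action U E X' m k \<cdot> (component t m \<odot> \<i> (fob (S m) k)) = component t k \<cdot> simplex_action U E X m k"
proof -
  have [simp]: "X \<in> Obj SE" "X' \<in> Obj SE" "t \<in> Arr SE" "Dom SE t = X" "Cod SE t = X'" using t by auto
  show ?thesis
  proof (rule jointly_epicD[OF elem_tens_jointly_epic])
    fix f assume f: "f \<in> Hom \<Delta> k m"
    have "(simplex_action U E X' m k \<cdot> (component t m \<odot> \<i> (fob (S m) k))) \<cdot> (\<i> (fob X m) \<odot> elem m k f) =
        (simplex_action U E X' m k \<cdot> (\<i> (fob X' m) \<odot> elem m k f)) \<cdot> (component t m \<odot> \<i> \<u>)"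
      using f by simp
    also have "\<dots> = (far X' f \<cdot> component t m) \<cdot> \<r> (fob X m)"
      using f by (simp add: simplex_action_elem runit_natural)
    also have "\<dots> = (component t k \<cdot> simplex_action U E X m k) \<cdot> (\<i> (fob X m) \<odot> elem m k f)"
    proof -
      have n: "component t k \<cdot> far X f = far X' f \<cdot> component t m"
        using component_natural_SE[of t f] f by auto
      show ?thesis using f by (simp add: simplex_action_elem reassoc[OF n])
    qed
    finally show "(simplex_action U E X' m k \<cdot> (component t m \<odot> \<i> (fob (S m) k))) \<cdot> (\<i> (fob X m) \<odot> elem m k f) =
      (component t k \<cdot> simplex_action U E X m k) \<cdot> (\<i> (fob X m) \<odot> elem m k f)" .
  qed auto
qed

lemma simplex_action_simplex:
  assumes X[simp]: "X \<in> Obj SE" and g[simp]: "g \<in> Arr \<Delta>"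
  shows "simplex_action U E X (Dom \<Delta> g) k \<cdot> (far X g \<odot> \<i> (fob (S (Dom \<Delta> g)) k)) =
    simplex_action U E X (Cod \<Delta> g) k \<cdot> (\<i> (fob X (Cod \<Delta> g)) \<odot> component (SA g) k)"
proof (rule jointly_epicD[OF jointly_epic_tens_left[OF elem_jointly_epic, where D = "fob X (Cod \<Delta> g)"]])
  fix f assume f: "f \<in> Hom \<Delta> k (Dom \<Delta> g)"
  have "(simplex_action U E X (Dom \<Delta> g) k \<cdot> (far X g \<odot> \<i> (fob (S (Dom \<Delta> g)) k))) \<cdot> (\<i> (fob X (Cod \<Delta> g)) \<odot> elem (Dom \<Delta> g) k f) =
      (simplex_action U E X (Dom \<Delta> g) k \<cdot> (\<i> (fob X (Dom \<Delta> g)) \<odot> elem (Dom \<Delta> g) k f)) \<cdot> (far X g \<odot> \<i> \<u>)"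
    using f by simp
  also have "\<dots> = far X (g \<cdot>\<^bsub>\<Delta>\<^esub> f) \<cdot> \<r> (fob X (Cod \<Delta> g))"
    using f by (simp add: simplex_action_elem runit_natural)
  also have "\<dots> = simplex_action U E X (Cod \<Delta> g) k \<cdot> (\<i> (fob X (Cod \<Delta> g)) \<odot> elem (Cod \<Delta> g) k (g \<cdot>\<^bsub>\<Delta>\<^esub> f))"
    using f by (subst simplex_action_elem) auto
  also have "\<dots> = (simplex_action U E X (Cod \<Delta> g) k \<cdot> (\<i> (fob X (Cod \<Delta> g)) \<odot> component (SA g) k)) \<cdot>
      (\<i> (fob X (Cod \<Delta> g)) \<odot> elem (Dom \<Delta> g) k f)"
    using f by (simp add: component_SA_elem)
  finally show "(simplex_action U E X (Dom \<Delta> g) k \<cdot> (far X g \<odot> \<i> (fob (S (Dom \<Delta> g)) k))) \<cdot> (\<i> (fob X (Cod \<Delta> g)) \<odot> elem (Dom \<Delta> g) k f) =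
    (simplex_action U E X (Cod \<Delta> g) k \<cdot> (\<i> (fob X (Cod \<Delta> g)) \<odot> component (SA g) k)) \<cdot>
      (\<i> (fob X (Cod \<Delta> g)) \<odot> elem (Dom \<Delta> g) k f)" .
qed auto

lemma simplex_action_ide:
  "simplex_action U E (S m) m k \<cdot> (elem m m (Ide \<Delta> m) \<odot> \<i> (fob (S m) k)) = \<l> (fob (S m) k)"
proof (rule jointly_epicD[OF jointly_epic_tens_left[OF elem_jointly_epic, where D = \<u>]])
  fix f assume f: "f \<in> Hom \<Delta> k m"
  have "(simplex_action U E (S m) m k \<cdot> (elem m m (Ide \<Delta> m) \<odot> \<i> (fob (S m) k))) \<cdot> (\<i> \<u> \<odot> elem m k f) =
      (simplex_action U E (S m) m k \<cdot> (\<i> (fob (S m) m) \<odot> elem m k f)) \<cdot> (elem m m (Ide \<Delta> m) \<odot> \<i> \<u>)"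
    using f by simp
  also have "\<dots> = (far (S m) f \<cdot> elem m m (Ide \<Delta> m)) \<cdot> \<r> \<u>"
    using f by (simp add: simplex_action_elem runit_natural)
  also have "\<dots> = \<l> (fob (S m) k) \<cdot> (\<i> \<u> \<odot> elem m k f)"
    using f far_S_elem[of f "Ide \<Delta> m" m] by (auto simp: lunit_natural runit_unit)
  finally show "(simplex_action U E (S m) m k \<cdot> (elem m m (Ide \<Delta> m) \<odot> \<i> (fob (S m) k))) \<cdot> (\<i> \<u> \<odot> elem m k f) =
      \<l> (fob (S m) k) \<cdot> (\<i> \<u> \<odot> elem m k f)" .
qed auto

abbreviation co_yoneda :: "('o, 'a) simplicial \<Rightarrow> nat \<Rightarrow> 'a" where
  "co_yoneda X m \<equiv> realised_action (fob X m) (S m) X (simplex_action U E X m)"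

lemma co_yoneda_simps [simp]:
  "X \<in> Obj SE \<Longrightarrow> co_yoneda X m \<in> Arr E" "X \<in> Obj SE \<Longrightarrow> Dom E (co_yoneda X m) = fob X m \<otimes> R (S m)"
  "X \<in> Obj SE \<Longrightarrow> Cod E (co_yoneda X m) = R X"
  by (simp_all add: realised_simps[OF simplex_action_action])

lemma leg_co_yoneda:
  assumes X[simp]: "X \<in> Obj SE"
  shows "co_yoneda X m \<cdot> (\<i> (fob X m) \<odot> yon m) = leg X m"
proof -
  have "(co_yoneda X m \<cdot> (\<i> (fob X m) \<odot> yon m)) \<cdot> (\<i> (fob X m) \<odot> \<l> (fob C m)) =
     (co_yoneda X m \<cdot> (\<i> (fob X m) \<odot> leg (S m) m)) \<cdot> (\<i> (fob X m) \<odot> (elem m m (Ide \<Delta> m) \<odot> \<i> (fob C m)))"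
    by (simp add: leg_elem)
  also have "\<dots> = leg X m \<cdot> (((simplex_action U E X m m \<cdot> (\<i> (fob X m) \<odot> elem m m (Ide \<Delta> m))) \<odot> \<i> (fob C m)) \<cdot> \<alpha>' (fob X m) \<u> (fob C m))"
    unfolding realised_leg[OF simplex_action_action[OF X]] by (simp add: assoc_inv_natural)
  also have "\<dots> = leg X m \<cdot> (\<i> (fob X m) \<odot> \<l> (fob C m))"
    by (simp add: simplex_action_elem triangle_inverse)
  finally show ?thesis by (rule iso_cancel_right[rotated 5]) simp_all
qed

lemma co_yoneda_jointly_epic: "X \<in> Obj SE \<Longrightarrow> jointly_epic UNIV (co_yoneda X) (R X)"
proof (rule jointly_epicI)
  fix h h' B assume X[simp]: "X \<in> Obj SE" and h: "h \<in> Hom E (R X) B" and h': "h' \<in> Hom E (R X) B"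
    and eq: "\<And>m. m \<in> UNIV \<Longrightarrow> h \<cdot> co_yoneda X m = h' \<cdot> co_yoneda X m"
  show "h = h'"
  proof (rule jointly_epicD[OF leg_jointly_epic[OF X]])
    fix m
    have "h \<cdot> leg X m = (h \<cdot> co_yoneda X m) \<cdot> (\<i> (fob X m) \<odot> yon m)"
      using h by (simp add: leg_co_yoneda)
    also have "\<dots> = h' \<cdot> leg X m" unfolding eq[OF UNIV_I] using h' by (simp add: leg_co_yoneda)
    finally show "h \<cdot> leg X m = h' \<cdot> leg X m" .
  qed (use h h' in auto)
qed auto

end


section \<open>Eilenberg-Zilber families as pairings of realisations\<close>

context symmetric_monoidal_category
begin

lemma is_functor_external_tensor:
  assumes X: "is_functor J E X" and Z: "is_functor K E Z"
  shows "is_functor (prod_cat J K) E (external_tensor E X Z)"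
  by (rule is_functorI)
     (auto simp: external_tensor_def functor_simps[OF X] functor_simps[OF Z] functor_category_left[OF X]
       functor_category_left[OF Z] category_prod_cat category_axioms)

lemma is_functor_external_tensor_op:
  assumes X: "is_functor (op_cat J) E X" and Z: "is_functor (op_cat K) E Z" and J: "category J" and K: "category K"
  shows "is_functor (op_cat (prod_cat J K)) E (external_tensor E X Z)"
  by (rule is_functorI)
     (auto simp: external_tensor_def functor_simps[OF X, simplified] functor_simps[OF Z, simplified] J K
       category_prod_cat category_op_cat category_axioms)

text \<open>If a parameter \<open>A\<close> carries \<open>x\<close> to \<open>x'\<close>, it carries the interchange of \<open>x\<close> and \<open>y\<close> to that
  of \<open>x'\<close> and \<open>y\<close>.  The maps \<open>x\<close> and \<open>y\<close> will be actions on simplices, both in a fixed degree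
  and after realisation.\<close>

lemma interchange_linear:
  assumes [simp]: "A \<in> Obj E" "V \<in> Obj E" "Y \<in> Obj E" "W \<in> Obj E" "S \<in> Obj E" "T \<in> Obj E" "V' \<in> Obj E" "Y' \<in> Obj E" "W' \<in> Obj E"
    and x: "x \<in> Hom E (V \<otimes> S) V'" and y: "y \<in> Hom E (Y \<otimes> T) Y'" and q: "q \<in> Hom E (A \<otimes> V') W'"
    and f: "f \<in> Hom E (A \<otimes> V) W" and x': "x' \<in> Hom E (W \<otimes> S) W'"
    and eq: "q \<cdot> (\<i> A \<odot> x) = x' \<cdot> ((f \<odot> \<i> S) \<cdot> \<alpha>' A V S)"
  shows "(q \<odot> \<i> Y') \<cdot> (\<alpha>' A V' Y' \<cdot> (\<i> A \<odot> ((x \<odot> y) \<cdot> \<m> V Y S T))) =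
    (x' \<odot> y) \<cdot> (\<m> W Y S T \<cdot> ((((f \<odot> \<i> Y) \<cdot> \<alpha>' A V Y) \<odot> \<i> (S \<otimes> T)) \<cdot> \<alpha>' A (V \<otimes> Y) (S \<otimes> T)))"
proof -
  note [simp] = x[simplified] y[simplified] q[simplified] f[simplified] x'[simplified]
  have "(q \<odot> \<i> Y') \<cdot> (\<alpha>' A V' Y' \<cdot> (\<i> A \<odot> ((x \<odot> y) \<cdot> \<m> V Y S T))) =
      ((q \<cdot> (\<i> A \<odot> x)) \<odot> y) \<cdot> (\<alpha>' A (V \<otimes> S) (Y \<otimes> T) \<cdot> (\<i> A \<odot> \<m> V Y S T))"
    by (simp add: assoc_inv_natural_Comp)
  also have "\<dots> = ((x' \<cdot> (f \<odot> \<i> S)) \<odot> y) \<cdot> ((\<alpha>' A V S \<odot> \<i> (Y \<otimes> T)) \<cdot> (\<alpha>' A (V \<otimes> S) (Y \<otimes> T) \<cdot> (\<i> A \<odot> \<m> V Y S T)))"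
    unfolding eq by simp
  also have "\<dots> = (x' \<odot> y) \<cdot> (((f \<odot> \<i> S) \<odot> \<i> (Y \<otimes> T)) \<cdot> (\<m> (A \<otimes> V) Y S T \<cdot> ((\<alpha>' A V Y \<odot> \<i> (S \<otimes> T)) \<cdot> \<alpha>' A (V \<otimes> Y) (S \<otimes> T))))"
    unfolding interchange_assoc[OF assms(1,2,3,5,6)] by simp
  also have "\<dots> = (x' \<odot> y) \<cdot> (\<m> W Y S T \<cdot> ((((f \<odot> \<i> Y) \<cdot> \<alpha>' A V Y) \<odot> \<i> (S \<otimes> T)) \<cdot> \<alpha>' A (V \<otimes> Y) (S \<otimes> T)))"
  proof -
    have "\<m> W Y S T \<cdot> ((f \<odot> \<i> Y) \<odot> \<i> (S \<otimes> T)) = ((f \<odot> \<i> S) \<odot> \<i> (Y \<otimes> T)) \<cdot> \<m> (A \<otimes> V) Y S T"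
      using interchange_natural_left[of f "\<i> Y" S T W Y] by simp
    note n = reassoc[OF this]
    have "\<m> W Y S T \<cdot> ((((f \<odot> \<i> Y) \<cdot> \<alpha>' A V Y) \<odot> \<i> (S \<otimes> T)) \<cdot> \<alpha>' A (V \<otimes> Y) (S \<otimes> T)) =
      \<m> W Y S T \<cdot> (((f \<odot> \<i> Y) \<odot> \<i> (S \<otimes> T)) \<cdot> ((\<alpha>' A V Y \<odot> \<i> (S \<otimes> T)) \<cdot> \<alpha>' A (V \<otimes> Y) (S \<otimes> T)))" by simp
    also have "\<dots> = ((f \<odot> \<i> S) \<odot> \<i> (Y \<otimes> T)) \<cdot> (\<m> (A \<otimes> V) Y S T \<cdot> ((\<alpha>' A V Y \<odot> \<i> (S \<otimes> T)) \<cdot> \<alpha>' A (V \<otimes> Y) (S \<otimes> T)))"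
      by (subst n) simp_all
    finally show ?thesis by simp
  qed
  finally show ?thesis .
qed

end

context realisation_setting
begin

lemma co_yoneda_dinatural:
  assumes X[simp]: "X \<in> Obj SE" and g[simp]: "g \<in> Arr \<Delta>"
  shows "co_yoneda X (Dom \<Delta> g) \<cdot> (far X g \<odot> \<i> (R (S (Dom \<Delta> g)))) = co_yoneda X (Cod \<Delta> g) \<cdot> (\<i> (fob X (Cod \<Delta> g)) \<odot> RA (SA g))"
proof -
  have h: "far X g \<in> Hom E (fob X (Cod \<Delta> g)) (fob X (Dom \<Delta> g))" by simp
  have t: "SA g \<in> Hom SE (S (Dom \<Delta> g)) (S (Cod \<Delta> g))" by simp
  show ?thesis
    unfolding realised_parameter[OF simplex_action_action[OF X] h] realised_precomp[OF simplex_action_action[OF X] t]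
    by (simp add: simplex_action_simplex)
qed

lemma co_yoneda_natural:
  assumes t: "t \<in> Hom SE X X'"
  shows "RA t \<cdot> co_yoneda X m = co_yoneda X' m \<cdot> (component t m \<odot> \<i> (R (S m)))"
proof -
  have [simp]: "X \<in> Obj SE" "X' \<in> Obj SE" using t by auto
  have h: "component t m \<in> Hom E (fob X m) (fob X' m)" using t by auto
  show ?thesis
    unfolding realised_parameter[OF simplex_action_action h, OF \<open>X' \<in> Obj SE\<close>] realised_postcomp[OF simplex_action_action t, OF \<open>X \<in> Obj SE\<close>]
    using simplex_action_natural[OF t] by simp
qed

lemma co_yoneda_ide:
  "co_yoneda (S m) m \<cdot> (elem m m (Ide \<Delta> m) \<odot> \<i> (R (S m))) = \<l> (R (S m))"
proof -
  have h: "elem m m (Ide \<Delta> m) \<in> Hom E \<u> (fob (S m) m)" by simp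
  have S: "S m \<in> Obj SE" by simp
  show ?thesis
    unfolding realised_parameter[OF simplex_action_action[OF S] h] by (simp add: simplex_action_ide realised_lunit)
qed

text \<open>Elements of a simplex act through the structure maps of \<open>V\<close> and \<open>W\<close>, and with these an action
  commutes by definition.\<close>

lemma simplex_action_linear:
  assumes a: "action A V W \<phi>"
  shows "\<phi> k \<cdot> ((\<i> A \<odot> simplex_action U E V m k) \<cdot> \<alpha> A (fob V m) (fob (S m) k)) =
    simplex_action U E W m k \<cdot> (\<phi> m \<odot> \<i> (fob (S m) k))"
proof (rule jointly_epicD[OF jointly_epic_tens_left[OF elem_jointly_epic, where D = "A \<otimes> fob V m"]])
  note [simp] = actionD(1-6)[OF a]
  fix f assume f: "f \<in> Hom \<Delta> k m"
  have n: "\<phi> k \<cdot> (\<i> A \<odot> far V f) = far W f \<cdot> \<phi> m" using action_natural[OF a, of f] f by auto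
  have "(\<phi> k \<cdot> ((\<i> A \<odot> simplex_action U E V m k) \<cdot> \<alpha> A (fob V m) (fob (S m) k))) \<cdot> (\<i> (A \<otimes> fob V m) \<odot> elem m k f) =
      \<phi> k \<cdot> ((\<i> A \<odot> (simplex_action U E V m k \<cdot> (\<i> (fob V m) \<odot> elem m k f))) \<cdot> \<alpha> A (fob V m) \<u>)"
    using f by (simp add: assoc_natural_ide)
  also have "\<dots> = (\<phi> k \<cdot> (\<i> A \<odot> far V f)) \<cdot> ((\<i> A \<odot> \<r> (fob V m)) \<cdot> \<alpha> A (fob V m) \<u>)"
    using f by (simp add: simplex_action_elem)
  also have "\<dots> = far W f \<cdot> (\<phi> m \<cdot> \<r> (A \<otimes> fob V m))"
    unfolding n using f by (simp add: runit_tens)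
  also have "\<dots> = (simplex_action U E W m k \<cdot> (\<i> (fob W m) \<odot> elem m k f)) \<cdot> (\<phi> m \<odot> \<i> \<u>)"
    using f by (simp add: simplex_action_elem runit_natural)
  also have "\<dots> = (simplex_action U E W m k \<cdot> (\<phi> m \<odot> \<i> (fob (S m) k))) \<cdot> (\<i> (A \<otimes> fob V m) \<odot> elem m k f)"
    using f by simp
  finally show "(\<phi> k \<cdot> ((\<i> A \<odot> simplex_action U E V m k) \<cdot> \<alpha> A (fob V m) (fob (S m) k))) \<cdot> (\<i> (A \<otimes> fob V m) \<odot> elem m k f) =
    (simplex_action U E W m k \<cdot> (\<phi> m \<odot> \<i> (fob (S m) k))) \<cdot> (\<i> (A \<otimes> fob V m) \<odot> elem m k f)" .
qed (use a in \<open>auto simp: actionD\<close>)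

lemma co_yoneda_linear:
  assumes a: "action A V W \<phi>"
  shows "realised_action A V W \<phi> \<cdot> (\<i> A \<odot> co_yoneda V m) =
    co_yoneda W m \<cdot> ((\<phi> m \<odot> \<i> (R (S m))) \<cdot> \<alpha>' A (fob V m) (R (S m)))"
proof -
  note [simp] = actionD(1-6)[OF a]
  have h: "\<phi> m \<in> Hom E (A \<otimes> fob V m) (fob W m)" by simp
  have V: "V \<in> Obj SE" and W: "W \<in> Obj SE" by simp_all
  have "co_yoneda W m \<cdot> ((\<phi> m \<odot> \<i> (R (S m))) \<cdot> \<alpha>' A (fob V m) (R (S m))) =
     (co_yoneda W m \<cdot> (\<phi> m \<odot> \<i> (R (S m)))) \<cdot> \<alpha>' A (fob V m) (R (S m))" by simp
  also have "\<dots> = realised_action A V W \<phi> \<cdot> (\<i> A \<odot> co_yoneda V m)"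
    unfolding realised_realised[OF a simplex_action_action[OF V]] realised_parameter[OF simplex_action_action[OF W] h]
    by (simp add: simplex_action_linear[OF a])
  finally show ?thesis by simp
qed

lemma action_tens:
  assumes a: "action A V W \<phi>" and b: "action B V' W' \<psi>"
  shows "action (A \<otimes> B) (V \<otimes>\<^bsub>SE\<^esub> V') (W \<otimes>\<^bsub>SE\<^esub> W') (\<lambda>k. (\<phi> k \<odot> \<psi> k) \<cdot> \<m> A B (fob V k) (fob V' k))"
proof (rule actionI)
  note [simp] = actionD(1-6)[OF a] actionD(1-6)[OF b]
  fix f assume f: "f \<in> Arr \<Delta>"
  let ?m = "Dom \<Delta> f" and ?n = "Cod \<Delta> f"
  have "((\<phi> ?m \<odot> \<psi> ?m) \<cdot> \<m> A B (fob V ?m) (fob V' ?m)) \<cdot> (\<i> (A \<otimes> B) \<odot> far (V \<otimes>\<^bsub>SE\<^esub> V') f) =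
      ((\<phi> ?m \<cdot> (\<i> A \<odot> far V f)) \<odot> (\<psi> ?m \<cdot> (\<i> B \<odot> far V' f))) \<cdot> \<m> A B (fob V ?n) (fob V' ?n)"
    using f by (simp add: interchange_natural_right)
  also have "\<dots> = far (W \<otimes>\<^bsub>SE\<^esub> W') f \<cdot> ((\<phi> ?n \<odot> \<psi> ?n) \<cdot> \<m> A B (fob V ?n) (fob V' ?n))"
    unfolding action_natural[OF a f] action_natural[OF b f] using f by simp
  finally show "((\<phi> ?m \<odot> \<psi> ?m) \<cdot> \<m> A B (fob V ?m) (fob V' ?m)) \<cdot> (\<i> (A \<otimes> B) \<odot> far (V \<otimes>\<^bsub>SE\<^esub> V') f) =
      far (W \<otimes>\<^bsub>SE\<^esub> W') f \<cdot> ((\<phi> ?n \<odot> \<psi> ?n) \<cdot> \<m> A B (fob V ?n) (fob V' ?n))" .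
qed (use a b in \<open>auto simp: actionD\<close>)

text \<open>The source legs are made of co-Yoneda maps and the target legs are the realisation of an action
  that is made of actions on simplices.  Hence both inherit dinaturality, naturality, compatibility
  with the symmetry and linearity from the actions on simplices.\<close>

abbreviation srcl :: "('o, 'a) simplicial \<Rightarrow> ('o, 'a) simplicial \<Rightarrow> nat \<Rightarrow> nat \<Rightarrow> 'a" where
  "srcl X Y m n \<equiv> source_leg U E C X Y m n"
abbreviation tgtl :: "('o, 'a) simplicial \<Rightarrow> ('o, 'a) simplicial \<Rightarrow> nat \<Rightarrow> nat \<Rightarrow> 'a" where
  "tgtl X Y m n \<equiv> target_leg U E C X Y m n"
abbreviation pair_action :: "('o, 'a) simplicial \<Rightarrow> ('o, 'a) simplicial \<Rightarrow> nat \<Rightarrow> nat \<Rightarrow> nat \<Rightarrow> 'a" where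
  "pair_action X Y m n k \<equiv> (simplex_action U E X m k \<odot> simplex_action U E Y n k) \<cdot> \<m> (fob X m) (fob Y n) (fob (S m) k) (fob (S n) k)"

lemma source_leg_eq:
  assumes [simp]: "X \<in> Obj SE" "Y \<in> Obj SE"
  shows "srcl X Y m n = (co_yoneda X m \<odot> co_yoneda Y n) \<cdot> \<m> (fob X m) (fob Y n) (R (S m)) (R (S n))"
proof -
  have c: "leg Z k \<cdot> (\<i> (fob Z k) \<odot> inv_arr E (yon k)) = co_yoneda Z k" if "Z \<in> Obj SE" for Z k
    using that by (simp add: leg_co_yoneda[symmetric])
  have "srcl X Y m n = ((leg X m \<cdot> (\<i> (fob X m) \<odot> inv_arr E (yon m))) \<odot> (leg Y n \<cdot> (\<i> (fob Y n) \<odot> inv_arr E (yon n)))) \<cdot>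
      \<m> (fob X m) (fob Y n) (R (S m)) (R (S n))"
    by (simp add: source_leg_def interchange_natural_right)
  then show ?thesis by (simp add: c)
qed

lemma pair_action_action:
  "X \<in> Obj SE \<Longrightarrow> Y \<in> Obj SE \<Longrightarrow> action (fob X m \<otimes> fob Y n) (S m \<otimes>\<^bsub>SE\<^esub> S n) (X \<otimes>\<^bsub>SE\<^esub> Y) (pair_action X Y m n)"
  by (rule action_tens[OF simplex_action_action simplex_action_action])

lemma target_leg_eq:
  assumes [simp]: "X \<in> Obj SE" "Y \<in> Obj SE"
  shows "tgtl X Y m n = realised_action (fob X m \<otimes> fob Y n) (S m \<otimes>\<^bsub>SE\<^esub> S n) (X \<otimes>\<^bsub>SE\<^esub> Y) (pair_action X Y m n)"
proof -
  note a = pair_action_action[OF assms, of m n]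
  note [simp] = realised_simps[OF a]
  show ?thesis
    unfolding target_leg_def Let_def
    by (rule the_equality) (auto simp: realised_leg[OF a, simplified] intro!: realised_eqI[OF a])
qed

lemma
  assumes [simp]: "X \<in> Obj SE" "Y \<in> Obj SE"
  shows Arr_srcl [simp]: "srcl X Y m n \<in> Arr E"
    and Dom_srcl [simp]: "Dom E (srcl X Y m n) = (fob X m \<otimes> fob Y n) \<otimes> (R (S m) \<otimes> R (S n))"
    and Cod_srcl [simp]: "Cod E (srcl X Y m n) = R X \<otimes> R Y"
    and Arr_tgtl [simp]: "tgtl X Y m n \<in> Arr E"
    and Dom_tgtl [simp]: "Dom E (tgtl X Y m n) = (fob X m \<otimes> fob Y n) \<otimes> R (S m \<otimes>\<^bsub>SE\<^esub> S n)"
    and Cod_tgtl [simp]: "Cod E (tgtl X Y m n) = R (X \<otimes>\<^bsub>SE\<^esub> Y)"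
  by (simp_all add: source_leg_eq target_leg_eq realised_simps[OF pair_action_action])

lemma source_leg_jointly_epic:
  assumes [simp]: "X \<in> Obj SE" "Y \<in> Obj SE"
  shows "jointly_epic UNIV (\<lambda>(m, n). srcl X Y m n) (R X \<otimes> R Y)"
proof -
  have "jointly_epic (UNIV \<times> UNIV) (\<lambda>(m, n). co_yoneda X m \<odot> co_yoneda Y n) (R X \<otimes> R Y)"
    by (rule jointly_epic_tens[OF co_yoneda_jointly_epic co_yoneda_jointly_epic]) auto
  from jointly_epic_iso[OF this, of "\<lambda>(m, n). \<m> (fob X m) (fob Y n) (R (S m)) (R (S n))"]
  show ?thesis by (simp add: source_leg_eq case_prod_unfold)
qed

lemma source_leg_dinatural:
  assumes [simp]: "X \<in> Obj SE" "Y \<in> Obj SE" "f \<in> Arr \<Delta>" "g \<in> Arr \<Delta>"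
  shows "srcl X Y (Dom \<Delta> f) (Dom \<Delta> g) \<cdot> ((far X f \<odot> far Y g) \<odot> \<i> (R (S (Dom \<Delta> f)) \<otimes> R (S (Dom \<Delta> g)))) =
    srcl X Y (Cod \<Delta> f) (Cod \<Delta> g) \<cdot> (\<i> (fob X (Cod \<Delta> f) \<otimes> fob Y (Cod \<Delta> g)) \<odot> (RA (SA f) \<odot> RA (SA g)))"
  by (simp add: source_leg_eq interchange_natural_left interchange_natural_right co_yoneda_dinatural)

lemma source_leg_natural:
  assumes s: "s \<in> Hom SE X X'" and t: "t \<in> Hom SE Y Y'"
  shows "(RA s \<odot> RA t) \<cdot> srcl X Y m n = srcl X' Y' m n \<cdot> ((component s m \<odot> component t n) \<odot> \<i> (R (S m) \<otimes> R (S n)))"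
proof -
  have [simp]: "X \<in> Obj SE" "X' \<in> Obj SE" "s \<in> Arr SE" "Dom SE s = X" "Cod SE s = X'"
    "Y \<in> Obj SE" "Y' \<in> Obj SE" "t \<in> Arr SE" "Dom SE t = Y" "Cod SE t = Y'" using s t by auto
  show ?thesis
    by (simp add: source_leg_eq interchange_natural_left co_yoneda_natural[OF s] co_yoneda_natural[OF t])
qed

lemma target_leg_dinatural:
  assumes [simp]: "X \<in> Obj SE" "Y \<in> Obj SE" "f \<in> Arr \<Delta>" "g \<in> Arr \<Delta>"
  shows "tgtl X Y (Dom \<Delta> f) (Dom \<Delta> g) \<cdot> ((far X f \<odot> far Y g) \<odot> \<i> (R (S (Dom \<Delta> f) \<otimes>\<^bsub>SE\<^esub> S (Dom \<Delta> g)))) =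
    tgtl X Y (Cod \<Delta> f) (Cod \<Delta> g) \<cdot> (\<i> (fob X (Cod \<Delta> f) \<otimes> fob Y (Cod \<Delta> g)) \<odot> RA (SA f \<odot>\<^bsub>SE\<^esub> SA g))"
proof -
  have h: "far X f \<odot> far Y g \<in> Hom E (fob X (Cod \<Delta> f) \<otimes> fob Y (Cod \<Delta> g)) (fob X (Dom \<Delta> f) \<otimes> fob Y (Dom \<Delta> g))" by simp
  have t: "SA f \<odot>\<^bsub>SE\<^esub> SA g \<in> Hom SE (S (Dom \<Delta> f) \<otimes>\<^bsub>SE\<^esub> S (Dom \<Delta> g)) (S (Cod \<Delta> f) \<otimes>\<^bsub>SE\<^esub> S (Cod \<Delta> g))" by simp
  show ?thesis
    unfolding target_leg_eq[OF assms(1,2)] realised_parameter[OF pair_action_action[OF assms(1,2)] h]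
      realised_precomp[OF pair_action_action[OF assms(1,2)] t]
    by (simp add: interchange_natural_left interchange_natural_right simplex_action_simplex)
qed

lemma target_leg_natural:
  assumes s: "s \<in> Hom SE X X'" and t: "t \<in> Hom SE Y Y'"
  shows "RA (s \<odot>\<^bsub>SE\<^esub> t) \<cdot> tgtl X Y m n = tgtl X' Y' m n \<cdot> ((component s m \<odot> component t n) \<odot> \<i> (R (S m \<otimes>\<^bsub>SE\<^esub> S n)))"
proof -
  have [simp]: "X \<in> Obj SE" "X' \<in> Obj SE" "s \<in> Arr SE" "Dom SE s = X" "Cod SE s = X'"
    "Y \<in> Obj SE" "Y' \<in> Obj SE" "t \<in> Arr SE" "Dom SE t = Y" "Cod SE t = Y'" using s t by auto
  have h: "component s m \<odot> component t n \<in> Hom E (fob X m \<otimes> fob Y n) (fob X' m \<otimes> fob Y' n)" by simp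
  have st: "s \<odot>\<^bsub>SE\<^esub> t \<in> Hom SE (X \<otimes>\<^bsub>SE\<^esub> Y) (X' \<otimes>\<^bsub>SE\<^esub> Y')" by simp
  have n: "component s k \<cdot> simplex_action U E X m k = simplex_action U E X' m k \<cdot> (component s m \<odot> \<i> (fob (S m) k))"
    "component t k \<cdot> simplex_action U E Y n k = simplex_action U E Y' n k \<cdot> (component t n \<odot> \<i> (fob (S n) k))" for k
    using simplex_action_natural[OF s, of m k] simplex_action_natural[OF t, of n k] by simp_all
  show ?thesis
    unfolding target_leg_eq[OF \<open>X \<in> Obj SE\<close> \<open>Y \<in> Obj SE\<close>] target_leg_eq[OF \<open>X' \<in> Obj SE\<close> \<open>Y' \<in> Obj SE\<close>]
      realised_parameter[OF pair_action_action[OF \<open>X' \<in> Obj SE\<close> \<open>Y' \<in> Obj SE\<close>] h]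
      realised_postcomp[OF pair_action_action[OF \<open>X \<in> Obj SE\<close> \<open>Y \<in> Obj SE\<close>] st]
    by (simp add: interchange_natural_left n)
qed

lemma target_leg_swap:
  assumes [simp]: "X \<in> Obj SE" "Y \<in> Obj SE"
  shows "RA (Swap SE X Y) \<cdot> tgtl X Y m n = tgtl Y X n m \<cdot> (\<s> (fob X m) (fob Y n) \<odot> RA (Swap SE (S m) (S n)))"
proof -
  have h: "\<s> (fob X m) (fob Y n) \<in> Hom E (fob X m \<otimes> fob Y n) (fob Y n \<otimes> fob X m)" by simp
  have s: "Swap SE X Y \<in> Hom SE (X \<otimes>\<^bsub>SE\<^esub> Y) (Y \<otimes>\<^bsub>SE\<^esub> X)" by simp
  have t: "Swap SE (S m) (S n) \<in> Hom SE (S m \<otimes>\<^bsub>SE\<^esub> S n) (S n \<otimes>\<^bsub>SE\<^esub> S m)" by simp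
  note a = pair_action_action[OF assms(2,1), of n m]
  have "tgtl Y X n m \<cdot> (\<s> (fob X m) (fob Y n) \<odot> RA (Swap SE (S m) (S n))) =
     (tgtl Y X n m \<cdot> (\<i> (fob Y n \<otimes> fob X m) \<odot> RA (Swap SE (S m) (S n)))) \<cdot> (\<s> (fob X m) (fob Y n) \<odot> \<i> (R (S m \<otimes>\<^bsub>SE\<^esub> S n)))"
    by simp
  also have "\<dots> = RA (Swap SE X Y) \<cdot> tgtl X Y m n"
    unfolding target_leg_eq[OF assms] target_leg_eq[OF assms(2,1)] realised_precomp[OF a t]
      realised_parameter[OF action_precomp[OF a t] h] realised_postcomp[OF pair_action_action[OF assms] s]
    by (simp add: interchange_swap[symmetric] reassoc[OF swap_natural])
  finally show ?thesis by simp
qed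

lemma target_leg_ide:
  "tgtl (S m) (S n) m n \<cdot> ((elem m m (Ide \<Delta> m) \<odot> elem n n (Ide \<Delta> n)) \<odot> \<i> (R (S m \<otimes>\<^bsub>SE\<^esub> S n))) =
    \<l> (R (S m \<otimes>\<^bsub>SE\<^esub> S n)) \<cdot> (\<l> \<u> \<odot> \<i> (R (S m \<otimes>\<^bsub>SE\<^esub> S n)))"
proof -
  have S: "S m \<in> Obj SE" "S n \<in> Obj SE" and ST: "S m \<otimes>\<^bsub>SE\<^esub> S n \<in> Obj SE" by simp_all
  have h: "elem m m (Ide \<Delta> m) \<odot> elem n n (Ide \<Delta> n) \<in> Hom E (\<u> \<otimes> \<u>) (fob (S m) m \<otimes> fob (S n) n)" by simp
  have l: "\<l> \<u> \<in> Hom E (\<u> \<otimes> \<u>) \<u>" by simp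
  have a: "action \<u> (S m \<otimes>\<^bsub>SE\<^esub> S n) (S m \<otimes>\<^bsub>SE\<^esub> S n) (\<lambda>k. \<l> (fob (S m \<otimes>\<^bsub>SE\<^esub> S n) k))"
    by (rule actionI) (auto simp: lunit_natural)
  show ?thesis
    unfolding target_leg_eq[OF S] realised_lunit[OF ST, symmetric] realised_parameter[OF pair_action_action[OF S] h] realised_parameter[OF a l]
    by (simp add: interchange_natural_left simplex_action_ide interchange_unit_left)
qed

lemma target_leg_linear:
  assumes a: "action A V W \<phi>" and Y[simp]: "Y \<in> Obj SE"
  shows "realised_action A (V \<otimes>\<^bsub>SE\<^esub> Y) (W \<otimes>\<^bsub>SE\<^esub> Y) (\<lambda>k. (\<phi> k \<odot> \<i> (fob Y k)) \<cdot> \<alpha>' A (fob V k) (fob Y k)) \<cdot> (\<i> A \<odot> tgtl V Y m n) =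
    tgtl W Y m n \<cdot> ((((\<phi> m \<odot> \<i> (fob Y n)) \<cdot> \<alpha>' A (fob V m) (fob Y n)) \<odot> \<i> (R (S m \<otimes>\<^bsub>SE\<^esub> S n))) \<cdot>
      \<alpha>' A (fob V m \<otimes> fob Y n) (R (S m \<otimes>\<^bsub>SE\<^esub> S n)))"
    and action_tens_right: "action A (V \<otimes>\<^bsub>SE\<^esub> Y) (W \<otimes>\<^bsub>SE\<^esub> Y) (\<lambda>k. (\<phi> k \<odot> \<i> (fob Y k)) \<cdot> \<alpha>' A (fob V k) (fob Y k))"
proof -
  note [simp] = actionD(1-6)[OF a]
  show b: "action A (V \<otimes>\<^bsub>SE\<^esub> Y) (W \<otimes>\<^bsub>SE\<^esub> Y) (\<lambda>k. (\<phi> k \<odot> \<i> (fob Y k)) \<cdot> \<alpha>' A (fob V k) (fob Y k))"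
    by (rule actionI) (auto simp: assoc_inv_natural action_natural[OF a])
  have V: "V \<in> Obj SE" and W: "W \<in> Obj SE" by simp_all
  let ?f = "(\<phi> m \<odot> \<i> (fob Y n)) \<cdot> \<alpha>' A (fob V m) (fob Y n)"
  have h: "?f \<in> Hom E (A \<otimes> (fob V m \<otimes> fob Y n)) (fob W m \<otimes> fob Y n)" by simp
  note pV = pair_action_action[OF V Y, of m n] and pW = pair_action_action[OF W Y, of m n]
  have eq: "((\<phi> k \<odot> \<i> (fob Y k)) \<cdot> \<alpha>' A (fob V k) (fob Y k)) \<cdot> ((\<i> A \<odot> pair_action V Y m n k) \<cdot>
      \<alpha> A (fob V m \<otimes> fob Y n) (fob (S m) k \<otimes> fob (S n) k)) =
    pair_action W Y m n k \<cdot> (?f \<odot> \<i> (fob (S m) k \<otimes> fob (S n) k))" for k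
  proof -
    have l: "\<phi> k \<cdot> (\<i> A \<odot> simplex_action U E V m k) =
        simplex_action U E W m k \<cdot> ((\<phi> m \<odot> \<i> (fob (S m) k)) \<cdot> \<alpha>' A (fob V m) (fob (S m) k))"
    proof -
      have "(\<phi> k \<cdot> (\<i> A \<odot> simplex_action U E V m k)) \<cdot> \<alpha> A (fob V m) (fob (S m) k) = simplex_action U E W m k \<cdot> (\<phi> m \<odot> \<i> (fob (S m) k))"
        using simplex_action_linear[OF a, of k m] by simp
      from iso_move_right[OF _ _ _ this] show ?thesis by simp
    qed
    have "(\<phi> k \<odot> \<i> (fob Y k)) \<cdot> (\<alpha>' A (fob V k) (fob Y k) \<cdot> (\<i> A \<odot> pair_action V Y m n k)) =
        (simplex_action U E W m k \<odot> simplex_action U E Y n k) \<cdot> (\<m> (fob W m) (fob Y n) (fob (S m) k) (fob (S n) k) \<cdot>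
        ((?f \<odot> \<i> (fob (S m) k \<otimes> fob (S n) k)) \<cdot> \<alpha>' A (fob V m \<otimes> fob Y n) (fob (S m) k \<otimes> fob (S n) k)))"
      by (rule interchange_linear[where W = "fob W m" and W' = "fob W k"]) (simp_all add: l)
    from arg_cong[OF this, of "\<lambda>x. x \<cdot> \<alpha> A (fob V m \<otimes> fob Y n) (fob (S m) k \<otimes> fob (S n) k)"]
    show ?thesis by simp
  qed
  show "realised_action A (V \<otimes>\<^bsub>SE\<^esub> Y) (W \<otimes>\<^bsub>SE\<^esub> Y) (\<lambda>k. (\<phi> k \<odot> \<i> (fob Y k)) \<cdot> \<alpha>' A (fob V k) (fob Y k)) \<cdot> (\<i> A \<odot> tgtl V Y m n) =
    tgtl W Y m n \<cdot> ((?f \<odot> \<i> (R (S m \<otimes>\<^bsub>SE\<^esub> S n))) \<cdot> \<alpha>' A (fob V m \<otimes> fob Y n) (R (S m \<otimes>\<^bsub>SE\<^esub> S n)))"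
  proof -
    have "tgtl W Y m n \<cdot> ((?f \<odot> \<i> (R (S m \<otimes>\<^bsub>SE\<^esub> S n))) \<cdot> \<alpha>' A (fob V m \<otimes> fob Y n) (R (S m \<otimes>\<^bsub>SE\<^esub> S n))) =
      (tgtl W Y m n \<cdot> (?f \<odot> \<i> (R (S m \<otimes>\<^bsub>SE\<^esub> S n)))) \<cdot> \<alpha>' A (fob V m \<otimes> fob Y n) (R (S m \<otimes>\<^bsub>SE\<^esub> S n))" by simp
    then show ?thesis
      unfolding target_leg_eq[OF V Y] target_leg_eq[OF W Y] realised_realised[OF b pV] realised_parameter[OF pW h]
      using eq by simp
  qed
qed

end


section \<open>The coends behind a pairing\<close>

context realisation_setting
begin

lemma functor_XY: "X \<in> Obj SE \<Longrightarrow> Y \<in> Obj SE \<Longrightarrow> is_functor (op_cat \<Delta>\<Delta>) E (external_tensor E X Y)"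
  by (rule is_functor_external_tensor_op[OF functor_SE functor_SE category_Delta category_Delta])

lemma functor_EZ_source: "is_functor \<Delta>\<Delta> E (EZ_source U E C)"
  unfolding EZ_source_def
  by (rule is_functor_external_tensor[OF is_functor_comp[OF is_functor_simplex_E is_functor_realisation]
        is_functor_comp[OF is_functor_simplex_E is_functor_realisation]])

lemma functor_EZ_target: "is_functor \<Delta>\<Delta> E (EZ_target U E C)"
  unfolding EZ_target_def
  by (rule is_functor_comp[OF SE.is_functor_external_tensor[OF is_functor_simplex_E is_functor_simplex_E] is_functor_realisation])

lemma external_simps [simp]:
  "fob (external_tensor E X Y) (m, n) = fob X m \<otimes> fob Y n"
  "far (external_tensor E X Y) (f, g) = far X f \<odot> far Y g"
  "fob (EZ_source U E C) (m, n) = R (S m) \<otimes> R (S n)"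
  "far (EZ_source U E C) (f, g) = RA (SA f) \<odot> RA (SA g)"
  "fob (EZ_target U E C) (m, n) = R (S m \<otimes>\<^bsub>SE\<^esub> S n)"
  "far (EZ_target U E C) (f, g) = RA (SA f \<odot>\<^bsub>SE\<^esub> SA g)"
  by (simp_all add: EZ_source_def EZ_target_def external_tensor_def)

text \<open>Through \<open>yon\<close> the realised simplices are the objects \<open>C m\<close>, so that a family on the source
  legs is a family on pairs of legs of \<open>X\<close> and \<open>Y\<close>.  The dinaturality of such a family in one
  variable is its dinaturality over \<open>\<Delta> \<times> \<Delta>\<close> with an identity in the other variable.\<close>

lemma source_universal:
  assumes X[simp]: "X \<in> Obj SE" and Y[simp]: "Y \<in> Obj SE"
  shows "universal_family UNIV (\<lambda>(m, n). srcl X Y m n) (coend_relations \<Delta>\<Delta> (external_tensor E X Y) (EZ_source U E C)) (R X \<otimes> R Y)"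
proof (rule universal_familyI)
  fix i x j y assume "(i, x, j, y) \<in> coend_relations \<Delta>\<Delta> (external_tensor E X Y) (EZ_source U E C)"
  then obtain f g where fg: "f \<in> Arr \<Delta>" "g \<in> Arr \<Delta>" and e: "i = (Dom \<Delta> f, Dom \<Delta> g)" "j = (Cod \<Delta> f, Cod \<Delta> g)"
    "x = (far X f \<odot> far Y g) \<odot> \<i> (R (S (Dom \<Delta> f)) \<otimes> R (S (Dom \<Delta> g)))"
    "y = \<i> (fob X (Cod \<Delta> f) \<otimes> fob Y (Cod \<Delta> g)) \<odot> (RA (SA f) \<odot> RA (SA g))"
    unfolding coend_relations_def by auto
  then show "i \<in> UNIV \<and> j \<in> UNIV \<and> x \<in> Arr E \<and> y \<in> Arr E \<and> Dom E x = Dom E y \<and>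
     Cod E x = Dom E (case i of (m, n) \<Rightarrow> srcl X Y m n) \<and> Cod E y = Dom E (case j of (m, n) \<Rightarrow> srcl X Y m n) \<and>
     (case i of (m, n) \<Rightarrow> srcl X Y m n) \<cdot> x = (case j of (m, n) \<Rightarrow> srcl X Y m n) \<cdot> y"
    by (simp add: source_leg_dinatural)
next
  fix B v assume B: "B \<in> Obj E" and v0: "\<And>i. i \<in> UNIV \<Longrightarrow> v i \<in> Hom E (Dom E (case i of (m, n) \<Rightarrow> srcl X Y m n)) B"
    and rel: "\<And>i x j y. (i, x, j, y) \<in> coend_relations \<Delta>\<Delta> (external_tensor E X Y) (EZ_source U E C) \<Longrightarrow> v i \<cdot> x = v j \<cdot> y"
  have v[simp]: "v (m, n) \<in> Arr E" "Dom E (v (m, n)) = (fob X m \<otimes> fob Y n) \<otimes> (R (S m) \<otimes> R (S n))" "Cod E (v (m, n)) = B" for m n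
    using v0[of "(m, n)"] by simp_all
  have vrel: "v (Dom \<Delta> f, Dom \<Delta> g) \<cdot> ((far X f \<odot> far Y g) \<odot> \<i> (R (S (Dom \<Delta> f)) \<otimes> R (S (Dom \<Delta> g)))) =
      v (Cod \<Delta> f, Cod \<Delta> g) \<cdot> (\<i> (fob X (Cod \<Delta> f) \<otimes> fob Y (Cod \<Delta> g)) \<odot> (RA (SA f) \<odot> RA (SA g)))"
    if "f \<in> Arr \<Delta>" "g \<in> Arr \<Delta>" for f g
    by (rule rel) (use that in \<open>force simp: coend_relations_def image_iff\<close>)
  let ?k = "\<lambda>m n. \<i> (fob X m \<otimes> fob Y n) \<odot> (yon m \<odot> yon n)"
  define t where "t m n = v (m, n) \<cdot> (?k m n \<cdot> \<m> (fob X m) (fob C m) (fob Y n) (fob C n))" for m n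
  have t[simp]: "t m n \<in> Arr E" "Dom E (t m n) = (fob X m \<otimes> fob C m) \<otimes> (fob Y n \<otimes> fob C n)" "Cod E (t m n) = B" for m n
    by (simp_all add: t_def)
  have tx: "t m n \<cdot> ((a \<odot> b) \<odot> (c \<odot> d)) = v (m, n) \<cdot> (((a \<odot> c) \<odot> ((yon m \<cdot> b) \<odot> (yon n \<cdot> d))) \<cdot>
      \<m> (Dom E a) (Dom E b) (Dom E c) (Dom E d))"
    if "a \<in> Arr E" "b \<in> Arr E" "c \<in> Arr E" "d \<in> Arr E" "Cod E a = fob X m" "Cod E b = fob C m" "Cod E c = fob Y n" "Cod E d = fob C n" for m n a b c d
    using that by (simp add: t_def interchange_natural)
  have relX: "t (Dom \<Delta> f) n \<cdot> ((far X f \<odot> \<i> (fob C (Dom \<Delta> f))) \<odot> \<i> (fob Y n \<otimes> fob C n)) =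
      t (Cod \<Delta> f) n \<cdot> ((\<i> (fob X (Cod \<Delta> f)) \<odot> far C f) \<odot> \<i> (fob Y n \<otimes> fob C n))" if f[simp]: "f \<in> Arr \<Delta>" for f n
  proof -
    let ?m = "Dom \<Delta> f" and ?m' = "Cod \<Delta> f"
    have "t ?m n \<cdot> ((far X f \<odot> \<i> (fob C ?m)) \<odot> (\<i> (fob Y n) \<odot> \<i> (fob C n))) =
      (v (?m, n) \<cdot> ((far X f \<odot> \<i> (fob Y n)) \<odot> \<i> (R (S ?m) \<otimes> R (S n)))) \<cdot>
        ((\<i> (fob X ?m' \<otimes> fob Y n) \<odot> (yon ?m \<odot> yon n)) \<cdot> \<m> (fob X ?m') (fob C ?m) (fob Y n) (fob C n))"
      by (subst tx) simp_all
    also have "\<dots> = (v (?m', n) \<cdot> (\<i> (fob X ?m' \<otimes> fob Y n) \<odot> (RA (SA f) \<odot> \<i> (R (S n))))) \<cdot>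
        ((\<i> (fob X ?m' \<otimes> fob Y n) \<odot> (yon ?m \<odot> yon n)) \<cdot> \<m> (fob X ?m') (fob C ?m) (fob Y n) (fob C n))"
      using vrel[of f "Ide \<Delta> n"] by simp
    also have "\<dots> = t ?m' n \<cdot> ((\<i> (fob X ?m') \<odot> far C f) \<odot> (\<i> (fob Y n) \<odot> \<i> (fob C n)))"
      by (subst tx) (simp_all add: yon_natural)
    finally show ?thesis by simp
  qed
  have relY: "t m (Dom \<Delta> g) \<cdot> (\<i> (fob X m \<otimes> fob C m) \<odot> (far Y g \<odot> \<i> (fob C (Dom \<Delta> g)))) =
      t m (Cod \<Delta> g) \<cdot> (\<i> (fob X m \<otimes> fob C m) \<odot> (\<i> (fob Y (Cod \<Delta> g)) \<odot> far C g))" if g[simp]: "g \<in> Arr \<Delta>" for g m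
  proof -
    let ?n = "Dom \<Delta> g" and ?n' = "Cod \<Delta> g"
    have "t m ?n \<cdot> ((\<i> (fob X m) \<odot> \<i> (fob C m)) \<odot> (far Y g \<odot> \<i> (fob C ?n))) =
      (v (m, ?n) \<cdot> ((\<i> (fob X m) \<odot> far Y g) \<odot> \<i> (R (S m) \<otimes> R (S ?n)))) \<cdot>
        ((\<i> (fob X m \<otimes> fob Y ?n') \<odot> (yon m \<odot> yon ?n)) \<cdot> \<m> (fob X m) (fob C m) (fob Y ?n') (fob C ?n))"
      by (subst tx) simp_all
    also have "\<dots> = (v (m, ?n') \<cdot> (\<i> (fob X m \<otimes> fob Y ?n') \<odot> (\<i> (R (S m)) \<odot> RA (SA g)))) \<cdot>
        ((\<i> (fob X m \<otimes> fob Y ?n') \<odot> (yon m \<odot> yon ?n)) \<cdot> \<m> (fob X m) (fob C m) (fob Y ?n') (fob C ?n))"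
      using vrel[of "Ide \<Delta> m" g] by simp
    also have "\<dots> = t m ?n' \<cdot> ((\<i> (fob X m) \<odot> \<i> (fob C m)) \<odot> (\<i> (fob Y ?n') \<odot> far C g))"
      by (subst tx) (simp_all add: yon_natural)
    finally show ?thesis by simp
  qed
  obtain h where h: "h \<in> Hom E (R X \<otimes> R Y) B" and hl: "\<And>m n. h \<cdot> (leg X m \<odot> leg Y n) = t m n"
  proof (rule tens_desc[OF leg_universal[OF X] leg_universal[OF Y] B, of t])
    fix i x j y k assume "(i, x, j, y) \<in> coend_relations \<Delta> X C"
    then show "t i k \<cdot> (x \<odot> \<i> (Dom E (leg Y k))) = t j k \<cdot> (y \<odot> \<i> (Dom E (leg Y k)))"
      using relX unfolding coend_relations_def by auto
  next
    fix k x l y i assume "(k, x, l, y) \<in> coend_relations \<Delta> Y C"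
    then show "t i k \<cdot> (\<i> (Dom E (leg X i)) \<odot> x) = t i l \<cdot> (\<i> (Dom E (leg X i)) \<odot> y)"
      using relY unfolding coend_relations_def by auto
  qed auto
  have "h \<cdot> srcl X Y m n = v (m, n)" for m n
  proof -
    have "h \<cdot> srcl X Y m n = (h \<cdot> (leg X m \<odot> leg Y n)) \<cdot> (\<m> (fob X m) (fob Y n) (fob C m) (fob C n) \<cdot>
        (\<i> (fob X m \<otimes> fob Y n) \<odot> (inv_arr E (yon m) \<odot> inv_arr E (yon n))))"
      using h by (simp add: source_leg_def)
    also have "\<dots> = v (m, n)" unfolding hl t_def by simp
    finally show ?thesis .
  qed
  then show "\<exists>h. h \<in> Hom E (R X \<otimes> R Y) B \<and> (\<forall>i\<in>UNIV. h \<cdot> (case i of (m, n) \<Rightarrow> srcl X Y m n) = v i)"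
    using h by auto
qed (auto simp: source_leg_jointly_epic)

text \<open>The simplex \<open>(f, g)\<close> of the product of two standard simplices, as a map from \<open>C k\<close> to the
  realisation.\<close>

definition diag :: "nat \<Rightarrow> nat \<Rightarrow> nat \<Rightarrow> simplex_arr \<Rightarrow> simplex_arr \<Rightarrow> 'a" where
  "diag m n k f g = leg (S m \<otimes>\<^bsub>SE\<^esub> S n) k \<cdot> (((elem m k f \<odot> elem n k g) \<odot> \<i> (fob C k)) \<cdot> ((\<l>' \<u> \<odot> \<i> (fob C k)) \<cdot> \<l>' (fob C k)))"

lemma
  assumes "f \<in> Arr \<Delta>" "Dom \<Delta> f = k" "Cod \<Delta> f = m" "g \<in> Arr \<Delta>" "Dom \<Delta> g = k" "Cod \<Delta> g = n"
  shows Arr_diag [simp]: "diag m n k f g \<in> Arr E" and Dom_diag [simp]: "Dom E (diag m n k f g) = fob C k"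
    and Cod_diag [simp]: "Cod E (diag m n k f g) = R (S m \<otimes>\<^bsub>SE\<^esub> S n)"
  using assms by (simp_all add: diag_def)

lemma diag_jointly_epic:
  assumes [simp]: "A \<in> Obj E"
  shows "jointly_epic (SIGMA k:UNIV. Hom \<Delta> k m \<times> Hom \<Delta> k n) (\<lambda>(k, f, g). \<i> A \<odot> diag m n k f g) (A \<otimes> R (S m \<otimes>\<^bsub>SE\<^esub> S n))"
proof -
  have "jointly_epic (SIGMA k:UNIV. Hom \<Delta> k m \<times> Hom \<Delta> k n)
      (\<lambda>(k, fg). leg (S m \<otimes>\<^bsub>SE\<^esub> S n) k \<cdot> ((case fg of (f, g) \<Rightarrow> elem m k f \<odot> elem n k g) \<odot> \<i> (fob C k))) (R (S m \<otimes>\<^bsub>SE\<^esub> S n))"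
    by (rule jointly_epic_Comp[OF leg_jointly_epic])
       (auto intro!: jointly_epic_tens_right jointly_epic_tens elem_jointly_epic)
  from jointly_epic_iso[OF this, of "\<lambda>(k, fg). (\<l>' \<u> \<odot> \<i> (fob C k)) \<cdot> \<l>' (fob C k)"]
  have "jointly_epic (SIGMA k:UNIV. Hom \<Delta> k m \<times> Hom \<Delta> k n) (\<lambda>(k, fg).
      (leg (S m \<otimes>\<^bsub>SE\<^esub> S n) k \<cdot> ((case fg of (f, g) \<Rightarrow> elem m k f \<odot> elem n k g) \<odot> \<i> (fob C k))) \<cdot> ((\<l>' \<u> \<odot> \<i> (fob C k)) \<cdot> \<l>' (fob C k)))
      (R (S m \<otimes>\<^bsub>SE\<^esub> S n))" (is "jointly_epic ?I ?w _")
    by (auto simp: case_prod_unfold)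
  moreover have "?w kfg = (case kfg of (k, f, g) \<Rightarrow> diag m n k f g)" if "kfg \<in> ?I" for kfg
    using that by (auto simp: diag_def)
  ultimately have "jointly_epic ?I (\<lambda>(k, f, g). diag m n k f g) (R (S m \<otimes>\<^bsub>SE\<^esub> S n))"
    unfolding jointly_epic_def by simp
  from jointly_epic_tens_left[OF this, of A] show ?thesis by (simp add: case_prod_unfold)
qed

lemma diag_precomp:
  assumes [simp]: "f \<in> Arr \<Delta>" "Dom \<Delta> f = l" "Cod \<Delta> f = m" "g \<in> Arr \<Delta>" "Dom \<Delta> g = l" "Cod \<Delta> g = n"
    "h \<in> Arr \<Delta>" "Dom \<Delta> h = k" "Cod \<Delta> h = l"
  shows "diag m n l f g \<cdot> far C h = diag m n k (f \<cdot>\<^bsub>\<Delta>\<^esub> h) (g \<cdot>\<^bsub>\<Delta>\<^esub> h)"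
proof -
  have n: "\<l>' (fob C l) \<cdot> far C h = (\<i> \<u> \<odot> far C h) \<cdot> \<l>' (fob C k)" by (simp add: lunit_inv_natural)
  have "diag m n l f g \<cdot> far C h = (leg (S m \<otimes>\<^bsub>SE\<^esub> S n) l \<cdot> (\<i> (fob (S m \<otimes>\<^bsub>SE\<^esub> S n) l) \<odot> far C h)) \<cdot>
      (((elem m l f \<odot> elem n l g) \<odot> \<i> (fob C k)) \<cdot> ((\<l>' \<u> \<odot> \<i> (fob C k)) \<cdot> \<l>' (fob C k)))"
    by (simp add: diag_def n)
  also have "\<dots> = (leg (S m \<otimes>\<^bsub>SE\<^esub> S n) k \<cdot> (far (S m \<otimes>\<^bsub>SE\<^esub> S n) h \<odot> \<i> (fob C k))) \<cdot>
      (((elem m l f \<odot> elem n l g) \<odot> \<i> (fob C k)) \<cdot> ((\<l>' \<u> \<odot> \<i> (fob C k)) \<cdot> \<l>' (fob C k)))"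
    by (subst leg_dinatural[of _ h k l]) simp_all
  also have "\<dots> = diag m n k (f \<cdot>\<^bsub>\<Delta>\<^esub> h) (g \<cdot>\<^bsub>\<Delta>\<^esub> h)"
    using far_S_elem[of h f m] far_S_elem[of h g n] by (simp add: diag_def)
  finally show ?thesis .
qed

lemma diag_postcomp:
  assumes [simp]: "f \<in> Arr \<Delta>" "Dom \<Delta> f = k" "Cod \<Delta> f = m" "g \<in> Arr \<Delta>" "Dom \<Delta> g = k" "Cod \<Delta> g = n"
    "a \<in> Arr \<Delta>" "Dom \<Delta> a = m" "b \<in> Arr \<Delta>" "Dom \<Delta> b = n"
  shows "RA (SA a \<odot>\<^bsub>SE\<^esub> SA b) \<cdot> diag m n k f g = diag (Cod \<Delta> a) (Cod \<Delta> b) k (a \<cdot>\<^bsub>\<Delta>\<^esub> f) (b \<cdot>\<^bsub>\<Delta>\<^esub> g)"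
proof -
  have ca: "component (SA a) k \<cdot> elem m k f = elem (Cod \<Delta> a) k (a \<cdot>\<^bsub>\<Delta>\<^esub> f)"
    and cb: "component (SA b) k \<cdot> elem n k g = elem (Cod \<Delta> b) k (b \<cdot>\<^bsub>\<Delta>\<^esub> g)"
    by (simp_all add: component_SA_elem)
  have l: "RA (SA a \<odot>\<^bsub>SE\<^esub> SA b) \<cdot> leg (S m \<otimes>\<^bsub>SE\<^esub> S n) k =
      leg (S (Cod \<Delta> a) \<otimes>\<^bsub>SE\<^esub> S (Cod \<Delta> b)) k \<cdot> ((component (SA a) k \<odot> component (SA b) k) \<odot> \<i> (fob C k))"
    by (subst RA_leg) simp_all
  show ?thesis by (simp add: diag_def reassoc[OF l] ca cb)
qed

text \<open>Evaluation at the simplices \<open>(f, g)\<close> expresses the target legs by the legs of \<open>X \<otimes> Y\<close>;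
  at a pair of identities it recovers the legs from the target legs.\<close>

lemma target_leg_diag:
  assumes [simp]: "X \<in> Obj SE" "Y \<in> Obj SE" "f \<in> Arr \<Delta>" "Dom \<Delta> f = k" "Cod \<Delta> f = m" "g \<in> Arr \<Delta>" "Dom \<Delta> g = k" "Cod \<Delta> g = n"
  shows "tgtl X Y m n \<cdot> (\<i> (fob X m \<otimes> fob Y n) \<odot> diag m n k f g) = leg (X \<otimes>\<^bsub>SE\<^esub> Y) k \<cdot> ((far X f \<odot> far Y g) \<odot> \<i> (fob C k))"
proof -
  let ?A = "fob X m \<otimes> fob Y n"
  note a = pair_action_action[OF assms(1,2), of m n]
  have "tgtl X Y m n \<cdot> (\<i> ?A \<odot> diag m n k f g) = (tgtl X Y m n \<cdot> (\<i> ?A \<odot> leg (S m \<otimes>\<^bsub>SE\<^esub> S n) k)) \<cdot>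
     ((\<i> ?A \<odot> ((elem m k f \<odot> elem n k g) \<odot> \<i> (fob C k))) \<cdot> (\<i> ?A \<odot> ((\<l>' \<u> \<odot> \<i> (fob C k)) \<cdot> \<l>' (fob C k))))"
    by (simp add: diag_def)
  also have "\<dots> = leg (X \<otimes>\<^bsub>SE\<^esub> Y) k \<cdot> ((pair_action X Y m n k \<odot> \<i> (fob C k)) \<cdot> (((\<i> ?A \<odot> (elem m k f \<odot> elem n k g)) \<odot> \<i> (fob C k)) \<cdot>
     (\<alpha>' ?A (\<u> \<otimes> \<u>) (fob C k) \<cdot> (\<i> ?A \<odot> ((\<l>' \<u> \<odot> \<i> (fob C k)) \<cdot> \<l>' (fob C k))))))"
    unfolding target_leg_eq[OF assms(1,2)] realised_leg[OF a]
    by (simp add: reassoc[OF assoc_inv_natural] del: tens_Comp tens_Comp')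
  also have "\<dots> = leg (X \<otimes>\<^bsub>SE\<^esub> Y) k \<cdot> (((pair_action X Y m n k \<cdot> (\<i> ?A \<odot> (elem m k f \<odot> elem n k g))) \<odot> \<i> (fob C k)) \<cdot>
     (\<alpha>' ?A (\<u> \<otimes> \<u>) (fob C k) \<cdot> (\<i> ?A \<odot> ((\<l>' \<u> \<odot> \<i> (fob C k)) \<cdot> \<l>' (fob C k)))))"
    by simp
  also have "pair_action X Y m n k \<cdot> (\<i> ?A \<odot> (elem m k f \<odot> elem n k g)) = (far X f \<odot> far Y g) \<cdot> (\<r> ?A \<cdot> (\<i> ?A \<odot> \<l> \<u>))"
  proof -
    have "pair_action X Y m n k \<cdot> (\<i> ?A \<odot> (elem m k f \<odot> elem n k g)) =
       ((far X f \<cdot> \<r> (fob X m)) \<odot> (far Y g \<cdot> \<r> (fob Y n))) \<cdot> \<m> (fob X m) (fob Y n) \<u> \<u>"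
      by (simp add: interchange_natural_right simplex_action_elem)
    also have "\<dots> = (far X f \<odot> far Y g) \<cdot> ((\<r> (fob X m) \<odot> \<r> (fob Y n)) \<cdot> \<m> (fob X m) (fob Y n) \<u> \<u>)" by simp
    finally show ?thesis by (simp add: interchange_unit_right)
  qed
  also have "leg (X \<otimes>\<^bsub>SE\<^esub> Y) k \<cdot> ((((far X f \<odot> far Y g) \<cdot> (\<r> ?A \<cdot> (\<i> ?A \<odot> \<l> \<u>))) \<odot> \<i> (fob C k)) \<cdot>
     (\<alpha>' ?A (\<u> \<otimes> \<u>) (fob C k) \<cdot> (\<i> ?A \<odot> ((\<l>' \<u> \<odot> \<i> (fob C k)) \<cdot> \<l>' (fob C k))))) =
     leg (X \<otimes>\<^bsub>SE\<^esub> Y) k \<cdot> ((((far X f \<odot> far Y g) \<cdot> \<r> ?A) \<odot> \<i> (fob C k)) \<cdot> (\<alpha>' ?A \<u> (fob C k) \<cdot> (\<i> ?A \<odot> \<l>' (fob C k))))"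
    by (simp add: assoc_inv_natural_Comp)
  also have "\<dots> = leg (X \<otimes>\<^bsub>SE\<^esub> Y) k \<cdot> (((far X f \<odot> far Y g) \<odot> \<i> (fob C k)) \<cdot> (((\<r> ?A \<odot> \<i> (fob C k)) \<cdot> \<alpha>' ?A \<u> (fob C k)) \<cdot> (\<i> ?A \<odot> \<l>' (fob C k))))"
    by simp
  also have "\<dots> = leg (X \<otimes>\<^bsub>SE\<^esub> Y) k \<cdot> ((far X f \<odot> far Y g) \<odot> \<i> (fob C k))"
    by (subst triangle_inverse) simp_all
  finally show ?thesis .
qed

lemma target_leg_ide_diag:
  assumes [simp]: "X \<in> Obj SE" "Y \<in> Obj SE"
  shows "tgtl X Y k k \<cdot> (\<i> (fob X k \<otimes> fob Y k) \<odot> diag k k k (Ide \<Delta> k) (Ide \<Delta> k)) = leg (X \<otimes>\<^bsub>SE\<^esub> Y) k"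
  by (subst target_leg_diag) simp_all

lemma target_leg_jointly_epic:
  assumes [simp]: "X \<in> Obj SE" "Y \<in> Obj SE"
  shows "jointly_epic UNIV (\<lambda>(m, n). tgtl X Y m n) (R (X \<otimes>\<^bsub>SE\<^esub> Y))"
proof (rule jointly_epicI)
  fix h h' B assume h: "h \<in> Hom E (R (X \<otimes>\<^bsub>SE\<^esub> Y)) B" and h': "h' \<in> Hom E (R (X \<otimes>\<^bsub>SE\<^esub> Y)) B"
    and eq: "\<And>i. i \<in> UNIV \<Longrightarrow> h \<cdot> (case i of (m, n) \<Rightarrow> tgtl X Y m n) = h' \<cdot> (case i of (m, n) \<Rightarrow> tgtl X Y m n)"
  show "h = h'"
  proof (rule jointly_epicD[OF leg_jointly_epic[of "X \<otimes>\<^bsub>SE\<^esub> Y"]])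
    fix k
    have "h \<cdot> leg (X \<otimes>\<^bsub>SE\<^esub> Y) k = (h \<cdot> tgtl X Y k k) \<cdot> (\<i> (fob X k \<otimes> fob Y k) \<odot> diag k k k (Ide \<Delta> k) (Ide \<Delta> k))"
      using h by (simp add: target_leg_ide_diag)
    also have "h \<cdot> tgtl X Y k k = h' \<cdot> tgtl X Y k k" using eq[of "(k, k)"] by simp
    also have "(h' \<cdot> tgtl X Y k k) \<cdot> (\<i> (fob X k \<otimes> fob Y k) \<odot> diag k k k (Ide \<Delta> k) (Ide \<Delta> k)) = h' \<cdot> leg (X \<otimes>\<^bsub>SE\<^esub> Y) k"
      using h' by (simp add: target_leg_ide_diag)
    finally show "h \<cdot> leg (X \<otimes>\<^bsub>SE\<^esub> Y) k = h' \<cdot> leg (X \<otimes>\<^bsub>SE\<^esub> Y) k" .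
  qed (use h h' in auto)
qed auto

text \<open>Every simplex \<open>(f, g)\<close> in degree \<open>k\<close> is the image of the pair of identities of \<open>k\<close>.  By the
  relations the given family is therefore determined by its values \<open>u k\<close> at these pairs, and the
  same relations for \<open>f = g\<close> make them a wedge over \<open>\<Delta>\<close>.\<close>

lemma target_desc:
  assumes [simp]: "X \<in> Obj SE" "Y \<in> Obj SE" and B[simp]: "B \<in> Obj E"
    and v: "\<And>m n. v m n \<in> Hom E ((fob X m \<otimes> fob Y n) \<otimes> R (S m \<otimes>\<^bsub>SE\<^esub> S n)) B"
    and rel: "\<And>f g. f \<in> Arr \<Delta> \<Longrightarrow> g \<in> Arr \<Delta> \<Longrightarrow>
      v (Dom \<Delta> f) (Dom \<Delta> g) \<cdot> ((far X f \<odot> far Y g) \<odot> \<i> (R (S (Dom \<Delta> f) \<otimes>\<^bsub>SE\<^esub> S (Dom \<Delta> g)))) =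
      v (Cod \<Delta> f) (Cod \<Delta> g) \<cdot> (\<i> (fob X (Cod \<Delta> f) \<otimes> fob Y (Cod \<Delta> g)) \<odot> RA (SA f \<odot>\<^bsub>SE\<^esub> SA g))"
  obtains h where "h \<in> Hom E (R (X \<otimes>\<^bsub>SE\<^esub> Y)) B" "\<And>m n. h \<cdot> tgtl X Y m n = v m n"
proof -
  have [simp]: "v m n \<in> Arr E" "Dom E (v m n) = (fob X m \<otimes> fob Y n) \<otimes> R (S m \<otimes>\<^bsub>SE\<^esub> S n)" "Cod E (v m n) = B" for m n
    using v[of m n] by simp_all
  let ?d = "\<lambda>k. diag k k k (Ide \<Delta> k) (Ide \<Delta> k)"
  define u where "u k = v k k \<cdot> (\<i> (fob X k \<otimes> fob Y k) \<odot> ?d k)" for k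
  have [simp]: "u k \<in> Arr E" "Dom E (u k) = (fob X k \<otimes> fob Y k) \<otimes> fob C k" "Cod E (u k) = B" for k
    by (simp_all add: u_def)
  have uv: "u k \<cdot> ((far X f \<odot> far Y g) \<odot> \<i> (fob C k)) = v m n \<cdot> (\<i> (fob X m \<otimes> fob Y n) \<odot> diag m n k f g)"
    if [simp]: "f \<in> Arr \<Delta>" "Dom \<Delta> f = k" "Cod \<Delta> f = m" "g \<in> Arr \<Delta>" "Dom \<Delta> g = k" "Cod \<Delta> g = n" for f g k m n
  proof -
    have "u k \<cdot> ((far X f \<odot> far Y g) \<odot> \<i> (fob C k)) = (v k k \<cdot> ((far X f \<odot> far Y g) \<odot> \<i> (R (S k \<otimes>\<^bsub>SE\<^esub> S k)))) \<cdot> (\<i> (fob X m \<otimes> fob Y n) \<odot> ?d k)"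
      by (simp add: u_def)
    also have "\<dots> = (v m n \<cdot> (\<i> (fob X m \<otimes> fob Y n) \<odot> RA (SA f \<odot>\<^bsub>SE\<^esub> SA g))) \<cdot> (\<i> (fob X m \<otimes> fob Y n) \<odot> ?d k)"
      using rel[of f g] by simp
    also have "\<dots> = v m n \<cdot> (\<i> (fob X m \<otimes> fob Y n) \<odot> diag m n k f g)"
      using diag_postcomp[of "Ide \<Delta> k" k k "Ide \<Delta> k" k f g] by simp
    finally show ?thesis .
  qed
  obtain h where h: "h \<in> Hom E (R (X \<otimes>\<^bsub>SE\<^esub> Y)) B" and hl: "\<And>k. h \<cdot> leg (X \<otimes>\<^bsub>SE\<^esub> Y) k = u k"
  proof (rule universal_desc[OF leg_universal[of "X \<otimes>\<^bsub>SE\<^esub> Y"] B, of u])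
    fix i x j y assume "(i, x, j, y) \<in> coend_relations \<Delta> (X \<otimes>\<^bsub>SE\<^esub> Y) C"
    then obtain g where g[simp]: "g \<in> Arr \<Delta>" and "(i, x, j, y) = (Dom \<Delta> g, far (X \<otimes>\<^bsub>SE\<^esub> Y) g \<odot> \<i> (fob C (Dom \<Delta> g)),
        Cod \<Delta> g, \<i> (fob (X \<otimes>\<^bsub>SE\<^esub> Y) (Cod \<Delta> g)) \<odot> far C g)"
      unfolding coend_relations_def by blast
    then have e: "i = Dom \<Delta> g" "j = Cod \<Delta> g" "x = (far X g \<odot> far Y g) \<odot> \<i> (fob C i)" "y = \<i> (fob X j \<otimes> fob Y j) \<odot> far C g"
      by simp_all
    have "u i \<cdot> x = v j j \<cdot> (\<i> (fob X j \<otimes> fob Y j) \<odot> diag j j i g g)"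
      unfolding e(3) by (rule uv) (use e(1,2) g in simp_all)
    also have "\<dots> = u j \<cdot> y"
    proof -
      have d: "?d j \<cdot> far C g = diag j j i g g"
        by (subst diag_precomp[of _ j _ _ _ _ i]) (use e(1,2) g in simp_all)
      have [simp]: "Dom \<Delta> g = i" "Cod \<Delta> g = j" using e(1,2) by simp_all
      show ?thesis by (simp add: u_def e(4) d)
    qed
    finally show "u i \<cdot> x = u j \<cdot> y" .
  qed auto
  have "h \<cdot> tgtl X Y m n = v m n" for m n
  proof (rule jointly_epicD[OF diag_jointly_epic[of "fob X m \<otimes> fob Y n" m n]])
    fix kfg assume "kfg \<in> (SIGMA k:UNIV. Hom \<Delta> k m \<times> Hom \<Delta> k n)"
    then obtain k f g where kfg: "kfg = (k, f, g)" and [simp]: "f \<in> Arr \<Delta>" "Dom \<Delta> f = k" "Cod \<Delta> f = m" "g \<in> Arr \<Delta>" "Dom \<Delta> g = k" "Cod \<Delta> g = n"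
      by (cases kfg) force
    have "(h \<cdot> tgtl X Y m n) \<cdot> (\<i> (fob X m \<otimes> fob Y n) \<odot> diag m n k f g) = (h \<cdot> leg (X \<otimes>\<^bsub>SE\<^esub> Y) k) \<cdot> ((far X f \<odot> far Y g) \<odot> \<i> (fob C k))"
      using h by (simp add: target_leg_diag)
    also have "\<dots> = v m n \<cdot> (\<i> (fob X m \<otimes> fob Y n) \<odot> diag m n k f g)"
      unfolding hl by (rule uv) simp_all
    finally show "(h \<cdot> tgtl X Y m n) \<cdot> (case kfg of (k, f, g) \<Rightarrow> \<i> (fob X m \<otimes> fob Y n) \<odot> diag m n k f g) =
        v m n \<cdot> (case kfg of (k, f, g) \<Rightarrow> \<i> (fob X m \<otimes> fob Y n) \<odot> diag m n k f g)"
      by (simp add: kfg)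
  qed (use h in auto)
  then show thesis using that h by blast
qed

end


section \<open>Associativity of a symmetric pairing\<close>

text \<open>A symmetric monoidal functor up to its unit and its associativity, which can then be discussed
  for single triples of objects.\<close>

locale symmetric_pairing =
  M: symmetric_monoidal_category M + N: symmetric_monoidal_category N
  for M :: "('i, 'j, 'y) smcat_scheme" and N :: "('o, 'a, 'z) smcat_scheme"
    and F :: "('i, 'j, 'o, 'a) functor_data" and p :: "'i \<Rightarrow> 'i \<Rightarrow> 'a" +
  assumes functor_F: "is_functor M N F"
    and mult_map: "X \<in> Obj M \<Longrightarrow> Y \<in> Obj M \<Longrightarrow> p X Y \<in> Hom N (fob F X \<otimes>\<^bsub>N\<^esub> fob F Y) (fob F (X \<otimes>\<^bsub>M\<^esub> Y))"
    and mult_natural: "f \<in> Hom M X X' \<Longrightarrow> g \<in> Hom M Y Y' \<Longrightarrow>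
      p X' Y' \<cdot>\<^bsub>N\<^esub> (far F f \<odot>\<^bsub>N\<^esub> far F g) = far F (f \<odot>\<^bsub>M\<^esub> g) \<cdot>\<^bsub>N\<^esub> p X Y"
    and mult_swap: "X \<in> Obj M \<Longrightarrow> Y \<in> Obj M \<Longrightarrow>
      far F (Swap M X Y) \<cdot>\<^bsub>N\<^esub> p X Y = p Y X \<cdot>\<^bsub>N\<^esub> Swap N (fob F X) (fob F Y)"
begin

lemmas functor_F_simps [simp] = functor_simps[OF functor_F]

lemma
  assumes "X \<in> Obj M" "Y \<in> Obj M"
  shows Arr_mult [simp]: "p X Y \<in> Arr N" and Dom_mult [simp]: "Dom N (p X Y) = fob F X \<otimes>\<^bsub>N\<^esub> fob F Y"
    and Cod_mult [simp]: "Cod N (p X Y) = fob F (X \<otimes>\<^bsub>M\<^esub> Y)"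
  using mult_map[OF assms] by auto

lemma mult_nat_left:
  assumes "f \<in> Arr M" "Cod M f = X'" "Y \<in> Obj M"
  shows "p X' Y \<cdot>\<^bsub>N\<^esub> (far F f \<odot>\<^bsub>N\<^esub> Ide N (fob F Y)) = far F (f \<odot>\<^bsub>M\<^esub> Ide M Y) \<cdot>\<^bsub>N\<^esub> p (Dom M f) Y"
  using mult_natural[of f "Dom M f" X' "Ide M Y" Y Y] assms by simp

lemma mult_nat_right:
  assumes "g \<in> Arr M" "Cod M g = Y'" "X \<in> Obj M"
  shows "p X Y' \<cdot>\<^bsub>N\<^esub> (Ide N (fob F X) \<odot>\<^bsub>N\<^esub> far F g) = far F (Ide M X \<odot>\<^bsub>M\<^esub> g) \<cdot>\<^bsub>N\<^esub> p X (Dom M g)"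
  using mult_natural[of "Ide M X" X X g "Dom M g" Y'] assms by simp

lemma mult_flip:
  assumes [simp]: "X \<in> Obj M" "Y \<in> Obj M"
  shows "p X Y = far F (Swap M Y X) \<cdot>\<^bsub>N\<^esub> (p Y X \<cdot>\<^bsub>N\<^esub> Swap N (fob F X) (fob F Y))"
proof -
  have "far F (Swap M Y X) \<cdot>\<^bsub>N\<^esub> (p Y X \<cdot>\<^bsub>N\<^esub> Swap N (fob F X) (fob F Y)) =
      p X Y \<cdot>\<^bsub>N\<^esub> (Swap N (fob F Y) (fob F X) \<cdot>\<^bsub>N\<^esub> Swap N (fob F X) (fob F Y))"
    by (subst N.reassoc[OF mult_swap]) simp_all
  then show ?thesis by simp
qed

definition associative :: "'i \<Rightarrow> 'i \<Rightarrow> 'i \<Rightarrow> bool" where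
  "associative X Y Z \<longleftrightarrow>
     far F (Assoc M X Y Z) \<cdot>\<^bsub>N\<^esub> (p (X \<otimes>\<^bsub>M\<^esub> Y) Z \<cdot>\<^bsub>N\<^esub> (p X Y \<odot>\<^bsub>N\<^esub> Ide N (fob F Z))) =
     p X (Y \<otimes>\<^bsub>M\<^esub> Z) \<cdot>\<^bsub>N\<^esub> ((Ide N (fob F X) \<odot>\<^bsub>N\<^esub> p Y Z) \<cdot>\<^bsub>N\<^esub> Assoc N (fob F X) (fob F Y) (fob F Z))"

definition triple :: "'i \<Rightarrow> 'i \<Rightarrow> 'i \<Rightarrow> 'a" where
  "triple X Y Z = p X (Y \<otimes>\<^bsub>M\<^esub> Z) \<cdot>\<^bsub>N\<^esub> (Ide N (fob F X) \<odot>\<^bsub>N\<^esub> p Y Z)"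

lemma
  assumes [simp]: "X \<in> Obj M" "Y \<in> Obj M" "Z \<in> Obj M"
  shows Arr_triple [simp]: "triple X Y Z \<in> Arr N"
    and Dom_triple [simp]: "Dom N (triple X Y Z) = fob F X \<otimes>\<^bsub>N\<^esub> (fob F Y \<otimes>\<^bsub>N\<^esub> fob F Z)"
    and Cod_triple [simp]: "Cod N (triple X Y Z) = fob F (X \<otimes>\<^bsub>M\<^esub> (Y \<otimes>\<^bsub>M\<^esub> Z))"
  by (simp_all add: triple_def)

lemma triple_swap:
  assumes [simp]: "X \<in> Obj M" "Y \<in> Obj M" "Z \<in> Obj M"
  shows "triple X Z Y \<cdot>\<^bsub>N\<^esub> (Ide N (fob F X) \<odot>\<^bsub>N\<^esub> Swap N (fob F Y) (fob F Z)) =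
    far F (Ide M X \<odot>\<^bsub>M\<^esub> Swap M Y Z) \<cdot>\<^bsub>N\<^esub> triple X Y Z"
proof -
  have "triple X Z Y \<cdot>\<^bsub>N\<^esub> (Ide N (fob F X) \<odot>\<^bsub>N\<^esub> Swap N (fob F Y) (fob F Z)) =
    p X (Z \<otimes>\<^bsub>M\<^esub> Y) \<cdot>\<^bsub>N\<^esub> (Ide N (fob F X) \<odot>\<^bsub>N\<^esub> (p Z Y \<cdot>\<^bsub>N\<^esub> Swap N (fob F Y) (fob F Z)))"
    by (simp add: triple_def)
  also have "\<dots> = p X (Z \<otimes>\<^bsub>M\<^esub> Y) \<cdot>\<^bsub>N\<^esub> ((Ide N (fob F X) \<odot>\<^bsub>N\<^esub> far F (Swap M Y Z)) \<cdot>\<^bsub>N\<^esub> (Ide N (fob F X) \<odot>\<^bsub>N\<^esub> p Y Z))"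
    by (simp add: mult_swap[symmetric])
  also have "\<dots> = far F (Ide M X \<odot>\<^bsub>M\<^esub> Swap M Y Z) \<cdot>\<^bsub>N\<^esub> triple X Y Z"
    by (subst N.reassoc[OF mult_nat_right]) (simp_all add: triple_def)
  finally show ?thesis .
qed

text \<open>Associativity at \<open>X, Y, Z\<close> says that the right-nested triple pairing is compatible with the
  cyclic permutation that moves \<open>Z\<close> to the end: the left-nested pairing is a right-nested one
  after a flip of its outer pairing.\<close>

lemma associative_iff_cycle:
  assumes [simp]: "X \<in> Obj M" "Y \<in> Obj M" "Z \<in> Obj M"
  shows "associative X Y Z \<longleftrightarrow>
    triple X Y Z \<cdot>\<^bsub>N\<^esub> (Assoc N (fob F X) (fob F Y) (fob F Z) \<cdot>\<^bsub>N\<^esub> Swap N (fob F Z) (fob F X \<otimes>\<^bsub>N\<^esub> fob F Y)) =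
    far F (Assoc M X Y Z) \<cdot>\<^bsub>N\<^esub> (far F (Swap M Z (X \<otimes>\<^bsub>M\<^esub> Y)) \<cdot>\<^bsub>N\<^esub> triple Z X Y)" (is "_ \<longleftrightarrow> ?l = ?r")
proof -
  let ?XY = "fob F X \<otimes>\<^bsub>N\<^esub> fob F Y"
  have 1: "far F (Assoc M X Y Z) \<cdot>\<^bsub>N\<^esub> (p (X \<otimes>\<^bsub>M\<^esub> Y) Z \<cdot>\<^bsub>N\<^esub> (p X Y \<odot>\<^bsub>N\<^esub> Ide N (fob F Z))) = ?r \<cdot>\<^bsub>N\<^esub> Swap N ?XY (fob F Z)"
  proof -
    have "p (X \<otimes>\<^bsub>M\<^esub> Y) Z \<cdot>\<^bsub>N\<^esub> (p X Y \<odot>\<^bsub>N\<^esub> Ide N (fob F Z)) = far F (Swap M Z (X \<otimes>\<^bsub>M\<^esub> Y)) \<cdot>\<^bsub>N\<^esub> (p Z (X \<otimes>\<^bsub>M\<^esub> Y) \<cdot>\<^bsub>N\<^esub>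
       (Swap N (fob F (X \<otimes>\<^bsub>M\<^esub> Y)) (fob F Z) \<cdot>\<^bsub>N\<^esub> (p X Y \<odot>\<^bsub>N\<^esub> Ide N (fob F Z))))"
      by (subst mult_flip) simp_all
    also have "\<dots> = far F (Swap M Z (X \<otimes>\<^bsub>M\<^esub> Y)) \<cdot>\<^bsub>N\<^esub> (triple Z X Y \<cdot>\<^bsub>N\<^esub> Swap N ?XY (fob F Z))"
      by (simp add: N.swap_natural triple_def)
    finally show ?thesis by simp
  qed
  have 2: "p X (Y \<otimes>\<^bsub>M\<^esub> Z) \<cdot>\<^bsub>N\<^esub> ((Ide N (fob F X) \<odot>\<^bsub>N\<^esub> p Y Z) \<cdot>\<^bsub>N\<^esub> Assoc N (fob F X) (fob F Y) (fob F Z)) = ?l \<cdot>\<^bsub>N\<^esub> Swap N ?XY (fob F Z)"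
    by (simp add: triple_def)
  have "?r \<cdot>\<^bsub>N\<^esub> Swap N ?XY (fob F Z) = ?l \<cdot>\<^bsub>N\<^esub> Swap N ?XY (fob F Z) \<longleftrightarrow> ?l = ?r"
  proof
    assume "?r \<cdot>\<^bsub>N\<^esub> Swap N ?XY (fob F Z) = ?l \<cdot>\<^bsub>N\<^esub> Swap N ?XY (fob F Z)"
    from N.iso_cancel_right[OF _ _ _ _ _ this] show "?l = ?r" by simp
  qed simp
  then show ?thesis unfolding associative_def 1 2 .
qed

text \<open>Conjugation with transpositions of the last two factors turns the inverse of the cycle for
  \<open>X, Y, Z\<close> into the cycle for \<open>Z, Y, X\<close>, and the triple pairing respects such transpositions
  by symmetry of the inner pairing.\<close>

lemma associative_reverse:
  assumes a: "associative X Y Z" and [simp]: "X \<in> Obj M" "Y \<in> Obj M" "Z \<in> Obj M"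
  shows "associative Z Y X"
proof -
  let ?X = "fob F X" and ?Y = "fob F Y" and ?Z = "fob F Z"
  let ?c = "Swap N (?X \<otimes>\<^bsub>N\<^esub> ?Y) ?Z \<cdot>\<^bsub>N\<^esub> inv_arr N (Assoc N ?X ?Y ?Z)"
  let ?C = "Swap M (X \<otimes>\<^bsub>M\<^esub> Y) Z \<cdot>\<^bsub>M\<^esub> inv_arr M (Assoc M X Y Z)"
  let ?d = "Assoc N ?Z ?Y ?X \<cdot>\<^bsub>N\<^esub> Swap N ?X (?Z \<otimes>\<^bsub>N\<^esub> ?Y)"
  let ?D = "Assoc M Z Y X \<cdot>\<^bsub>M\<^esub> Swap M X (Z \<otimes>\<^bsub>M\<^esub> Y)"
  have cyc: "triple X Y Z \<cdot>\<^bsub>N\<^esub> (Assoc N ?X ?Y ?Z \<cdot>\<^bsub>N\<^esub> Swap N ?Z (?X \<otimes>\<^bsub>N\<^esub> ?Y)) =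
      far F (Assoc M X Y Z \<cdot>\<^bsub>M\<^esub> Swap M Z (X \<otimes>\<^bsub>M\<^esub> Y)) \<cdot>\<^bsub>N\<^esub> triple Z X Y"
    using a[unfolded associative_iff_cycle[OF assms(2,3,4)]] by simp
  have cyc': "triple Z X Y \<cdot>\<^bsub>N\<^esub> ?c = far F ?C \<cdot>\<^bsub>N\<^esub> triple X Y Z"
  proof -
    have "far F ?C \<cdot>\<^bsub>N\<^esub> triple X Y Z = far F ?C \<cdot>\<^bsub>N\<^esub> ((triple X Y Z \<cdot>\<^bsub>N\<^esub> (Assoc N ?X ?Y ?Z \<cdot>\<^bsub>N\<^esub> Swap N ?Z (?X \<otimes>\<^bsub>N\<^esub> ?Y))) \<cdot>\<^bsub>N\<^esub> ?c)"
      by simp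
    also have "\<dots> = far F (?C \<cdot>\<^bsub>M\<^esub> (Assoc M X Y Z \<cdot>\<^bsub>M\<^esub> Swap M Z (X \<otimes>\<^bsub>M\<^esub> Y))) \<cdot>\<^bsub>N\<^esub> (triple Z X Y \<cdot>\<^bsub>N\<^esub> ?c)"
      unfolding cyc by (simp del: M.inv_Comp M.inv_Comp' M.swap_Swap M.swap_Swap')
    also have "?C \<cdot>\<^bsub>M\<^esub> (Assoc M X Y Z \<cdot>\<^bsub>M\<^esub> Swap M Z (X \<otimes>\<^bsub>M\<^esub> Y)) = Ide M (Z \<otimes>\<^bsub>M\<^esub> (X \<otimes>\<^bsub>M\<^esub> Y))" by simp
    finally show ?thesis by simp
  qed
  have "(far F (Ide M Z \<odot>\<^bsub>M\<^esub> Swap M Y X)) \<cdot>\<^bsub>N\<^esub> (triple Z Y X \<cdot>\<^bsub>N\<^esub> ?d) =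
      triple Z X Y \<cdot>\<^bsub>N\<^esub> ((Ide N ?Z \<odot>\<^bsub>N\<^esub> Swap N ?Y ?X) \<cdot>\<^bsub>N\<^esub> ?d)"
    using N.reassoc[OF triple_swap[of Z Y X], of ?d] by simp
  also have "\<dots> = (triple Z X Y \<cdot>\<^bsub>N\<^esub> ?c) \<cdot>\<^bsub>N\<^esub> (Ide N ?X \<odot>\<^bsub>N\<^esub> Swap N ?Z ?Y)"
    using N.cycle_reverse[of ?X ?Y ?Z] by simp
  also have "\<dots> = far F ?C \<cdot>\<^bsub>N\<^esub> (far F (Ide M X \<odot>\<^bsub>M\<^esub> Swap M Z Y) \<cdot>\<^bsub>N\<^esub> triple X Z Y)"
    unfolding cyc' triple_swap[OF assms(2,4,3), symmetric] by simp
  also have "\<dots> = far F (?C \<cdot>\<^bsub>M\<^esub> (Ide M X \<odot>\<^bsub>M\<^esub> Swap M Z Y)) \<cdot>\<^bsub>N\<^esub> triple X Z Y" by simp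
  also have "?C \<cdot>\<^bsub>M\<^esub> (Ide M X \<odot>\<^bsub>M\<^esub> Swap M Z Y) = (Ide M Z \<odot>\<^bsub>M\<^esub> Swap M Y X) \<cdot>\<^bsub>M\<^esub> ?D"
    using M.cycle_reverse[of X Y Z] by simp
  also have "far F ((Ide M Z \<odot>\<^bsub>M\<^esub> Swap M Y X) \<cdot>\<^bsub>M\<^esub> ?D) \<cdot>\<^bsub>N\<^esub> triple X Z Y =
      far F (Ide M Z \<odot>\<^bsub>M\<^esub> Swap M Y X) \<cdot>\<^bsub>N\<^esub> (far F ?D \<cdot>\<^bsub>N\<^esub> triple X Z Y)" by simp
  finally have "triple Z Y X \<cdot>\<^bsub>N\<^esub> ?d = far F ?D \<cdot>\<^bsub>N\<^esub> triple X Z Y"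
    by (rule N.iso_cancel_left[rotated 5]) (simp_all add: functor_iso(1)[OF functor_F])
  then show ?thesis unfolding associative_iff_cycle[OF assms(4,3,2)] by simp
qed

text \<open>The cycle for \<open>X, Z, Y\<close> followed by a transposition of the last two factors is the exchange of
  the first two, so the triple pairing respects this exchange.  By associativity at \<open>X, Y, Z\<close> the
  exchange is a swap inside the inner pairing of \<open>X\<close> and \<open>Y\<close>, and this is the law for
  \<open>Y, X, Z\<close>.\<close>

lemma associative_middle:
  assumes a: "associative X Y Z" and b: "associative X Z Y" and [simp]: "X \<in> Obj M" "Y \<in> Obj M" "Z \<in> Obj M"
  shows "associative Y X Z"
proof -
  let ?X = "fob F X" and ?Y = "fob F Y" and ?Z = "fob F Z"
  have cyc: "triple X Z Y \<cdot>\<^bsub>N\<^esub> (Assoc N ?X ?Z ?Y \<cdot>\<^bsub>N\<^esub> Swap N ?Y (?X \<otimes>\<^bsub>N\<^esub> ?Z)) =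
      far F (Assoc M X Z Y \<cdot>\<^bsub>M\<^esub> Swap M Y (X \<otimes>\<^bsub>M\<^esub> Z)) \<cdot>\<^bsub>N\<^esub> triple Y X Z"
    using b[unfolded associative_iff_cycle[OF assms(3,5,4)]] by simp
  have ex: "triple X Y Z \<cdot>\<^bsub>N\<^esub> N.exchange ?Y ?X ?Z = far F (M.exchange Y X Z) \<cdot>\<^bsub>N\<^esub> triple Y X Z"
  proof -
    have "triple X Y Z \<cdot>\<^bsub>N\<^esub> N.exchange ?Y ?X ?Z =
        (triple X Y Z \<cdot>\<^bsub>N\<^esub> (Ide N ?X \<odot>\<^bsub>N\<^esub> Swap N ?Z ?Y)) \<cdot>\<^bsub>N\<^esub> (Assoc N ?X ?Z ?Y \<cdot>\<^bsub>N\<^esub> Swap N ?Y (?X \<otimes>\<^bsub>N\<^esub> ?Z))"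
      by (simp add: N.cycle_hexagon[symmetric] del: N.cycle_hexagon)
    also have "\<dots> = far F (Ide M X \<odot>\<^bsub>M\<^esub> Swap M Z Y) \<cdot>\<^bsub>N\<^esub> (triple X Z Y \<cdot>\<^bsub>N\<^esub> (Assoc N ?X ?Z ?Y \<cdot>\<^bsub>N\<^esub> Swap N ?Y (?X \<otimes>\<^bsub>N\<^esub> ?Z)))"
      unfolding triple_swap[OF assms(3,5,4)] by simp
    also have "\<dots> = far F ((Ide M X \<odot>\<^bsub>M\<^esub> Swap M Z Y) \<cdot>\<^bsub>M\<^esub> (Assoc M X Z Y \<cdot>\<^bsub>M\<^esub> Swap M Y (X \<otimes>\<^bsub>M\<^esub> Z))) \<cdot>\<^bsub>N\<^esub> triple Y X Z"
      unfolding cyc by simp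
    also have "(Ide M X \<odot>\<^bsub>M\<^esub> Swap M Z Y) \<cdot>\<^bsub>M\<^esub> (Assoc M X Z Y \<cdot>\<^bsub>M\<^esub> Swap M Y (X \<otimes>\<^bsub>M\<^esub> Z)) = M.exchange Y X Z"
      by (rule M.cycle_hexagon) simp_all
    finally show ?thesis .
  qed
  have ex': "far F (M.exchange X Y Z) \<cdot>\<^bsub>N\<^esub> (triple X Y Z \<cdot>\<^bsub>N\<^esub> N.exchange ?Y ?X ?Z) = triple Y X Z"
  proof -
    have "far F (M.exchange X Y Z) \<cdot>\<^bsub>N\<^esub> (triple X Y Z \<cdot>\<^bsub>N\<^esub> N.exchange ?Y ?X ?Z) =
        far F (M.exchange X Y Z \<cdot>\<^bsub>M\<^esub> M.exchange Y X Z) \<cdot>\<^bsub>N\<^esub> triple Y X Z"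
      unfolding ex by (simp del: M.exchange_exchange)
    then show ?thesis by simp
  qed
  have asc: "p (X \<otimes>\<^bsub>M\<^esub> Y) Z \<cdot>\<^bsub>N\<^esub> (p X Y \<odot>\<^bsub>N\<^esub> Ide N ?Z) = far F (inv_arr M (Assoc M X Y Z)) \<cdot>\<^bsub>N\<^esub> (triple X Y Z \<cdot>\<^bsub>N\<^esub> Assoc N ?X ?Y ?Z)"
  proof -
    have "far F (inv_arr M (Assoc M X Y Z)) \<cdot>\<^bsub>N\<^esub> (triple X Y Z \<cdot>\<^bsub>N\<^esub> Assoc N ?X ?Y ?Z) =
        far F (inv_arr M (Assoc M X Y Z)) \<cdot>\<^bsub>N\<^esub> (far F (Assoc M X Y Z) \<cdot>\<^bsub>N\<^esub> (p (X \<otimes>\<^bsub>M\<^esub> Y) Z \<cdot>\<^bsub>N\<^esub> (p X Y \<odot>\<^bsub>N\<^esub> Ide N ?Z)))"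
      using a unfolding associative_def by (simp add: triple_def)
    also have "\<dots> = far F (inv_arr M (Assoc M X Y Z) \<cdot>\<^bsub>M\<^esub> Assoc M X Y Z) \<cdot>\<^bsub>N\<^esub> (p (X \<otimes>\<^bsub>M\<^esub> Y) Z \<cdot>\<^bsub>N\<^esub> (p X Y \<odot>\<^bsub>N\<^esub> Ide N ?Z))"
      by (simp del: M.inv_Comp)
    finally show ?thesis by simp
  qed
  have "far F (Assoc M Y X Z) \<cdot>\<^bsub>N\<^esub> (p (Y \<otimes>\<^bsub>M\<^esub> X) Z \<cdot>\<^bsub>N\<^esub> (p Y X \<odot>\<^bsub>N\<^esub> Ide N ?Z)) =
      far F (Assoc M Y X Z) \<cdot>\<^bsub>N\<^esub> (p (Y \<otimes>\<^bsub>M\<^esub> X) Z \<cdot>\<^bsub>N\<^esub> ((far F (Swap M X Y) \<odot>\<^bsub>N\<^esub> Ide N ?Z) \<cdot>\<^bsub>N\<^esub>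
        ((p X Y \<odot>\<^bsub>N\<^esub> Ide N ?Z) \<cdot>\<^bsub>N\<^esub> (Swap N ?Y ?X \<odot>\<^bsub>N\<^esub> Ide N ?Z))))"
    by (subst (2) mult_flip) simp_all
  also have "\<dots> = far F (Assoc M Y X Z) \<cdot>\<^bsub>N\<^esub> (far F (Swap M X Y \<odot>\<^bsub>M\<^esub> Ide M Z) \<cdot>\<^bsub>N\<^esub> ((p (X \<otimes>\<^bsub>M\<^esub> Y) Z \<cdot>\<^bsub>N\<^esub>
        (p X Y \<odot>\<^bsub>N\<^esub> Ide N ?Z)) \<cdot>\<^bsub>N\<^esub> (Swap N ?Y ?X \<odot>\<^bsub>N\<^esub> Ide N ?Z)))"
    by (subst N.reassoc[OF mult_nat_left]) simp_all
  also have "\<dots> = far F (M.exchange X Y Z) \<cdot>\<^bsub>N\<^esub> (triple X Y Z \<cdot>\<^bsub>N\<^esub> (Assoc N ?X ?Y ?Z \<cdot>\<^bsub>N\<^esub> (Swap N ?Y ?X \<odot>\<^bsub>N\<^esub> Ide N ?Z)))"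
    unfolding asc by (simp add: M.exchange_def)
  also have "\<dots> = far F (M.exchange X Y Z) \<cdot>\<^bsub>N\<^esub> (triple X Y Z \<cdot>\<^bsub>N\<^esub> (N.exchange ?Y ?X ?Z \<cdot>\<^bsub>N\<^esub> Assoc N ?Y ?X ?Z))"
    by (simp add: N.exchange_def)
  also have "\<dots> = (far F (M.exchange X Y Z) \<cdot>\<^bsub>N\<^esub> (triple X Y Z \<cdot>\<^bsub>N\<^esub> N.exchange ?Y ?X ?Z)) \<cdot>\<^bsub>N\<^esub> Assoc N ?Y ?X ?Z" by simp
  also have "\<dots> = triple Y X Z \<cdot>\<^bsub>N\<^esub> Assoc N ?Y ?X ?Z" unfolding ex' ..
  finally show ?thesis unfolding associative_def by (simp add: triple_def)
qed

end


section \<open>The pairing induced by an Eilenberg-Zilber family\<close>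

locale natural_EZ = realisation_setting U E C
  for U :: "'u itself" and E :: "('o, 'a, 'z) smcat_scheme" (structure) and C :: "('o, 'a) cosimplicial" +
  fixes e :: "nat \<Rightarrow> nat \<Rightarrow> 'a"
  assumes e_hom: "e m n \<in> Hom E (R (S m) \<otimes> R (S n)) (R (S m \<otimes>\<^bsub>SE\<^esub> S n))"
    and e_natural: "f \<in> Hom \<Delta> m m' \<Longrightarrow> g \<in> Hom \<Delta> n n' \<Longrightarrow>
      e m' n' \<cdot> (RA (SA f) \<odot> RA (SA g)) = RA (SA f \<odot>\<^bsub>SE\<^esub> SA g) \<cdot> e m n"
begin

abbreviation P :: "('o, 'a) simplicial \<Rightarrow> ('o, 'a) simplicial \<Rightarrow> 'a" where "P X Y \<equiv> EZ_extension U E C e X Y"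

lemma e_simps [simp]:
  "e m n \<in> Arr E" "Dom E (e m n) = R (S m) \<otimes> R (S n)" "Cod E (e m n) = R (S m \<otimes>\<^bsub>SE\<^esub> S n)"
  using e_hom[of m n] by auto

text \<open>The extension is defined through abstract coends over \<open>\<Delta> \<times> \<Delta>\<close>.  The comparison with the
  source is invertible by \<open>source_universal\<close>, and evaluation on the legs of the abstract coends
  removes them from the description.\<close>

lemma
  assumes X[simp]: "X \<in> Obj SE" and Y[simp]: "Y \<in> Obj SE"
  shows Arr_P [simp]: "P X Y \<in> Arr E" and Dom_P [simp]: "Dom E (P X Y) = R X \<otimes> R Y"
    and Cod_P [simp]: "Cod E (P X Y) = R (X \<otimes>\<^bsub>SE\<^esub> Y)"
    and P_source_leg: "P X Y \<cdot> srcl X Y m n = tgtl X Y m n \<cdot> (\<i> (fob X m \<otimes> fob Y n) \<odot> e m n)"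
proof -
  note F = functor_XY[OF X Y]
  let ?XY = "external_tensor E X Y" and ?Z = "EZ_source U E C" and ?W = "EZ_target U E C"
  let ?s = "tensor_over_leg \<Delta>\<Delta> E ?XY ?Z" and ?t = "tensor_over_leg \<Delta>\<Delta> E ?XY ?W"
  have UU: "Obj \<Delta>\<Delta> = UNIV" by simp
  note us = tensor_over_universal[OF F functor_EZ_source, unfolded UU] and ut = tensor_over_universal[OF F functor_EZ_target, unfolded UU]
  have s[simp]: "?s i \<in> Arr E" "Cod E (?s i) = tensor_over \<Delta>\<Delta> E ?XY ?Z" and sD: "Dom E (?s i) = fob ?XY i \<otimes> fob ?Z i" for i
    using Arr_universal[OF us(1)] Cod_universal[OF us(1)] us(2) by simp_all
  have t[simp]: "?t i \<in> Arr E" "Cod E (?t i) = tensor_over \<Delta>\<Delta> E ?XY ?W" and tD: "Dom E (?t i) = fob ?XY i \<otimes> fob ?W i" for i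
    using Arr_universal[OF ut(1)] Cod_universal[OF ut(1)] ut(2) by simp_all
  have tO[simp]: "tensor_over \<Delta>\<Delta> E ?XY ?W \<in> Obj E" "tensor_over \<Delta>\<Delta> E ?XY ?Z \<in> Obj E"
    using Obj_universal[OF ut(1)] Obj_universal[OF us(1)] .
  have ws: "is_wedge \<Delta>\<Delta> E (external_tensor E ?XY ?Z) (R X \<otimes> R Y) (\<lambda>(m, n). srcl X Y m n)"
    unfolding is_wedge_iff[OF F functor_EZ_source] by (auto simp: source_leg_dinatural)
  have wt: "is_wedge \<Delta>\<Delta> E (external_tensor E ?XY ?W) (R (X \<otimes>\<^bsub>SE\<^esub> Y)) (\<lambda>(m, n). tgtl X Y m n)"
    unfolding is_wedge_iff[OF F functor_EZ_target] by (auto simp: target_leg_dinatural)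
  have trel: "?t (Dom \<Delta> f, Dom \<Delta> g) \<cdot> ((far X f \<odot> far Y g) \<odot> \<i> (R (S (Dom \<Delta> f) \<otimes>\<^bsub>SE\<^esub> S (Dom \<Delta> g)))) =
      ?t (Cod \<Delta> f, Cod \<Delta> g) \<cdot> (\<i> (fob X (Cod \<Delta> f) \<otimes> fob Y (Cod \<Delta> g)) \<odot> RA (SA f \<odot>\<^bsub>SE\<^esub> SA g))"
    if fg: "f \<in> Arr \<Delta>" "g \<in> Arr \<Delta>" for f g
  proof -
    have "is_wedge \<Delta>\<Delta> E (external_tensor E ?XY ?W) (tensor_over \<Delta>\<Delta> E ?XY ?W) ?t"
      using tensor_over_is_coend[OF F functor_EZ_target] by (simp add: is_coend_def)
    from this[unfolded is_wedge_iff[OF F functor_EZ_target], THEN conjunct2, THEN conjunct2, rule_format, of "(f, g)"] fg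
    show ?thesis by simp
  qed
  let ?m = "\<lambda>(m, n). ?t (m, n) \<cdot> (\<i> (fob X m \<otimes> fob Y n) \<odot> e m n)"
  have wm: "is_wedge \<Delta>\<Delta> E (external_tensor E ?XY ?Z) (tensor_over \<Delta>\<Delta> E ?XY ?W) ?m"
    unfolding is_wedge_iff[OF F functor_EZ_source]
  proof (intro conjI ballI)
    show "?m i \<in> Hom E (fob ?XY i \<otimes> fob ?Z i) (tensor_over \<Delta>\<Delta> E ?XY ?W)" for i
      by (cases i) (simp add: tD)
    fix fg assume "fg \<in> Arr \<Delta>\<Delta>"
    then obtain f g where fg: "fg = (f, g)" and [simp]: "f \<in> Arr \<Delta>" "g \<in> Arr \<Delta>" by (cases fg) auto
    have "(?t (Dom \<Delta> f, Dom \<Delta> g) \<cdot> (\<i> (fob X (Dom \<Delta> f) \<otimes> fob Y (Dom \<Delta> g)) \<odot> e (Dom \<Delta> f) (Dom \<Delta> g))) \<cdot>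
        ((far X f \<odot> far Y g) \<odot> \<i> (R (S (Dom \<Delta> f)) \<otimes> R (S (Dom \<Delta> g)))) =
      (?t (Dom \<Delta> f, Dom \<Delta> g) \<cdot> ((far X f \<odot> far Y g) \<odot> \<i> (R (S (Dom \<Delta> f) \<otimes>\<^bsub>SE\<^esub> S (Dom \<Delta> g))))) \<cdot>
        (\<i> (fob X (Cod \<Delta> f) \<otimes> fob Y (Cod \<Delta> g)) \<odot> e (Dom \<Delta> f) (Dom \<Delta> g))"
      by (simp add: tD)
    also have "\<dots> = (?t (Cod \<Delta> f, Cod \<Delta> g) \<cdot> (\<i> (fob X (Cod \<Delta> f) \<otimes> fob Y (Cod \<Delta> g)) \<odot> e (Cod \<Delta> f) (Cod \<Delta> g))) \<cdot>
        (\<i> (fob X (Cod \<Delta> f) \<otimes> fob Y (Cod \<Delta> g)) \<odot> (RA (SA f) \<odot> RA (SA g)))"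
      by (simp add: trel tD e_natural[of f "Dom \<Delta> f" "Cod \<Delta> f" g "Dom \<Delta> g" "Cod \<Delta> g"])
    finally show "?m (Dom \<Delta>\<Delta> fg) \<cdot> (far ?XY fg \<odot> \<i> (fob ?Z (Dom \<Delta>\<Delta> fg))) = ?m (Cod \<Delta>\<Delta> fg) \<cdot> (\<i> (fob ?XY (Cod \<Delta>\<Delta> fg)) \<odot> far ?Z fg)"
      by (simp add: fg)
  qed simp
  note ds = tensor_over_desc[OF F functor_EZ_source ws, folded source_iso_def, unfolded UU]
    and dt = tensor_over_desc[OF F functor_EZ_target wt, folded target_iso_def, unfolded UU]
    and dm = tensor_over_desc[OF F functor_EZ_source wm, unfolded UU]
  let ?mid = "tensor_over_desc \<Delta>\<Delta> E ?XY ?Z (tensor_over \<Delta>\<Delta> E ?XY ?W) ?m"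
  have si: "is_iso E (source_iso U E C X Y)"
    by (rule universal_comparison_iso[OF us(1) source_universal[OF X Y] _ ds(1)]) (use ds(2) in \<open>auto simp: sD\<close>)
  note [simp] = ds(1)[simplified] dt(1)[simplified] dm(1)[simplified] si
  have P: "P X Y = target_iso U E C X Y \<cdot> (?mid \<cdot> inv_arr E (source_iso U E C X Y))"
    by (simp add: EZ_extension_def)
  show "P X Y \<in> Arr E" "Dom E (P X Y) = R X \<otimes> R Y" "Cod E (P X Y) = R (X \<otimes>\<^bsub>SE\<^esub> Y)" by (simp_all add: P)
  have "P X Y \<cdot> srcl X Y m n = P X Y \<cdot> (source_iso U E C X Y \<cdot> ?s (m, n))" using ds(2)[of "(m, n)"] by simp
  also have "\<dots> = target_iso U E C X Y \<cdot> (?mid \<cdot> ?s (m, n))" by (simp add: P)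
  also have "\<dots> = (target_iso U E C X Y \<cdot> ?t (m, n)) \<cdot> (\<i> (fob X m \<otimes> fob Y n) \<odot> e m n)"
    using dm(2)[of "(m, n)"] by (simp add: tD)
  also have "\<dots> = tgtl X Y m n \<cdot> (\<i> (fob X m \<otimes> fob Y n) \<odot> e m n)" using dt(2)[of "(m, n)"] by simp
  finally show "P X Y \<cdot> srcl X Y m n = tgtl X Y m n \<cdot> (\<i> (fob X m \<otimes> fob Y n) \<odot> e m n)" .
qed

lemma P_eqI:
  assumes [simp]: "X \<in> Obj SE" "Y \<in> Obj SE" and h: "h \<in> Hom E (R X \<otimes> R Y) (R (X \<otimes>\<^bsub>SE\<^esub> Y))"
    and "\<And>m n. h \<cdot> srcl X Y m n = tgtl X Y m n \<cdot> (\<i> (fob X m \<otimes> fob Y n) \<odot> e m n)"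
  shows "P X Y = h"
  by (rule jointly_epicD[OF source_leg_jointly_epic[OF assms(1,2)]]) (use assms in \<open>auto simp: P_source_leg\<close>)

lemma P_natural:
  assumes s: "s \<in> Hom SE X X'" and t: "t \<in> Hom SE Y Y'"
  shows "P X' Y' \<cdot> (RA s \<odot> RA t) = RA (s \<odot>\<^bsub>SE\<^esub> t) \<cdot> P X Y"
proof -
  have [simp]: "X \<in> Obj SE" "X' \<in> Obj SE" "s \<in> Arr SE" "Dom SE s = X" "Cod SE s = X'"
    "Y \<in> Obj SE" "Y' \<in> Obj SE" "t \<in> Arr SE" "Dom SE t = Y" "Cod SE t = Y'" using s t by auto
  show ?thesis
  proof (rule jointly_epicD[OF source_leg_jointly_epic[of X Y]])
    fix mn :: "nat \<times> nat"
    obtain m n where mn: "mn = (m, n)" by (cases mn)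
    have "(P X' Y' \<cdot> (RA s \<odot> RA t)) \<cdot> srcl X Y m n = P X' Y' \<cdot> ((RA s \<odot> RA t) \<cdot> srcl X Y m n)" by simp
    also have "\<dots> = (P X' Y' \<cdot> srcl X' Y' m n) \<cdot> ((component s m \<odot> component t n) \<odot> \<i> (R (S m) \<otimes> R (S n)))"
      unfolding source_leg_natural[OF s t] by simp
    also have "\<dots> = (tgtl X' Y' m n \<cdot> ((component s m \<odot> component t n) \<odot> \<i> (R (S m \<otimes>\<^bsub>SE\<^esub> S n)))) \<cdot> (\<i> (fob X m \<otimes> fob Y n) \<odot> e m n)"
      by (simp add: P_source_leg)
    also have "\<dots> = RA (s \<odot>\<^bsub>SE\<^esub> t) \<cdot> (P X Y \<cdot> srcl X Y m n)"
      unfolding target_leg_natural[OF s t, symmetric] by (simp add: P_source_leg)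
    finally show "(P X' Y' \<cdot> (RA s \<odot> RA t)) \<cdot> (case mn of (m, n) \<Rightarrow> srcl X Y m n) = (RA (s \<odot>\<^bsub>SE\<^esub> t) \<cdot> P X Y) \<cdot> (case mn of (m, n) \<Rightarrow> srcl X Y m n)"
      by (simp add: mn)
  qed simp_all
qed

lemma source_leg_ide:
  "srcl (S m) (S n) m n \<cdot> ((elem m m (Ide \<Delta> m) \<odot> elem n n (Ide \<Delta> n)) \<odot> \<i> (R (S m) \<otimes> R (S n))) =
    \<l> (R (S m) \<otimes> R (S n)) \<cdot> (\<l> \<u> \<odot> \<i> (R (S m) \<otimes> R (S n)))"
  by (simp add: source_leg_eq interchange_natural_left co_yoneda_ide interchange_unit_left)

lemma P_simplex: "P (S m) (S n) = e m n"
proof -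
  let ?i = "(elem m m (Ide \<Delta> m) \<odot> elem n n (Ide \<Delta> n)) \<odot> \<i> (R (S m) \<otimes> R (S n))"
  let ?l = "\<l> (R (S m) \<otimes> R (S n)) \<cdot> (\<l> \<u> \<odot> \<i> (R (S m) \<otimes> R (S n)))"
  have "P (S m) (S n) \<cdot> ?l = (P (S m) (S n) \<cdot> srcl (S m) (S n) m n) \<cdot> ?i"
    unfolding source_leg_ide[symmetric] by simp
  also have "\<dots> = (tgtl (S m) (S n) m n \<cdot> ((elem m m (Ide \<Delta> m) \<odot> elem n n (Ide \<Delta> n)) \<odot> \<i> (R (S m \<otimes>\<^bsub>SE\<^esub> S n)))) \<cdot> (\<i> (\<u> \<otimes> \<u>) \<odot> e m n)"
    by (simp add: P_source_leg)
  also have "\<dots> = \<l> (R (S m \<otimes>\<^bsub>SE\<^esub> S n)) \<cdot> ((\<i> \<u> \<odot> e m n) \<cdot> (\<l> \<u> \<odot> \<i> (R (S m) \<otimes> R (S n))))"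
    unfolding target_leg_ide by simp
  also have "\<dots> = e m n \<cdot> ?l"
    by (subst reassoc[OF lunit_natural]) simp_all
  finally show ?thesis by (rule iso_cancel_right[rotated 5]) simp_all
qed

text \<open>Coefficients that act on the first variable pass through the pairing, because they pass through
  the legs of its source and of its target.  Nested pairings are treated with the induced action on
  a tensor product, which \<open>action_tens_right\<close> provides.\<close>

lemma P_linear:
  assumes a: "action A V W \<phi>" and Y[simp]: "Y \<in> Obj SE"
  shows "P W Y \<cdot> (realised_action A V W \<phi> \<odot> \<i> (R Y)) =
    realised_action A (V \<otimes>\<^bsub>SE\<^esub> Y) (W \<otimes>\<^bsub>SE\<^esub> Y) (\<lambda>k. (\<phi> k \<odot> \<i> (fob Y k)) \<cdot> \<alpha>' A (fob V k) (fob Y k)) \<cdot>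
      ((\<i> A \<odot> P V Y) \<cdot> \<alpha> A (R V) (R Y))" (is "_ = ?r \<cdot> _")
proof -
  note [simp] = actionD(1-6)[OF a] realised_simps[OF a] realised_simps[OF action_tens_right[OF a Y]]
  let ?a = "realised_action A V W \<phi>"
  have "(P W Y \<cdot> (?a \<odot> \<i> (R Y))) \<cdot> \<alpha>' A (R V) (R Y) = ?r \<cdot> (\<i> A \<odot> P V Y)"
  proof (rule jointly_epicD[OF jointly_epic_tens_left[OF source_leg_jointly_epic[of V Y], of A]])
    fix mn :: "nat \<times> nat"
    obtain m n where mn: "mn = (m, n)" by (cases mn)
    let ?f = "(\<phi> m \<odot> \<i> (fob Y n)) \<cdot> \<alpha>' A (fob V m) (fob Y n)"
    have lin: "(?a \<odot> \<i> (R Y)) \<cdot> (\<alpha>' A (R V) (R Y) \<cdot> (\<i> A \<odot> ((co_yoneda V m \<odot> co_yoneda Y n) \<cdot> \<m> (fob V m) (fob Y n) (R (S m)) (R (S n))))) =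
      (co_yoneda W m \<odot> co_yoneda Y n) \<cdot> (\<m> (fob W m) (fob Y n) (R (S m)) (R (S n)) \<cdot>
        ((?f \<odot> \<i> (R (S m) \<otimes> R (S n))) \<cdot> \<alpha>' A (fob V m \<otimes> fob Y n) (R (S m) \<otimes> R (S n))))"
      by (rule interchange_linear[where W = "fob W m" and W' = "R W"]) (simp_all add: co_yoneda_linear[OF a])
    have "((P W Y \<cdot> (?a \<odot> \<i> (R Y))) \<cdot> \<alpha>' A (R V) (R Y)) \<cdot> (\<i> A \<odot> srcl V Y m n) =
        P W Y \<cdot> ((?a \<odot> \<i> (R Y)) \<cdot> (\<alpha>' A (R V) (R Y) \<cdot> (\<i> A \<odot> ((co_yoneda V m \<odot> co_yoneda Y n) \<cdot> \<m> (fob V m) (fob Y n) (R (S m)) (R (S n))))))"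
      by (simp add: source_leg_eq)
    also have "\<dots> = (P W Y \<cdot> srcl W Y m n) \<cdot> ((?f \<odot> \<i> (R (S m) \<otimes> R (S n))) \<cdot> \<alpha>' A (fob V m \<otimes> fob Y n) (R (S m) \<otimes> R (S n)))"
      unfolding lin by (simp add: source_leg_eq)
    also have "\<dots> = tgtl W Y m n \<cdot> ((?f \<odot> \<i> (R (S m \<otimes>\<^bsub>SE\<^esub> S n))) \<cdot> ((\<i> (A \<otimes> (fob V m \<otimes> fob Y n)) \<odot> e m n) \<cdot> \<alpha>' A (fob V m \<otimes> fob Y n) (R (S m) \<otimes> R (S n))))"
      by (simp add: P_source_leg)
    also have "\<dots> = (tgtl W Y m n \<cdot> ((?f \<odot> \<i> (R (S m \<otimes>\<^bsub>SE\<^esub> S n))) \<cdot> \<alpha>' A (fob V m \<otimes> fob Y n) (R (S m \<otimes>\<^bsub>SE\<^esub> S n)))) \<cdot>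
        (\<i> A \<odot> (\<i> (fob V m \<otimes> fob Y n) \<odot> e m n))"
      using assoc_inv_natural[of "\<i> A" "\<i> (fob V m \<otimes> fob Y n)" "e m n" A "fob V m \<otimes> fob Y n" "R (S m \<otimes>\<^bsub>SE\<^esub> S n)"] by simp
    also have "\<dots> = ?r \<cdot> (\<i> A \<odot> (tgtl V Y m n \<cdot> (\<i> (fob V m \<otimes> fob Y n) \<odot> e m n)))"
      unfolding target_leg_linear(1)[OF a Y, symmetric] by simp
    also have "\<dots> = (?r \<cdot> (\<i> A \<odot> P V Y)) \<cdot> (\<i> A \<odot> srcl V Y m n)"
      by (simp add: P_source_leg)
    finally show "((P W Y \<cdot> (?a \<odot> \<i> (R Y))) \<cdot> \<alpha>' A (R V) (R Y)) \<cdot> (\<i> A \<odot> (case mn of (m, n) \<Rightarrow> srcl V Y m n)) =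
      (?r \<cdot> (\<i> A \<odot> P V Y)) \<cdot> (\<i> A \<odot> (case mn of (m, n) \<Rightarrow> srcl V Y m n))" by (simp add: mn)
  qed simp_all
  from iso_move_right[OF _ _ _ this] show ?thesis by simp
qed

text \<open>The inverses of the \<open>e m n\<close> are again a natural family, and since the target is a coend like the
  source, they extend in the opposite direction.\<close>

lemma P_iso:
  assumes iso: "\<And>m n. is_iso E (e m n)" and [simp]: "X \<in> Obj SE" "Y \<in> Obj SE"
  shows "is_iso E (P X Y)"
proof -
  note [simp] = iso
  let ?v = "\<lambda>m n. srcl X Y m n \<cdot> (\<i> (fob X m \<otimes> fob Y n) \<odot> inv_arr E (e m n))"
  have rel: "?v (Dom \<Delta> f) (Dom \<Delta> g) \<cdot> ((far X f \<odot> far Y g) \<odot> \<i> (R (S (Dom \<Delta> f) \<otimes>\<^bsub>SE\<^esub> S (Dom \<Delta> g)))) =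
      ?v (Cod \<Delta> f) (Cod \<Delta> g) \<cdot> (\<i> (fob X (Cod \<Delta> f) \<otimes> fob Y (Cod \<Delta> g)) \<odot> RA (SA f \<odot>\<^bsub>SE\<^esub> SA g))"
    if [simp]: "f \<in> Arr \<Delta>" "g \<in> Arr \<Delta>" for f g
  proof -
    have n: "inv_arr E (e (Cod \<Delta> f) (Cod \<Delta> g)) \<cdot> RA (SA f \<odot>\<^bsub>SE\<^esub> SA g) = (RA (SA f) \<odot> RA (SA g)) \<cdot> inv_arr E (e (Dom \<Delta> f) (Dom \<Delta> g))"
      by (rule square_inverse[OF e_natural[of f "Dom \<Delta> f" "Cod \<Delta> f" g "Dom \<Delta> g" "Cod \<Delta> g"]]) simp_all
    have "?v (Dom \<Delta> f) (Dom \<Delta> g) \<cdot> ((far X f \<odot> far Y g) \<odot> \<i> (R (S (Dom \<Delta> f) \<otimes>\<^bsub>SE\<^esub> S (Dom \<Delta> g)))) =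
       (srcl X Y (Dom \<Delta> f) (Dom \<Delta> g) \<cdot> ((far X f \<odot> far Y g) \<odot> \<i> (R (S (Dom \<Delta> f)) \<otimes> R (S (Dom \<Delta> g))))) \<cdot>
       (\<i> (fob X (Cod \<Delta> f) \<otimes> fob Y (Cod \<Delta> g)) \<odot> inv_arr E (e (Dom \<Delta> f) (Dom \<Delta> g)))" by simp
    also have "\<dots> = ?v (Cod \<Delta> f) (Cod \<Delta> g) \<cdot> (\<i> (fob X (Cod \<Delta> f) \<otimes> fob Y (Cod \<Delta> g)) \<odot> RA (SA f \<odot>\<^bsub>SE\<^esub> SA g))"
      unfolding source_leg_dinatural[OF assms(2,3) that] by (simp add: n)
    finally show ?thesis .
  qed
  obtain h where h: "h \<in> Hom E (R (X \<otimes>\<^bsub>SE\<^esub> Y)) (R X \<otimes> R Y)" and ht: "\<And>m n. h \<cdot> tgtl X Y m n = ?v m n"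
    by (rule target_desc[OF assms(2,3), of "R X \<otimes> R Y" ?v]) (use rel in auto)
  show ?thesis
  proof (rule is_isoI[OF _ h])
    show "h \<cdot> P X Y = \<i> (R X \<otimes> R Y)"
    proof (rule jointly_epicD[OF source_leg_jointly_epic[OF assms(2,3)]])
      fix mn :: "nat \<times> nat"
      obtain m n where mn: "mn = (m, n)" by (cases mn)
      have "(h \<cdot> P X Y) \<cdot> srcl X Y m n = (h \<cdot> tgtl X Y m n) \<cdot> (\<i> (fob X m \<otimes> fob Y n) \<odot> e m n)"
        using h by (simp add: P_source_leg)
      then show "(h \<cdot> P X Y) \<cdot> (case mn of (m, n) \<Rightarrow> srcl X Y m n) = \<i> (R X \<otimes> R Y) \<cdot> (case mn of (m, n) \<Rightarrow> srcl X Y m n)"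
        by (simp add: mn ht)
    qed (use h in auto)
    show "P X Y \<cdot> h = \<i> (R (X \<otimes>\<^bsub>SE\<^esub> Y))"
    proof (rule jointly_epicD[OF target_leg_jointly_epic[OF assms(2,3)]])
      fix mn :: "nat \<times> nat"
      obtain m n where mn: "mn = (m, n)" by (cases mn)
      have "(P X Y \<cdot> h) \<cdot> tgtl X Y m n = (P X Y \<cdot> srcl X Y m n) \<cdot> (\<i> (fob X m \<otimes> fob Y n) \<odot> inv_arr E (e m n))"
        using h by (simp add: ht)
      then show "(P X Y \<cdot> h) \<cdot> (case mn of (m, n) \<Rightarrow> tgtl X Y m n) = \<i> (R (X \<otimes>\<^bsub>SE\<^esub> Y)) \<cdot> (case mn of (m, n) \<Rightarrow> tgtl X Y m n)"
        by (simp add: mn P_source_leg)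
    qed (use h in auto)
  qed simp
qed

end


section \<open>From an Eilenberg-Zilber family to a monoidal realisation\<close>

context natural_EZ
begin

lemma P_swap:
  assumes e_swap: "\<And>m n. RA (Swap SE (S m) (S n)) \<cdot> e m n = e n m \<cdot> \<s> (R (S m)) (R (S n))"
    and [simp]: "X \<in> Obj SE" "Y \<in> Obj SE"
  shows "RA (Swap SE X Y) \<cdot> P X Y = P Y X \<cdot> \<s> (R X) (R Y)"
proof (rule jointly_epicD[OF source_leg_jointly_epic[of X Y]])
  fix mn :: "nat \<times> nat"
  obtain m n where mn: "mn = (m, n)" by (cases mn)
  have sw: "\<s> (R X) (R Y) \<cdot> srcl X Y m n = srcl Y X n m \<cdot> (\<s> (fob X m) (fob Y n) \<odot> \<s> (R (S m)) (R (S n)))"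
    by (simp add: source_leg_eq reassoc[OF swap_natural] interchange_swap)
  have "(P Y X \<cdot> \<s> (R X) (R Y)) \<cdot> srcl X Y m n = P Y X \<cdot> (\<s> (R X) (R Y) \<cdot> srcl X Y m n)" by simp
  also have "\<dots> = (P Y X \<cdot> srcl Y X n m) \<cdot> (\<s> (fob X m) (fob Y n) \<odot> \<s> (R (S m)) (R (S n)))"
    unfolding sw by simp
  also have "\<dots> = tgtl Y X n m \<cdot> (\<s> (fob X m) (fob Y n) \<odot> (e n m \<cdot> \<s> (R (S m)) (R (S n))))"
    by (simp add: P_source_leg)
  also have "\<dots> = (tgtl Y X n m \<cdot> (\<s> (fob X m) (fob Y n) \<odot> RA (Swap SE (S m) (S n)))) \<cdot> (\<i> (fob X m \<otimes> fob Y n) \<odot> e m n)"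
    unfolding e_swap[symmetric] by simp
  also have "\<dots> = (RA (Swap SE X Y) \<cdot> P X Y) \<cdot> srcl X Y m n"
    unfolding target_leg_swap[OF assms(2,3), symmetric] by (simp add: P_source_leg)
  finally show "(RA (Swap SE X Y) \<cdot> P X Y) \<cdot> (case mn of (m, n) \<Rightarrow> srcl X Y m n) = (P Y X \<cdot> \<s> (R X) (R Y)) \<cdot> (case mn of (m, n) \<Rightarrow> srcl X Y m n)"
    by (simp add: mn)
qed simp_all

text \<open>The maps \<open>X m \<otimes> |S m| \<rightarrow> |X|\<close> are jointly epic, and by linearity both sides of the law for
  \<open>X\<close> restrict along them to the law for \<open>S m\<close> with coefficients \<open>X m\<close>.\<close>

lemma P_assoc_peel:
  assumes X[simp]: "X \<in> Obj SE" and Y[simp]: "Y \<in> Obj SE" and Z[simp]: "Z \<in> Obj SE"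
    and hyp: "\<And>m. RA (Assoc SE (S m) Y Z) \<cdot> (P (S m \<otimes>\<^bsub>SE\<^esub> Y) Z \<cdot> (P (S m) Y \<odot> \<i> (R Z))) =
      P (S m) (Y \<otimes>\<^bsub>SE\<^esub> Z) \<cdot> ((\<i> (R (S m)) \<odot> P Y Z) \<cdot> \<alpha> (R (S m)) (R Y) (R Z))"
  shows "RA (Assoc SE X Y Z) \<cdot> (P (X \<otimes>\<^bsub>SE\<^esub> Y) Z \<cdot> (P X Y \<odot> \<i> (R Z))) = P X (Y \<otimes>\<^bsub>SE\<^esub> Z) \<cdot> ((\<i> (R X) \<odot> P Y Z) \<cdot> \<alpha> (R X) (R Y) (R Z))"
proof (rule jointly_epicD[OF jointly_epic_tens_right[OF jointly_epic_tens_right[OF co_yoneda_jointly_epic[OF X], of "R Y"], of "R Z"]])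
  fix m
  let ?A = "fob X m" and ?S = "S m" and ?co = "co_yoneda X m"
  let ?a = "simplex_action U E X m"
  let ?aY = "\<lambda>k. (?a k \<odot> \<i> (fob Y k)) \<cdot> \<alpha>' ?A (fob ?S k) (fob Y k)"
  let ?aYZ = "\<lambda>k. (?aY k \<odot> \<i> (fob Z k)) \<cdot> \<alpha>' ?A (fob (?S \<otimes>\<^bsub>SE\<^esub> Y) k) (fob Z k)"
  let ?b = "\<lambda>k. (?a k \<odot> \<i> (fob (Y \<otimes>\<^bsub>SE\<^esub> Z) k)) \<cdot> \<alpha>' ?A (fob ?S k) (fob (Y \<otimes>\<^bsub>SE\<^esub> Z) k)"
  note a = simplex_action_action[OF X, of m]
  note aY = action_tens_right[OF a Y] and b = action_tens_right[OF a, of "Y \<otimes>\<^bsub>SE\<^esub> Z"]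
  note aYZ = action_tens_right[OF aY Z]
  let ?ry = "realised_action ?A (?S \<otimes>\<^bsub>SE\<^esub> Y) (X \<otimes>\<^bsub>SE\<^esub> Y) ?aY"
  let ?ryz = "realised_action ?A ((?S \<otimes>\<^bsub>SE\<^esub> Y) \<otimes>\<^bsub>SE\<^esub> Z) ((X \<otimes>\<^bsub>SE\<^esub> Y) \<otimes>\<^bsub>SE\<^esub> Z) ?aYZ"
  let ?rb = "realised_action ?A (?S \<otimes>\<^bsub>SE\<^esub> (Y \<otimes>\<^bsub>SE\<^esub> Z)) (X \<otimes>\<^bsub>SE\<^esub> (Y \<otimes>\<^bsub>SE\<^esub> Z)) ?b"
  have YZ: "Y \<otimes>\<^bsub>SE\<^esub> Z \<in> Obj SE" by simp
  note [simp] = realised_simps[OF aY] realised_simps[OF aYZ, simplified SE_simps] realised_simps[OF b[OF YZ], simplified SE_simps]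
  have tX: "Assoc SE X Y Z \<in> Hom SE ((X \<otimes>\<^bsub>SE\<^esub> Y) \<otimes>\<^bsub>SE\<^esub> Z) (X \<otimes>\<^bsub>SE\<^esub> (Y \<otimes>\<^bsub>SE\<^esub> Z))"
    and tS: "Assoc SE ?S Y Z \<in> Hom SE ((?S \<otimes>\<^bsub>SE\<^esub> Y) \<otimes>\<^bsub>SE\<^esub> Z) (?S \<otimes>\<^bsub>SE\<^esub> (Y \<otimes>\<^bsub>SE\<^esub> Z))" by simp_all
  have as: "RA (Assoc SE X Y Z) \<cdot> ?ryz = ?rb \<cdot> (\<i> ?A \<odot> RA (Assoc SE ?S Y Z))"
    unfolding realised_postcomp[OF aYZ tX] realised_precomp[OF b[OF YZ] tS]
    by (simp add: reassoc[OF assoc_natural_Comp] pentagon_mixed)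
  have lY: "P X Y \<cdot> (?co \<odot> \<i> (R Y)) = ?ry \<cdot> ((\<i> ?A \<odot> P ?S Y) \<cdot> \<alpha> ?A (R ?S) (R Y))"
    by (rule P_linear[OF a Y])
  have lZ: "P (X \<otimes>\<^bsub>SE\<^esub> Y) Z \<cdot> (?ry \<odot> \<i> (R Z)) = ?ryz \<cdot> ((\<i> ?A \<odot> P (?S \<otimes>\<^bsub>SE\<^esub> Y) Z) \<cdot> \<alpha> ?A (R (?S \<otimes>\<^bsub>SE\<^esub> Y)) (R Z))"
    by (rule P_linear[OF aY Z])
  have lYZ: "P X (Y \<otimes>\<^bsub>SE\<^esub> Z) \<cdot> (?co \<odot> \<i> (R (Y \<otimes>\<^bsub>SE\<^esub> Z))) = ?rb \<cdot> ((\<i> ?A \<odot> P ?S (Y \<otimes>\<^bsub>SE\<^esub> Z)) \<cdot> \<alpha> ?A (R ?S) (R (Y \<otimes>\<^bsub>SE\<^esub> Z)))"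
    by (rule P_linear[OF a YZ])
  have "(RA (Assoc SE X Y Z) \<cdot> (P (X \<otimes>\<^bsub>SE\<^esub> Y) Z \<cdot> (P X Y \<odot> \<i> (R Z)))) \<cdot> ((?co \<odot> \<i> (R Y)) \<odot> \<i> (R Z)) =
      RA (Assoc SE X Y Z) \<cdot> (P (X \<otimes>\<^bsub>SE\<^esub> Y) Z \<cdot> ((P X Y \<cdot> (?co \<odot> \<i> (R Y))) \<odot> \<i> (R Z)))" by simp
  also have "\<dots> = RA (Assoc SE X Y Z) \<cdot> ((P (X \<otimes>\<^bsub>SE\<^esub> Y) Z \<cdot> (?ry \<odot> \<i> (R Z))) \<cdot> (((\<i> ?A \<odot> P ?S Y) \<cdot> \<alpha> ?A (R ?S) (R Y)) \<odot> \<i> (R Z)))"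
    unfolding lY by simp
  also have "\<dots> = (RA (Assoc SE X Y Z) \<cdot> ?ryz) \<cdot> ((\<i> ?A \<odot> P (?S \<otimes>\<^bsub>SE\<^esub> Y) Z) \<cdot> (\<alpha> ?A (R (?S \<otimes>\<^bsub>SE\<^esub> Y)) (R Z) \<cdot>
      (((\<i> ?A \<odot> P ?S Y) \<cdot> \<alpha> ?A (R ?S) (R Y)) \<odot> \<i> (R Z))))"
    unfolding lZ by simp
  also have "\<dots> = ?rb \<cdot> ((\<i> ?A \<odot> (RA (Assoc SE ?S Y Z) \<cdot> (P (?S \<otimes>\<^bsub>SE\<^esub> Y) Z \<cdot> (P ?S Y \<odot> \<i> (R Z))))) \<cdot>
      (\<alpha> ?A (R ?S \<otimes> R Y) (R Z) \<cdot> (\<alpha> ?A (R ?S) (R Y) \<odot> \<i> (R Z))))"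
    unfolding as by (simp add: assoc_natural_Comp)
  also have "\<dots> = ?rb \<cdot> ((\<i> ?A \<odot> P ?S (Y \<otimes>\<^bsub>SE\<^esub> Z)) \<cdot> ((\<i> ?A \<odot> (\<i> (R ?S) \<odot> P Y Z)) \<cdot> ((\<i> ?A \<odot> \<alpha> (R ?S) (R Y) (R Z)) \<cdot>
      (\<alpha> ?A (R ?S \<otimes> R Y) (R Z) \<cdot> (\<alpha> ?A (R ?S) (R Y) \<odot> \<i> (R Z))))))"
    unfolding hyp by simp
  also have "\<dots> = ?rb \<cdot> ((\<i> ?A \<odot> P ?S (Y \<otimes>\<^bsub>SE\<^esub> Z)) \<cdot> ((\<i> ?A \<odot> (\<i> (R ?S) \<odot> P Y Z)) \<cdot> (\<alpha> ?A (R ?S) (R Y \<otimes> R Z) \<cdot> \<alpha> (?A \<otimes> R ?S) (R Y) (R Z))))"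
    by (subst pentagon_equation) simp_all
  also have "\<dots> = (?rb \<cdot> ((\<i> ?A \<odot> P ?S (Y \<otimes>\<^bsub>SE\<^esub> Z)) \<cdot> \<alpha> ?A (R ?S) (R (Y \<otimes>\<^bsub>SE\<^esub> Z)))) \<cdot> ((\<i> (?A \<otimes> R ?S) \<odot> P Y Z) \<cdot> \<alpha> (?A \<otimes> R ?S) (R Y) (R Z))"
    by (simp add: reassoc[OF assoc_natural_ide] del: tens_Comp tens_Comp')
  also have "\<dots> = P X (Y \<otimes>\<^bsub>SE\<^esub> Z) \<cdot> ((\<i> (R X) \<odot> P Y Z) \<cdot> ((?co \<odot> \<i> (R Y \<otimes> R Z)) \<cdot> \<alpha> (?A \<otimes> R ?S) (R Y) (R Z)))"
    unfolding lYZ[symmetric] by simp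
  also have "\<dots> = (P X (Y \<otimes>\<^bsub>SE\<^esub> Z) \<cdot> ((\<i> (R X) \<odot> P Y Z) \<cdot> \<alpha> (R X) (R Y) (R Z))) \<cdot> ((?co \<odot> \<i> (R Y)) \<odot> \<i> (R Z))"
    by (simp add: assoc_natural)
  finally show "(RA (Assoc SE X Y Z) \<cdot> (P (X \<otimes>\<^bsub>SE\<^esub> Y) Z \<cdot> (P X Y \<odot> \<i> (R Z)))) \<cdot> ((?co \<odot> \<i> (R Y)) \<odot> \<i> (R Z)) =
    (P X (Y \<otimes>\<^bsub>SE\<^esub> Z) \<cdot> ((\<i> (R X) \<odot> P Y Z) \<cdot> \<alpha> (R X) (R Y) (R Z))) \<cdot> ((?co \<odot> \<i> (R Y)) \<odot> \<i> (R Z))" .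
qed simp_all

text \<open>The coefficients are removed from the first variable as in the associativity law; naturality of
  \<open>P\<close> exchanges the unit object for the simplex \<open>S 0\<close>.\<close>

lemma P_runit:
  assumes u: "u \<in> Hom E \<u> (R (S 0))" and s: "s \<in> Hom SE (S 0) (Unit SE)" and X[simp]: "X \<in> Obj SE"
    and hyp: "\<And>m. RA (RUnit SE (S m) \<cdot>\<^bsub>SE\<^esub> (Ide SE (S m) \<odot>\<^bsub>SE\<^esub> s)) \<cdot> (e m 0 \<cdot> (\<i> (R (S m)) \<odot> u)) = \<r> (R (S m))"
  shows "RA (RUnit SE X) \<cdot> (P X (Unit SE) \<cdot> (\<i> (R X) \<odot> (RA s \<cdot> u))) = \<r> (R X)"
proof (rule jointly_epicD[OF jointly_epic_tens_right[OF co_yoneda_jointly_epic[OF X], of \<u>]])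
  note [simp] = u[simplified] s[simplified]
  fix m
  let ?A = "fob X m" and ?S = "S m" and ?co = "co_yoneda X m"
  let ?a = "simplex_action U E X m"
  note a = simplex_action_action[OF X, of m]
  let ?b = "\<lambda>k. (?a k \<odot> \<i> (fob (S 0) k)) \<cdot> \<alpha>' ?A (fob ?S k) (fob (S 0) k)"
  have S0: "S 0 \<in> Obj SE" by simp
  note b = action_tens_right[OF a S0]
  let ?rb = "realised_action ?A (?S \<otimes>\<^bsub>SE\<^esub> S 0) (X \<otimes>\<^bsub>SE\<^esub> S 0) ?b"
  note [simp] = realised_simps[OF b]
  let ?t = "\<lambda>X. RUnit SE X \<cdot>\<^bsub>SE\<^esub> (Ide SE X \<odot>\<^bsub>SE\<^esub> s)"
  have tX: "?t X \<in> Hom SE (X \<otimes>\<^bsub>SE\<^esub> S 0) X" and tS: "?t ?S \<in> Hom SE (?S \<otimes>\<^bsub>SE\<^esub> S 0) ?S" by simp_all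
  have as: "RA (?t X) \<cdot> ?rb = ?co \<cdot> (\<i> ?A \<odot> RA (?t ?S))"
  proof -
    have "component (?t X) k \<cdot> ?b k = ?a k \<cdot> (\<i> ?A \<odot> component (?t ?S) k)" for k
    proof -
      have "component (?t X) k \<cdot> ?b k = \<r> (fob X k) \<cdot> ((?a k \<odot> \<i> \<u>) \<cdot> ((\<i> (?A \<otimes> fob ?S k) \<odot> component s k) \<cdot> \<alpha>' ?A (fob ?S k) (fob (S 0) k)))"
        by simp
      also have "\<dots> = ?a k \<cdot> (\<r> (?A \<otimes> fob ?S k) \<cdot> ((\<i> (?A \<otimes> fob ?S k) \<odot> component s k) \<cdot> \<alpha>' ?A (fob ?S k) (fob (S 0) k)))"
        by (subst reassoc[OF runit_natural]) simp_all
      also have "\<dots> = ?a k \<cdot> ((\<i> ?A \<odot> \<r> (fob ?S k)) \<cdot> ((\<alpha> ?A (fob ?S k) \<u> \<cdot> (\<i> (?A \<otimes> fob ?S k) \<odot> component s k)) \<cdot> \<alpha>' ?A (fob ?S k) (fob (S 0) k)))"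
        by (simp add: runit_tens[symmetric])
      also have "\<dots> = ?a k \<cdot> (\<i> ?A \<odot> component (?t ?S) k)"
        by (simp add: assoc_natural_ide)
      finally show ?thesis .
    qed
    then show ?thesis
      unfolding realised_postcomp[OF b tX] realised_precomp[OF a tS] by simp
  qed
  have n: "P X (Unit SE) \<cdot> (\<i> (R X) \<odot> RA s) = RA (Ide SE X \<odot>\<^bsub>SE\<^esub> s) \<cdot> P X (S 0)"
    using P_natural[of "Ide SE X" X X s "S 0" "Unit SE"] by simp
  have l: "P X (S 0) \<cdot> (?co \<odot> \<i> (R (S 0))) = ?rb \<cdot> ((\<i> ?A \<odot> P ?S (S 0)) \<cdot> \<alpha> ?A (R ?S) (R (S 0)))"
    by (rule P_linear[OF a S0])
  have "(RA (RUnit SE X) \<cdot> (P X (Unit SE) \<cdot> (\<i> (R X) \<odot> (RA s \<cdot> u)))) \<cdot> (?co \<odot> \<i> \<u>) =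
     RA (RUnit SE X) \<cdot> ((P X (Unit SE) \<cdot> (\<i> (R X) \<odot> RA s)) \<cdot> ((?co \<odot> \<i> (R (S 0))) \<cdot> (\<i> (?A \<otimes> R ?S) \<odot> u)))"
    by simp
  also have "\<dots> = RA (?t X) \<cdot> ((P X (S 0) \<cdot> (?co \<odot> \<i> (R (S 0)))) \<cdot> (\<i> (?A \<otimes> R ?S) \<odot> u))"
    unfolding n by (simp add: RA_Comp)
  also have "\<dots> = (RA (?t X) \<cdot> ?rb) \<cdot> ((\<i> ?A \<odot> P ?S (S 0)) \<cdot> (\<alpha> ?A (R ?S) (R (S 0)) \<cdot> (\<i> (?A \<otimes> R ?S) \<odot> u)))"
    unfolding l by simp
  also have "\<dots> = ?co \<cdot> ((\<i> ?A \<odot> (RA (?t ?S) \<cdot> (e m 0 \<cdot> (\<i> (R ?S) \<odot> u)))) \<cdot> \<alpha> ?A (R ?S) \<u>)"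
    unfolding as by (simp add: P_simplex assoc_natural_ide)
  also have "\<dots> = \<r> (R X) \<cdot> (?co \<odot> \<i> \<u>)"
    unfolding hyp by (simp add: runit_tens runit_natural)
  finally show "(RA (RUnit SE X) \<cdot> (P X (Unit SE) \<cdot> (\<i> (R X) \<odot> (RA s \<cdot> u)))) \<cdot> (?co \<odot> \<i> \<u>) = \<r> (R X) \<cdot> (?co \<odot> \<i> \<u>)" .
qed (use u s in auto)

end

locale pointed_realisation = realisation_setting U E C
  for U :: "'u itself" and E :: "('o, 'a, 'z) smcat_scheme" (structure) and C :: "('o, 'a) cosimplicial" +
  fixes \<iota> :: 'a
  assumes iota_hom: "\<iota> \<in> Hom E (Unit E) (fob C 0)" and iota_iso: "is_iso E \<iota>"
begin

abbreviation s0 :: "('o, 'a) simplicial_map" where "s0 \<equiv> simplex0_E U E"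
abbreviation su :: 'a where "su \<equiv> simplex_unit U E C \<iota>"
abbreviation ru :: 'a where "ru \<equiv> realisation_unit U E C \<iota>"

lemma Hom_Delta_0: "Hom \<Delta> k 0 = {(replicate (Suc k) 0, 0)}"
proof (intro set_eqI iffI)
  fix f assume "f \<in> Hom \<Delta> k 0"
  then obtain xs where f: "f = (xs, 0)" and xs: "xs \<noteq> []" "length xs - 1 = k" "\<forall>x\<in>set xs. x \<le> 0"
    by (auto simp: Hom_def \<Delta>_def)
  have "length xs = Suc k" using xs by (cases xs) auto
  then have "xs = replicate (Suc k) 0" using xs by (intro replicate_eqI) auto
  then show "f \<in> {(replicate (Suc k) 0, 0)}" using f by simp
qed (auto simp: Hom_def \<Delta>_def)

text \<open>In every degree the simplex \<open>S 0\<close> has a single summand.\<close>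

lemma
  shows s0_elem: "f \<in> Hom \<Delta> k 0 \<Longrightarrow> component s0 k \<cdot> elem 0 k f = \<i> \<u>"
    and s0_hom: "s0 \<in> Hom SE (S 0) (Unit SE)"
    and s0_iso [simp]: "is_iso SE s0"
proof -
  have c: "component s0 k = copower_desc E (code ` Hom \<Delta> k 0 :: 'u set) \<u> (\<lambda>_. \<i> \<u>)" for k
    by (simp add: simplex0_E_def)
  have d: "component s0 k \<in> Hom E (fob (S 0) k) \<u>" for k
    unfolding c fob_S by (rule copower_desc(1)) auto
  note [simp] = d[simplified]
  show el: "f \<in> Hom \<Delta> k 0 \<Longrightarrow> component s0 k \<cdot> elem 0 k f = \<i> \<u>" for f k
    unfolding c simplex_in_def simplex_simps by (rule copower_desc(2)) auto
  have n: "component s0 (Dom \<Delta> g) \<cdot> far (S 0) g = component s0 (Cod \<Delta> g)" if g[simp]: "g \<in> Arr \<Delta>" for g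
  proof (rule jointly_epicD[OF elem_jointly_epic])
    fix f assume f: "f \<in> Hom \<Delta> (Cod \<Delta> g) 0"
    show "(component s0 (Dom \<Delta> g) \<cdot> far (S 0) g) \<cdot> elem 0 (Cod \<Delta> g) f = component s0 (Cod \<Delta> g) \<cdot> elem 0 (Cod \<Delta> g) f"
      using f by (simp add: far_S_elem el)
  qed simp_all
  have "(S 0, \<lambda>k\<in>Obj (op_cat \<Delta>). component s0 k, Unit SE) \<in> nat_transs (op_cat \<Delta>) E"
    by (rule nat_transsI) (simp_all add: n Obj_SE[symmetric])
  moreover have "(S 0, \<lambda>k\<in>Obj (op_cat \<Delta>). component s0 k, Unit SE) = s0"
    by (simp add: simplex0_E_def)
  ultimately have s0: "s0 \<in> Arr SE" by (simp add: Arr_SE)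
  then show h: "s0 \<in> Hom SE (S 0) (Unit SE)" by (simp add: Dom_SE Cod_SE simplex0_E_def)
  show "is_iso SE s0"
  proof (rule is_iso_SE[OF s0])
    fix k
    let ?f = "(replicate (Suc k) 0, 0) :: simplex_arr"
    have f: "?f \<in> Hom \<Delta> k 0" by (simp only: Hom_Delta_0 singletonI)
    then have fA: "?f \<in> Arr \<Delta>" "Dom \<Delta> ?f = k" "Cod \<Delta> ?f = 0" unfolding in_Hom by blast+
    note fe = Arr_elem[OF fA] Dom_elem[OF fA] Cod_elem[OF fA]
    have 2: "elem 0 k ?f \<cdot> component s0 k = \<i> (fob (S 0) k)"
    proof (rule jointly_epicD[OF elem_jointly_epic])
      fix g assume "g \<in> Hom \<Delta> k 0"
      then have "g = ?f" by (simp only: Hom_Delta_0 singleton_iff)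
      then show "(elem 0 k ?f \<cdot> component s0 k) \<cdot> elem 0 k g = \<i> (fob (S 0) k) \<cdot> elem 0 k g"
        using fe el[OF f] by simp
    qed (use fe in simp_all)
    show "is_iso E (component s0 k)"
      by (rule is_isoI[OF _ _ 2 el[OF f]]) (use fe in simp_all)
  qed
qed

lemma s0_simps [simp]: "s0 \<in> Arr SE" "Dom SE s0 = S 0" "Cod SE s0 = Unit SE"
  using s0_hom by auto

lemma iota_simps [simp]: "\<iota> \<in> Arr E" "Dom E \<iota> = \<u>" "Cod E \<iota> = fob C 0" "is_iso E \<iota>"
  using iota_hom iota_iso by auto

lemma su_simps [simp]: "su \<in> Arr E" "Dom E su = \<u>" "Cod E su = R (S 0)" "is_iso E su"
  by (simp_all add: simplex_unit_def)

lemma ru_simps [simp]: "ru \<in> Arr E" "Dom E ru = \<u>" "Cod E ru = R (Unit SE)" "is_iso E ru"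
  by (simp_all add: realisation_unit_def)

lemma natural_EZ_of_system: "EZ_system U E C \<iota> e \<Longrightarrow> natural_EZ U E C e"
proof -
  assume Z: "EZ_system U E C \<iota> e"
  interpret Z: EZ_system U E C \<iota> e S R RA by (rule Z reflexive)+
  show ?thesis by unfold_locales (use Z.EZ_hom Z.EZ_natural in blast)+
qed

text \<open>The law of associativity holds for three simplices.  A variable in the first place can be freed
  from being a simplex; the symmetry brings the other variables to the first place in turn.  The
  left unit law follows from the right one by symmetry.\<close>

lemma monoidal_of_EZ_system:
  assumes Z: "EZ_system U E C \<iota> e"
  shows "symmetric_monoidal_functor SE E (realisation E C) ru (EZ_extension U E C e)"
proof -
  interpret Z: EZ_system U E C \<iota> e S R RA by (rule Z reflexive)+
  interpret N: natural_EZ U E C e by (rule natural_EZ_of_system[OF Z])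
  let ?P = "EZ_extension U E C e"
  interpret Q: symmetric_pairing SE E "realisation E C" ?P
    by unfold_locales (use is_functor_realisation N.P_natural N.P_swap[OF Z.EZ_swap] in \<open>auto\<close>)
  have peel: "Q.associative X Y W" if "X \<in> Obj SE" "Y \<in> Obj SE" "W \<in> Obj SE" "\<And>m. Q.associative (S m) Y W" for X Y W
    using N.P_assoc_peel[OF that(1-3)] that(4) unfolding Q.associative_def by blast
  have A0: "Q.associative (S m) (S n) (S q)" for m n q
    using Z.EZ_assoc[of m n q] unfolding Q.associative_def by (simp add: N.P_simplex)
  have A1: "Q.associative X (S n) (S q)" if "X \<in> Obj SE" for X n q
    by (rule peel) (use that A0 in auto)
  (* the free variable moves to the second place, and the new first variable is freed *)
  have A2: "Q.associative (S n) X (S q)" if "X \<in> Obj SE" for X n q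
    by (rule Q.associative_middle[OF A1 A1]) (use that in auto)
  have A3: "Q.associative Y X (S q)" if "X \<in> Obj SE" "Y \<in> Obj SE" for X Y q
    by (rule peel) (use that A2 in auto)
  (* the remaining simplex moves from the last place to the first *)
  have A4: "Q.associative (S q) X Y" if "X \<in> Obj SE" "Y \<in> Obj SE" for X Y q
    by (rule Q.associative_reverse[OF A3]) (use that in auto)
  have A: "Q.associative W X Y" if "X \<in> Obj SE" "Y \<in> Obj SE" "W \<in> Obj SE" for X Y W
    by (rule peel) (use that A4 in auto)
  have ru: "RA (RUnit SE X) \<cdot> (?P X (Unit SE) \<cdot> (\<i> (R X) \<odot> ru)) = \<r> (R X)" if X: "X \<in> Obj SE" for X
    unfolding realisation_unit_def
    by (rule N.P_runit[OF _ s0_hom X]) (use Z.EZ_right_unit in \<open>simp_all\<close>)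
  show ?thesis
  proof
    show "is_functor SE E (realisation E C)" by (rule is_functor_realisation)
    show "ru \<in> Hom E \<u> (R (Unit SE))" by simp
  next
    fix X Y assume X: "X \<in> Obj SE" and Y: "Y \<in> Obj SE"
    show "?P X Y \<in> Hom E (R X \<otimes> R Y) (R (X \<otimes>\<^bsub>SE\<^esub> Y))" by (rule Q.mult_map[OF X Y])
    show "RA (Swap SE X Y) \<cdot> ?P X Y = ?P Y X \<cdot> \<s> (R X) (R Y)" by (rule Q.mult_swap[OF X Y])
    fix W assume W: "W \<in> Obj SE"
    show "RA (Assoc SE X Y W) \<cdot> ?P (X \<otimes>\<^bsub>SE\<^esub> Y) W \<cdot> (?P X Y \<odot> \<i> (R W)) =
        ?P X (Y \<otimes>\<^bsub>SE\<^esub> W) \<cdot> (\<i> (R X) \<odot> ?P Y W) \<cdot> \<alpha> (R X) (R Y) (R W)"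
      using A[OF Y W X] X Y W unfolding Q.associative_def by simp
  next
    fix f g X X' Y Y' assume f: "f \<in> Hom SE X X'" and g: "g \<in> Hom SE Y Y'"
    show "?P X' Y' \<cdot> (RA f \<odot> RA g) = RA (f \<odot>\<^bsub>SE\<^esub> g) \<cdot> ?P X Y" by (rule Q.mult_natural[OF f g])
  next
    fix X assume X[simp]: "X \<in> Obj SE"
    show "RA (RUnit SE X) \<cdot> ?P X (Unit SE) \<cdot> (\<i> (R X) \<odot> ru) = \<r> (R X)"
      using ru[OF X] by simp
    have "RA (LUnit SE X) \<cdot> (?P (Unit SE) X \<cdot> (ru \<odot> \<i> (R X))) =
        RA (LUnit SE X) \<cdot> (RA (Swap SE X (Unit SE)) \<cdot> (?P X (Unit SE) \<cdot> (\<s> (R (Unit SE)) (R X) \<cdot> (ru \<odot> \<i> (R X)))))"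
      by (subst Q.mult_flip) simp_all
    also have "\<dots> = (RA (RUnit SE X) \<cdot> (?P X (Unit SE) \<cdot> (\<i> (R X) \<odot> ru))) \<cdot> \<s> \<u> (R X)"
      by (simp add: RA_Comp' SE.lunit_swap swap_natural)
    also have "\<dots> = \<l> (R X)" unfolding ru[OF X] by (simp add: runit_swap)
    finally show "RA (LUnit SE X) \<cdot> ?P (Unit SE) X \<cdot> (ru \<odot> \<i> (R X)) = \<l> (R X)" by simp
  qed
qed

end


section \<open>Simplicial sets\<close>

context pointed_realisation
begin

abbreviation G :: "(('u set, 'u set_map) simplicial, ('u set, 'u set_map) simplicial_map,
    ('o, 'a) simplicial, ('o, 'a) simplicial_map) functor_data" where "G \<equiv> simp_copower E"

definition simp_unit :: "('o, 'a) simplicial_map" where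
  "simp_unit = (Unit SE, \<lambda>k\<in>Obj (op_cat \<Delta>). copower_unit, fob G (Unit sSet))"

definition simp_mult :: "('u set, 'u set_map) simplicial \<Rightarrow> ('u set, 'u set_map) simplicial \<Rightarrow> ('o, 'a) simplicial_map" where
  "simp_mult X Y = (fob G X \<otimes>\<^bsub>SE\<^esub> fob G Y, \<lambda>k\<in>Obj (op_cat \<Delta>). copower_mult (fob X k) (fob Y k), fob G (X \<otimes>\<^bsub>sSet\<^esub> Y))"

lemma symmetric_monoidal_simp_copower: "symmetric_monoidal_functor sSet SE G simp_unit simp_mult"
  unfolding simp_unit_def[abs_def] simp_mult_def[abs_def] Simplicial_def simp_copower_def
  by (rule symmetric_monoidal_functor_postcomp[OF symmetric_monoidal_copower category_op_cat[OF category_Delta]])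

end

sublocale pointed_realisation \<subseteq> K: symmetric_monoidal_functor "Simplicial (Sets :: ('u set, 'u set_map) smcat)" "Simplicial E"
    "simp_copower E" simp_unit simp_mult
  by (rule symmetric_monoidal_simp_copower)

context pointed_realisation
begin

lemma Obj_sSet: "X \<in> Obj sSet \<longleftrightarrow> X \<in> functors (op_cat \<Delta>) SetU"
  and Arr_sSet: "t \<in> Arr sSet \<longleftrightarrow> t \<in> nat_transs (op_cat \<Delta>) SetU"
  and Dom_sSet: "Dom sSet t = source t" and Cod_sSet: "Cod sSet t = target t"
  by (simp_all add: Simplicial_def)

lemma small_sSet: "X \<in> Obj sSet \<Longrightarrow> small (fob X k)"
  unfolding Obj_sSet using Obj_functor[OF functorsD, of X "op_cat \<Delta>" SetU k] by simp

lemma component_simp_mult [simp]: "component (simp_mult X Y) k = copower_mult (fob X k) (fob Y k)"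
  and component_simp_unit [simp]: "component simp_unit k = copower_unit"
  by (simp_all add: simp_mult_def simp_unit_def)

lemma fob_G [simp]: "fob (fob G X) k = copower E (fob X k)"
  and component_G [simp]: "component (far G t) k = far (copower_functor E) (component t k)"
  by (simp_all add: simp_copower_def)

lemma is_iso_simp_mult [simp]: "X \<in> Obj sSet \<Longrightarrow> Y \<in> Obj sSet \<Longrightarrow> is_iso SE (simp_mult X Y)"
  by (rule is_iso_SE) (simp_all add: small_sSet)

lemma is_iso_simp_unit [simp]: "is_iso SE simp_unit"
  by (rule is_iso_SE) simp_all

lemma G_simplex: "fob G (simplex m) = S m" and G_yoneda: "far G (far yoneda f) = SA f"
  by (simp_all add: simplex_E_def)

lemma simplex_sSet [simp]: "simplex m \<in> Obj sSet"
  by (simp add: Obj_sSet simplex_in_functors)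

lemma yoneda_sSet [simp]:
  "f \<in> Arr \<Delta> \<Longrightarrow> far yoneda f \<in> Arr sSet" "Dom sSet (far yoneda f) = simplex (Dom \<Delta> f)" "Cod sSet (far yoneda f) = simplex (Cod \<Delta> f)"
  by (simp_all add: Arr_sSet yoneda_in_nat_transs Dom_sSet Cod_sSet)

lemma simplex0_set_hom: "(simplex0_set :: ('u set, 'u set_map) simplicial_map) \<in> Hom sSet (simplex 0) (Unit sSet)"
proof -
  let ?t = "\<lambda>k. (code ` Hom \<Delta> k 0, \<lambda>x\<in>code ` Hom \<Delta> k 0. undefined, set_unit) :: 'u set_map"
  have tA: "?t k \<in> Arr SetU" for k by (rule Arr_SetsI) (auto simp: set_unit_def small_finite)
  have unit: "Unit sSet \<in> functors (op_cat \<Delta>) SetU" using SS.unit_obj by (simp add: Obj_sSet)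
  have Un: "fob (Unit sSet) k = set_unit" "f \<in> Arr \<Delta> \<Longrightarrow> far (Unit sSet) f = Ide SetU set_unit" for k f
    by (simp_all add: Simplicial_def)
  have u: "(undefined :: 'u) \<in> set_unit" by (simp add: set_unit_def)
  have nat: "?t (Dom \<Delta> f) \<cdot>\<^bsub>SetU\<^esub> far (simplex 0) f = far (Unit sSet) f \<cdot>\<^bsub>SetU\<^esub> ?t (Cod \<Delta> f)" if f: "f \<in> Arr \<Delta>" for f
  proof (rule Sets_eqI)
    fix c assume "c \<in> source (?t (Dom \<Delta> f) \<cdot>\<^bsub>SetU\<^esub> far (simplex 0) f)"
    then obtain h where h: "c = code h" "h \<in> Arr \<Delta>" "Dom \<Delta> h = Cod \<Delta> f" "Cod \<Delta> h = 0" using f by auto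
    show "component (?t (Dom \<Delta> f) \<cdot>\<^bsub>SetU\<^esub> far (simplex 0) f) c = component (far (Unit sSet) f \<cdot>\<^bsub>SetU\<^esub> ?t (Cod \<Delta> f)) c"
      using f h u by (simp add: Un image_iff)
  qed (use f tA in \<open>simp_all add: Un\<close>)
  have "(simplex 0, \<lambda>k\<in>Obj (op_cat \<Delta>). ?t k, Unit sSet) \<in> nat_transs (op_cat \<Delta>) SetU"
    by (rule nat_transsI[OF simplex_in_functors unit]) (use tA nat in \<open>simp_all add: Un\<close>)
  then show ?thesis by (simp add: simplex0_set_def Arr_sSet Dom_sSet Cod_sSet)
qed

lemma simplex0_set_simps [simp]:
  "(simplex0_set :: ('u set, 'u set_map) simplicial_map) \<in> Arr sSet"
  "Dom sSet (simplex0_set :: ('u set, 'u set_map) simplicial_map) = simplex 0"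
  "Cod sSet (simplex0_set :: ('u set, 'u set_map) simplicial_map) = Unit sSet"
  using simplex0_set_hom by auto

lemma G_simplex0: "far G simplex0_set = simp_unit \<cdot>\<^bsub>SE\<^esub> s0"
proof (rule SE_eqI)
  fix k
  have A: "component (simplex0_set :: ('u set, 'u set_map) simplicial_map) k \<in> Arr SetU"
    using Arr_component[of simplex0_set "op_cat \<Delta>" SetU k] simplex0_set_simps(1) unfolding Arr_sSet by simp
  have c: "component (simplex0_set :: ('u set, 'u set_map) simplicial_map) k =
      (code ` Hom \<Delta> k 0, \<lambda>x\<in>code ` Hom \<Delta> k 0. undefined, set_unit)" by (simp add: simplex0_set_def)
  show "component (far G simplex0_set) k = component (simp_unit \<cdot>\<^bsub>SE\<^esub> s0) k"
  proof (rule jointly_epicD[OF elem_jointly_epic[of k 0]])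
    fix f assume f: "f \<in> Hom \<Delta> k 0"
    have "far (copower_functor E) (component (simplex0_set :: ('u set, 'u set_map) simplicial_map) k) \<cdot> elem 0 k f = copower_unit"
      unfolding c using copower_in_natural[OF A[unfolded c], of "code f"] f by (simp add: simplex_in_def copower_unit_def)
    then show "component (far G simplex0_set) k \<cdot> elem 0 k f = component (simp_unit \<cdot>\<^bsub>SE\<^esub> s0) k \<cdot> elem 0 k f"
      using f s0_elem[OF f] by simp
  qed (use A c in \<open>simp_all add: fob_S\<close>)
qed (simp_all add: G_simplex)

lemma set_realisation_unit_eq: "set_realisation_unit U E C \<iota> = RA simp_unit \<cdot> ru"
  by (simp add: set_realisation_unit_def set_realisation_def G_simplex0 realisation_unit_def RA_Comp)

text \<open>The realisation of simplicial sets is the composite of two symmetric monoidal functors.\<close>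

lemma monoidal_set_of_monoidal:
  assumes p: "symmetric_monoidal_functor SE E (realisation E C) ru p"
  shows "symmetric_monoidal_functor sSet E (set_realisation E C) (set_realisation_unit U E C \<iota>)
     (\<lambda>X Y. RA (simp_mult X Y) \<cdot> p (fob G X) (fob G Y))"
  unfolding set_realisation_unit_eq set_realisation_def
  by (rule symmetric_monoidal_functor_comp[OF symmetric_monoidal_simp_copower p])

lemma set_realisation_unit_iso: "is_iso E (set_realisation_unit U E C \<iota>)"
  by (simp add: set_realisation_unit_eq)

end

section \<open>From simplicial sets to an Eilenberg-Zilber system\<close>

locale monoidal_set_realisation_setting = pointed_realisation U E C \<iota>
  for U :: "'u itself" and E :: "('o, 'a, 'z) smcat_scheme" (structure) and C :: "('o, 'a) cosimplicial" and \<iota> +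
  fixes p :: "('u set, 'u set_map) simplicial \<Rightarrow> ('u set, 'u set_map) simplicial \<Rightarrow> 'a"
  assumes monoidal_p: "symmetric_monoidal_functor (Simplicial (Sets :: ('u set, 'u set_map) smcat)) E
    (set_realisation E C) (set_realisation_unit U E C \<iota>) p"
begin

sublocale L: symmetric_monoidal_functor sSet E "set_realisation E C" "set_realisation_unit U E C \<iota>" p
  by (rule monoidal_p)

lemma set_realisation_simps [simp]:
  "fob (set_realisation E C) X = R (fob G X)" "far (set_realisation E C) t = RA (far G t)"
  by (simp_all add: set_realisation_def)

text \<open>The structure map corrected by the isomorphism of \<open>G X \<otimes> G Y\<close> with \<open>G (X \<times> Y)\<close>, so that its
  target has the form of the target of an Eilenberg-Zilber map.\<close>

definition pairing :: "('u set, 'u set_map) simplicial \<Rightarrow> ('u set, 'u set_map) simplicial \<Rightarrow> 'a" where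
  "pairing X Y = RA (inv_arr SE (simp_mult X Y)) \<cdot> p X Y"

lemma pairing_simps [simp]:
  assumes "X \<in> Obj sSet" "Y \<in> Obj sSet"
  shows "pairing X Y \<in> Arr E" "Dom E (pairing X Y) = R (fob G X) \<otimes> R (fob G Y)" "Cod E (pairing X Y) = R (fob G X \<otimes>\<^bsub>SE\<^esub> fob G Y)"
  using assms by (simp_all add: pairing_def)

lemma mult_pairing:
  assumes [simp]: "X \<in> Obj sSet" "Y \<in> Obj sSet"
  shows "RA (simp_mult X Y) \<cdot> pairing X Y = p X Y"
  by (simp add: pairing_def RA_Comp')

lemma pairing_natural:
  assumes s: "s \<in> Hom sSet X X'" and t: "t \<in> Hom sSet Y Y'"
  shows "pairing X' Y' \<cdot> (RA (far G s) \<odot> RA (far G t)) = RA (far G s \<odot>\<^bsub>SE\<^esub> far G t) \<cdot> pairing X Y"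
proof -
  have [simp]: "X \<in> Obj sSet" "X' \<in> Obj sSet" "s \<in> Arr sSet" "Dom sSet s = X" "Cod sSet s = X'"
    "Y \<in> Obj sSet" "Y' \<in> Obj sSet" "t \<in> Arr sSet" "Dom sSet t = Y" "Cod sSet t = Y'" using s t by auto
  have n: "inv_arr SE (simp_mult X' Y') \<cdot>\<^bsub>SE\<^esub> far G (s \<odot>\<^bsub>sSet\<^esub> t) = (far G s \<odot>\<^bsub>SE\<^esub> far G t) \<cdot>\<^bsub>SE\<^esub> inv_arr SE (simp_mult X Y)"
    by (rule SE.square_inverse[OF K.mult_natural[OF s t]]) simp_all
  have "pairing X' Y' \<cdot> (RA (far G s) \<odot> RA (far G t)) = RA (inv_arr SE (simp_mult X' Y')) \<cdot> (RA (far G (s \<odot>\<^bsub>sSet\<^esub> t)) \<cdot> p X Y)"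
    using L.mult_natural[OF s t] by (simp add: pairing_def)
  also have "\<dots> = RA (far G s \<odot>\<^bsub>SE\<^esub> far G t) \<cdot> pairing X Y"
    by (simp add: RA_Comp' n) (simp add: pairing_def RA_Comp)
  finally show ?thesis .
qed

definition ez :: "nat \<Rightarrow> nat \<Rightarrow> 'a" where
  "ez m n = pairing (simplex m) (simplex n)"

sublocale ez: natural_EZ U E C ez
proof
  show "ez m n \<in> Hom E (R (S m) \<otimes> R (S n)) (R (S m \<otimes>\<^bsub>SE\<^esub> S n))" for m n
    by (simp add: ez_def G_simplex)
  show "ez m' n' \<cdot> (RA (SA f) \<odot> RA (SA g)) = RA (SA f \<odot>\<^bsub>SE\<^esub> SA g) \<cdot> ez m n"
    if "f \<in> Hom \<Delta> m m'" "g \<in> Hom \<Delta> n n'" for f g m m' n n'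
    using pairing_natural[of "far yoneda f" "simplex m" "simplex m'" "far yoneda g" "simplex n" "simplex n'"] that
    by (simp add: ez_def G_yoneda)
qed

text \<open>The summand of \<open>x\<close> in a free simplicial object is the image of the identity element of a simplex
  under the map that classifies \<open>x\<close>.\<close>

lemma classify_elem:
  assumes X: "X \<in> Obj sSet" and x: "x \<in> fob X m"
  shows "component (far G (classify X m x)) m \<cdot> elem m m (Ide \<Delta> m) = copower_in E (fob X m) x"
    and "classify X m x \<in> Hom sSet (simplex m) X"
proof -
  note c = classify_in_nat_transs[OF X[unfolded Obj_sSet] x]
  show "classify X m x \<in> Hom sSet (simplex m) X" using c by (simp add: Arr_sSet Dom_sSet Cod_sSet)
  have A: "component (classify X m x) m \<in> Arr SetU" using Arr_component[OF c, of m] by simp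
  have i: "far X (Ide \<Delta> m) = Ide SetU (fob X m)"
    using Ide_functor[OF functorsD[OF X[unfolded Obj_sSet]], of m] by simp
  show "component (far G (classify X m x)) m \<cdot> elem m m (Ide \<Delta> m) = copower_in E (fob X m) x"
    using copower_in_natural[OF A, of "code (Ide \<Delta> m)"] x by (simp add: simplex_in_def i)
qed

text \<open>On free simplicial objects the extension of the family gives back the given pairing:
  both are natural, and every element of a simplicial set is the image of a universal one.\<close>

lemma P_free:
  assumes X[simp]: "X \<in> Obj sSet" and Y[simp]: "Y \<in> Obj sSet"
  shows "ez.P (fob G X) (fob G Y) = pairing X Y"
proof (rule ez.P_eqI)
  have GX[simp]: "fob G X \<in> Obj SE" "fob G Y \<in> Obj SE" by simp_all
  note [simp] = small_sSet[OF X] small_sSet[OF Y]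
  show "pairing X Y \<in> Hom E (R (fob G X) \<otimes> R (fob G Y)) (R (fob G X \<otimes>\<^bsub>SE\<^esub> fob G Y))" by simp
  fix m n
  let ?T = "tgtl (fob G X) (fob G Y) m n"
  show "pairing X Y \<cdot> srcl (fob G X) (fob G Y) m n = ?T \<cdot> (\<i> (fob (fob G X) m \<otimes> fob (fob G Y) n) \<odot> ez m n)"
  proof (rule jointly_epicD[OF jointly_epic_tens_right[OF copower_tens_jointly_epic[of "fob X m" "fob Y n"], of "R (S m) \<otimes> R (S n)"]])
    fix xy assume "xy \<in> fob X m \<times> fob Y n"
    then obtain x y where xy: "xy = (x, y)" and x: "x \<in> fob X m" and y: "y \<in> fob Y n" by auto
    let ?s = "classify X m x" and ?t = "classify Y n y"
    let ?e = "elem m m (Ide \<Delta> m) \<odot> elem n n (Ide \<Delta> n)"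
    note cs = classify_elem[OF X x] and ct = classify_elem[OF Y y]
    have [simp]: "?s \<in> Arr sSet" "Dom sSet ?s = simplex m" "Cod sSet ?s = X" "?t \<in> Arr sSet" "Dom sSet ?t = simplex n" "Cod sSet ?t = Y"
      using cs(2) ct(2) by auto
    have s: "far G ?s \<in> Hom SE (S m) (fob G X)" and t: "far G ?t \<in> Hom SE (S n) (fob G Y)"
      by (simp_all add: G_simplex)
    note [simp] = s[simplified] t[simplified]
    have ci: "copower_in E (fob X m) x \<odot> copower_in E (fob Y n) y = (component (far G ?s) m \<odot> component (far G ?t) n) \<cdot> ?e"
      unfolding cs(1)[symmetric] ct(1)[symmetric] by (simp del: component_G)
    have "(pairing X Y \<cdot> srcl (fob G X) (fob G Y) m n) \<cdot> ((copower_in E (fob X m) x \<odot> copower_in E (fob Y n) y) \<odot> \<i> (R (S m) \<otimes> R (S n))) =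
        pairing X Y \<cdot> ((srcl (fob G X) (fob G Y) m n \<cdot> ((component (far G ?s) m \<odot> component (far G ?t) n) \<odot> \<i> (R (S m) \<otimes> R (S n)))) \<cdot>
        (?e \<odot> \<i> (R (S m) \<otimes> R (S n))))"
      unfolding ci by (simp del: component_G fob_G)
    also have "\<dots> = (pairing X Y \<cdot> (RA (far G ?s) \<odot> RA (far G ?t))) \<cdot> (srcl (S m) (S n) m n \<cdot> (?e \<odot> \<i> (R (S m) \<otimes> R (S n))))"
      unfolding source_leg_natural[OF s t, symmetric] by (simp del: component_G fob_G)
    also have "\<dots> = RA (far G ?s \<odot>\<^bsub>SE\<^esub> far G ?t) \<cdot> (ez m n \<cdot> (\<l> (R (S m) \<otimes> R (S n)) \<cdot> (\<l> \<u> \<odot> \<i> (R (S m) \<otimes> R (S n)))))"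
      unfolding pairing_natural[OF cs(2) ct(2)] ez.source_leg_ide by (simp add: ez_def[symmetric])
    also have "\<dots> = RA (far G ?s \<odot>\<^bsub>SE\<^esub> far G ?t) \<cdot> ((\<l> (R (S m \<otimes>\<^bsub>SE\<^esub> S n)) \<cdot> (\<l> \<u> \<odot> \<i> (R (S m \<otimes>\<^bsub>SE\<^esub> S n)))) \<cdot> (\<i> (\<u> \<otimes> \<u>) \<odot> ez m n))"
    proof -
      have "ez m n \<cdot> \<l> (R (S m) \<otimes> R (S n)) = \<l> (R (S m \<otimes>\<^bsub>SE\<^esub> S n)) \<cdot> (\<i> \<u> \<odot> ez m n)" by (simp add: lunit_natural)
      from reassoc[OF this, of "\<l> \<u> \<odot> \<i> (R (S m) \<otimes> R (S n))"] show ?thesis by simp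
    qed
    also have "\<dots> = (RA (far G ?s \<odot>\<^bsub>SE\<^esub> far G ?t) \<cdot> tgtl (S m) (S n) m n) \<cdot> ((?e \<odot> \<i> (R (S m \<otimes>\<^bsub>SE\<^esub> S n))) \<cdot> (\<i> (\<u> \<otimes> \<u>) \<odot> ez m n))"
      unfolding target_leg_ide[symmetric] by simp
    also have "\<dots> = (?T \<cdot> (\<i> (fob (fob G X) m \<otimes> fob (fob G Y) n) \<odot> ez m n)) \<cdot> ((copower_in E (fob X m) x \<odot> copower_in E (fob Y n) y) \<odot> \<i> (R (S m) \<otimes> R (S n)))"
      unfolding target_leg_natural[OF s t] ci by (simp del: component_G fob_G)
    finally show "(pairing X Y \<cdot> srcl (fob G X) (fob G Y) m n) \<cdot> ((case xy of (x, y) \<Rightarrow> copower_in E (fob X m) x \<odot> copower_in E (fob Y n) y) \<odot> \<i> (R (S m) \<otimes> R (S n))) =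
      (?T \<cdot> (\<i> (fob (fob G X) m \<otimes> fob (fob G Y) n) \<odot> ez m n)) \<cdot> ((case xy of (x, y) \<Rightarrow> copower_in E (fob X m) x \<odot> copower_in E (fob Y n) y) \<odot> \<i> (R (S m) \<otimes> R (S n)))"
      by (simp add: xy)
  qed simp_all
qed simp_all

text \<open>Each condition is the corresponding axiom for \<open>p\<close>, transported along the structure isomorphisms
  of \<open>G\<close>.  The associativity condition involves the extension at a tensor product of two
  simplices; this is isomorphic to the free object on their product, where \<open>P_free\<close> identifies
  the extension.\<close>

lemma EZ_system_ez: "EZ_system U E C \<iota> ez"
proof unfold_locales
  fix m n
  show "ez m n \<in> Hom E (R (S m) \<otimes> R (S n)) (R (S m \<otimes>\<^bsub>SE\<^esub> S n))" by (rule ez.e_hom)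
  let ?M = "simplex m :: ('u set, 'u set_map) simplicial" and ?N = "simplex n :: ('u set, 'u set_map) simplicial"
  have sw: "Swap SE (S m) (S n) \<cdot>\<^bsub>SE\<^esub> inv_arr SE (simp_mult ?M ?N) = inv_arr SE (simp_mult ?N ?M) \<cdot>\<^bsub>SE\<^esub> far G (Swap sSet ?M ?N)"
    by (rule SE.square_inverse[OF K.mult_swap[symmetric], of ?M ?N, unfolded G_simplex, symmetric]) (simp_all add: G_simplex)
  have "RA (Swap SE (S m) (S n)) \<cdot> ez m n = RA (Swap SE (S m) (S n) \<cdot>\<^bsub>SE\<^esub> inv_arr SE (simp_mult ?M ?N)) \<cdot> p ?M ?N"
    by (simp add: ez_def pairing_def RA_Comp G_simplex)
  also have "\<dots> = RA (inv_arr SE (simp_mult ?N ?M)) \<cdot> (RA (far G (Swap sSet ?M ?N)) \<cdot> p ?M ?N)"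
    unfolding sw by (simp add: RA_Comp)
  also have "\<dots> = ez n m \<cdot> \<s> (R (S m)) (R (S n))"
    using L.mult_swap[of ?M ?N] by (simp add: ez_def pairing_def G_simplex)
  finally show "RA (Swap SE (S m) (S n)) \<cdot> ez m n = ez n m \<cdot> \<s> (R (S m)) (R (S n))" .
next
  fix f g m m' n n' assume "f \<in> Hom \<Delta> m m'" "g \<in> Hom \<Delta> n n'"
  then show "ez m' n' \<cdot> (RA (SA f) \<odot> RA (SA g)) = RA (SA f \<odot>\<^bsub>SE\<^esub> SA g) \<cdot> ez m n" by (rule ez.e_natural)
next
  fix m n q
  let ?M = "simplex m :: ('u set, 'u set_map) simplicial" and ?N = "simplex n :: ('u set, 'u set_map) simplicial"
    and ?Q = "simplex q :: ('u set, 'u set_map) simplicial"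
  let ?\<mu> = "simp_mult" and ?MN = "?M \<otimes>\<^bsub>sSet\<^esub> ?N" and ?NQ = "?N \<otimes>\<^bsub>sSet\<^esub> ?Q"
  (* ?l and ?r compare the two threefold tensor products of simplices with the free objects on the products *)
  let ?l = "(?\<mu> ?MN ?Q \<cdot>\<^bsub>SE\<^esub> (?\<mu> ?M ?N \<odot>\<^bsub>SE\<^esub> Ide SE (S q)))"
  let ?r = "(?\<mu> ?M ?NQ \<cdot>\<^bsub>SE\<^esub> (Ide SE (S m) \<odot>\<^bsub>SE\<^esub> ?\<mu> ?N ?Q))"
  have li: "is_iso SE ?l" and ri: "is_iso SE ?r" by (simp_all add: G_simplex)
  note [simp] = SE.is_iso_Arr[OF li] SE.is_iso_Arr[OF ri]
  have left: "RA ?l \<cdot> (ez.P (S m \<otimes>\<^bsub>SE\<^esub> S n) (S q) \<cdot> (ez m n \<odot> \<i> (R (S q)))) = p ?MN ?Q \<cdot> (p ?M ?N \<odot> \<i> (R (S q)))"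
  proof -
    have "RA ?l \<cdot> (ez.P (S m \<otimes>\<^bsub>SE\<^esub> S n) (S q) \<cdot> (ez m n \<odot> \<i> (R (S q)))) =
       RA (?\<mu> ?MN ?Q) \<cdot> ((RA (?\<mu> ?M ?N \<odot>\<^bsub>SE\<^esub> Ide SE (S q)) \<cdot> ez.P (S m \<otimes>\<^bsub>SE\<^esub> S n) (S q)) \<cdot> (ez m n \<odot> \<i> (R (S q))))"
      by (simp add: RA_Comp G_simplex)
    also have "\<dots> = RA (?\<mu> ?MN ?Q) \<cdot> ((ez.P (fob G ?MN) (fob G ?Q) \<cdot> (RA (?\<mu> ?M ?N) \<odot> \<i> (R (S q)))) \<cdot> (ez m n \<odot> \<i> (R (S q))))"
      using ez.P_natural[of "?\<mu> ?M ?N" "S m \<otimes>\<^bsub>SE\<^esub> S n" "fob G ?MN" "Ide SE (S q)" "S q" "S q"] by (simp add: G_simplex)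
    also have "\<dots> = (RA (?\<mu> ?MN ?Q) \<cdot> pairing ?MN ?Q) \<cdot> ((RA (?\<mu> ?M ?N) \<cdot> pairing ?M ?N) \<odot> \<i> (R (S q)))"
      unfolding P_free[of ?MN ?Q, OF SS.tens_obj[OF simplex_sSet simplex_sSet] simplex_sSet]
      by (simp add: G_simplex ez_def)
    finally show ?thesis by (simp add: mult_pairing)
  qed
  have right: "RA ?r \<cdot> (ez.P (S m) (S n \<otimes>\<^bsub>SE\<^esub> S q) \<cdot> (\<i> (R (S m)) \<odot> ez n q)) = p ?M ?NQ \<cdot> (\<i> (R (S m)) \<odot> p ?N ?Q)"
  proof -
    have "RA ?r \<cdot> (ez.P (S m) (S n \<otimes>\<^bsub>SE\<^esub> S q) \<cdot> (\<i> (R (S m)) \<odot> ez n q)) =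
       RA (?\<mu> ?M ?NQ) \<cdot> ((RA (Ide SE (S m) \<odot>\<^bsub>SE\<^esub> ?\<mu> ?N ?Q) \<cdot> ez.P (S m) (S n \<otimes>\<^bsub>SE\<^esub> S q)) \<cdot> (\<i> (R (S m)) \<odot> ez n q))"
      by (simp add: RA_Comp G_simplex)
    also have "\<dots> = RA (?\<mu> ?M ?NQ) \<cdot> ((ez.P (fob G ?M) (fob G ?NQ) \<cdot> (\<i> (R (S m)) \<odot> RA (?\<mu> ?N ?Q))) \<cdot> (\<i> (R (S m)) \<odot> ez n q))"
      using ez.P_natural[of "Ide SE (S m)" "S m" "S m" "?\<mu> ?N ?Q" "S n \<otimes>\<^bsub>SE\<^esub> S q" "fob G ?NQ"] by (simp add: G_simplex)
    also have "\<dots> = (RA (?\<mu> ?M ?NQ) \<cdot> pairing ?M ?NQ) \<cdot> (\<i> (R (S m)) \<odot> (RA (?\<mu> ?N ?Q) \<cdot> pairing ?N ?Q))"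
      unfolding P_free[of ?M ?NQ, OF simplex_sSet SS.tens_obj[OF simplex_sSet simplex_sSet]]
      by (simp add: G_simplex ez_def)
    finally show ?thesis by (simp add: mult_pairing)
  qed
  have assoc: "?r \<cdot>\<^bsub>SE\<^esub> Assoc SE (S m) (S n) (S q) = far G (Assoc sSet ?M ?N ?Q) \<cdot>\<^bsub>SE\<^esub> ?l"
    using K.mult_assoc[of ?M ?N ?Q] by (simp add: G_simplex)
  have "RA ?r \<cdot> (RA (Assoc SE (S m) (S n) (S q)) \<cdot> (ez.P (S m \<otimes>\<^bsub>SE\<^esub> S n) (S q) \<cdot> (ez m n \<odot> \<i> (R (S q))))) =
      RA (?r \<cdot>\<^bsub>SE\<^esub> Assoc SE (S m) (S n) (S q)) \<cdot> (ez.P (S m \<otimes>\<^bsub>SE\<^esub> S n) (S q) \<cdot> (ez m n \<odot> \<i> (R (S q))))"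
    by (rule RA_Comp') (simp_all add: G_simplex)
  also have "\<dots> = RA (far G (Assoc sSet ?M ?N ?Q)) \<cdot> (RA ?l \<cdot> (ez.P (S m \<otimes>\<^bsub>SE\<^esub> S n) (S q) \<cdot> (ez m n \<odot> \<i> (R (S q)))))"
    unfolding assoc by (rule RA_Comp'[symmetric]) (simp_all add: G_simplex)
  also have "\<dots> = (p ?M ?NQ \<cdot> (\<i> (R (S m)) \<odot> p ?N ?Q)) \<cdot> \<alpha> (R (S m)) (R (S n)) (R (S q))"
    unfolding left using L.mult_assoc[of ?M ?N ?Q] by (simp add: G_simplex)
  also have "\<dots> = RA ?r \<cdot> ((ez.P (S m) (S n \<otimes>\<^bsub>SE\<^esub> S q) \<cdot> (\<i> (R (S m)) \<odot> ez n q)) \<cdot> \<alpha> (R (S m)) (R (S n)) (R (S q)))"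
    unfolding right[symmetric] by (simp add: G_simplex)
  finally have "RA (Assoc SE (S m) (S n) (S q)) \<cdot> (ez.P (S m \<otimes>\<^bsub>SE\<^esub> S n) (S q) \<cdot> (ez m n \<odot> \<i> (R (S q)))) =
      (ez.P (S m) (S n \<otimes>\<^bsub>SE\<^esub> S q) \<cdot> (\<i> (R (S m)) \<odot> ez n q)) \<cdot> \<alpha> (R (S m)) (R (S n)) (R (S q))"
    by (rule iso_cancel_left[OF is_iso_RA[OF ri], rotated 4]) (simp_all add: G_simplex)
  then show "RA (Assoc SE (S m) (S n) (S q)) \<cdot> ez.P (S m \<otimes>\<^bsub>SE\<^esub> S n) (S q) \<cdot> (ez m n \<odot> \<i> (R (S q))) =
      ez.P (S m) (S n \<otimes>\<^bsub>SE\<^esub> S q) \<cdot> (\<i> (R (S m)) \<odot> ez n q) \<cdot> \<alpha> (R (S m)) (R (S n)) (R (S q))"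
    by simp
next
  fix n
  let ?N = "simplex n :: ('u set, 'u set_map) simplicial" and ?O = "simplex 0 :: ('u set, 'u set_map) simplicial"
  have K1: "far G (LUnit sSet ?N \<cdot>\<^bsub>sSet\<^esub> (simplex0_set \<odot>\<^bsub>sSet\<^esub> Ide sSet ?N)) \<cdot>\<^bsub>SE\<^esub> simp_mult ?O ?N =
      LUnit SE (S n) \<cdot>\<^bsub>SE\<^esub> (s0 \<odot>\<^bsub>SE\<^esub> Ide SE (S n))"
  proof -
    have "far G (LUnit sSet ?N \<cdot>\<^bsub>sSet\<^esub> (simplex0_set \<odot>\<^bsub>sSet\<^esub> Ide sSet ?N)) \<cdot>\<^bsub>SE\<^esub> simp_mult ?O ?N =
        far G (LUnit sSet ?N) \<cdot>\<^bsub>SE\<^esub> (simp_mult (Unit sSet) ?N \<cdot>\<^bsub>SE\<^esub> ((simp_unit \<cdot>\<^bsub>SE\<^esub> s0) \<odot>\<^bsub>SE\<^esub> Ide SE (S n)))"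
      using K.mult_nat_left[of simplex0_set "Unit sSet" ?N] by (simp add: G_simplex G_simplex0)
    also have "\<dots> = (far G (LUnit sSet ?N) \<cdot>\<^bsub>SE\<^esub> simp_mult (Unit sSet) ?N \<cdot>\<^bsub>SE\<^esub> (simp_unit \<odot>\<^bsub>SE\<^esub> Ide SE (S n))) \<cdot>\<^bsub>SE\<^esub> (s0 \<odot>\<^bsub>SE\<^esub> Ide SE (S n))"
      by (simp add: G_simplex)
    also have "\<dots> = LUnit SE (S n) \<cdot>\<^bsub>SE\<^esub> (s0 \<odot>\<^bsub>SE\<^esub> Ide SE (S n))"
      using K.left_unit[of ?N] by (simp add: G_simplex)
    finally show ?thesis .
  qed
  have "RA (LUnit SE (S n) \<cdot>\<^bsub>SE\<^esub> (s0 \<odot>\<^bsub>SE\<^esub> Ide SE (S n))) \<cdot> (ez 0 n \<cdot> (su \<odot> \<i> (R (S n)))) =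
      RA (far G (LUnit sSet ?N \<cdot>\<^bsub>sSet\<^esub> (simplex0_set \<odot>\<^bsub>sSet\<^esub> Ide sSet ?N))) \<cdot> ((RA (simp_mult ?O ?N) \<cdot> pairing ?O ?N) \<cdot> (su \<odot> \<i> (R (S n))))"
    unfolding K1[symmetric] by (simp add: RA_Comp G_simplex ez_def)
  also have "\<dots> = RA (far G (LUnit sSet ?N)) \<cdot> ((RA (far G (simplex0_set \<odot>\<^bsub>sSet\<^esub> Ide sSet ?N)) \<cdot> p ?O ?N) \<cdot> (su \<odot> \<i> (R (S n))))"
    by (simp add: mult_pairing RA_Comp G_simplex)
  also have "RA (far G (simplex0_set \<odot>\<^bsub>sSet\<^esub> Ide sSet ?N)) \<cdot> p ?O ?N = p (Unit sSet) ?N \<cdot> (RA (far G simplex0_set) \<odot> \<i> (R (S n)))"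
    using L.mult_nat_left[of simplex0_set "Unit sSet" ?N] by (simp add: G_simplex)
  also have "RA (far G (LUnit sSet ?N)) \<cdot> ((p (Unit sSet) ?N \<cdot> (RA (far G simplex0_set) \<odot> \<i> (R (S n)))) \<cdot> (su \<odot> \<i> (R (S n)))) =
      RA (far G (LUnit sSet ?N)) \<cdot> (p (Unit sSet) ?N \<cdot> ((RA (far G simplex0_set) \<cdot> su) \<odot> \<i> (R (S n))))"
    by (simp add: G_simplex)
  also have "\<dots> = \<l> (R (S n))"
    using L.left_unit[of ?N] by (simp add: G_simplex set_realisation_unit_def)
  finally show "RA (LUnit SE (S n) \<cdot>\<^bsub>SE\<^esub> (s0 \<odot>\<^bsub>SE\<^esub> Ide SE (S n))) \<cdot> ez 0 n \<cdot> (su \<odot> \<i> (R (S n))) = \<l> (R (S n))"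
    by simp
next
  fix m
  let ?M = "simplex m :: ('u set, 'u set_map) simplicial" and ?O = "simplex 0 :: ('u set, 'u set_map) simplicial"
  have K1: "far G (RUnit sSet ?M \<cdot>\<^bsub>sSet\<^esub> (Ide sSet ?M \<odot>\<^bsub>sSet\<^esub> simplex0_set)) \<cdot>\<^bsub>SE\<^esub> simp_mult ?M ?O =
      RUnit SE (S m) \<cdot>\<^bsub>SE\<^esub> (Ide SE (S m) \<odot>\<^bsub>SE\<^esub> s0)"
  proof -
    have "far G (RUnit sSet ?M \<cdot>\<^bsub>sSet\<^esub> (Ide sSet ?M \<odot>\<^bsub>sSet\<^esub> simplex0_set)) \<cdot>\<^bsub>SE\<^esub> simp_mult ?M ?O =
        far G (RUnit sSet ?M) \<cdot>\<^bsub>SE\<^esub> (simp_mult ?M (Unit sSet) \<cdot>\<^bsub>SE\<^esub> (Ide SE (S m) \<odot>\<^bsub>SE\<^esub> (simp_unit \<cdot>\<^bsub>SE\<^esub> s0)))"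
      using K.mult_nat_right[of simplex0_set "Unit sSet" ?M] by (simp add: G_simplex G_simplex0)
    also have "\<dots> = (far G (RUnit sSet ?M) \<cdot>\<^bsub>SE\<^esub> simp_mult ?M (Unit sSet) \<cdot>\<^bsub>SE\<^esub> (Ide SE (S m) \<odot>\<^bsub>SE\<^esub> simp_unit)) \<cdot>\<^bsub>SE\<^esub> (Ide SE (S m) \<odot>\<^bsub>SE\<^esub> s0)"
      by (simp add: G_simplex)
    also have "\<dots> = RUnit SE (S m) \<cdot>\<^bsub>SE\<^esub> (Ide SE (S m) \<odot>\<^bsub>SE\<^esub> s0)"
      using K.right_unit[of ?M] by (simp add: G_simplex)
    finally show ?thesis .
  qed
  have "RA (RUnit SE (S m) \<cdot>\<^bsub>SE\<^esub> (Ide SE (S m) \<odot>\<^bsub>SE\<^esub> s0)) \<cdot> (ez m 0 \<cdot> (\<i> (R (S m)) \<odot> su)) =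
      RA (far G (RUnit sSet ?M \<cdot>\<^bsub>sSet\<^esub> (Ide sSet ?M \<odot>\<^bsub>sSet\<^esub> simplex0_set))) \<cdot> ((RA (simp_mult ?M ?O) \<cdot> pairing ?M ?O) \<cdot> (\<i> (R (S m)) \<odot> su))"
    unfolding K1[symmetric] by (simp add: RA_Comp G_simplex ez_def)
  also have "\<dots> = RA (far G (RUnit sSet ?M)) \<cdot> ((RA (far G (Ide sSet ?M \<odot>\<^bsub>sSet\<^esub> simplex0_set)) \<cdot> p ?M ?O) \<cdot> (\<i> (R (S m)) \<odot> su))"
    by (simp add: mult_pairing RA_Comp G_simplex)
  also have "RA (far G (Ide sSet ?M \<odot>\<^bsub>sSet\<^esub> simplex0_set)) \<cdot> p ?M ?O = p ?M (Unit sSet) \<cdot> (\<i> (R (S m)) \<odot> RA (far G simplex0_set))"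
    using L.mult_nat_right[of simplex0_set "Unit sSet" ?M] by (simp add: G_simplex)
  also have "RA (far G (RUnit sSet ?M)) \<cdot> ((p ?M (Unit sSet) \<cdot> (\<i> (R (S m)) \<odot> RA (far G simplex0_set))) \<cdot> (\<i> (R (S m)) \<odot> su)) =
      RA (far G (RUnit sSet ?M)) \<cdot> (p ?M (Unit sSet) \<cdot> (\<i> (R (S m)) \<odot> (RA (far G simplex0_set) \<cdot> su)))"
    by (simp add: G_simplex)
  also have "\<dots> = \<r> (R (S m))"
    using L.right_unit[of ?M] by (simp add: G_simplex set_realisation_unit_def)
  finally show "RA (RUnit SE (S m) \<cdot>\<^bsub>SE\<^esub> (Ide SE (S m) \<odot>\<^bsub>SE\<^esub> s0)) \<cdot> ez m 0 \<cdot> (\<i> (R (S m)) \<odot> su) = \<r> (R (S m))"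
    by simp
qed

lemma ez_iso: "(\<And>X Y. X \<in> Obj sSet \<Longrightarrow> Y \<in> Obj sSet \<Longrightarrow> is_iso E (p X Y)) \<Longrightarrow> is_iso E (ez m n)"
  unfolding ez_def pairing_def by simp

end


theorem proposition9p3:
  fixes U :: "'u itself" and E :: "('o, 'a) smcat"
    and C :: "('o, 'a) cosimplicial" and \<iota> :: 'a
  assumes "regular_universe U"
    and "symmetric_monoidal_category E"
    and "monoidal_closed E"
    and "cocomplete U E"
    and "finitely_complete E"
    and "is_functor \<Delta> E C"
    and "\<iota> \<in> Hom E (Unit E) (fob C 0)" and "is_iso E \<iota>"
  shows "(monoidal_cosimplicial U E C \<iota> \<longleftrightarrow> monoidal_set_realisation U E C \<iota>) \<and>
         (monoidal_set_realisation U E C \<iota> \<longleftrightarrow> (\<exists>e. EZ_system U E C \<iota> e)) \<and>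
         (strong_monoidal_cosimplicial U E C \<iota> \<longleftrightarrow> strong_monoidal_set_realisation U E C \<iota>) \<and>
         (strong_monoidal_set_realisation U E C \<iota> \<longleftrightarrow>
            (\<exists>e. EZ_system U E C \<iota> e \<and> (\<forall>m n. is_iso E (e m n))))"
proof -
  interpret E: symmetric_monoidal_category E by fact
  interpret pointed_realisation U E C \<iota>
    by unfold_locales (use assms in auto)
  have a: "monoidal_set_realisation U E C \<iota>" if "monoidal_cosimplicial U E C \<iota>"
    using that monoidal_set_of_monoidal unfolding monoidal_cosimplicial_def monoidal_set_realisation_def by blast
  have b: "\<exists>e. EZ_system U E C \<iota> e" if m: "monoidal_set_realisation U E C \<iota>"
  proof -
    obtain p where p: "symmetric_monoidal_functor sSet E (set_realisation E C) (set_realisation_unit U E C \<iota>) p"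
      using m unfolding monoidal_set_realisation_def by blast
    interpret L: monoidal_set_realisation_setting U E C \<iota> p
      by (intro monoidal_set_realisation_setting.intro monoidal_set_realisation_setting_axioms.intro pointed_realisation_axioms p)
    show ?thesis using L.EZ_system_ez by blast
  qed
  have c: "monoidal_cosimplicial U E C \<iota>" if "\<exists>e. EZ_system U E C \<iota> e"
    using that monoidal_of_EZ_system ru_simps(4) unfolding monoidal_cosimplicial_def unit_preserving_def by blast
  have a': "strong_monoidal_set_realisation U E C \<iota>" if s: "strong_monoidal_cosimplicial U E C \<iota>"
  proof -
    obtain p where p: "symmetric_monoidal_functor SE E (realisation E C) ru p" and st: "strong_structure SE E ru p"
      using s unfolding strong_monoidal_cosimplicial_def by blast
    interpret p: symmetric_monoidal_functor SE E "realisation E C" ru p by (rule p)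
    have "is_iso E (RA (simp_mult X Y) \<cdot>\<^bsub>E\<^esub> p (fob G X) (fob G Y))" if "X \<in> Obj sSet" "Y \<in> Obj sSet" for X Y
      using that st unfolding strong_structure_def by simp
    then have "strong_structure sSet E (set_realisation_unit U E C \<iota>) (\<lambda>X Y. RA (simp_mult X Y) \<cdot>\<^bsub>E\<^esub> p (fob G X) (fob G Y))"
      unfolding strong_structure_def using set_realisation_unit_iso by blast
    then show ?thesis
      using monoidal_set_of_monoidal[OF p] unfolding strong_monoidal_set_realisation_def by blast
  qed
  have b': "\<exists>e. EZ_system U E C \<iota> e \<and> (\<forall>m n. is_iso E (e m n))" if m: "strong_monoidal_set_realisation U E C \<iota>"
  proof -
    obtain p where p: "symmetric_monoidal_functor sSet E (set_realisation E C) (set_realisation_unit U E C \<iota>) p"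
      and st: "strong_structure sSet E (set_realisation_unit U E C \<iota>) p"
      using m unfolding strong_monoidal_set_realisation_def by blast
    interpret L: monoidal_set_realisation_setting U E C \<iota> p
      by (intro monoidal_set_realisation_setting.intro monoidal_set_realisation_setting_axioms.intro pointed_realisation_axioms p)
    show ?thesis using L.EZ_system_ez L.ez_iso st unfolding strong_structure_def by blast
  qed
  have c': "strong_monoidal_cosimplicial U E C \<iota>" if s: "\<exists>e. EZ_system U E C \<iota> e \<and> (\<forall>m n. is_iso E (e m n))"
  proof -
    obtain e where e: "EZ_system U E C \<iota> e" and iso: "\<And>m n. is_iso E (e m n)" using s by blast
    interpret N: natural_EZ U E C e by (rule natural_EZ_of_system[OF e])
    have "strong_structure SE E ru (EZ_extension U E C e)"
      unfolding strong_structure_def using N.P_iso[OF iso] ru_simps(4) by blast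
    then show ?thesis
      using monoidal_of_EZ_system[OF e] ru_simps(4) unfolding strong_monoidal_cosimplicial_def unit_preserving_def by blast
  qed
  show ?thesis using a b c a' b' c' by blast
qed

end
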